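(* Let $0<\varepsilon<1$. Let $G$ be a graph on vertex set $[n]$ with $m$ edges, with adjacency matrix $A$ and diagonal degree matrix $D$. Let $\mathrm{OPT}$ be the size (number of cut edges) of the largest cut in $G$. Set $k = \mathrm{rank}_{\le -\varepsilon}(D^{-1/2} A D^{-1/2})$. Then there is an algorithm which, in time $(1/\varepsilon)^{O(k)} \cdot \widetilde{O}(n + m)$, outputs a (random) cut of $G$ whose expected value is at least $(1 - O(\varepsilon)) \cdot \mathrm{OPT}$.
   Context: For a square matrix $B$ with real eigenvalues and $0<\varepsilon<1$, $\mathrm{rank}_{\le -\varepsilon}(B)$ denotes the number of eigenvalues of $B$ (counted with multiplicity) that are less than $-\varepsilon$. $D^{-1/2} A D^{-1/2}$ is the normalized adjacency matrix of $G$. $\widetilde{O}(\cdot)$ hides polylogarithmic factors and $O(\cdot)$ hides absolute constants. *)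

theory Defs
  imports
    "HOL-Probability.SPMF"
    "HOL-Library.Landau_Symbols"
    "HOL-Library.Log_Nat"
    "Jordan_Normal_Form.Char_Poly"
begin

section \<open>Graphs, cuts and the normalized adjacency matrix\<close>

text \<open>The vertex set \<open>[n]\<close> is \<open>{0..<n}\<close>, so that vertices index JNF matrices directly.\<close>

definition simple_graph :: "nat \<Rightarrow> nat set set \<Rightarrow> bool" where
  "simple_graph n E \<longleftrightarrow> E \<subseteq> {e. e \<subseteq> {0..<n} \<and> card e = 2}"

definition vertex_degree :: "nat set set \<Rightarrow> nat \<Rightarrow> nat" where
  "vertex_degree E v = card {e \<in> E. v \<in> e}"

definition adjacency_matrix :: "nat \<Rightarrow> nat set set \<Rightarrow> real mat" where
  "adjacency_matrix n E = Matrix.mat n n (\<lambda>(i, j). if {i, j} \<in> E then 1 else 0)"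

text \<open>\<open>D\<^sup>-\<^sup>1\<^sup>/\<^sup>2\<close>. At an isolated vertex the entry is \<open>1 / sqrt 0 = 0\<close>, the usual
  pseudo-inverse convention, so an isolated vertex contributes the eigenvalue \<open>0\<close>.\<close>

definition degree_inv_sqrt :: "nat \<Rightarrow> nat set set \<Rightarrow> real mat" where
  "degree_inv_sqrt n E = mat_diag n (\<lambda>v. 1 / sqrt (real (vertex_degree E v)))"

definition normalized_adjacency :: "nat \<Rightarrow> nat set set \<Rightarrow> real mat" where
  "normalized_adjacency n E =
     degree_inv_sqrt n E * adjacency_matrix n E * degree_inv_sqrt n E"

text \<open>The multiplicity of an eigenvalue is its multiplicity as a root of the characteristic
  polynomial.\<close>

definition neg_threshold_rank :: "real \<Rightarrow> real mat \<Rightarrow> nat" where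
  "neg_threshold_rank \<epsilon> B =
     (\<Sum>x \<in> {x. eigenvalue B x \<and> x < - \<epsilon>}. Polynomial.order x (char_poly B))"

definition cut_value :: "nat set set \<Rightarrow> nat set \<Rightarrow> nat" where
  "cut_value E S = card {e \<in> E. e \<inter> S \<noteq> {} \<and> e - S \<noteq> {}}"

definition max_cut :: "nat \<Rightarrow> nat set set \<Rightarrow> nat" where
  "max_cut n E = Max {cut_value E S | S. S \<subseteq> {0..<n}}"

section \<open>Randomized random access machines with logarithmic cost\<close>

text \<open>
  Algorithms are programs of a fixed structured programming language over an integer memory with
  indirect addressing. Time is measured by the logarithmic cost criterion: every operation is
  charged the bit lengths of the numbers (values and addresses) it handles, and multiplication and
  division are charged the product of the bit lengths. Hence arithmetic on long integers is
  never free. The only source of randomness is the fair coin.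
\<close>

type_synonym memory = "int \<Rightarrow> int"

datatype expr =
    Const int
  | Load expr            \<comment> \<open>contents of the cell with the given address\<close>
  | Add expr expr
  | Sub expr expr
  | Mul expr expr
  | Div expr expr        \<comment> \<open>rounding down; \<open>x div 0 = 0\<close>\<close>
  | Less expr expr       \<comment> \<open>1 or 0\<close>

datatype prog =
    Store expr expr      \<comment> \<open>address, value\<close>
  | Flip expr            \<comment> \<open>store a uniformly random bit at the given address\<close>
  | Seq prog prog
  | If expr prog prog    \<comment> \<open>nonzero means true\<close>
  | While expr prog

fun val :: "expr \<Rightarrow> memory \<Rightarrow> int" where
  "val (Const c) s = c"
| "val (Load a) s = s (val a s)"
| "val (Add a b) s = val a s + val b s"
| "val (Sub a b) s = val a s - val b s"
| "val (Mul a b) s = val a s * val b s"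
| "val (Div a b) s = val a s div val b s"
| "val (Less a b) s = (if val a s < val b s then 1 else 0)"

text \<open>Number of bits of an integer including the sign bit; in particular at least 1.\<close>

definition len :: "int \<Rightarrow> nat" where
  "len x = nat (bitlen \<bar>x\<bar>) + 1"

fun cost :: "expr \<Rightarrow> memory \<Rightarrow> nat" where
  "cost (Const c) s = len c"
| "cost (Load a) s = cost a s + len (val a s) + len (s (val a s))"
| "cost (Add a b) s = cost a s + cost b s + len (val a s) + len (val b s)"
| "cost (Sub a b) s = cost a s + cost b s + len (val a s) + len (val b s)"
| "cost (Mul a b) s = cost a s + cost b s + len (val a s) * len (val b s)"
| "cost (Div a b) s = cost a s + cost b s + len (val a s) * len (val b s)"
| "cost (Less a b) s = cost a s + cost b s + len (val a s) + len (val b s)"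

text \<open>\<open>exec p s\<close> is the joint distribution of the final memory and the running time of \<open>p\<close> started
  in memory \<open>s\<close>; the missing probability mass is the probability that \<open>p\<close> does not halt.\<close>

partial_function (spmf) exec :: "prog \<Rightarrow> memory \<Rightarrow> (memory \<times> nat) spmf" where
  "exec p s = (case p of
      Store a b \<Rightarrow>
        return_spmf (s(val a s := val b s), cost a s + cost b s + len (val a s) + len (val b s))
    | Flip a \<Rightarrow>
        bind_spmf coin_spmf (\<lambda>b.
          return_spmf (s(val a s := (if b then 1 else 0)), cost a s + len (val a s) + 1))
    | Seq p1 p2 \<Rightarrow>
        bind_spmf (exec p1 s) (\<lambda>r1.
          bind_spmf (exec p2 (fst r1)) (\<lambda>r2.
            return_spmf (fst r2, snd r1 + snd r2)))
    | If a p1 p2 \<Rightarrow>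
        bind_spmf (exec (if val a s \<noteq> 0 then p1 else p2) s) (\<lambda>r.
          return_spmf (fst r, cost a s + len (val a s) + snd r))
    | While a q \<Rightarrow>
        (if val a s \<noteq> 0 then
           bind_spmf (exec q s) (\<lambda>r1.
             bind_spmf (exec (While a q) (fst r1)) (\<lambda>r2.
               return_spmf (fst r2, cost a s + len (val a s) + snd r1 + snd r2)))
         else return_spmf (s, cost a s + len (val a s))))"

text \<open>Worst-case bound over all outcomes of the coin flips. Every coin flip costs at least 1, so for
  a bounded support losslessness (halting with probability 1) excludes nonhalting runs
  altogether.\<close>

definition runs_in_time :: "prog \<Rightarrow> memory \<Rightarrow> real \<Rightarrow> bool" where
  "runs_in_time p s T \<longleftrightarrow>
     lossless_spmf (exec p s) \<and> (\<forall>(s', t) \<in> set_spmf (exec p s). real t \<le> T)"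

section \<open>Input and output conventions\<close>

text \<open>A list of the edges of a graph: every edge once, in any order and either orientation.\<close>

definition edge_list_of :: "nat set set \<Rightarrow> (nat \<times> nat) list \<Rightarrow> bool" where
  "edge_list_of E es \<longleftrightarrow>
     distinct (map (\<lambda>(u, v). {u, v}) es) \<and> set (map (\<lambda>(u, v). {u, v}) es) = E"

text \<open>
  Initial memory: \<open>n\<close>, \<open>m\<close>, \<open>\<lfloor>1/\<epsilon>\<rfloor>\<close> and then the \<open>2 m\<close> endpoints of the edges in
  cells \<open>0, 1, 2, \<dots>\<close>; all other cells contain \<open>0\<close>. A real \<open>\<epsilon>\<close> is not a finite object; all the
  program is told about it is the integer \<open>\<lfloor>1/\<epsilon>\<rfloor>\<close>, which pins \<open>\<epsilon>\<close> down up to a factor of 2.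
\<close>

definition input_memory :: "real \<Rightarrow> nat \<Rightarrow> (nat \<times> nat) list \<Rightarrow> memory" where
  "input_memory \<epsilon> n es =
     (let xs = [int n, int (length es), \<lfloor>1 / \<epsilon>\<rfloor>]
               @ concat (map (\<lambda>(u, v). [int u, int v]) es)
      in (\<lambda>a. if 0 \<le> a \<and> a < int (length xs) then xs ! nat a else 0))"

text \<open>The output cut, as the vertices whose cell holds \<open>1\<close> in the final memory.\<close>

definition output_cut :: "nat \<Rightarrow> memory \<Rightarrow> nat set" where
  "output_cut n s = {v \<in> {0..<n}. s (int v) = 1}"

definition expected_cut_value :: "nat \<Rightarrow> nat set set \<Rightarrow> prog \<Rightarrow> memory \<Rightarrow> real" where
  "expected_cut_value n E p s =
     (\<integral>r. real (cut_value E (output_cut n (fst r))) \<partial>measure_spmf (exec p s))"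

text \<open>\<open>soft_O h\<close> is \<open>h\<close> up to constant and polylogarithmic factors.\<close>

definition soft_O :: "(nat \<Rightarrow> real) \<Rightarrow> (nat \<Rightarrow> real) set" where
  "soft_O h = {g. \<exists>c::nat. g \<in> O(\<lambda>N. h N * ln (h N) ^ c)}"

end

theory Submission
  imports Defs "Jordan_Normal_Form.Spectral_Radius" "HOL-Real_Asymp.Real_Asymp"
begin

text \<open>Let \<open>P\<close> be the power of two with \<open>P \<le> \<lfloor>1 / \<epsilon>\<rfloor> < 2 * P\<close> and consider the quadratic form
  \<open>B\<^sub>0 = P * A + D\<close>, which is nonnegative on the span of the eigenvectors of the normalized adjacency
  matrix with eigenvalue at least \<open>- \<epsilon>\<close>, hence on a subspace of codimension \<open>k\<close>. As long as
  \<open>B\<^sub>q(x) < - x\<^sup>T D x\<close> for some \<open>x\<close>, power iteration from a random start finds with probability at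
  least one half a vector \<open>v\<close> that lies essentially in the negative part of \<open>B\<^sub>q\<close>. With \<open>w = B\<^sub>q v\<close> the
  rank one update \<open>B\<^sub>q + w w\<^sup>T / (- v\<^sup>T w)\<close> annihilates \<open>v\<close> and decreases the codimension, so that
  there are at most \<open>k\<close> updates.

  In the end \<open>B\<^sub>0(x) = B\<^sub>q(x) - \<Sum>\<^sub>i \<langle>w\<^sub>i, x\<rangle>\<^sup>2 / s\<^sub>i\<close>, where \<open>B\<^sub>q + D\<close> is convex. If \<open>t\<^sub>i\<close> is close
  to \<open>\<langle>w\<^sub>i, x\<^sup>*\<rangle>\<close> for an optimal cut \<open>x\<^sup>*\<close>, then \<open>B\<^sub>0(x) + \<Sum>\<^sub>i (\<langle>w\<^sub>i, x\<rangle> - t\<^sub>i)\<^sup>2 / s\<^sub>i\<close> is an almost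
  convex upper bound of \<open>B\<^sub>0\<close> that is almost tight at \<open>x\<^sup>*\<close>. It is minimized over the cube by the
  Frank--Wolfe method for each of \<open>O(P)\<^sup>k\<close> guesses of \<open>t\<close>. The best fractional cut found is rounded at
  each vertex independently, which preserves the expected number of cut edges. All arithmetic is
  on integers with a common denominator, whose bit length is bounded along the way.\<close>

section \<open>Eigenbases and the negative threshold rank\<close>

text \<open>Neither \<open>k\<close> nor the spectrum is available to the program. Updates are
  limited to \<open>k\<close> because acceptance is a certificate: the norm reached by the power
  iteration shows by itself that the vector is almost negative, however the start was chosen. A
  stage is closed after \<open>P + q\<close> failures in a row, so a premature stop has probability
  at most \<open>2 * (1/2) ^ P\<close>, which is O(\<epsilon>). Only the final form plus
  \<open>D\<close> is made convex. The gap between the thresholds -1 and -1/2 lets O(P log H)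
  iterations decide, while the defect costs O(m) in the form, hence O(m / P) in the cut, and this is
  O(\<epsilon>) OPT since OPT is at least m / 2. There are few guesses because the weighted squares
  of the products for a sign vector add up to O(P m), while a total error of m is allowed. Under
  logarithmic cost the length of the integers matters. An update multiplies it by at most 8, and the
  resulting \<open>8 ^ k\<close> is absorbed by a power of \<open>(1 / \<epsilon>) ^ k\<close> only
  when 1 / \<epsilon> stays away from 1. For \<epsilon> > 1/2 the promised value is negative, so any
  output will do.\<close>

lemma real_symmetric_eigenvector:
  fixes A :: "real mat"
  assumes A: "A \<in> carrier_mat n n" and sym: "\<And>i j. i < n \<Longrightarrow> j < n \<Longrightarrow> A $$ (i, j) = A $$ (j, i)"
    and n: "n > 0"
  shows "\<exists>x a. x \<in> carrier_vec n \<and> x \<noteq> 0\<^sub>v n \<and> A *\<^sub>v x = a \<cdot>\<^sub>v x"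
proof -
  let ?C = "map_mat complex_of_real A"
  have C: "?C \<in> carrier_mat n n" using A by auto
  obtain l where "eigenvalue ?C l" using spectrum_non_empty[OF C n] unfolding spectrum_def by auto
  then obtain w where w: "w \<in> carrier_vec n" "w \<noteq> 0\<^sub>v n" "?C *\<^sub>v w = l \<cdot>\<^sub>v w"
    using C unfolding eigenvalue_def eigenvector_def by auto
  define x where "x = map_vec Re w"
  define y where "y = map_vec Im w"
  have xy: "x \<in> carrier_vec n" "y \<in> carrier_vec n" using w by (auto simp: x_def y_def)
  have eq: "(\<Sum>j<n. complex_of_real (A $$ (i, j)) * w $ j) = l * w $ i" if "i < n" for i
  proof -
    have "(?C *\<^sub>v w) $ i = (l \<cdot>\<^sub>v w) $ i" using w by simp
    moreover have "(?C *\<^sub>v w) $ i = (\<Sum>j<n. complex_of_real (A $$ (i, j)) * w $ j)"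
      using that w(1) A by (auto simp: scalar_prod_def lessThan_atLeast0)
    ultimately show ?thesis using that w by simp
  qed
  have ex: "(\<Sum>j<n. A $$ (i, j) * x $ j) = Re l * x $ i - Im l * y $ i" if "i < n" for i
    using arg_cong[OF eq[OF that], of Re] that w by (simp add: x_def y_def Re_sum)
  have ey: "(\<Sum>j<n. A $$ (i, j) * y $ j) = Re l * y $ i + Im l * x $ i" if "i < n" for i
    using arg_cong[OF eq[OF that], of Im] that w by (simp add: x_def y_def Im_sum)
  \<comment> \<open>For the real part \<open>x\<close> and the imaginary part \<open>y\<close> of a
    complex eigenvector, symmetry equates the two mixed products; the eigenvalue equations then
    leave \<open>Im l\<close> times the squared norm.\<close>
  have "(\<Sum>i<n. y $ i * (\<Sum>j<n. A $$ (i, j) * x $ j)) = (\<Sum>i<n. x $ i * (\<Sum>j<n. A $$ (i, j) * y $ j))"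
    unfolding sum_distrib_left
    by (subst sum.swap) (intro sum.cong refl, auto simp: sym)
  hence "(\<Sum>i<n. y $ i * (Re l * x $ i - Im l * y $ i)) = (\<Sum>i<n. x $ i * (Re l * y $ i + Im l * x $ i))"
    using ex ey by simp
  hence "Im l * (\<Sum>i<n. x $ i * x $ i + y $ i * y $ i) = 0"
    by (simp add: algebra_simps sum.distrib sum_subtractf sum_distrib_left)
  moreover have "(\<Sum>i<n. x $ i * x $ i + y $ i * y $ i) > 0"
  proof -
    obtain i where i: "i < n" "w $ i \<noteq> 0" using w by (metis eq_vecI carrier_vecD index_zero_vec)
    hence "x $ i \<noteq> 0 \<or> y $ i \<noteq> 0" using w by (auto simp: x_def y_def complex_eq_iff)
    hence "x $ i * x $ i + y $ i * y $ i > 0" by (metis sum_squares_gt_zero_iff)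
    thus ?thesis using i by (intro sum_pos2[of _ i]) auto
  qed
  ultimately have im: "Im l = 0" by simp
  have "A *\<^sub>v x = Re l \<cdot>\<^sub>v x" "A *\<^sub>v y = Re l \<cdot>\<^sub>v y"
    using ex ey A xy im by (auto simp: scalar_prod_def lessThan_atLeast0 intro!: eq_vecI)
  moreover have "x \<noteq> 0\<^sub>v n \<or> y \<noteq> 0\<^sub>v n"
  proof (rule ccontr)
    assume "\<not> ?thesis"
    hence "\<And>i. i < n \<Longrightarrow> x $ i = 0 \<and> y $ i = 0" by auto
    hence "\<And>i. i < n \<Longrightarrow> w $ i = 0" using w by (auto simp: x_def y_def complex_eq_iff)
    thus False using w by (metis eq_vecI carrier_vecD index_zero_vec)
  qed
  ultimately show ?thesis using xy by auto
qed

text \<open>The reflection that exchanges \<open>v\<close> with the first unit vector is symmetric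
  and involutory and has \<open>v\<close> as its first column. If \<open>v\<close> is the unit
  vector itself, the identity takes its place.\<close>

lemma householder:
  assumes v: "(\<Sum>i<n. (v i)\<^sup>2) = 1" and n: "n > 0"
  shows "\<exists>w :: nat \<Rightarrow> nat \<Rightarrow> real. (\<forall>i<n. \<forall>j<n. w i j = w j i) \<and> (\<forall>i<n. w i 0 = v i) \<and>
     (\<forall>i<n. \<forall>j<n. (\<Sum>l<n. w i l * w l j) = (if i = j then 1 else 0))"
proof -
  define d where "d i = (if i = (0::nat) then 1 else 0 :: real)" for i
  define u where "u i = v i - d i" for i
  define q where "q = (\<Sum>i<n. (u i)\<^sup>2)"
  define w where "w i j = (if i = j then 1 else 0) - 2 / q * u i * u j" for i j
  have dsum: "(\<Sum>l<n. (if l = a then f l else 0)) = (if a < n then f a else 0)" for a and f :: "nat \<Rightarrow> real"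
    by (simp add: sum.delta)
  have q2: "q = 2 - 2 * v 0"
  proof -
    have "q = (\<Sum>i<n. (v i)\<^sup>2 + (if i = 0 then 1 - 2 * v i else 0))"
      unfolding q_def u_def d_def by (intro sum.cong) (auto simp: power2_eq_square algebra_simps)
    also have "\<dots> = 1 + (1 - 2 * v 0)" using v n by (simp add: sum.distrib)
    finally show ?thesis by simp
  qed
  show ?thesis
  proof (cases "q = 0")
    case True
    hence "\<And>i. i < n \<Longrightarrow> u i = 0" unfolding q_def by (simp add: sum_nonneg_eq_0_iff)
    hence "\<And>i. i < n \<Longrightarrow> v i = d i" by (simp add: u_def)
    thus ?thesis
      by (intro exI[of _ "\<lambda>i j. if i = j then 1 else 0"])
         (auto simp: d_def if_distrib[of "\<lambda>x. x * _"] sum.delta cong: if_cong)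
  next
    case False
    have "w i 0 = v i" if "i < n" for i
    proof -
      have "w i 0 = d i - 2 / q * u i * u 0" by (simp add: w_def d_def)
      also have "2 / q * u i * u 0 = - u i"
      proof -
        have "2 * u 0 = - q" using q2 by (simp add: u_def d_def)
        hence "2 / q * u i * u 0 = - q / q * u i" by (metis (no_types, opaque_lifting) mult.commute mult.left_commute times_divide_eq_left)
        thus ?thesis using False by simp
      qed
      finally show ?thesis by (simp add: u_def)
    qed
    moreover have "(\<Sum>l<n. w i l * w l j) = (if i = j then 1 else 0)" if "i < n" "j < n" for i j
    proof -
      have "(\<Sum>l<n. w i l * w l j) = (\<Sum>l<n. (if l = i then (if i = j then 1 else 0) - 2/q * u i * u j else 0)
          - (if l = j then 2/q * u i * u j else 0) + 4 / q\<^sup>2 * u i * u j * (u l)\<^sup>2)"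
        by (intro sum.cong refl) (auto simp: w_def algebra_simps power2_eq_square)
      also have "\<dots> = (if i = j then 1 else 0) - 4/q * u i * u j + 4 / q\<^sup>2 * u i * u j * q"
        using that unfolding q_def sum.distrib sum_subtractf dsum sum_distrib_left[symmetric] by simp
      also have "\<dots> = (if i = j then 1 else 0)" using False by (simp add: field_simps power2_eq_square)
      finally show ?thesis .
    qed
    ultimately show ?thesis by (intro exI[of _ w]) (auto simp: w_def)
  qed
qed

text \<open>Vectors and matrices are plain functions of which only the arguments below
  \<open>n\<close> matter. Induction on the dimension, linear functionals and the arrays of the
  machine thus share one representation.\<close>

definition mv :: "nat \<Rightarrow> (nat \<Rightarrow> nat \<Rightarrow> real) \<Rightarrow> (nat \<Rightarrow> real) \<Rightarrow> nat \<Rightarrow> real" where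
  "mv n a x = (\<lambda>l. \<Sum>r<n. a l r * x r)"

definition ip :: "nat \<Rightarrow> (nat \<Rightarrow> real) \<Rightarrow> (nat \<Rightarrow> real) \<Rightarrow> real" where
  "ip n x y = (\<Sum>l<n. x l * y l)"

lemma mv_cong: "(\<And>r. r < n \<Longrightarrow> x r = y r) \<Longrightarrow> mv n a x = mv n a y"
  by (auto simp: mv_def intro!: ext sum.cong)

lemma ip_cong: "(\<And>r. r < n \<Longrightarrow> x r = x' r) \<Longrightarrow> (\<And>r. r < n \<Longrightarrow> y r = y' r) \<Longrightarrow> ip n x y = ip n x' y'"
  by (auto simp: ip_def intro!: sum.cong)

lemma mv_scale: "mv n a (\<lambda>r. c * x r) l = c * mv n a x l"
  by (simp add: mv_def sum_distrib_left mult_ac)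

lemma ip_mv_sym:
  assumes "\<And>i j. i < n \<Longrightarrow> j < n \<Longrightarrow> a i j = a j i"
  shows "ip n (mv n a x) y = ip n x (mv n a y)"
  unfolding ip_def mv_def sum_distrib_left sum_distrib_right
  by (subst sum.swap) (intro sum.cong refl, auto simp: assms)

text \<open>Conjugation by a reflection \<open>w\<close> whose first column is an eigenvector turns
  the first row and column into \<open>c\<close> times the unit vector. The induction hypothesis
  applies to the remaining block.\<close>

theorem spectral_theorem:
  fixes a :: "nat \<Rightarrow> nat \<Rightarrow> real"
  assumes "\<And>i j. i < n \<Longrightarrow> j < n \<Longrightarrow> a i j = a j i"
  shows "\<exists>e \<mu>. (\<forall>i<n. \<forall>j<n. ip n (e i) (e j) = (if i = j then 1 else 0)) \<and>
     (\<forall>i<n. \<forall>l<n. mv n a (e i) l = \<mu> i * e i l)"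
  using assms
proof (induction n arbitrary: a)
  case (Suc n)
  let ?n = "Suc n"
  obtain x c where x: "x \<in> carrier_vec ?n" "x \<noteq> 0\<^sub>v ?n" "Matrix.mat ?n ?n (\<lambda>(i, j). a i j) *\<^sub>v x = c \<cdot>\<^sub>v x"
    using real_symmetric_eigenvector[of "Matrix.mat ?n ?n (\<lambda>(i, j). a i j)" ?n] Suc.prems by auto
  have ax: "mv ?n a (\<lambda>r. x $ r) l = c * x $ l" if "l < ?n" for l
  proof -
    have "(Matrix.mat ?n ?n (\<lambda>(i, j). a i j) *\<^sub>v x) $ l = (\<Sum>r<?n. a l r * x $ r)"
      using that x(1) by (auto simp: scalar_prod_def lessThan_atLeast0 simp del: sum.op_ivl_Suc sum.lessThan_Suc intro!: sum.cong)
    moreover have "(Matrix.mat ?n ?n (\<lambda>(i, j). a i j) *\<^sub>v x) $ l = c * x $ l"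
      unfolding x(3) using that x(1) by simp
    ultimately show ?thesis by (simp add: mv_def)
  qed
  define q where "q = sqrt (\<Sum>l<?n. (x $ l)\<^sup>2)"
  have "\<exists>l<?n. x $ l \<noteq> 0" using x by (metis eq_vecI carrier_vecD index_zero_vec)
  then obtain l where "l < ?n" "x $ l \<noteq> 0" by blast
  hence sp: "(\<Sum>l<?n. (x $ l)\<^sup>2) > 0" by (intro sum_pos2[of _ l]) auto
  hence q: "q > 0" "q\<^sup>2 = (\<Sum>l<?n. (x $ l)\<^sup>2)" unfolding q_def by (simp_all add: sum_nonneg)
  define v where "v l = 1 / q * x $ l" for l
  have v1: "(\<Sum>l<?n. (v l)\<^sup>2) = 1"
    using q sp by (simp add: v_def power_divide sum_divide_distrib[symmetric] del: sum.lessThan_Suc)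
  have av: "mv ?n a v l = c * v l" if "l < ?n" for l
    using ax[OF that] unfolding v_def mv_scale by simp
  obtain w where w: "\<forall>i<?n. \<forall>j<?n. w i j = w j i" "\<forall>i<?n. w i 0 = v i"
    "\<forall>i<?n. \<forall>j<?n. (\<Sum>l<?n. w i l * w l j) = (if i = j then 1 else 0)"
    using householder[OF v1] by blast
  have ww: "mv ?n w (mv ?n w y) l = y l" if "l < ?n" for y l
  proof -
    have "mv ?n w (mv ?n w y) l = (\<Sum>j<?n. (\<Sum>r<?n. w l r * w r j) * y j)"
      unfolding mv_def sum_distrib_left sum_distrib_right by (subst sum.swap) (simp only: mult.assoc)
    also have "\<dots> = (\<Sum>j<?n. (if j = l then y j else 0))"
      using w(3) that by (intro sum.cong) auto
    also have "\<dots> = y l" using that by (subst sum.delta) auto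
    finally show ?thesis .
  qed
  define b where "b i j = mv ?n w (mv ?n a (\<lambda>r. w r j)) i" for i j
  have bop: "mv ?n b y l = mv ?n w (mv ?n a (mv ?n w y)) l" if "l < ?n" for y l
  proof -
    have "mv ?n b y l = (\<Sum>j<?n. \<Sum>p<?n. \<Sum>r<?n. w l p * a p r * w r j * y j)"
      unfolding mv_def b_def sum_distrib_left sum_distrib_right by (simp only: mult.assoc)
    also have "\<dots> = (\<Sum>p<?n. \<Sum>j<?n. \<Sum>r<?n. w l p * a p r * w r j * y j)"
      by (rule sum.swap)
    also have "\<dots> = (\<Sum>p<?n. \<Sum>r<?n. \<Sum>j<?n. w l p * a p r * w r j * y j)"
      by (rule sum.cong[OF refl], rule sum.swap)
    also have "\<dots> = mv ?n w (mv ?n a (mv ?n w y)) l"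
      unfolding mv_def sum_distrib_left sum_distrib_right by (simp only: mult.assoc)
    finally show ?thesis .
  qed
  have bsym: "b i j = b j i" if "i < ?n" "j < ?n" for i j
  proof -
    have *: "b i j = ip ?n (\<lambda>r. w r i) (mv ?n a (\<lambda>r. w r j))" if "i < ?n" "j < ?n" for i j
      unfolding b_def ip_def mv_def[of _ w] using w(1) that by (intro sum.cong) auto
    show ?thesis unfolding *[OF that] *[OF that(2,1)]
      by (subst ip_mv_sym[symmetric]) (auto simp: Suc.prems ip_def mult.commute)
  qed
  have b0: "b l 0 = (if l = 0 then c else 0)" if "l < ?n" for l
  proof -
    have "mv ?n a (\<lambda>r. w r 0) = mv ?n a v" by (rule mv_cong) (use w(2) in auto)
    hence "b l 0 = mv ?n w (mv ?n a v) l" by (simp add: b_def)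
    also have "\<dots> = mv ?n w (\<lambda>l. c * v l) l" by (rule fun_cong[OF mv_cong]) (use av in auto)
    also have "\<dots> = c * mv ?n w v l" by (rule mv_scale)
    also have "mv ?n w v l = (\<Sum>r<?n. w l r * w r 0)" unfolding mv_def using w(2) by (intro sum.cong) auto
    also have "\<dots> = (if l = 0 then 1 else 0)" using w(3) that by auto
    finally show ?thesis by simp
  qed
  obtain f \<nu> where f: "\<forall>i<n. \<forall>j<n. ip n (f i) (f j) = (if i = j then 1 else 0)"
     "\<forall>i<n. \<forall>l<n. mv n (\<lambda>i j. b (Suc i) (Suc j)) (f i) l = \<nu> i * f i l"
    using Suc.IH[of "\<lambda>i j. b (Suc i) (Suc j)"] bsym by auto
  \<comment> \<open>Eigenvectors in the reflected coordinates: the first unit vector, and those of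
    the block with a zero put in front. The reflection carries them back.\<close>
  define g where "g i = (case i of 0 \<Rightarrow> (\<lambda>l. if l = 0 then 1 else 0) | Suc i \<Rightarrow> (\<lambda>l. case l of 0 \<Rightarrow> 0 | Suc l \<Rightarrow> f i l))" for i
  define \<mu> where "\<mu> i = (case i of 0 \<Rightarrow> c | Suc i \<Rightarrow> \<nu> i)" for i
  have gg: "ip ?n (g i) (g j) = (if i = j then 1 else 0)" if "i < ?n" "j < ?n" for i j
    using f(1) that unfolding ip_def g_def
    by (subst sum.lessThan_Suc_shift) (auto split: nat.splits simp: sum.lessThan_Suc_shift simp del: sum.lessThan_Suc)
  have bg: "mv ?n b (g i) l = \<mu> i * g i l" if "i < ?n" "l < ?n" for i l
  proof (cases i)
    case 0
    thus ?thesis using b0[OF that(2)] unfolding mv_def g_def \<mu>_def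
      by (subst sum.lessThan_Suc_shift) (auto)
  next
    case (Suc i')
    show ?thesis
    proof (cases l)
      case 0
      have "b 0 (Suc r) = 0" if "r < n" for r using bsym[of 0 "Suc r"] b0[of "Suc r"] that by auto
      thus ?thesis using 0 Suc unfolding mv_def g_def \<mu>_def
        by (subst sum.lessThan_Suc_shift) (auto intro!: sum.neutral)
    next
      case (Suc l')
      thus ?thesis using \<open>i = Suc i'\<close> f(2) that unfolding mv_def g_def \<mu>_def
        by (subst sum.lessThan_Suc_shift) (auto simp: mv_def)
    qed
  qed
  define e where "e i = mv ?n w (g i)" for i
  have "ip ?n (e i) (e j) = (if i = j then 1 else 0)" if "i < ?n" "j < ?n" for i j
  proof -
    have "ip ?n (e i) (e j) = ip ?n (g i) (mv ?n w (mv ?n w (g j)))"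
      unfolding e_def by (rule ip_mv_sym) (use w(1) in auto)
    also have "\<dots> = ip ?n (g i) (g j)" by (rule ip_cong) (use ww in auto)
    finally show ?thesis using gg that by simp
  qed
  moreover have "mv ?n a (e i) l = \<mu> i * e i l" if "i < ?n" "l < ?n" for i l
  proof -
    have "mv ?n a (e i) l = mv ?n w (mv ?n w (mv ?n a (e i))) l" using ww that by simp
    also have "\<dots> = mv ?n w (mv ?n b (g i)) l" unfolding e_def
      by (rule fun_cong[OF mv_cong]) (use bop in auto)
    also have "\<dots> = mv ?n w (\<lambda>l. \<mu> i * g i l) l"
      by (rule fun_cong[OF mv_cong]) (use bg that in auto)
    also have "\<dots> = \<mu> i * e i l" unfolding e_def by (rule mv_scale)
    finally show ?thesis .
  qed
  ultimately show ?case by blast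
qed auto

text \<open>A one-sided inverse of a square matrix is two-sided, so orthonormal rows give
  orthonormal columns.\<close>

lemma orthonormal_complete:
  assumes "\<forall>i<n. \<forall>j<n. ip n (e i) (e j) = (if i = j then 1 else 0)" and lr: "l < n" "r < n"
  shows "(\<Sum>i<n. e i l * e i r) = (if l = r then 1 else 0)"
proof -
  let ?E = "Matrix.mat n n (\<lambda>(i, j). e i j)"
  have E: "?E \<in> carrier_mat n n" by auto
  have "?E * transpose_mat ?E = 1\<^sub>m n"
    using assms(1) by (intro eq_matI) (auto simp: scalar_prod_def ip_def lessThan_atLeast0)
  hence "transpose_mat ?E * ?E = 1\<^sub>m n" using mat_mult_left_right_inverse[OF E, of "transpose_mat ?E"] by auto
  hence "(transpose_mat ?E * ?E) $$ (l, r) = 1\<^sub>m n $$ (l, r)" by simp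
  thus ?thesis using lr by (auto simp: scalar_prod_def lessThan_atLeast0)
qed

lemma char_poly_of_eigenbasis:
  assumes on: "\<forall>i<n. \<forall>j<n. ip n (e i) (e j) = (if i = j then 1 else 0)"
    and ev: "\<forall>i<n. \<forall>l<n. mv n a (e i) l = \<mu> i * e i l"
  shows "char_poly (Matrix.mat n n (\<lambda>(i, j). a i j)) = (\<Prod>i<n. [:- \<mu> i, 1:])"
proof -
  let ?A = "Matrix.mat n n (\<lambda>(i, j). a i j)"
  let ?E = "Matrix.mat n n (\<lambda>(i, j). e j i)"
  let ?D = "Matrix.mat n n (\<lambda>(i, j). if i = j then \<mu> i else 0)"
  have EE: "transpose_mat ?E * ?E = 1\<^sub>m n" 
    using on by (intro eq_matI) (auto simp: scalar_prod_def ip_def lessThan_atLeast0)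
  have EE': "?E * transpose_mat ?E = 1\<^sub>m n"
    using mat_mult_left_right_inverse[OF _ _ EE] by auto
  have AE: "?A * ?E = ?E * ?D"
  proof (intro eq_matI)
    fix i j assume "i < dim_row (?E * ?D)" "j < dim_col (?E * ?D)"
    hence ij: "i < n" "j < n" by auto
    have "(?A * ?E) $$ (i, j) = mv n a (e j) i" using ij by (auto simp: scalar_prod_def mv_def lessThan_atLeast0)
    moreover have "(?E * ?D) $$ (i, j) = (\<Sum>l = 0..<n. if l = j then e j i * \<mu> j else 0)"
    proof -
      have "(?E * ?D) $$ (i, j) = (\<Sum>l = 0..<n. e l i * (if l = j then \<mu> l else 0))"
        using ij by (auto simp: scalar_prod_def)
      also have "\<dots> = (\<Sum>l = 0..<n. if l = j then e j i * \<mu> j else 0)" by (intro sum.cong) auto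
      finally show ?thesis .
    qed
    ultimately show "(?A * ?E) $$ (i, j) = (?E * ?D) $$ (i, j)" using ev ij by simp
  qed auto
  have "?A = ?A * (?E * transpose_mat ?E)" unfolding EE' by simp
  also have "\<dots> = ?E * ?D * transpose_mat ?E"
    by (subst assoc_mult_mat[symmetric, of _ n n _ n _ n]) (auto simp: AE)
  finally have "similar_mat ?A ?D"
    by (intro similar_matI[of _ _ ?E "transpose_mat ?E" n]) (auto simp: EE EE')
  hence "char_poly ?A = char_poly ?D" by (rule char_poly_similar)
  also have "\<dots> = (\<Prod> a \<leftarrow> diag_mat ?D. [:- a, 1:])"
    by (rule char_poly_upper_triangular[of _ n]) (auto simp: upper_triangular_def)
  also have "\<dots> = (\<Prod>i<n. [:- \<mu> i, 1:])"
  proof -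
    have "diag_mat ?D = map \<mu> [0..<n]" by (auto simp: diag_mat_def)
    thus ?thesis by (simp add: prod.list_conv_set_nth lessThan_atLeast0)
  qed
  finally show ?thesis .
qed

lemma order_prod_linear:
  assumes "finite I"
  shows "Polynomial.order x (\<Prod>i\<in>I. [:- \<mu> i, 1:]) = card {i\<in>I. \<mu> i = (x::real)}"
  using assms
proof (induction I)
  case (insert j I)
  have "Polynomial.order x [:- \<mu> j, 1:] = (if \<mu> j = x then 1 else 0)"
    using order_linear[of "\<mu> j"] by (auto simp: order_0I)
  moreover have "{i \<in> insert j I. \<mu> i = x} = (if \<mu> j = x then insert j {i\<in>I. \<mu> i = x} else {i\<in>I. \<mu> i = x})" by auto
  moreover have "[:- \<mu> j, 1:] * (\<Prod>i\<in>I. [:- \<mu> i, 1:]) \<noteq> 0"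
    using insert by (simp del: mult_pCons_left)
  ultimately show ?case using insert by (simp add: order_mult del: mult_pCons_left)
qed (simp add: order_0I)

text \<open>Multiplicities of roots become numbers of indices of an eigenbasis; this lets the rank
  act as the number of coordinates to be annihilated.\<close>

lemma neg_threshold_rank_eq:
  assumes on: "\<forall>i<n. \<forall>j<n. ip n (e i) (e j) = (if i = j then 1 else 0)"
    and ev: "\<forall>i<n. \<forall>l<n. mv n a (e i) l = \<mu> i * e i l"
  shows "neg_threshold_rank \<epsilon> (Matrix.mat n n (\<lambda>(i, j). a i j)) = card {i. i < n \<and> \<mu> i < - \<epsilon>}"
proof -
  let ?A = "Matrix.mat n n (\<lambda>(i, j). a i j)"
  have cp: "char_poly ?A = (\<Prod>i<n. [:- \<mu> i, 1:])" by (rule char_poly_of_eigenbasis[OF on ev])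
  have "eigenvalue ?A x \<longleftrightarrow> x \<in> \<mu> ` {..<n}" for x
    by (subst eigenvalue_root_char_poly[of _ n]) (auto simp: cp poly_prod)
  hence S: "{x. eigenvalue ?A x \<and> x < - \<epsilon>} = \<mu> ` {i. i < n \<and> \<mu> i < - \<epsilon>}" by auto
  have "neg_threshold_rank \<epsilon> ?A = (\<Sum>x\<in>\<mu> ` {i. i < n \<and> \<mu> i < - \<epsilon>}. card {i. i < n \<and> \<mu> i = x})"
    unfolding neg_threshold_rank_def S cp by (simp add: order_prod_linear)
  also have "\<dots> = (\<Sum>x\<in>\<mu> ` {i. i < n \<and> \<mu> i < - \<epsilon>}. card {i\<in>{i. i < n \<and> \<mu> i < - \<epsilon>}. \<mu> i = x})"
    by (intro sum.cong refl arg_cong[of _ _ card]) auto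
  also have "\<dots> = card {i. i < n \<and> \<mu> i < - \<epsilon>}"
    using sum.image_gen[of "{i. i < n \<and> \<mu> i < - \<epsilon>}" "\<lambda>_. 1::nat" \<mu>] by simp
  finally show ?thesis .
qed

section \<open>Deflation, power iteration and the Frank--Wolfe method\<close>

definition qf :: "nat \<Rightarrow> (nat \<Rightarrow> nat \<Rightarrow> real) \<Rightarrow> (nat \<Rightarrow> real) \<Rightarrow> real" where
  "qf n b x = ip n x (mv n b x)"

lemma mv_add: "mv n b (\<lambda>l. x l + c * y l) = (\<lambda>l. mv n b x l + c * mv n b y l)"
  by (auto simp: mv_def sum.distrib sum_distrib_left algebra_simps)

lemma ip_add_left: "ip n (\<lambda>l. x l + c * y l) z = ip n x z + c * ip n y z"
  by (auto simp: ip_def sum.distrib sum_distrib_left algebra_simps)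

lemma ip_add_right: "ip n z (\<lambda>l. x l + c * y l) = ip n z x + c * ip n z y"
  by (auto simp: ip_def sum.distrib sum_distrib_left algebra_simps)

lemma ip_commute: "ip n x y = ip n y x"
  by (auto simp: ip_def mult.commute)

abbreviation symm :: "nat \<Rightarrow> (nat \<Rightarrow> nat \<Rightarrow> real) \<Rightarrow> bool" where
  "symm n b \<equiv> \<forall>i<n. \<forall>j<n. b i j = b j i"

lemma qf_add:
  assumes "symm n b"
  shows "qf n b (\<lambda>l. x l + c * y l) = qf n b x + 2 * c * ip n x (mv n b y) + c\<^sup>2 * qf n b y"
proof -
  have "ip n y (mv n b x) = ip n x (mv n b y)"
    by (subst ip_commute, subst ip_mv_sym) (use assms in auto)
  thus ?thesis unfolding qf_def mv_add ip_add_left ip_add_right by (simp add: power2_eq_square algebra_simps)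
qed

text \<open>For \<open>qf n b v < 0\<close> and symmetric \<open>b\<close> the new form is constant
  on every line in direction \<open>v\<close>, with the maximum of the old form on that line as its
  value.\<close>

definition deflate :: "nat \<Rightarrow> (nat \<Rightarrow> nat \<Rightarrow> real) \<Rightarrow> (nat \<Rightarrow> real) \<Rightarrow> nat \<Rightarrow> nat \<Rightarrow> real" where
  "deflate n b v = (\<lambda>i j. b i j + mv n b v i * mv n b v j / (- qf n b v))"

lemma qf_deflate: "qf n (deflate n b v) y = qf n b y + (ip n y (mv n b v))\<^sup>2 / (- qf n b v)"
proof -
  have "mv n (deflate n b v) y l = mv n b y l + mv n b v l / (- qf n b v) * ip n y (mv n b v)" for l
  proof -
    have "mv n (deflate n b v) y l = (\<Sum>r<n. b l r * y r + mv n b v l / (- qf n b v) * (y r * mv n b v r))"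
      unfolding mv_def[of n "deflate n b v"] unfolding deflate_def by (intro sum.cong refl) (simp add: algebra_simps)
    thus ?thesis unfolding sum.distrib sum_distrib_left[symmetric] ip_def mv_def[of n b y] .
  qed
  hence "qf n (deflate n b v) y = ip n y (\<lambda>l. mv n b y l + (ip n y (mv n b v) / (- qf n b v)) * mv n b v l)"
    unfolding qf_def[of n "deflate n b v"] by (intro arg_cong[of _ _ "ip n y"]) (auto simp: mult_ac)
  thus ?thesis unfolding ip_add_right qf_def by (simp add: power2_eq_square)
qed

definition lin :: "((nat \<Rightarrow> real) \<Rightarrow> real) \<Rightarrow> bool" where
  "lin \<phi> \<longleftrightarrow> (\<forall>x y c. \<phi> (\<lambda>l. x l + c * y l) = \<phi> x + c * \<phi> y)"

text \<open>A bound on the number of negative squares, phrased with functionals in place of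
  subspaces and dimensions: a deflation then has to remove just one functional.\<close>

definition codim_nonneg :: "nat \<Rightarrow> (nat \<Rightarrow> nat \<Rightarrow> real) \<Rightarrow> nat \<Rightarrow> bool" where
  "codim_nonneg n b r \<longleftrightarrow> (\<exists>\<phi>. (\<forall>i<r. lin (\<phi> i)) \<and> (\<forall>x. (\<forall>i<r. \<phi> i x = 0) \<longrightarrow> qf n b x \<ge> 0))"

text \<open>Some \<open>\<phi> j\<close> does not vanish at \<open>v\<close>, because the form is
  negative there. Moving \<open>x\<close> along \<open>v\<close> until \<open>\<phi> j\<close>
  vanishes is a linear projection, and the deflated form at \<open>x\<close> is at least the old
  form at the moved point. Hence the other functionals, composed with the projection,
  suffice.\<close>

lemma codim_deflate:
  assumes sym: "symm n b" and c: "codim_nonneg n b r" and v: "qf n b v < 0"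
  shows "\<exists>r'. r = Suc r' \<and> codim_nonneg n (deflate n b v) r'"
proof -
  obtain \<phi> where \<phi>: "\<forall>i<r. lin (\<phi> i)" "\<forall>x. (\<forall>i<r. \<phi> i x = 0) \<longrightarrow> qf n b x \<ge> 0"
    using c unfolding codim_nonneg_def by blast
  obtain j where j: "j < r" "\<phi> j v \<noteq> 0" using \<phi>(2)[rule_format, of v] v by force
  then obtain r' where r': "r = Suc r'" by (cases r) auto
  define \<pi> where "\<pi> i = (if i < j then i else Suc i)" for i
  define s where "s x = - \<phi> j x / \<phi> j v" for x
  \<comment> \<open>The difference of the two sides is the square
    \<open>(q - t * B)^2 / B\<close>.\<close>
  have ge: "qf n (deflate n b v) x \<ge> qf n b (\<lambda>l. x l + t * v l)" for x t
  proof -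
    define B where "B = - qf n b v"
    define q where "q = ip n x (mv n b v)"
    have B: "B > 0" using v by (simp add: B_def)
    have "0 \<le> (q - t * B)\<^sup>2 / B" using B by simp
    also have "\<dots> = q\<^sup>2 / B - 2 * t * q + t\<^sup>2 * B"
      using B by (simp add: field_simps power2_eq_square)
    finally show ?thesis unfolding qf_add[OF sym] qf_deflate B_def[symmetric] q_def[symmetric]
      using B_def by (simp add: algebra_simps)
  qed
  have lj: "lin (\<phi> j)" using \<phi>(1) j by auto
  show ?thesis unfolding codim_nonneg_def
  proof (intro exI conjI)
    show "r = Suc r'" by fact
    show "\<forall>i<r'. lin (\<lambda>x. \<phi> (\<pi> i) x + s x * \<phi> (\<pi> i) v)"
    proof (intro allI impI)
      fix i assume "i < r'"
      hence "lin (\<phi> (\<pi> i))" using \<phi>(1) r' by (auto simp: \<pi>_def)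
      thus "lin (\<lambda>x. \<phi> (\<pi> i) x + s x * \<phi> (\<pi> i) v)"
        using lj j(2) unfolding lin_def s_def by (auto simp: field_simps)
    qed
    show "\<forall>x. (\<forall>i<r'. \<phi> (\<pi> i) x + s x * \<phi> (\<pi> i) v = 0) \<longrightarrow> 0 \<le> qf n (deflate n b v) x"
    proof (intro allI impI)
      fix x assume a: "\<forall>i<r'. \<phi> (\<pi> i) x + s x * \<phi> (\<pi> i) v = 0"
      have "\<phi> i (\<lambda>l. x l + s x * v l) = 0" if "i < r" for i
      proof (cases "i = j")
        case True
        have "\<phi> j (\<lambda>l. x l + s x * v l) = \<phi> j x + s x * \<phi> j v" using lj unfolding lin_def by blast
        thus ?thesis using True j(2) by (simp add: s_def)
      next
        case False
        define i' where "i' = (if i < j then i else i - 1)"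
        have "i' < r'" "\<pi> i' = i" using False that j r' by (auto simp: i'_def \<pi>_def)
        thus ?thesis using a \<phi>(1) that unfolding lin_def by auto
      qed
      hence "0 \<le> qf n b (\<lambda>l. x l + s x * v l)" using \<phi>(2) by blast
      thus "0 \<le> qf n (deflate n b v) x" using ge order_trans by blast
    qed
  qed
qed

text \<open>Everything is in eigenbasis coordinates: \<open>\<alpha>\<close> belongs to the vector
  used for the deflation, \<open>y\<close> to an arbitrary one. On the eigenvalues at most -1/2,
  Cauchy--Schwarz bounds the added square by what the form is negative there, so a purely negative
  vector would leave the upper bound \<open>C\<close> intact. The share \<open>\<eta>^2\<close> of
  mass outside this part costs the extra \<open>16 * c^2 * \<eta>\<close>.\<close>

lemma spectral_deflation_bound:
  fixes \<mu> \<alpha> y :: "nat \<Rightarrow> real"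
  assumes c: "\<And>i. i < n \<Longrightarrow> \<bar>\<mu> i\<bar> \<le> c" "c \<ge> 1" and C: "\<And>i. i < n \<Longrightarrow> \<mu> i \<le> C" "C \<ge> 0"
    and A: "A = (\<Sum>i<n. (\<alpha> i)\<^sup>2)" "A > 0"
    and small: "(\<Sum>i | i < n \<and> \<mu> i > - 1/2. (\<alpha> i)\<^sup>2) \<le> \<eta>\<^sup>2 * A"
    and \<eta>: "\<eta> > 0" "\<eta> \<le> 1 / (8 * c)"
    and \<beta>: "\<beta> = - (\<Sum>i<n. \<mu> i * (\<alpha> i)\<^sup>2)"
  shows "\<beta> \<ge> A / 4"
    and "(\<Sum>i<n. \<mu> i * (y i)\<^sup>2) + (\<Sum>i<n. \<mu> i * \<alpha> i * y i)\<^sup>2 / \<beta> \<le> (C + 16 * c\<^sup>2 * \<eta>) * (\<Sum>i<n. (y i)\<^sup>2)"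
proof -
  define I where "I = {i. i < n \<and> \<mu> i > - 1/2}"
  define W where "W = {i. i < n \<and> \<not> \<mu> i > - 1/2}"
  have fin: "finite I" "finite W" "I \<inter> W = {}" "{..<n} = I \<union> W" by (auto simp: I_def W_def)
  have split: "(\<Sum>i<n. f i) = (\<Sum>i\<in>I. f i) + (\<Sum>i\<in>W. f i)" for f :: "nat \<Rightarrow> real"
    unfolding fin(4) by (rule sum.union_disjoint) (use fin in auto)
  define a where "a = (\<Sum>i\<in>W. - \<mu> i * (\<alpha> i)\<^sup>2)"
  define aI where "aI = (\<Sum>i\<in>I. (\<alpha> i)\<^sup>2)"
  define Y where "Y = (\<Sum>i\<in>W. - \<mu> i * (y i)\<^sup>2)"
  define YI where "YI = (\<Sum>i\<in>I. \<mu> i * (y i)\<^sup>2)"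
  define p where "p = (\<Sum>i\<in>W. \<mu> i * \<alpha> i * y i)"
  define r where "r = (\<Sum>i\<in>I. \<mu> i * \<alpha> i * y i)"
  define y2 where "y2 = (\<Sum>i<n. (y i)\<^sup>2)"
  have aI: "0 \<le> aI" "aI \<le> \<eta>\<^sup>2 * A" using small by (auto simp: aI_def I_def sum_nonneg)
  have \<eta>c: "\<eta> * (8 * c) \<le> 1" using \<eta> c by (simp add: field_simps)
  have "\<eta> * 8 * 1 \<le> \<eta> * 8 * c" using c(2) \<eta>(1) by (intro mult_left_mono) auto
  hence \<eta>1: "\<eta> \<le> 1 / 8" using \<eta>c by simp
  have \<eta>2: "\<eta>\<^sup>2 \<le> \<eta> / (8 * c)" using \<eta> c by (simp add: power2_eq_square field_simps)
  have \<eta>3: "c * \<eta>\<^sup>2 \<le> \<eta> / 8" using mult_left_mono[OF \<eta>2, of c] c(2) by simp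
  have cn: "c > 0" using c by auto
  have YI: "\<bar>\<Sum>i\<in>I. \<mu> i * (\<alpha> i)\<^sup>2\<bar> \<le> c * aI"
    unfolding aI_def sum_distrib_left
    by (rule order_trans[OF sum_abs]) (auto simp: abs_mult I_def intro!: sum_mono mult_right_mono c)
  have \<beta>a: "\<beta> = a - (\<Sum>i\<in>I. \<mu> i * (\<alpha> i)\<^sup>2)" unfolding \<beta> split a_def by (simp add: sum_negf)
  have a1: "a \<ge> 1/2 * (A - aI)"
  proof -
    have "A - aI = (\<Sum>i\<in>W. (\<alpha> i)\<^sup>2)" unfolding A split aI_def by simp
    also have "1/2 * \<dots> \<le> a" unfolding a_def sum_distrib_left by (intro sum_mono mult_right_mono) (auto simp: W_def)
    finally show ?thesis by simp
  qed
  have caI: "c * aI \<le> c * \<eta>\<^sup>2 * A" using aI cn by (simp add: mult.assoc)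
  have caI2: "c * \<eta>\<^sup>2 * A \<le> \<eta> / 8 * A" using \<eta>3 A(2) by (intro mult_right_mono) auto
  have "\<eta>\<^sup>2 \<le> 1/64" using power_mono[OF \<eta>1, of 2] \<eta>(1) by (simp add: power_divide)
  hence "\<eta>\<^sup>2 * A \<le> 1/64 * A" using A(2) by (intro mult_right_mono) auto
  hence aI3: "aI \<le> 1/64 * A" using aI by linarith
  have "\<eta> / 8 * A \<le> 1/64 * A" using \<eta>1 A(2) by (intro mult_right_mono) auto
  hence caI3: "c * aI \<le> 1/64 * A" using caI caI2 by linarith
  have "(\<Sum>i\<in>I. \<mu> i * (\<alpha> i)\<^sup>2) \<le> 1/64 * A" using YI caI3 by (auto simp: abs_le_iff)
  hence "\<beta> \<ge> 1/2 * (A - aI) - 1/64 * A" using \<beta>a a1 by linarith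
  thus b4: "\<beta> \<ge> A / 4" using aI3 A(2) by (simp add: field_simps)
  have \<beta>p: "\<beta> > 0" using b4 A by auto
  have Y0: "Y \<ge> 0" unfolding Y_def by (intro sum_nonneg) (auto simp: W_def intro!: mult_nonpos_nonneg)
  have y20: "y2 \<ge> 0" unfolding y2_def by (intro sum_nonneg) auto
  have Yc: "Y \<le> c * y2"
  proof -
    have "Y \<le> (\<Sum>i\<in>W. c * (y i)\<^sup>2)" unfolding Y_def using c(1)
      by (intro sum_mono mult_right_mono) (auto simp: W_def abs_le_iff)
    also have "\<dots> \<le> c * y2" unfolding y2_def sum_distrib_left
      by (intro sum_mono2) (use fin cn in \<open>auto simp: W_def\<close>)
    finally show ?thesis .
  qed
  have yI: "(\<Sum>i\<in>I. (y i)\<^sup>2) \<le> y2" unfolding y2_def by (intro sum_mono2) (auto simp: I_def)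
  have ac: "a \<le> c * A"
  proof -
    have "a \<le> (\<Sum>i\<in>W. c * (\<alpha> i)\<^sup>2)" unfolding a_def using c(1)
      by (intro sum_mono mult_right_mono) (auto simp: W_def abs_le_iff)
    also have "\<dots> \<le> c * A" unfolding A sum_distrib_left
      by (intro sum_mono2) (use fin cn in \<open>auto simp: W_def\<close>)
    finally show ?thesis .
  qed
  have p2: "p\<^sup>2 \<le> a * Y"
  proof -
    have "p = - (\<Sum>i\<in>W. (sqrt (- \<mu> i) * \<alpha> i) * (sqrt (- \<mu> i) * y i))"
      unfolding p_def sum_negf[symmetric]
    proof (intro sum.cong refl)
      fix i assume "i \<in> W"
      hence "- \<mu> i \<ge> 0" by (auto simp: W_def)
      hence "sqrt (- \<mu> i) * sqrt (- \<mu> i) = - \<mu> i" by simp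
      thus "\<mu> i * \<alpha> i * y i = - (sqrt (- \<mu> i) * \<alpha> i * (sqrt (- \<mu> i) * y i))"
        by (metis (no_types, opaque_lifting) mult.assoc mult.left_commute mult_minus_left minus_minus)
    qed
    hence "p\<^sup>2 = (\<Sum>i\<in>W. (sqrt (- \<mu> i) * \<alpha> i) * (sqrt (- \<mu> i) * y i))\<^sup>2" by simp
    also have "\<dots> \<le> (\<Sum>i\<in>W. (sqrt (- \<mu> i) * \<alpha> i)\<^sup>2) * (\<Sum>i\<in>W. (sqrt (- \<mu> i) * y i)\<^sup>2)"
      by (rule Cauchy_Schwarz_ineq_sum)
    also have "(\<Sum>i\<in>W. (sqrt (- \<mu> i) * \<alpha> i)\<^sup>2) = a" unfolding a_def
      by (intro sum.cong refl) (auto simp: W_def power_mult_distrib)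
    also have "(\<Sum>i\<in>W. (sqrt (- \<mu> i) * y i)\<^sup>2) = Y" unfolding Y_def
      by (intro sum.cong refl) (auto simp: W_def power_mult_distrib)
    finally show ?thesis .
  qed
  have r2: "r\<^sup>2 \<le> c\<^sup>2 * \<eta>\<^sup>2 * A * y2"
  proof -
    have "r\<^sup>2 \<le> (\<Sum>i\<in>I. (\<mu> i * \<alpha> i)\<^sup>2) * (\<Sum>i\<in>I. (y i)\<^sup>2)"
      unfolding r_def by (rule Cauchy_Schwarz_ineq_sum)
    also have "\<dots> \<le> (c\<^sup>2 * aI) * y2"
    proof (intro mult_mono yI)
      show "(\<Sum>i\<in>I. (\<mu> i * \<alpha> i)\<^sup>2) \<le> c\<^sup>2 * aI" unfolding aI_def sum_distrib_left
      proof (intro sum_mono)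
        fix i assume "i \<in> I"
        hence "\<bar>\<mu> i\<bar> \<le> \<bar>c\<bar>" using c by (auto simp: I_def)
        thus "(\<mu> i * \<alpha> i)\<^sup>2 \<le> c\<^sup>2 * (\<alpha> i)\<^sup>2" unfolding power_mult_distrib
          by (intro mult_right_mono) (auto simp: abs_le_square_iff)
      qed
    qed (use aI in \<open>auto intro!: sum_nonneg mult_nonneg_nonneg\<close>)
    also have "\<dots> \<le> (c\<^sup>2 * (\<eta>\<^sup>2 * A)) * y2" using aI y20 by (intro mult_right_mono mult_left_mono) auto
    finally show ?thesis by (simp add: mult_ac)
  qed
  have pA: "p\<^sup>2 \<le> c\<^sup>2 * A * y2"
  proof -
    have "a * Y \<le> (c * A) * (c * y2)" using ac Yc Y0 cn A(2) by (intro mult_mono) auto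
    thus ?thesis using p2 by (simp add: power2_eq_square mult_ac)
  qed
  \<comment> \<open>Arithmetic--geometric mean with weight \<open>\<eta>\<close>, because
    \<open>p^2\<close> is of order \<open>A * y2\<close> and \<open>r^2\<close> of order
    \<open>\<eta>^2 * A * y2\<close>.\<close>
  have pr: "2 * p * r \<le> 2 * c\<^sup>2 * \<eta> * A * y2"
  proof -
    have "0 \<le> (\<eta> * p - r)\<^sup>2 / \<eta>" using \<eta> by simp
    also have "\<dots> = \<eta> * p\<^sup>2 - 2 * p * r + r\<^sup>2 / \<eta>" using \<eta> by (simp add: field_simps power2_eq_square)
    finally have "2 * p * r \<le> \<eta> * p\<^sup>2 + r\<^sup>2 / \<eta>" by simp
    also have "\<dots> \<le> \<eta> * (c\<^sup>2 * A * y2) + (c\<^sup>2 * \<eta>\<^sup>2 * A * y2) / \<eta>"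
      using pA r2 \<eta> by (intro add_mono mult_left_mono divide_right_mono) auto
    also have "\<dots> = 2 * c\<^sup>2 * \<eta> * A * y2" using \<eta> by (simp add: field_simps power2_eq_square)
    finally show ?thesis .
  qed
  have a\<beta>: "a \<le> \<beta> + c * \<eta>\<^sup>2 * A" using \<beta>a YI caI by linarith
  have A4: "A \<le> 4 * \<beta>" using b4 by simp
  have ub: "(p + r)\<^sup>2 \<le> \<beta> * (Y + 16 * c\<^sup>2 * \<eta> * y2)"
  proof -
    have "(p + r)\<^sup>2 = p\<^sup>2 + 2 * p * r + r\<^sup>2" by (simp add: power2_eq_square algebra_simps)
    also have "\<dots> \<le> (\<beta> + c * \<eta>\<^sup>2 * A) * Y + 2 * c\<^sup>2 * \<eta> * A * y2 + c\<^sup>2 * \<eta>\<^sup>2 * A * y2"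
      using p2 pr r2 mult_right_mono[OF a\<beta> Y0] by linarith
    also have "(\<beta> + c * \<eta>\<^sup>2 * A) * Y \<le> \<beta> * Y + c\<^sup>2 * \<eta>\<^sup>2 * A * y2"
    proof -
      have "c * \<eta>\<^sup>2 * A * Y \<le> c * \<eta>\<^sup>2 * A * (c * y2)" using Yc cn A(2) by (intro mult_left_mono) auto
      thus ?thesis by (simp add: algebra_simps power2_eq_square)
    qed
    also have "\<beta> * Y + c\<^sup>2 * \<eta>\<^sup>2 * A * y2 + 2 * c\<^sup>2 * \<eta> * A * y2 + c\<^sup>2 * \<eta>\<^sup>2 * A * y2
        = \<beta> * Y + A * (c\<^sup>2 * y2 * (2 * \<eta>\<^sup>2 + 2 * \<eta>))" by (simp add: algebra_simps)
    also have "\<dots> \<le> \<beta> * Y + (4 * \<beta>) * (c\<^sup>2 * y2 * (4 * \<eta>))"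
    proof -
      have "\<eta>\<^sup>2 \<le> \<eta>" using \<eta>(1) \<eta>1 by (simp add: power2_eq_square)
      hence "c\<^sup>2 * y2 * (2 * \<eta>\<^sup>2 + 2 * \<eta>) \<le> c\<^sup>2 * y2 * (4 * \<eta>)" using y20 by (intro mult_left_mono) auto
      hence "A * (c\<^sup>2 * y2 * (2 * \<eta>\<^sup>2 + 2 * \<eta>)) \<le> (4 * \<beta>) * (c\<^sup>2 * y2 * (4 * \<eta>))"
        by (rule mult_mono[OF A4]) (use \<beta>p y20 \<eta>(1) in \<open>auto intro!: mult_nonneg_nonneg add_nonneg_nonneg\<close>)
      thus ?thesis by simp
    qed
    finally show ?thesis by (simp add: algebra_simps)
  qed
  have "(p + r)\<^sup>2 / \<beta> \<le> Y + 16 * c\<^sup>2 * \<eta> * y2" using ub \<beta>p by (simp add: field_simps)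
  moreover have "(\<Sum>i<n. \<mu> i * (y i)\<^sup>2) = YI - Y" unfolding split YI_def Y_def by (simp add: sum_negf)
  moreover have "YI \<le> C * y2"
  proof -
    have "YI \<le> (\<Sum>i\<in>I. C * (y i)\<^sup>2)" unfolding YI_def by (intro sum_mono mult_right_mono C) (auto simp: I_def)
    also have "\<dots> \<le> C * y2" unfolding sum_distrib_left[symmetric] using yI C by (intro mult_left_mono) auto
    finally show ?thesis .
  qed
  moreover have "(\<Sum>i<n. \<mu> i * \<alpha> i * y i) = p + r" unfolding split p_def r_def by simp
  ultimately show "(\<Sum>i<n. \<mu> i * (y i)\<^sup>2) + (\<Sum>i<n. \<mu> i * \<alpha> i * y i)\<^sup>2 / \<beta> \<le> (C + 16 * c\<^sup>2 * \<eta>) * (\<Sum>i<n. (y i)\<^sup>2)"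
    unfolding y2_def[symmetric] by (simp add: algebra_simps)
qed

text \<open>Eigenbasis of \<open>b\<close> relative to the diagonal matrix \<open>d\<close>,
  orthonormal for the weighted inner product. The weights take the place of a conjugation by square
  roots of degrees, which has no counterpart in integer arithmetic. With \<open>d = 1\<close> it
  also covers the normalized adjacency matrix.\<close>

locale weighted_basis =
  fixes n :: nat and b :: "nat \<Rightarrow> nat \<Rightarrow> real" and d :: "nat \<Rightarrow> real"
    and e :: "nat \<Rightarrow> nat \<Rightarrow> real" and \<mu> :: "nat \<Rightarrow> real"
  assumes sym: "symm n b" and d: "l < n \<Longrightarrow> d l > 0"
    and on: "i < n \<Longrightarrow> j < n \<Longrightarrow> (\<Sum>l<n. d l * e i l * e j l) = (if i = j then 1 else 0)"
    and ev: "i < n \<Longrightarrow> l < n \<Longrightarrow> mv n b (e i) l = \<mu> i * d l * e i l"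
    and complete: "l < n \<Longrightarrow> r < n \<Longrightarrow> (\<Sum>i<n. e i l * e i r) * d r = (if l = r then 1 else 0)"
begin

definition co :: "nat \<Rightarrow> (nat \<Rightarrow> real) \<Rightarrow> real" where
  "co i x = (\<Sum>l<n. d l * e i l * x l)"

lemma parseval: "(\<Sum>l<n. d l * x l * y l) = (\<Sum>i<n. co i x * co i y)"
proof -
  have "(\<Sum>i<n. co i x * co i y) = (\<Sum>i<n. \<Sum>l<n. \<Sum>r<n. d l * x l * y r * (e i l * e i r * d r))"
    unfolding co_def sum_product by (simp add: mult_ac)
  also have "\<dots> = (\<Sum>l<n. \<Sum>i<n. \<Sum>r<n. d l * x l * y r * (e i l * e i r * d r))"
    by (rule sum.swap)
  also have "\<dots> = (\<Sum>l<n. \<Sum>r<n. \<Sum>i<n. d l * x l * y r * (e i l * e i r * d r))"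
    by (rule sum.cong[OF refl], rule sum.swap)
  also have "\<dots> = (\<Sum>l<n. \<Sum>r<n. d l * x l * y r * ((\<Sum>i<n. e i l * e i r) * d r))"
    unfolding sum_distrib_left sum_distrib_right by (simp add: mult.assoc)
  also have "\<dots> = (\<Sum>l<n. \<Sum>r<n. if r = l then d l * x l * y l else 0)"
    using complete by (intro sum.cong refl) auto
  also have "\<dots> = (\<Sum>l<n. d l * x l * y l)" by (intro sum.cong refl) (simp add: sum.delta)
  finally show ?thesis by simp
qed

lemma co_mv: "i < n \<Longrightarrow> co i (\<lambda>l. mv n b x l / d l) = \<mu> i * co i x"
proof -
  assume i: "i < n"
  have "co i (\<lambda>l. mv n b x l / d l) = ip n (e i) (mv n b x)"
    unfolding co_def ip_def using d by (intro sum.cong refl) (auto simp: less_imp_neq[symmetric])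
  also have "\<dots> = ip n (mv n b (e i)) x" by (rule ip_mv_sym[symmetric]) (use sym in auto)
  also have "\<dots> = \<mu> i * co i x" unfolding ip_def co_def sum_distrib_left
    using ev[OF i] by (intro sum.cong refl) auto
  finally show ?thesis .
qed

lemma ip_mv: "ip n y (mv n b x) = (\<Sum>i<n. \<mu> i * co i x * co i y)"
proof -
  have "ip n y (mv n b x) = (\<Sum>l<n. d l * y l * (mv n b x l / d l))"
    unfolding ip_def using d by (intro sum.cong refl) (auto simp: less_imp_neq[symmetric])
  also have "\<dots> = (\<Sum>i<n. \<mu> i * co i x * co i y)"
    unfolding parseval by (intro sum.cong refl) (auto simp: co_mv mult_ac)
  finally show ?thesis .
qed

lemma qf_co: "qf n b x = (\<Sum>i<n. \<mu> i * (co i x)\<^sup>2)"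
  unfolding qf_def ip_mv by (simp add: power2_eq_square mult.assoc)

lemma wn_co: "(\<Sum>l<n. d l * (x l)\<^sup>2) = (\<Sum>i<n. (co i x)\<^sup>2)"
  using parseval[of x x] by (simp add: power2_eq_square mult.assoc)

lemma co_basis: "i < n \<Longrightarrow> j < n \<Longrightarrow> co i (e j) = (if i = j then 1 else 0)"
  unfolding co_def using on .

lemma eigen_bounds:
  assumes "i < n"
  shows "qf n b (e i) = \<mu> i" "(\<Sum>l<n. d l * (e i l)\<^sup>2) = 1"
proof -
  have "(\<Sum>j<n. f j * (co j (e i))\<^sup>2) = f i" for f
  proof -
    have "(\<Sum>j<n. f j * (co j (e i))\<^sup>2) = (\<Sum>j<n. if j = i then f i else 0)"
      using assms by (intro sum.cong refl) (auto simp: co_basis)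
    thus ?thesis using assms by (simp add: sum.delta)
  qed
  from this[of \<mu>] this[of "\<lambda>_. 1"] show "qf n b (e i) = \<mu> i" "(\<Sum>l<n. d l * (e i l)\<^sup>2) = 1"
    unfolding qf_co wn_co by simp_all
qed

lemma co_lin: "co i (\<lambda>l. x l + c * y l) = co i x + c * co i y"
  unfolding co_def by (simp add: sum.distrib sum_distrib_left algebra_simps)

end

lemma weighted_basis_exists:
  assumes sym: "symm n b" and d: "\<And>l. l < n \<Longrightarrow> d l > 0"
  shows "\<exists>e \<mu>. weighted_basis n b d e \<mu>"
proof -
  define a where "a l r = b l r / (sqrt (d l) * sqrt (d r))" for l r
  have "a i j = a j i" if "i < n" "j < n" for i j using sym that by (simp add: a_def mult.commute)
  then obtain f \<mu> where f: "\<forall>i<n. \<forall>j<n. ip n (f i) (f j) = (if i = j then 1 else 0)"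
     "\<forall>i<n. \<forall>l<n. mv n a (f i) l = \<mu> i * f i l"
    using spectral_theorem[of n a] by blast
  define e where "e i l = f i l / sqrt (d l)" for i l
  have s: "sqrt (d l) * sqrt (d l) = d l" "sqrt (d l) > 0" if "l < n" for l using d[OF that] by auto
  have "weighted_basis n b d e \<mu>"
  proof
    show "symm n b" by fact
    show "d l > 0" if "l < n" for l using d[OF that] .
    show "(\<Sum>l<n. d l * e i l * e j l) = (if i = j then 1 else 0)" if "i < n" "j < n" for i j
    proof -
      have "(\<Sum>l<n. d l * e i l * e j l) = ip n (f i) (f j)"
        unfolding ip_def
      proof (intro sum.cong refl)
        fix l assume "l \<in> {..<n}"
        with s[of l] show "d l * e i l * e j l = f i l * f j l" unfolding e_def by (simp add: field_simps)
      qed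
      thus ?thesis using f(1) that by simp
    qed
    show "mv n b (e i) l = \<mu> i * d l * e i l" if "i < n" "l < n" for i l
    proof -
      have "mv n b (e i) l = sqrt (d l) * mv n a (f i) l"
        unfolding mv_def a_def e_def sum_distrib_left
      proof (intro sum.cong refl)
        fix r assume "r \<in> {..<n}"
        with s[of l] s[of r] that show "b l r * (f i r / sqrt (d r)) = sqrt (d l) * (b l r / (sqrt (d l) * sqrt (d r)) * f i r)"
          by (simp add: field_simps)
      qed
      also have "\<dots> = sqrt (d l) * \<mu> i * f i l" using f(2) that by simp
      also have "\<dots> = \<mu> i * d l * e i l" using s[OF that(2)] unfolding e_def by (simp add: field_simps)
      finally show ?thesis .
    qed
    show "(\<Sum>i<n. e i l * e i r) * d r = (if l = r then 1 else 0)" if "l < n" "r < n" for l r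
    proof -
      have "(\<Sum>i<n. e i l * e i r) = (\<Sum>i<n. f i l * f i r) / (sqrt (d l) * sqrt (d r))"
        unfolding e_def by (simp add: sum_divide_distrib)
      also have "\<dots> = (if l = r then 1 else 0) / (sqrt (d l) * sqrt (d r))"
        using orthonormal_complete[OF f(1) that] by simp
      finally show ?thesis using s[OF that(2)] that by auto
    qed
  qed
  thus ?thesis by blast
qed

section \<open>Power iteration with a certified outcome\<close>

fun power_iter :: "real \<Rightarrow> real \<Rightarrow> nat \<Rightarrow> (nat \<Rightarrow> nat \<Rightarrow> real) \<Rightarrow> (nat \<Rightarrow> real) \<Rightarrow> (nat \<Rightarrow> real) \<Rightarrow> nat \<Rightarrow> nat \<Rightarrow> real" where
  "power_iter \<kappa> c n b d z 0 = z"
| "power_iter \<kappa> c n b d z (Suc t) = (\<lambda>l. \<kappa> * (c * power_iter \<kappa> c n b d z t l - mv n b (power_iter \<kappa> c n b d z t) l / d l))"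

text \<open>The shift by \<open>c\<close> is meant to keep all factors nonnegative and to let the
  most negative eigenvalues dominate; \<open>\<kappa>\<close> clears denominators in the integer
  version.\<close>

lemma (in weighted_basis) co_power_iter:
  "i < n \<Longrightarrow> co i (power_iter \<kappa> c n b d z t) = (\<kappa> * (c - \<mu> i)) ^ t * co i z"
proof (induction t)
  case (Suc t)
  let ?x = "power_iter \<kappa> c n b d z t"
  have "co i (\<lambda>l. \<kappa> * (c * ?x l - mv n b ?x l / d l)) = co i (\<lambda>l. (\<kappa> * c) * ?x l + (- \<kappa>) * (mv n b ?x l / d l))"
    by (simp add: algebra_simps)
  also have "\<dots> = \<kappa> * c * co i ?x - \<kappa> * (\<mu> i * co i ?x)"
    using co_lin[of i "\<lambda>l. (\<kappa> * c) * ?x l" "- \<kappa>" "\<lambda>l. mv n b ?x l / d l"] co_mv[OF Suc.prems, of ?x]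
      co_lin[of i "\<lambda>_. 0" "\<kappa> * c" ?x] by (simp add: co_def[of i "\<lambda>_. 0"])
  finally show ?case using Suc by (simp add: algebra_simps)
qed simp

text \<open>The final norm is compared with the growth that eigenvalues above -1/2 can produce. If
  it is \<open>K\<close> times larger, scaling the 1-norm to about \<open>K\<close> leaves on these
  eigenvalues a weighted square of at most \<open>S\<close>; rounding to \<open>v\<close> adds an
  error of at most \<open>S\<close>, against a total of at least \<open>K^2 / (8 * n) - S\<close>.
  The conclusion does not depend on how good the start \<open>z\<close> was.\<close>

lemma accepted_trial:
  fixes b :: "nat \<Rightarrow> nat \<Rightarrow> real" and z v d :: "nat \<Rightarrow> real" and n N :: nat and \<kappa> c :: real
  defines "x \<equiv> power_iter \<kappa> c n b d z N"
  assumes sym: "symm n b" and d1: "\<And>l. l < n \<Longrightarrow> d l \<ge> 1" and S: "(\<Sum>l<n. d l) \<le> S" and n: "n > 0"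
    and c: "c \<ge> 1" "\<And>y. - c * (\<Sum>l<n. d l * (y l)\<^sup>2) \<le> qf n b y"
    and C: "0 \<le> C" "C \<le> c" "\<And>y. qf n b y \<le> C * (\<Sum>l<n. d l * (y l)\<^sup>2)"
    and z: "\<And>l. l < n \<Longrightarrow> \<bar>z l\<bar> \<le> 1" and \<kappa>: "\<kappa> \<ge> 1"
    and thr: "(\<Sum>l<n. \<bar>x l\<bar>) \<ge> K * (\<kappa> * (c + 1/2)) ^ N" and K: "K \<ge> 1"
    and v: "\<And>l. l < n \<Longrightarrow> \<bar>v l - K * x l / (1 + (\<Sum>l<n. \<bar>x l\<bar>))\<bar> \<le> 1"
    and \<eta>: "\<eta> > 0" "\<eta> \<le> 1 / (8 * c)" "4 * S \<le> \<eta>\<^sup>2 * (K\<^sup>2 / (8 * n) - S)"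
  shows "qf n b v < 0" "qf n (deflate n b v) y \<le> (C + 16 * c\<^sup>2 * \<eta>) * (\<Sum>l<n. d l * (y l)\<^sup>2)"
proof -
  obtain e \<mu> where "weighted_basis n b d e \<mu>" using weighted_basis_exists[OF sym, of d] d1 by force
  then interpret weighted_basis n b d e \<mu> .
  have \<mu>: "\<bar>\<mu> i\<bar> \<le> c" "\<mu> i \<le> C" if "i < n" for i
    using c(2)[of "e i"] C(2) C(3)[of "e i"] eigen_bounds[OF that] by auto
  define I where "I = {i. i < n \<and> \<mu> i > - 1/2}"
  define X where "X = (\<Sum>l<n. \<bar>x l\<bar>)"
  define h where "h l = K / (1 + X) * x l" for l
  define B where "B = \<kappa> * (c + 1/2)"
  have "1 * 1 \<le> \<kappa> * (c + 1/2)" using \<kappa> c by (intro mult_mono) auto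
  hence B1: "B \<ge> 1" by (simp add: B_def)
  have X1: "X \<ge> 1" using thr K one_le_power[OF B1, of N] mult_mono[of 1 K 1 "B^N"]
    unfolding X_def[symmetric] B_def[symmetric] by simp
  have "(\<Sum>l<n. d l) \<ge> 0" using d1 by (intro sum_nonneg) force
  hence S0: "S \<ge> 0" using S by simp
  have zS: "(\<Sum>i<n. (co i z)\<^sup>2) \<le> S"
  proof -
    have "(\<Sum>l<n. d l * (z l)\<^sup>2) \<le> (\<Sum>l<n. d l * 1)"
      using d1 z by (intro sum_mono mult_left_mono) (force simp: abs_square_le_1)+
    thus ?thesis using S wn_co[of z] by simp
  qed
  have Ix: "(\<Sum>i\<in>I. (co i x)\<^sup>2) \<le> (B ^ N)\<^sup>2 * S"
  proof -
    have "(\<Sum>i\<in>I. (co i x)\<^sup>2) \<le> (\<Sum>i\<in>I. (B^N)\<^sup>2 * (co i z)\<^sup>2)"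
    proof (intro sum_mono)
      fix i assume i: "i \<in> I"
      hence m: "0 \<le> c - \<mu> i" "c - \<mu> i \<le> c + 1/2" using \<mu>[of i] by (auto simp: I_def)
      have "(\<kappa> * (c - \<mu> i)) ^ N \<le> B ^ N" "0 \<le> (\<kappa> * (c - \<mu> i)) ^ N"
        using m \<kappa> unfolding B_def by (auto intro!: power_mono mult_left_mono)
      hence "((\<kappa> * (c - \<mu> i)) ^ N)\<^sup>2 \<le> (B ^ N)\<^sup>2" by (rule power_mono)
      thus "(co i x)\<^sup>2 \<le> (B^N)\<^sup>2 * (co i z)\<^sup>2" using i unfolding x_def
        by (auto simp: co_power_iter I_def power_mult_distrib intro!: mult_right_mono)
    qed
    also have "\<dots> = (B^N)\<^sup>2 * (\<Sum>i\<in>I. (co i z)\<^sup>2)" by (simp add: sum_distrib_left)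
    also have "(\<Sum>i\<in>I. (co i z)\<^sup>2) \<le> (\<Sum>i<n. (co i z)\<^sup>2)" by (intro sum_mono2) (auto simp: I_def)
    finally show ?thesis using zS by (meson mult_left_mono order_trans zero_le_power2)
  qed
  have coh: "co i h = K / (1 + X) * co i x" for i
    unfolding co_def h_def by (simp add: sum_distrib_left mult_ac)
  have Ih: "(\<Sum>i\<in>I. (co i h)\<^sup>2) \<le> S"
  proof -
    have "(\<Sum>i\<in>I. (co i h)\<^sup>2) = (K / (1 + X))\<^sup>2 * (\<Sum>i\<in>I. (co i x)\<^sup>2)"
      unfolding coh power_mult_distrib sum_distrib_left ..
    also have "\<dots> \<le> (K / (1 + X))\<^sup>2 * ((B ^ N)\<^sup>2 * S)" by (intro mult_left_mono Ix) auto
    also have "\<dots> = ((K * B ^ N) / (1 + X))\<^sup>2 * S" by (simp add: power_mult_distrib power_divide)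
    also have "\<dots> \<le> 1 * S"
    proof (intro mult_right_mono S0)
      have "(K * B^N) / (1 + X) \<le> 1" "0 \<le> (K * B^N) / (1 + X)" using thr X1 K B1 unfolding X_def[symmetric] B_def[symmetric] by (auto simp: field_simps)
      thus "((K * B ^ N) / (1 + X))\<^sup>2 \<le> 1" by (simp add: power_le_one)
    qed
    finally show ?thesis by simp
  qed
  have hh: "(\<Sum>i<n. (co i h)\<^sup>2) \<ge> K\<^sup>2 / (4 * n)"
  proof -
    have "K / 2 \<le> K * X / (1 + X)" using X1 K by (simp add: field_simps)
    also have "\<dots> = (\<Sum>l<n. \<bar>h l\<bar>)" unfolding h_def abs_mult sum_distrib_left[symmetric] X_def[symmetric] using K X1 by simp
    finally have "(K / 2)\<^sup>2 \<le> (\<Sum>l<n. 1 * \<bar>h l\<bar>)\<^sup>2" using K by (intro power_mono) auto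
    also have "\<dots> \<le> (\<Sum>l<n. 1\<^sup>2) * (\<Sum>l<n. \<bar>h l\<bar>\<^sup>2)" by (rule Cauchy_Schwarz_ineq_sum)
    also have "\<dots> = n * (\<Sum>l<n. (h l)\<^sup>2)" by simp
    finally have hn: "(K / 2)\<^sup>2 \<le> n * (\<Sum>l<n. (h l)\<^sup>2)" .
    have "(\<Sum>l<n. (h l)\<^sup>2) \<le> (\<Sum>l<n. d l * (h l)\<^sup>2)" 
    proof (intro sum_mono)
      fix l assume "l \<in> {..<n}"
      thus "(h l)\<^sup>2 \<le> d l * (h l)\<^sup>2" using mult_right_mono[of 1 "d l" "(h l)\<^sup>2"] d1 by auto
    qed
    hence "n * (\<Sum>l<n. (h l)\<^sup>2) \<le> n * (\<Sum>i<n. (co i h)\<^sup>2)" unfolding wn_co by (intro mult_left_mono) auto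
    hence "(K / 2)\<^sup>2 \<le> n * (\<Sum>i<n. (co i h)\<^sup>2)" using hn by linarith
    thus ?thesis using n by (simp add: field_simps power_divide)
  qed
  define r where "r l = v l - h l" for l
  have vr: "v l = h l + 1 * r l" "h l = v l + (-1) * r l" for l by (auto simp: r_def)
  have cov: "co i v = co i h + co i r" "co i h = co i v - co i r" for i
    using co_lin[of i h 1 r] co_lin[of i v "-1" r] by (simp_all add: r_def)
  have rS: "(\<Sum>i<n. (co i r)\<^sup>2) \<le> S"
  proof -
    have "(\<Sum>l<n. d l * (r l)\<^sup>2) \<le> (\<Sum>l<n. d l * 1)"
      using d1 v unfolding r_def h_def X_def
      by (intro sum_mono mult_left_mono) (force simp: abs_square_le_1)+
    thus ?thesis using S wn_co[of r] by simp
  qed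
  have sq: "(a + b)\<^sup>2 \<le> 2 * a\<^sup>2 + 2 * b\<^sup>2" "(a - b)\<^sup>2 \<le> 2 * a\<^sup>2 + 2 * b\<^sup>2" for a b :: real
    using zero_le_power2[of "a - b"] zero_le_power2[of "a + b"] unfolding power2_sum power2_diff by linarith+
  have Iv: "(\<Sum>i\<in>I. (co i v)\<^sup>2) \<le> 4 * S"
  proof -
    have "(\<Sum>i\<in>I. (co i v)\<^sup>2) \<le> (\<Sum>i\<in>I. 2 * (co i h)\<^sup>2 + 2 * (co i r)\<^sup>2)"
      unfolding cov(1) by (intro sum_mono sq)
    also have "\<dots> = 2 * (\<Sum>i\<in>I. (co i h)\<^sup>2) + 2 * (\<Sum>i\<in>I. (co i r)\<^sup>2)" by (simp add: sum.distrib sum_distrib_left)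
    also have "(\<Sum>i\<in>I. (co i r)\<^sup>2) \<le> (\<Sum>i<n. (co i r)\<^sup>2)" by (intro sum_mono2) (auto simp: I_def)
    finally show ?thesis using Ih rS by linarith
  qed
  define A where "A = (\<Sum>i<n. (co i v)\<^sup>2)"
  have A: "A \<ge> K\<^sup>2 / (8 * n) - S"
  proof -
    have "(\<Sum>i<n. (co i h)\<^sup>2) \<le> (\<Sum>i<n. 2 * (co i v)\<^sup>2 + 2 * (co i r)\<^sup>2)"
      unfolding cov(2) by (intro sum_mono sq)
    also have "\<dots> = 2 * A + 2 * (\<Sum>i<n. (co i r)\<^sup>2)" by (simp add: sum.distrib sum_distrib_left A_def)
    finally have "K\<^sup>2 / (4 * n) \<le> 2 * A + 2 * S" using hh rS by linarith
    thus ?thesis by (simp add: field_simps)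
  qed
  have S1: "S \<ge> 1"
  proof -
    have "(\<Sum>l<n. 1) \<le> (\<Sum>l<n. d l)" using d1 by (intro sum_mono) auto
    thus ?thesis using S n by simp
  qed
  have \<eta>A: "4 * S \<le> \<eta>\<^sup>2 * A" using \<eta>(3) mult_left_mono[OF A, of "\<eta>\<^sup>2"] by auto
  hence "0 < \<eta>\<^sup>2 * A" using S1 by linarith
  hence A0: "A > 0" using \<eta>(1) zero_less_mult_pos[of "\<eta>\<^sup>2" A] by simp
  have sm: "(\<Sum>i | i < n \<and> \<mu> i > - 1/2. (co i v)\<^sup>2) \<le> \<eta>\<^sup>2 * A" using Iv \<eta>A unfolding I_def by linarith
  note D = spectral_deflation_bound[OF \<mu>(1) c(1) \<mu>(2) C(1) A_def A0 sm \<eta>(1,2), of "- qf n b v"]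
  have "- qf n b v \<ge> A / 4" using D(1) by (simp add: qf_co)
  thus "qf n b v < 0" using A0 by linarith
  show "qf n (deflate n b v) y \<le> (C + 16 * c\<^sup>2 * \<eta>) * (\<Sum>l<n. d l * (y l)\<^sup>2)"
    unfolding qf_deflate wn_co ip_mv using D(2)[of "\<lambda>i. co i y"] by (simp add: qf_co)
qed

text \<open>Some eigenvalue is below -1, and the coordinate of \<open>z\<close> on its eigenvector
  grows at least like \<open>(\<kappa> * (c + 1)) ^ N\<close>. This coordinate is the linear form
  with coefficients \<open>a l = d l * e i l\<close>. One of them is at least \<open>1 / n\<close>
  in size, because the \<open>n\<close> weighted squares add up to 1, so a single coin can move the
  form away from 0.\<close>

lemma trial_progress:
  fixes b :: "nat \<Rightarrow> nat \<Rightarrow> real" and M K :: real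
  assumes sym: "symm n b" and d1: "\<And>l. l < n \<Longrightarrow> 1 \<le> d l \<and> d l \<le> M" and n: "n > 0"
    and c: "c \<ge> 1" and \<kappa>: "\<kappa> \<ge> 1" and M: "M \<ge> 1"
    and neg: "qf n b y < - (\<Sum>l<n. d l * (y l)\<^sup>2)"
    and N: "2 * n * M * K * (c + 1/2) ^ N \<le> (c + 1) ^ N" and K: "K \<ge> 0"
  shows "\<exists>a j. j < n \<and> \<bar>a j\<bar> \<ge> 1 / n \<and> (\<forall>z. \<bar>\<Sum>l<n. a l * z l\<bar> \<ge> 1 / (2 * n) \<longrightarrow>
     (\<Sum>l<n. \<bar>power_iter \<kappa> c n b d z N l\<bar>) \<ge> K * (\<kappa> * (c + 1/2)) ^ N)"
proof -
  obtain e \<mu> where "weighted_basis n b d e \<mu>" using weighted_basis_exists[OF sym, of d] d1 by force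
  then interpret weighted_basis n b d e \<mu> .
  have "\<exists>i<n. \<mu> i < -1"
  proof (rule ccontr)
    assume "\<not> ?thesis"
    hence "- 1 \<le> \<mu> i" if "i < n" for i using that by (meson not_less)
    hence "(\<Sum>i<n. - 1 * (co i y)\<^sup>2) \<le> (\<Sum>i<n. \<mu> i * (co i y)\<^sup>2)" by (intro sum_mono mult_right_mono) auto
    thus False using neg unfolding wn_co qf_co by (simp add: sum_negf)
  qed
  then obtain i where i: "i < n" "\<mu> i < -1" by blast
  define a where "a l = d l * e i l" for l
  have e1: "(\<Sum>l<n. d l * (e i l)\<^sup>2) = 1" by (rule eigen_bounds[OF i(1)])
  have de: "d l * (e i l)\<^sup>2 \<le> 1" if "l < n" for l
  proof -
    have "d l * (e i l)\<^sup>2 = (\<Sum>l\<in>{l}. d l * (e i l)\<^sup>2)" by simp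
    also have "\<dots> \<le> (\<Sum>l<n. d l * (e i l)\<^sup>2)"
    proof (intro sum_mono2)
      fix r assume "r \<in> {..<n} - {l}" 
      thus "0 \<le> d r * (e i r)\<^sup>2" using d1[of r] by auto
    qed (use that in auto)
    finally show ?thesis using e1 by simp
  qed
  have "\<exists>j<n. d j * (e i j)\<^sup>2 \<ge> 1 / n"
  proof (rule ccontr)
    assume "\<not> ?thesis"
    hence "(\<Sum>l<n. d l * (e i l)\<^sup>2) < (\<Sum>l<n. 1 / n)" using n by (intro sum_strict_mono) (auto simp: not_le)
    thus False using e1 n by simp
  qed
  then obtain j where j: "j < n" "d j * (e i j)\<^sup>2 \<ge> 1 / n" by blast
  have aM: "\<bar>a l\<bar> \<le> M" if "l < n" for l
  proof -
    have "(e i l)\<^sup>2 \<le> d l * (e i l)\<^sup>2" using d1[OF that] mult_right_mono[of 1 "d l" "(e i l)\<^sup>2"] by simp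
    hence "(e i l)\<^sup>2 \<le> 1" using de[OF that] by linarith
    hence "\<bar>e i l\<bar> \<le> 1" by (simp add: abs_square_le_1)
    hence "d l * \<bar>e i l\<bar> \<le> M * 1" using d1[OF that] by (intro mult_mono) auto
    thus ?thesis using d1[OF that] by (simp add: a_def abs_mult)
  qed
  have aj: "\<bar>a j\<bar> \<ge> 1 / n"
  proof -
    have "(1 / real n)\<^sup>2 \<le> 1 / n" using n by (simp add: power2_eq_square field_simps)
    also have "\<dots> \<le> d j * (e i j)\<^sup>2" by fact
    also have "\<dots> \<le> (d j * d j) * (e i j)\<^sup>2" using d1[OF j(1)] by (intro mult_right_mono) auto
    also have "\<dots> = \<bar>a j\<bar>\<^sup>2" by (simp add: a_def power2_eq_square)
    finally show ?thesis by (rule power2_le_imp_le) simp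
  qed
  have "(\<Sum>l<n. \<bar>power_iter \<kappa> c n b d z N l\<bar>) \<ge> K * (\<kappa> * (c + 1/2)) ^ N"
    if z: "\<bar>\<Sum>l<n. a l * z l\<bar> \<ge> 1 / (2 * n)" for z
  proof -
    define x where "x = power_iter \<kappa> c n b d z N"
    have coz: "\<bar>co i z\<bar> \<ge> 1 / (2 * n)" using z by (simp add: co_def a_def)
    have "(c + 1) ^ N * \<kappa> ^ N * (1 / (2 * n)) \<le> (\<kappa> * (c - \<mu> i)) ^ N * \<bar>co i z\<bar>"
    proof (intro mult_mono coz)
      have "((c + 1) * \<kappa>) ^ N \<le> (\<kappa> * (c - \<mu> i)) ^ N" using i \<kappa> c by (intro power_mono) (auto simp: mult.commute)
      thus "(c + 1) ^ N * \<kappa> ^ N \<le> (\<kappa> * (c - \<mu> i)) ^ N" by (simp add: power_mult_distrib)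
    qed (use i \<kappa> c in auto)
    also have "\<dots> = \<bar>co i x\<bar>" unfolding x_def co_power_iter[OF i(1)] using i \<kappa> c by (simp add: abs_mult)
    also have "\<dots> \<le> (\<Sum>l<n. \<bar>a l * x l\<bar>)" unfolding co_def a_def by (rule sum_abs)
    also have "\<dots> \<le> (\<Sum>l<n. M * \<bar>x l\<bar>)" unfolding abs_mult using aM by (intro sum_mono mult_right_mono) auto
    also have "\<dots> = M * (\<Sum>l<n. \<bar>x l\<bar>)" by (simp add: sum_distrib_left)
    finally have 1: "(c + 1) ^ N * \<kappa> ^ N / (2 * n) \<le> M * (\<Sum>l<n. \<bar>x l\<bar>)" by simp
    have "2 * n * M * K * (c + 1/2) ^ N * \<kappa> ^ N / (2 * n) \<le> (c + 1) ^ N * \<kappa> ^ N / (2 * n)"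
      using N \<kappa> by (intro divide_right_mono mult_right_mono) auto
    hence "M * (K * (\<kappa> * (c + 1/2)) ^ N) \<le> M * (\<Sum>l<n. \<bar>x l\<bar>)"
      using 1 n by (simp add: power_mult_distrib mult_ac)
    thus ?thesis using M unfolding x_def by simp
  qed
  thus ?thesis using j(1) aj by blast
qed

section \<open>Frank--Wolfe minimization of almost convex forms\<close>

lemma harmonic_le_sqrt: "(\<Sum>t<T. 1 / real (Suc t)) \<le> 2 * sqrt (real T)"
proof (induction T)
  case (Suc T)
  define a where "a = sqrt (real T)"
  define s where "s = sqrt (real (Suc T))"
  have as: "0 \<le> a" "a \<le> s" "s > 0" "s * s - a * a = 1" "s * s = real (Suc T)" by (auto simp: a_def s_def)
  have "1 = (s - a) * (s + a)" using as by (simp add: algebra_simps)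
  also have "\<dots> \<le> (s - a) * (2 * s)" using as by (intro mult_left_mono) auto
  also have "\<dots> \<le> (s - a) * (2 * (s * s))" using as
  proof (intro mult_left_mono)
    have "1 \<le> s" by (simp add: s_def)
    thus "s \<le> s * s" by simp
  qed auto
  finally have "1 / real (Suc T) \<le> 2 * (s - a)" unfolding as(5)[symmetric] using as by (simp add: field_simps)
  thus ?case using Suc unfolding a_def[symmetric] s_def[symmetric] by simp
qed simp

text \<open>With step \<open>1 / (t + 1)\<close> the iterate \<open>x t\<close> is the average of
  the points chosen so far, so \<open>t * x t\<close> is integral when they are. The lack of
  convexity enters each step through the squared weighted diameter \<open>4 * D\<close> of the cube,
  and \<open>t * h t\<close> collects these losses linearly, whereas the curvature contributes a
  harmonic sum. The set \<open>V\<close> confines the weights in \<open>D\<close> to the nonisolated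
  vertices, whose total weight is of order \<open>m\<close>.\<close>

lemma frank_wolfe:
  fixes b :: "nat \<Rightarrow> nat \<Rightarrow> real" and x s :: "nat \<Rightarrow> nat \<Rightarrow> real" and g y d :: "nat \<Rightarrow> real"
  assumes sym: "symm n b" and d: "\<And>l. l < n \<Longrightarrow> d l \<ge> 0"
    and lower: "\<And>y. - (\<Sum>l<n. d l * (y l)\<^sup>2) \<le> qf n b y"
    and upper: "\<And>y. qf n b y \<le> C * (\<Sum>l<n. d l * (y l)\<^sup>2)" and C: "C \<ge> 0"
    and V: "(\<Sum>l | l < n \<and> l \<in> V. d l) \<le> D"
    and x0: "\<And>l. x 0 l = 0"
    and xS: "\<And>t l. t < T \<Longrightarrow> l < n \<Longrightarrow> x (Suc t) l = x t l + (s t l - x t l) / real (Suc t)"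
    and s1: "\<And>t l. t < T \<Longrightarrow> l < n \<Longrightarrow> \<bar>s t l\<bar> \<le> 1"
    and sV: "\<And>t l. t < T \<Longrightarrow> l < n \<Longrightarrow> l \<notin> V \<Longrightarrow> s t l = 0"
    and smin: "\<And>t l. t < T \<Longrightarrow> l < n \<Longrightarrow> (mv n b (x t) l - g l) * s t l = - \<bar>mv n b (x t) l - g l\<bar>"
    and y1: "\<And>l. l < n \<Longrightarrow> \<bar>y l\<bar> \<le> 1" and yV: "\<And>l. l < n \<Longrightarrow> l \<notin> V \<Longrightarrow> y l = 0"
    and T: "T > 0" "2 * C * sqrt T \<le> T"
  shows "qf n b (x T) - 2 * ip n g (x T) \<le> qf n b y - 2 * ip n g y + 8 * D"
proof -
  define F where "F u = qf n b u - 2 * ip n g u" for u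
  have x1: "\<bar>x t l\<bar> \<le> 1 \<and> (l \<notin> V \<longrightarrow> x t l = 0)" if "t \<le> T" "l < n" for t l
    using that(1)
  proof (induction t)
    case (Suc t)
    have "x (Suc t) l = (real t * x t l + s t l) / real (Suc t)"
      using xS[of t l] Suc.prems that by (simp add: field_simps)
    moreover have "\<bar>real t * x t l + s t l\<bar> \<le> real t * \<bar>x t l\<bar> + \<bar>s t l\<bar>"
      by (rule order_trans[OF abs_triangle_ineq]) (simp add: abs_mult)
    moreover have "\<dots> \<le> real t * 1 + 1" using Suc s1[of t l] that by (intro add_mono mult_left_mono) auto
    moreover have "\<bar>q / real (Suc t)\<bar> = \<bar>q\<bar> / real (Suc t)" for q by (simp add: abs_divide)
    ultimately have "\<bar>x (Suc t) l\<bar> \<le> 1" by (simp add: divide_le_eq_1)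
    moreover have "x t l = 0" "s t l = 0" if "l \<notin> V" using Suc sV[of t l] that \<open>l < n\<close> by auto
    ultimately show ?case using xS[of t l] Suc.prems that by auto
  qed (use x0 in auto)
  have diam: "(\<Sum>l<n. d l * (u l - v l)\<^sup>2) \<le> 4 * D"
    if "\<And>l. l < n \<Longrightarrow> \<bar>u l\<bar> \<le> 1 \<and> \<bar>v l\<bar> \<le> 1 \<and> (l \<notin> V \<longrightarrow> u l = 0 \<and> v l = 0)" for u v
  proof -
    have "(\<Sum>l<n. d l * (u l - v l)\<^sup>2) = (\<Sum>l | l < n \<and> l \<in> V. d l * (u l - v l)\<^sup>2)"
      by (rule sum.mono_neutral_right) (use that in auto)
    also have "\<dots> \<le> (\<Sum>l | l < n \<and> l \<in> V. d l * 4)"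
    proof (intro sum_mono mult_left_mono)
      fix l assume "l \<in> {l. l < n \<and> l \<in> V}"
      hence "\<bar>u l\<bar> \<le> 1" "\<bar>v l\<bar> \<le> 1" using that by auto
      hence "\<bar>u l - v l\<bar> \<le> 2" by linarith
      from power_mono[OF this, of 2] show "(u l - v l)\<^sup>2 \<le> 4" by simp
    qed (use d in auto)
    also have "\<dots> \<le> 4 * D" unfolding sum_distrib_right[symmetric] using V by simp
    finally show ?thesis .
  qed
  have Fadd: "F (\<lambda>l. u l + c * (v l - u l)) = F u + 2 * c * ip n (\<lambda>l. mv n b u l - g l) (\<lambda>l. v l - u l) + c\<^sup>2 * qf n b (\<lambda>l. v l - u l)" for u v c
  proof -
    have "ip n u (mv n b (\<lambda>l. v l - u l)) = ip n (mv n b u) (\<lambda>l. v l - u l)"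
      by (rule ip_mv_sym[symmetric]) (use sym in auto)
    moreover have "ip n (\<lambda>l. mv n b u l - g l) (\<lambda>l. v l - u l) = ip n (mv n b u) (\<lambda>l. v l - u l) - ip n g (\<lambda>l. v l - u l)"
      using ip_add_left[of n "mv n b u" "-1" g "\<lambda>l. v l - u l"] by simp
    ultimately have 1: "ip n u (mv n b (\<lambda>l. v l - u l)) = ip n (\<lambda>l. mv n b u l - g l) (\<lambda>l. v l - u l) + ip n g (\<lambda>l. v l - u l)"
      by simp
    show ?thesis unfolding F_def qf_add[OF sym, of u c "\<lambda>l. v l - u l"] ip_add_right[of n g u c "\<lambda>l. v l - u l"] 1
      by (simp add: distrib_left)
  qed
  define h where "h t = F (x t) - F y" for t
  have step: "real (Suc t) * h (Suc t) \<le> real t * h t + 4 * D + 4 * C * D * (1 / real (Suc t))" if t: "t < T" for t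
  proof -
    define \<gamma> where "\<gamma> = 1 / real (Suc t)"
    define G where "G v = ip n (\<lambda>l. mv n b (x t) l - g l) (\<lambda>l. v l - x t l)" for v
    have \<gamma>: "0 < \<gamma>" "real (Suc t) * \<gamma> = 1" "real (Suc t) * \<gamma>\<^sup>2 = \<gamma>" by (auto simp: \<gamma>_def power2_eq_square)
    have eq: "qf n b u = qf n b v" "ip n g u = ip n g v" if "\<And>l. l < n \<Longrightarrow> u l = v l" for u v
      using that by (auto simp: qf_def intro!: ip_cong fun_cong[OF mv_cong])
    have "F (x (Suc t)) = F (\<lambda>l. x t l + \<gamma> * (s t l - x t l))"
    proof -
      have "x (Suc t) l = x t l + \<gamma> * (s t l - x t l)" if "l < n" for l using xS[OF t that] by (simp add: \<gamma>_def)
      from eq[OF this] show ?thesis unfolding F_def by simp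
    qed
    also have "\<dots> = F (x t) + 2 * \<gamma> * G (s t) + \<gamma>\<^sup>2 * qf n b (\<lambda>l. s t l - x t l)"
      unfolding Fadd G_def ..
    also have "\<gamma>\<^sup>2 * qf n b (\<lambda>l. s t l - x t l) \<le> \<gamma>\<^sup>2 * (C * (4 * D))"
      by (intro mult_left_mono order_trans[OF upper] diam) (use t x1[of t] s1[OF t] sV[OF t] C in auto)
    finally have 1: "F (x (Suc t)) \<le> F (x t) + 2 * \<gamma> * G (s t) + \<gamma>\<^sup>2 * (C * (4 * D))" by simp
    have Gs: "G (s t) \<le> G y"
      unfolding G_def ip_def
    proof (intro sum_mono)
      fix l assume "l \<in> {..<n}"
      define a where "a = mv n b (x t) l - g l"
      have "- (a * y l) \<le> \<bar>a * y l\<bar>" by simp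
      also have "\<dots> \<le> \<bar>a\<bar> * 1" unfolding abs_mult using y1[of l] \<open>l \<in> {..<n}\<close> by (intro mult_left_mono) auto
      finally show "(mv n b (x t) l - g l) * (s t l - x t l) \<le> (mv n b (x t) l - g l) * (y l - x t l)"
        using smin[OF t, of l] \<open>l \<in> {..<n}\<close> unfolding a_def[symmetric] by (simp add: algebra_simps)
    qed
    have "F y = F (\<lambda>l. x t l + 1 * (y l - x t l))" by simp
    also have "\<dots> = F (x t) + 2 * G y + qf n b (\<lambda>l. y l - x t l)" unfolding Fadd G_def by simp
    finally have "F y = F (x t) + 2 * G y + qf n b (\<lambda>l. y l - x t l)" .
    moreover have "qf n b (\<lambda>l. y l - x t l) \<ge> - (4 * D)"
      by (rule order_trans[OF _ lower], rule le_imp_neg_le, rule diam) (use t x1[of t] y1 yV in auto)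
    ultimately have 2: "2 * G (s t) \<le> - h t + 4 * D" using Gs unfolding h_def by linarith
    have "real (Suc t) * h (Suc t) \<le> real (Suc t) * (h t + \<gamma> * (2 * G (s t)) + \<gamma>\<^sup>2 * (C * (4 * D)))"
      using 1 unfolding h_def by (intro mult_left_mono) auto
    also have "\<dots> = real (Suc t) * h t + 2 * G (s t) * (real (Suc t) * \<gamma>) + real (Suc t) * \<gamma>\<^sup>2 * (C * (4 * D))"
      by (simp add: algebra_simps)
    also have "\<dots> = real (Suc t) * h t + 2 * G (s t) + \<gamma> * (C * (4 * D))" unfolding \<gamma> by simp
    also have "\<dots> \<le> real (Suc t) * h t + (- h t + 4 * D) + \<gamma> * (C * (4 * D))" using 2 by simp
    finally show ?thesis by (simp add: algebra_simps \<gamma>_def)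
  qed
  have "real t * h t \<le> 4 * D * real t + 4 * C * D * (\<Sum>i<t. 1 / real (Suc i))" if "t \<le> T" for t
    using that
  proof (induction t)
    case (Suc t)
    have "4 * C * D * (\<Sum>i<Suc t. 1 / real (Suc i)) = 4 * C * D * (\<Sum>i<t. 1 / real (Suc i)) + 4 * C * D * (1 / real (Suc t))"
      unfolding sum.lessThan_Suc distrib_left ..
    thus ?case using step[of t] Suc by (simp add: algebra_simps)
  qed simp
  from this[of T] have "real T * h T \<le> 4 * D * real T + 4 * C * D * (\<Sum>i<T. 1 / real (Suc i))" by simp
  \<comment> \<open>A square root in place of a logarithm suffices for the harmonic sum, since
    \<open>T\<close> is chosen of order \<open>C^2\<close>.\<close>
  also have "4 * C * D * (\<Sum>i<T. 1 / real (Suc i)) \<le> 4 * C * D * (2 * sqrt T)"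
  proof (intro mult_left_mono harmonic_le_sqrt)
    have "D \<ge> 0" using V order_trans[OF sum_nonneg V] d by auto
    thus "0 \<le> 4 * C * D" using C by auto
  qed
  also have "\<dots> = 4 * D * (2 * C * sqrt T)" by simp
  also have "\<dots> \<le> 4 * D * T"
  proof (intro mult_left_mono T)
    have "D \<ge> 0" using V order_trans[OF sum_nonneg V] d by auto
    thus "0 \<le> 4 * D" by auto
  qed
  finally have "real T * h T \<le> real T * (8 * D)" by (simp add: algebra_simps)
  hence "h T \<le> 8 * D" using T(1) by simp
  thus ?thesis unfolding h_def F_def by linarith
qed

section \<open>A cost logic for the machine\<close>

lemma len_le_iff: "len x \<le> Suc k \<longleftrightarrow> \<bar>x\<bar> < 2 ^ k"
  unfolding len_def using bitlen_le_iff_power[of "\<bar>x\<bar>" "int k"] by (auto simp: nat_le_iff)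

lemma len_pos: "len x \<ge> 1" by (simp add: len_def)

lemma len_abs_mono: "\<bar>x\<bar> \<le> \<bar>y\<bar> \<Longrightarrow> len x \<le> len y"
  unfolding len_def using bitlen_le_iff_power[of "\<bar>x\<bar>" "bitlen \<bar>y\<bar>"] bitlen_le_iff_power[of "\<bar>y\<bar>" "bitlen \<bar>y\<bar>"] by (auto intro!: nat_mono)

lemma len_add: "len (x + y) \<le> len x + len y"
proof -
  obtain i j where ij: "len x = Suc i" "len y = Suc j" using len_pos[of x] len_pos[of y] by (metis Suc_le_D One_nat_def)
  have x: "\<bar>x\<bar> < 2 ^ i" "\<bar>y\<bar> < 2 ^ j" using len_le_iff[of x i] len_le_iff[of y j] ij by auto
  have "\<bar>x + y\<bar> \<le> \<bar>x\<bar> + \<bar>y\<bar>" by simp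
  also have "\<dots> < 2 ^ i + 2 ^ j" using x by simp
  also have "\<dots> \<le> 2 ^ (i + j) + 2 ^ (i + j)" by (intro add_mono power_increasing) auto
  also have "\<dots> = 2 ^ Suc (i + j)" by simp
  finally show ?thesis using len_le_iff[of "x + y" "Suc (i + j)"] ij by simp
qed

lemma len_uminus: "len (- x) = len x" by (simp add: len_def)

lemma len_diff: "len (x - y) \<le> len x + len y"
  using len_add[of x "- y"] by (simp add: len_uminus)

lemma len_mult: "len (x * y) \<le> len x + len y"
proof -
  obtain i j where ij: "len x = Suc i" "len y = Suc j" using len_pos[of x] len_pos[of y] by (metis Suc_le_D One_nat_def)
  have x: "\<bar>x\<bar> < 2 ^ i" "\<bar>y\<bar> < 2 ^ j" using len_le_iff[of x i] len_le_iff[of y j] ij by auto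
  have "\<bar>x * y\<bar> < 2 ^ (i + j)" unfolding abs_mult power_add using x by (intro mult_strict_mono') auto
  thus ?thesis using len_le_iff[of "x * y" "i + j"] ij by simp
qed

lemma len_div: "len (x div y) \<le> len x"
proof (rule len_abs_mono)
  have pos: "\<bar>x div y\<bar> \<le> \<bar>x\<bar>" if "y > 0" for x y :: int
  proof (cases "x \<ge> 0")
    case True
    thus ?thesis using zdiv_mono2[of x 1 y] pos_imp_zdiv_nonneg_iff[of y x] that by simp
  next
    case False
    thus ?thesis using zdiv_mono2_neg[of x 1 y] pos_imp_zdiv_neg_iff[of y x] that by simp
  qed
  consider "y = 0" | "y > 0" | "- y > 0" by linarith
  thus "\<bar>x div y\<bar> \<le> \<bar>x\<bar>"
  proof cases
    case 3
    thus ?thesis using pos[of "- y" "- x"] by simp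
  qed (use pos in auto)
qed

text \<open>One bound for all cells at all times reduces the analysis of time to counting
  instructions: an expression of a fixed program then costs O(b^2).\<close>

definition bnd :: "nat \<Rightarrow> memory \<Rightarrow> bool" where
  "bnd b s \<longleftrightarrow> (\<forall>a. len (s a) \<le> b)"

text \<open>In a memory whose cells have at most \<open>b\<close> bits, \<open>wl e * b\<close> bounds the length of the value of \<open>e\<close> and
  \<open>wc e * b\<^sup>2\<close> its cost.\<close>

fun wl :: "expr \<Rightarrow> nat" where
  "wl (Const c) = len c"
| "wl (Load a) = 1"
| "wl (Add a b) = wl a + wl b"
| "wl (Sub a b) = wl a + wl b"
| "wl (Mul a b) = wl a + wl b"
| "wl (Div a b) = wl a"
| "wl (Less a b) = 2"

fun wc :: "expr \<Rightarrow> nat" where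
  "wc (Const c) = len c"
| "wc (Load a) = wc a + wl a + 1"
| "wc (Add a b) = wc a + wc b + wl a + wl b"
| "wc (Sub a b) = wc a + wc b + wl a + wl b"
| "wc (Mul a b) = wc a + wc b + wl a * wl b"
| "wc (Div a b) = wc a + wc b + wl a * wl b"
| "wc (Less a b) = wc a + wc b + wl a + wl b"

lemma len_val_le:
  assumes "bnd b s" "b > 0"
  shows "len (val e s) \<le> wl e * b"
proof (induction e)
  case (Const c)
  have "len c * 1 \<le> len c * b" using assms by (intro mult_left_mono) auto
  thus ?case by simp
next
  case (Load e)
  thus ?case using assms by (simp add: bnd_def)
next
  case (Add e1 e2)
  thus ?case using len_add[of "val e1 s" "val e2 s"] by (simp add: add_mult_distrib)
next
  case (Sub e1 e2)
  thus ?case using len_diff[of "val e1 s" "val e2 s"] by (simp add: add_mult_distrib)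
next
  case (Mul e1 e2)
  thus ?case using len_mult[of "val e1 s" "val e2 s"] by (simp add: add_mult_distrib)
next
  case (Div e1 e2)
  thus ?case using len_div[of "val e1 s" "val e2 s"] by simp
next
  case (Less e1 e2)
  thus ?case using assms by (auto simp: len_def bitlen_def floorlog_def)
qed

lemma len_val_sq:
  assumes "bnd b s" "b > 0"
  shows "len (val e s) \<le> wl e * b\<^sup>2"
proof -
  have "wl e * b \<le> wl e * b\<^sup>2" using assms by (simp add: power2_eq_square)
  thus ?thesis using len_val_le[OF assms, of e] by linarith
qed

lemma cost_le:
  assumes "bnd b s" "b > 0"
  shows "cost e s \<le> wc e * b\<^sup>2"
proof (induction e)
  case (Const c)
  have "len c * 1 \<le> len c * b\<^sup>2" using assms by (intro mult_left_mono) auto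
  thus ?case by simp
next
  case (Load e)
  have "b \<le> b\<^sup>2" using assms by (simp add: power2_eq_square)
  moreover have "len (s (val e s)) \<le> b" using assms by (simp add: bnd_def)
  ultimately show ?case using Load len_val_sq[OF assms, of e] by (simp add: add_mult_distrib)
next
  case (Add e1 e2)
  thus ?case using Add len_val_sq[OF assms, of e1] len_val_sq[OF assms, of e2] by (simp add: add_mult_distrib)
next
  case (Sub e1 e2)
  thus ?case using Sub len_val_sq[OF assms, of e1] len_val_sq[OF assms, of e2] by (simp add: add_mult_distrib)
next
  case (Less e1 e2)
  thus ?case using Less len_val_sq[OF assms, of e1] len_val_sq[OF assms, of e2] by (simp add: add_mult_distrib)
next
  case (Mul e1 e2)
  thus ?case using mult_le_mono[OF len_val_le[OF assms, of e1] len_val_le[OF assms, of e2]]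
    by (simp add: add_mult_distrib add_mult_distrib2 power2_eq_square mult_ac)
next
  case (Div e1 e2)
  thus ?case using mult_le_mono[OF len_val_le[OF assms, of e1] len_val_le[OF assms, of e2]]
    by (simp add: add_mult_distrib add_mult_distrib2 power2_eq_square mult_ac)
qed

text \<open>Besides a time bound and a postcondition, the judgement carries a lower bound \<open>x\<close> for the
  expectation of \<open>f\<close> on the final memory. Negative values of \<open>f\<close> count as \<open>0\<close>, because \<open>ennreal\<close>
  truncates them.\<close>

definition okE :: "nat \<Rightarrow> prog \<Rightarrow> memory \<Rightarrow> nat \<Rightarrow> (memory \<Rightarrow> bool) \<Rightarrow> (memory \<Rightarrow> real) \<Rightarrow> real \<Rightarrow> bool" where
  "okE b p s N Q f x \<longleftrightarrow> lossless_spmf (exec p s) \<and>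
     (\<forall>(s', t) \<in> set_spmf (exec p s). t \<le> N * b\<^sup>2 \<and> bnd b s' \<and> Q s') \<and>
     ennreal x \<le> (\<integral>\<^sup>+ r. ennreal (f (fst r)) \<partial>measure_spmf (exec p s))"

abbreviation ok :: "nat \<Rightarrow> prog \<Rightarrow> memory \<Rightarrow> nat \<Rightarrow> (memory \<Rightarrow> bool) \<Rightarrow> bool" where
  "ok b p s N Q \<equiv> okE b p s N Q (\<lambda>_. 0) 0"

lemma nn_integral_lossless_ge:
  assumes "lossless_spmf p" "\<And>r. r \<in> set_spmf p \<Longrightarrow> x \<le> g r"
  shows "x \<le> (\<integral>\<^sup>+ r. g r \<partial>measure_spmf p)"
proof -
  have "x = (\<integral>\<^sup>+ r. x \<partial>measure_spmf p)"
    using lossless_weight_spmfD[OF assms(1)] by (simp add: weight_spmf_def measure_spmf.emeasure_eq_measure)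
  also have "\<dots> \<le> (\<integral>\<^sup>+ r. g r \<partial>measure_spmf p)"
    using assms(2) by (intro nn_integral_mono_AE) (auto simp: AE_measure_spmf_iff)
  finally show ?thesis .
qed

lemma ok_imp_okE:
  assumes "okE b p s N Q f0 x0" "\<And>s'. bnd b s' \<Longrightarrow> Q s' \<Longrightarrow> x \<le> f s'"
  shows "okE b p s N Q f x"
  using assms unfolding okE_def
  by (auto intro!: nn_integral_lossless_ge ennreal_leI)

lemma okE_conseq:
  assumes "okE b p s N Q f x" "N \<le> N'" "\<And>s'. bnd b s' \<Longrightarrow> Q s' \<Longrightarrow> Q' s' \<and> f s' \<le> f' s'" "x' \<le> x"
  shows "okE b p s N' Q' f' x'"
proof -
  have "ennreal x' \<le> ennreal x" using assms(4) by (rule ennreal_leI)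
  also have "\<dots> \<le> (\<integral>\<^sup>+ r. ennreal (f (fst r)) \<partial>measure_spmf (exec p s))" using assms(1) by (auto simp: okE_def)
  also have "\<dots> \<le> (\<integral>\<^sup>+ r. ennreal (f' (fst r)) \<partial>measure_spmf (exec p s))"
    using assms(1,3) unfolding okE_def by (intro nn_integral_mono_AE) (auto simp: AE_measure_spmf_iff intro!: ennreal_leI)
  finally have "ennreal x' \<le> (\<integral>\<^sup>+ r. ennreal (f' (fst r)) \<partial>measure_spmf (exec p s))" .
  moreover have "N * b\<^sup>2 \<le> N' * b\<^sup>2" using assms(2) by simp
  moreover have "t \<le> N' * b\<^sup>2 \<and> bnd b s' \<and> Q' s'" if "(s', t) \<in> set_spmf (exec p s)" for s' t
  proof -
    have "t \<le> N * b\<^sup>2 \<and> bnd b s' \<and> Q s'" using assms(1) that unfolding okE_def by auto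
    thus ?thesis using assms(3) calculation(2) order_trans by blast
  qed
  ultimately show ?thesis using assms(1) unfolding okE_def by blast
qed

lemma nn_integral_return_spmf': "(\<integral>\<^sup>+ r. g r \<partial>measure_spmf (return_spmf x)) = g x"
  by (simp add: measure_spmf_return_spmf nn_integral_return)

lemma nn_integral_bind_spmf':
  "(\<integral>\<^sup>+ r. g r \<partial>measure_spmf (bind_spmf p f)) = (\<integral>\<^sup>+ x. (\<integral>\<^sup>+ r. g r \<partial>measure_spmf (f x)) \<partial>measure_spmf p)"
  by (subst measure_spmf_bind, subst nn_integral_bind[where B = "count_space UNIV"])
     (auto simp: space_subprob_algebra intro!: measurable_measure_spmf)

lemma okE_Store:
  assumes "bnd b s" "b > 0" "len (val e s) \<le> b" "Q (s(val a s := val e s))" "x \<le> f (s(val a s := val e s))"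
  shows "okE b (Store a e) s (wc a + wc e + wl a + wl e) Q f x"
proof -
  have "cost a s + cost e s + len (val a s) + len (val e s) \<le> (wc a + wc e + wl a + wl e) * b\<^sup>2"
    using cost_le[OF assms(1,2), of a] cost_le[OF assms(1,2), of e] len_val_sq[OF assms(1,2), of a] len_val_sq[OF assms(1,2), of e]
    by (simp add: add_mult_distrib)
  moreover have "bnd b (s(val a s := val e s))" using assms by (auto simp: bnd_def)
  moreover have "exec (Store a e) s = return_spmf (s(val a s := val e s), cost a s + cost e s + len (val a s) + len (val e s))"
    by (subst exec.simps) simp
  ultimately show ?thesis unfolding okE_def using assms by (auto simp: nn_integral_return_spmf' intro!: ennreal_leI)
qed

lemma exec_Seq: "exec (Seq p1 p2) s = bind_spmf (exec p1 s) (\<lambda>r1. bind_spmf (exec p2 (fst r1)) (\<lambda>r2. return_spmf (fst r2, snd r1 + snd r2)))"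
  by (subst exec.simps) simp

lemma exec_While: "exec (While a p) s = (if val a s \<noteq> 0 then
    bind_spmf (exec p s) (\<lambda>r1. bind_spmf (exec (While a p) (fst r1)) (\<lambda>r2. return_spmf (fst r2, cost a s + len (val a s) + snd r1 + snd r2)))
    else return_spmf (s, cost a s + len (val a s)))"
  by (subst exec.simps) simp

text \<open>The intermediate \<open>f1\<close> is a function of the state between the two programs,
  so the second program may promise more after a favourable outcome of the first.\<close>

lemma okE_Seq:
  assumes "okE b p1 s N1 Q1 f1 x" "\<And>s'. bnd b s' \<Longrightarrow> Q1 s' \<Longrightarrow> okE b p2 s' N2 Q f (f1 s')"
  shows "okE b (Seq p1 p2) s (N1 + N2) Q f x"
proof -
  have e: "exec (Seq p1 p2) s = bind_spmf (exec p1 s) (\<lambda>r1. bind_spmf (exec p2 (fst r1)) (\<lambda>r2. return_spmf (fst r2, snd r1 + snd r2)))"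
    by (rule exec_Seq)
  have "(\<integral>\<^sup>+ r. ennreal (f (fst r)) \<partial>measure_spmf (exec (Seq p1 p2) s)) =
    (\<integral>\<^sup>+ r1. (\<integral>\<^sup>+ r. ennreal (f (fst r)) \<partial>measure_spmf (exec p2 (fst r1))) \<partial>measure_spmf (exec p1 s))"
    unfolding e nn_integral_bind_spmf' nn_integral_return_spmf' by simp
  also have "\<dots> \<ge> (\<integral>\<^sup>+ r1. ennreal (f1 (fst r1)) \<partial>measure_spmf (exec p1 s))"
    using assms unfolding okE_def by (intro nn_integral_mono_AE) (auto simp: AE_measure_spmf_iff)
  finally have "ennreal x \<le> (\<integral>\<^sup>+ r. ennreal (f (fst r)) \<partial>measure_spmf (exec (Seq p1 p2) s))"
    using assms(1) unfolding okE_def by (meson order_trans)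
  moreover have "lossless_spmf (exec (Seq p1 p2) s)"
    using assms unfolding okE_def e by auto
  moreover have "\<forall>(s', t) \<in> set_spmf (exec (Seq p1 p2) s). t \<le> (N1 + N2) * b\<^sup>2 \<and> bnd b s' \<and> Q s'"
  proof (clarify)
    fix s' t assume "(s', t) \<in> set_spmf (exec (Seq p1 p2) s)"
    then obtain s1 t1 t2 where r: "(s1, t1) \<in> set_spmf (exec p1 s)" "(s', t2) \<in> set_spmf (exec p2 s1)" "t = t1 + t2"
      unfolding e by (auto simp: set_bind_spmf)
    have 1: "t1 \<le> N1 * b\<^sup>2 \<and> bnd b s1 \<and> Q1 s1" using assms(1) r(1) unfolding okE_def by auto
    hence "t2 \<le> N2 * b\<^sup>2 \<and> bnd b s' \<and> Q s'" using assms(2)[of s1] r(2) unfolding okE_def by auto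
    thus "t \<le> (N1 + N2) * b\<^sup>2 \<and> bnd b s' \<and> Q s'" using 1 r(3) by (simp add: add_mult_distrib)
  qed
  ultimately show ?thesis unfolding okE_def by blast
qed

lemma okE_Flip:
  assumes "bnd b s" "b \<ge> 2" "Q (s(val a s := 0))" "Q (s(val a s := 1))"
    "f (s(val a s := 0)) \<ge> 0" "f (s(val a s := 1)) \<ge> 0"
    "x \<le> (f (s(val a s := 0)) + f (s(val a s := 1))) / 2"
  shows "okE b (Flip a) s (wc a + wl a + 1) Q f x"
proof -
  have b0: "b > 0" using assms(2) by simp
  have "1 \<le> b\<^sup>2" using b0 by simp
  hence t: "cost a s + len (val a s) + 1 \<le> (wc a + wl a + 1) * b\<^sup>2"
    using cost_le[OF assms(1) b0, of a] len_val_sq[OF assms(1) b0, of a] by (simp add: add_mult_distrib)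
  have len01: "len 0 \<le> b" "len 1 \<le> b" using assms(2) by (auto simp: len_def bitlen_def floorlog_def)
  have bn: "bnd b (s(val a s := 0))" "bnd b (s(val a s := 1))" using assms len01 by (auto simp: bnd_def)
  have e: "exec (Flip a) s = bind_spmf coin_spmf (\<lambda>b. return_spmf (s(val a s := (if b then 1 else 0)), cost a s + len (val a s) + 1))"
    by (subst exec.simps) simp
  have "(\<integral>\<^sup>+ r. ennreal (f (fst r)) \<partial>measure_spmf (exec (Flip a) s)) = (ennreal (f (s(val a s := 0))) + ennreal (f (s(val a s := 1)))) / 2"
    unfolding e nn_integral_bind_spmf' nn_integral_return_spmf' nn_integral_spmf_of_set by (simp add: UNIV_bool)
  also have "\<dots> = ennreal ((f (s(val a s := 0)) + f (s(val a s := 1))) / 2)"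
    using assms by (simp add: divide_ennreal[symmetric])
  finally have "ennreal x \<le> (\<integral>\<^sup>+ r. ennreal (f (fst r)) \<partial>measure_spmf (exec (Flip a) s))"
    using assms(7) by (simp add: ennreal_leI)
  thus ?thesis unfolding okE_def using t bn assms unfolding e by (auto simp: set_bind_spmf)
qed

lemma okE_If:
  assumes "bnd b s" "b > 0" "okE b (if val a s \<noteq> 0 then p1 else p2) s N Q f x"
  shows "okE b (prog.If a p1 p2) s (wc a + wl a + N) Q f x"
proof -
  have t: "cost a s + len (val a s) \<le> (wc a + wl a) * b\<^sup>2"
    using cost_le[OF assms(1,2), of a] len_val_sq[OF assms(1,2), of a] by (simp add: add_mult_distrib)
  let ?e = "exec (if val a s \<noteq> 0 then p1 else p2) s"
  have e: "exec (prog.If a p1 p2) s = bind_spmf ?e (\<lambda>r. return_spmf (fst r, cost a s + len (val a s) + snd r))"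
    by (subst exec.simps) simp
  have "(\<integral>\<^sup>+ r. ennreal (f (fst r)) \<partial>measure_spmf (exec (prog.If a p1 p2) s)) = (\<integral>\<^sup>+ r. ennreal (f (fst r)) \<partial>measure_spmf ?e)"
    unfolding e nn_integral_bind_spmf' nn_integral_return_spmf' by simp
  moreover have "\<forall>(s', t) \<in> set_spmf (exec (prog.If a p1 p2) s). t \<le> (wc a + wl a + N) * b\<^sup>2 \<and> bnd b s' \<and> Q s'"
  proof -
    have *: "\<forall>(s', t) \<in> set_spmf ?e. t \<le> N * b\<^sup>2 \<and> bnd b s' \<and> Q s'" using assms(3) unfolding okE_def by blast
    show ?thesis
    proof (clarify)
      fix s' t assume "(s', t) \<in> set_spmf (exec (prog.If a p1 p2) s)"
      then obtain t' where t': "(s', t') \<in> set_spmf ?e" "t = cost a s + len (val a s) + t'" unfolding e by (auto simp: set_bind_spmf)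
      thus "t \<le> (wc a + wl a + N) * b\<^sup>2 \<and> bnd b s' \<and> Q s'" using * t by (force simp: add_mult_distrib)
    qed
  qed
  moreover have "lossless_spmf (exec (prog.If a p1 p2) s)" using assms(3) unfolding okE_def e by auto
  ultimately show ?thesis using assms(3) unfolding okE_def by auto
qed

text \<open>\<open>j\<close> is a budget of remaining rounds. The potential \<open>\<phi>\<close>
  may not decrease in expectation, so its initial value bounds the final expectation from below, as
  for a submartingale.\<close>

lemma okE_While:
  assumes step: "\<And>j s. J (j::nat) s \<Longrightarrow> bnd b s \<Longrightarrow> val a s \<noteq> 0 \<Longrightarrow> \<exists>j'. j = Suc j' \<and> okE b p s N (J j') \<phi> (\<phi> s)"
    and fin: "\<And>j s. J j s \<Longrightarrow> bnd b s \<Longrightarrow> val a s = 0 \<Longrightarrow> Q s \<and> \<phi> s \<le> f s"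
    and J: "J j s" "bnd b s" and b: "b > 0" and x: "x \<le> \<phi> s"
  shows "okE b (While a p) s ((j + 1) * (wc a + wl a) + j * N) Q f x"
  using J x
proof (induction j arbitrary: s x rule: nat.induct)
  case zero
  hence v: "val a s = 0" using step[of 0 s] by force
  have t: "cost a s + len (val a s) \<le> (wc a + wl a) * b\<^sup>2"
    using cost_le[OF zero(2) b, of a] len_val_sq[OF zero(2) b, of a] by (simp add: add_mult_distrib)
  have e: "exec (While a p) s = return_spmf (s, cost a s + len (val a s))"
    using v by (simp add: exec_While)
  have "ennreal x \<le> ennreal (f s)" using fin[OF zero(1,2) v] zero(3) by (intro ennreal_leI) auto
  thus ?case unfolding okE_def e using t zero(2) fin[OF zero(1,2) v] by (auto simp: nn_integral_return_spmf')
next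
  case (Suc j)
  have t: "cost a s + len (val a s) \<le> (wc a + wl a) * b\<^sup>2"
    using cost_le[OF Suc(3) b, of a] len_val_sq[OF Suc(3) b, of a] by (simp add: add_mult_distrib)
  show ?case
  proof (cases "val a s = 0")
    case v: True
    have e: "exec (While a p) s = return_spmf (s, cost a s + len (val a s))"
      using v by (simp add: exec_While)
    have "ennreal x \<le> ennreal (f s)" using fin[OF Suc(2,3) v] Suc(4) by (intro ennreal_leI) auto
    moreover have "(wc a + wl a) * b\<^sup>2 \<le> ((Suc j + 1) * (wc a + wl a) + Suc j * N) * b\<^sup>2" by (intro mult_right_mono) auto
    hence "cost a s + len (val a s) \<le> ((Suc j + 1) * (wc a + wl a) + Suc j * N) * b\<^sup>2"
      using t by (rule order_trans[rotated])
    ultimately show ?thesis unfolding okE_def e using Suc(3) fin[OF Suc(2,3) v] by (auto simp: nn_integral_return_spmf' simp del: mult_Suc)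
  next
    case v: False
    have ok1: "okE b p s N (J j) \<phi> (\<phi> s)" using step[OF Suc(2,3) v] by auto
    let ?N = "(j + 1) * (wc a + wl a) + j * N"
    have e: "exec (While a p) s = bind_spmf (exec (Seq p (While a p)) s) (\<lambda>r. return_spmf (fst r, cost a s + len (val a s) + snd r))"
      unfolding exec_Seq by (subst exec_While) (simp add: v add.assoc)
    have ok2: "okE b (Seq p (While a p)) s (N + ?N) Q f x"
      by (rule okE_Seq[OF okE_conseq[OF ok1, of N "J j" \<phi> x]]) (use Suc in auto)
    have "(\<integral>\<^sup>+ r. ennreal (f (fst r)) \<partial>measure_spmf (exec (While a p) s)) = (\<integral>\<^sup>+ r. ennreal (f (fst r)) \<partial>measure_spmf (exec (Seq p (While a p)) s))"
      unfolding e nn_integral_bind_spmf' nn_integral_return_spmf' by simp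
    moreover have "\<forall>(s', t) \<in> set_spmf (exec (While a p) s). t \<le> ((Suc j + 1) * (wc a + wl a) + Suc j * N) * b\<^sup>2 \<and> bnd b s' \<and> Q s'"
    proof (clarify)
      fix s' t assume "(s', t) \<in> set_spmf (exec (While a p) s)"
      then obtain t' where t': "(s', t') \<in> set_spmf (exec (Seq p (While a p)) s)" "t = cost a s + len (val a s) + t'" unfolding e by (auto simp: set_bind_spmf)
      hence "t' \<le> (N + ?N) * b\<^sup>2 \<and> bnd b s' \<and> Q s'" using ok2 unfolding okE_def by auto
      moreover have "(wc a + wl a) * b\<^sup>2 + (N + ?N) * b\<^sup>2 = ((Suc j + 1) * (wc a + wl a) + Suc j * N) * b\<^sup>2" by (simp add: algebra_simps)
      ultimately show "t \<le> ((Suc j + 1) * (wc a + wl a) + Suc j * N) * b\<^sup>2 \<and> bnd b s' \<and> Q s'" using t t'(2) by linarith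
    qed
    moreover have "lossless_spmf (exec (While a p) s)" using ok2 unfolding okE_def e by auto
    ultimately show ?thesis using ok2 unfolding okE_def by auto
  qed
qed

section \<open>Integer matrices attached to a graph\<close>

text \<open>\<open>P\<close> stands for 1 / \<epsilon> up to a constant. The power of two
  \<open>H\<close> serves as every large quantity at once: scale of the inverse degrees, bound on
  \<open>n\<close> and \<open>m\<close>, and precision of rounded vectors.\<close>

locale graph_instance =
  fixes n m :: nat and us vs :: "nat \<Rightarrow> nat" and P H lg :: nat
  assumes edges: "j < m \<Longrightarrow> us j < n" "j < m \<Longrightarrow> vs j < n" "j < m \<Longrightarrow> us j \<noteq> vs j"
    and P: "P \<ge> 2" and H: "H \<ge> 2048 * P\<^sup>2 * (n + m + 1)" "H = 2 ^ lg"
begin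

definition deg :: "nat \<Rightarrow> nat" where
  "deg v = (\<Sum>j<m. (if us j = v then 1 else 0) + (if vs j = v then 1 else 0))"

text \<open>\<open>hv v / H\<close> is the approximate inverse of the degree of \<open>v\<close> that is used in the power iteration. The
  analysis replaces the degree by the reciprocal \<open>wt v\<close>, so that no error arises.\<close>

definition hv :: "nat \<Rightarrow> nat" where
  "hv v = H div max 1 (deg v)"

definition wt :: "nat \<Rightarrow> real" where
  "wt v = real H / real (hv v)"

definition wn :: "(nat \<Rightarrow> real) \<Rightarrow> real" where
  "wn x = (\<Sum>v<n. wt v * (x v)\<^sup>2)"

text \<open>The matrix \<open>P * A + D\<close>, as a sum over the edges.\<close>

definition b0 :: "nat \<Rightarrow> nat \<Rightarrow> real" where
  "b0 v r = (\<Sum>j<m. (if us j = v then (if r = us j then 1 else 0) + (if r = vs j then real P else 0) else 0)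
                  + (if vs j = v then (if r = vs j then 1 else 0) + (if r = us j then real P else 0) else 0))"

lemma H_gt: "H > 0" "n < H" "m < H" "2 * (n + m) \<le> H" "1024 * P\<^sup>2 \<le> H"
proof -
  have "1 \<le> P\<^sup>2" using P by (simp add: power2_eq_square)
  hence "2048 * 1 * (n + m + 1) \<le> 2048 * P\<^sup>2 * (n + m + 1)" by (intro mult_right_mono mult_left_mono) auto
  hence "2048 * (n + m + 1) \<le> H" using H(1) by simp
  thus "H > 0" "n < H" "m < H" "2 * (n + m) \<le> H" by auto
  have "2048 * P\<^sup>2 * 1 \<le> 2048 * P\<^sup>2 * (n + m + 1)" by (intro mult_left_mono) auto
  thus "1024 * P\<^sup>2 \<le> H" using H(1) by simp
qed

lemma deg_le: "deg v \<le> 2 * m"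
  unfolding deg_def by (rule order_trans[OF sum_bounded_above[of _ _ 2]]) auto

lemma sum_deg: "(\<Sum>v<n. real (deg v) * f v) = (\<Sum>j<m. f (us j) + f (vs j))"
proof -
  have "(\<Sum>v<n. real (deg v) * f v) = (\<Sum>v<n. \<Sum>j<m. (if us j = v then f v else 0) + (if vs j = v then f v else 0))"
    unfolding deg_def of_nat_sum sum_distrib_right by (intro sum.cong refl) auto
  also have "\<dots> = (\<Sum>j<m. \<Sum>v<n. (if us j = v then f v else 0) + (if vs j = v then f v else 0))"
    by (rule sum.swap)
  also have "\<dots> = (\<Sum>j<m. f (us j) + f (vs j))"
    using edges by (intro sum.cong refl) (simp add: sum.distrib sum.delta')
  finally show ?thesis .
qed

text \<open>Rounding \<open>H / deg v\<close> down loses at most a factor of 2, because the quotient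
  is at least 1. An isolated vertex gets weight exactly 1.\<close>

lemma wt_bounds:
  "hv v \<ge> 1" "wt v \<ge> 1" "wt v \<ge> real (deg v)" "deg v \<ge> 1 \<Longrightarrow> wt v \<le> 2 * real (deg v)" "deg v = 0 \<Longrightarrow> wt v = 1" "wt v \<le> 2 * real H"
proof -
  let ?D = "max 1 (deg v)"
  have D: "?D \<ge> 1" "2 * ?D \<le> 2 * H" "?D * 1 \<le> H" using deg_le[of v] H_gt by auto
  show h1: "hv v \<ge> 1" unfolding hv_def using D div_le_mono[of ?D H ?D] by simp
  have "hv v * ?D \<le> H" unfolding hv_def by simp
  hence "real (hv v) * real ?D \<le> real H" by (metis of_nat_le_iff of_nat_mult)
  hence "real ?D \<le> wt v" unfolding wt_def using h1 by (simp add: field_simps)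
  thus "wt v \<ge> 1" "wt v \<ge> real (deg v)" by auto
  have "H < (hv v + 1) * ?D" unfolding hv_def using D(1) by (metis Suc_eq_plus1 less_le_trans less_one not_less_zero dividend_less_div_times mult_Suc add.commute zero_less_iff_neq_zero le_numeral_extra(2))
  also have "\<dots> \<le> (2 * hv v) * ?D" using h1 by (intro mult_right_mono) auto
  finally have "real H \<le> 2 * real (hv v) * real ?D" by (metis of_nat_mult of_nat_numeral less_imp_le of_nat_le_iff)
  hence w2: "wt v \<le> 2 * real ?D" unfolding wt_def using h1 by (simp add: field_simps)
  thus "deg v \<ge> 1 \<Longrightarrow> wt v \<le> 2 * real (deg v)" by simp
  show "wt v \<le> 2 * real H" using w2 D by linarith
  show "deg v = 0 \<Longrightarrow> wt v = 1" unfolding wt_def hv_def using H_gt by simp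
qed

text \<open>Over all vertices the total weight involves \<open>n\<close>; over nonisolated ones it
  is of order \<open>m\<close>. Errors in the cut value may only be charged to the latter.\<close>

lemma sum_wt: "(\<Sum>v<n. wt v) \<le> 4 * real H" "(\<Sum>v | v < n \<and> deg v > 0. wt v) \<le> 4 * real m"
proof -
  have d: "(\<Sum>v<n. real (deg v)) = 2 * real m" using sum_deg[of "\<lambda>_. 1"] by simp
  have "(\<Sum>v<n. wt v) \<le> (\<Sum>v<n. 2 * real (deg v) + 1)"
    using wt_bounds(4,5) by (intro sum_mono) (metis One_nat_def add_increasing2 dual_order.refl le_add_same_cancel2 less_one linorder_not_less mult_nonneg_nonneg of_nat_0_le_iff zero_le_numeral zero_le_one add.commute add_increasing)
  also have "\<dots> = 4 * real m + real n" using d by (simp add: sum.distrib sum_distrib_left[symmetric])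
  also have "\<dots> \<le> 4 * real H" using H_gt by simp
  finally show "(\<Sum>v<n. wt v) \<le> 4 * real H" .
  have "(\<Sum>v | v < n \<and> deg v > 0. wt v) \<le> (\<Sum>v | v < n \<and> deg v > 0. 2 * real (deg v))"
    using wt_bounds(4) by (intro sum_mono) auto
  also have "\<dots> \<le> (\<Sum>v<n. 2 * real (deg v))" by (intro sum_mono2) auto
  also have "\<dots> = 4 * real m" using d by (simp add: sum_distrib_left[symmetric])
  finally show "(\<Sum>v | v < n \<and> deg v > 0. wt v) \<le> 4 * real m" .
qed

lemma mv_b0: "v < n \<Longrightarrow> mv n b0 x v = (\<Sum>j<m. (if us j = v then x v + real P * x (vs j) else 0) + (if vs j = v then x v + real P * x (us j) else 0))"
proof -
  assume v: "v < n"
  have "mv n b0 x v = (\<Sum>r<n. \<Sum>j<m. (if us j = v then (if r = us j then x r else 0) + (if r = vs j then real P * x r else 0) else 0)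
                  + (if vs j = v then (if r = vs j then x r else 0) + (if r = us j then real P * x r else 0) else 0))"
    unfolding mv_def b0_def sum_distrib_right by (intro sum.cong refl) (auto simp: algebra_simps)
  also have "\<dots> = (\<Sum>j<m. \<Sum>r<n. (if us j = v then (if r = us j then x r else 0) + (if r = vs j then real P * x r else 0) else 0)
                  + (if vs j = v then (if r = vs j then x r else 0) + (if r = us j then real P * x r else 0) else 0))"
    by (rule sum.swap)
  also have "\<dots> = (\<Sum>j<m. (if us j = v then x v + real P * x (vs j) else 0) + (if vs j = v then x v + real P * x (us j) else 0))"
    using edges by (intro sum.cong refl) (auto simp: sum.distrib sum.delta)
  finally show ?thesis .
qed

lemma ip_b0: "ip n y (mv n b0 x) = (\<Sum>j<m. y (us j) * x (us j) + y (vs j) * x (vs j) + real P * (y (us j) * x (vs j) + y (vs j) * x (us j)))"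
proof -
  have "ip n y (mv n b0 x) = (\<Sum>v<n. \<Sum>j<m. (if v = us j then y v * (x v + real P * x (vs j)) else 0) + (if v = vs j then y v * (x v + real P * x (us j)) else 0))"
    unfolding ip_def
  proof (intro sum.cong refl)
    fix v assume "v \<in> {..<n}"
    thus "y v * mv n b0 x v = (\<Sum>j<m. (if v = us j then y v * (x v + real P * x (vs j)) else 0) + (if v = vs j then y v * (x v + real P * x (us j)) else 0))"
      by (subst mv_b0) (simp_all only: sum_distrib_left lessThan_iff, intro sum.cong refl, auto simp: distrib_left)
  qed
  also have "\<dots> = (\<Sum>j<m. \<Sum>v<n. (if v = us j then y v * (x v + real P * x (vs j)) else 0) + (if v = vs j then y v * (x v + real P * x (us j)) else 0))"
    by (rule sum.swap)
  also have "\<dots> = (\<Sum>j<m. y (us j) * x (us j) + y (vs j) * x (vs j) + real P * (y (us j) * x (vs j) + y (vs j) * x (us j)))"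
    using edges by (intro sum.cong refl) (simp add: sum.distrib sum.delta algebra_simps)
  finally show ?thesis .
qed

lemma qf_b0: "qf n b0 x = (\<Sum>j<m. (x (us j))\<^sup>2 + (x (vs j))\<^sup>2 + 2 * real P * (x (us j) * x (vs j)))"
  unfolding qf_def ip_b0 by (intro sum.cong refl) (simp add: power2_eq_square)

lemma symm_b0: "symm n b0"
  unfolding b0_def by (intro allI impI sum.cong refl) auto

lemma wn_nonneg: "wn x \<ge> 0"
proof -
  have "0 \<le> wt v" for v using wt_bounds(2)[of v] by linarith
  thus ?thesis unfolding wn_def by (intro sum_nonneg mult_nonneg_nonneg) auto
qed

lemma qf_b0_bounds: "qf n b0 x \<le> real (P + 1) * wn x" "- (real (P + 1) * wn x) \<le> qf n b0 x"
proof -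
  have d: "(\<Sum>j<m. (x (us j))\<^sup>2 + (x (vs j))\<^sup>2) \<le> wn x"
    unfolding sum_deg[symmetric, of "\<lambda>v. (x v)\<^sup>2"] wn_def
    using wt_bounds(3) by (intro sum_mono mult_right_mono) auto
  have ab: "\<bar>2 * (a * b)\<bar> \<le> a\<^sup>2 + b\<^sup>2" for a b :: real
    using zero_le_power2[of "a - b"] zero_le_power2[of "a + b"] unfolding power2_sum power2_diff by (auto simp: abs_le_iff)
  have "\<bar>qf n b0 x\<bar> \<le> (\<Sum>j<m. real (P + 1) * ((x (us j))\<^sup>2 + (x (vs j))\<^sup>2))"
    unfolding qf_b0
  proof (rule order_trans[OF sum_abs], intro sum_mono)
    fix j
    have "\<bar>2 * real P * (x (us j) * x (vs j))\<bar> = real P * \<bar>2 * (x (us j) * x (vs j))\<bar>" by (simp add: abs_mult)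
    also have "\<dots> \<le> real P * ((x (us j))\<^sup>2 + (x (vs j))\<^sup>2)" by (intro mult_left_mono ab) auto
    finally have t: "\<bar>2 * real P * (x (us j) * x (vs j))\<bar> \<le> real P * ((x (us j))\<^sup>2 + (x (vs j))\<^sup>2)" .
    have "\<bar>s + t\<bar> \<le> (p + 1) * s" if "s \<ge> 0" "\<bar>t\<bar> \<le> p * s" for s t p :: real
      using that by (simp add: distrib_right)
    from this[OF _ t] show "\<bar>(x (us j))\<^sup>2 + (x (vs j))\<^sup>2 + 2 * real P * (x (us j) * x (vs j))\<bar> \<le> real (P + 1) * ((x (us j))\<^sup>2 + (x (vs j))\<^sup>2)"
      by (simp add: add.commute[of 1])
  qed
  also have "\<dots> \<le> real (P + 1) * wn x" unfolding sum_distrib_left[symmetric] using d by (intro mult_left_mono) auto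
  finally show "qf n b0 x \<le> real (P + 1) * wn x" "- (real (P + 1) * wn x) \<le> qf n b0 x" by (auto simp: abs_le_iff)
qed

text \<open>All of \<open>Sc be i * bm w be i\<close> is integral, and \<open>yrec G \<tau> t w be x q\<close> below evaluates
  \<open>s\<^sub>q * (G * B\<^sub>q x - \<tau> * \<Sum>\<^sub>i t\<^sub>i * w\<^sub>i / s\<^sub>i\<^sub>+\<^sub>1)\<close> without divisions, where \<open>s = Sc be\<close>.\<close>

definition Sc :: "(nat \<Rightarrow> int) \<Rightarrow> nat \<Rightarrow> int" where
  "Sc be i = (\<Prod>j<i. be j)"

text \<open>The stored data of a stage are \<open>w i = s * B v\<close> and
  \<open>be i = - s * (v^T B v)\<close> with \<open>s = Sc be i\<close>. The deflation coefficient
  for \<open>w i\<close> is therefore \<open>1 / (s * be i) = 1 / Sc be (Suc i)\<close>.\<close>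

fun bm :: "(nat \<Rightarrow> nat \<Rightarrow> int) \<Rightarrow> (nat \<Rightarrow> int) \<Rightarrow> nat \<Rightarrow> nat \<Rightarrow> nat \<Rightarrow> real" where
  "bm w be 0 = b0"
| "bm w be (Suc i) = (\<lambda>u v. bm w be i u v + of_int (w i u) * of_int (w i v) / of_int (Sc be (Suc i)))"

lemma bm_cong: "(\<And>i v. i < q \<Longrightarrow> v < n \<Longrightarrow> w i v = w' i v) \<Longrightarrow> (\<And>i. i < q \<Longrightarrow> be i = be' i) \<Longrightarrow>
   u < n \<Longrightarrow> v < n \<Longrightarrow> bm w be q u v = bm w' be' q u v"
proof (induction q)
  case (Suc q)
  have "Sc be (Suc q) = Sc be' (Suc q)" unfolding Sc_def using Suc.prems(2) by (intro prod.cong) auto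
  thus ?case using Suc by auto
qed simp

lemma symm_bm: "symm n (bm w be q)"
  by (induction q) (use symm_b0 in \<open>auto simp: mult.commute\<close>)

lemma Sc_pos: "(\<And>i. i < q \<Longrightarrow> be i > 0) \<Longrightarrow> Sc be q > 0"
  unfolding Sc_def by (intro prod_pos) auto

lemma mv_bm_Suc: "mv n (bm w be (Suc i)) x v = mv n (bm w be i) x v + of_int (w i v) * ip n (\<lambda>v. of_int (w i v)) x / of_int (Sc be (Suc i))"
  unfolding mv_def ip_def by (simp add: sum.distrib sum_distrib_left sum_divide_distrib algebra_simps)

lemma qf_bm_Suc: "qf n (bm w be (Suc i)) x = qf n (bm w be i) x + (ip n (\<lambda>v. of_int (w i v)) x)\<^sup>2 / of_int (Sc be (Suc i))"
proof -
  have "qf n (bm w be (Suc i)) x = ip n x (\<lambda>v. mv n (bm w be i) x v + (ip n (\<lambda>v. of_int (w i v)) x / of_int (Sc be (Suc i))) * of_int (w i v))"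
    unfolding qf_def[of _ "bm w be (Suc i)"] by (intro ip_cong refl) (simp add: mv_bm_Suc del: bm.simps)
  also have "\<dots> = qf n (bm w be i) x + (ip n (\<lambda>v. of_int (w i v)) x / of_int (Sc be (Suc i))) * ip n x (\<lambda>v. of_int (w i v))"
    unfolding ip_add_right qf_def ..
  finally show ?thesis unfolding ip_commute[of n x "\<lambda>v. of_int (w i v)"] by (simp add: power2_eq_square)
qed

lemma qf_bm: "qf n (bm w be q) x = qf n b0 x + (\<Sum>i<q. (ip n (\<lambda>v. of_int (w i v)) x)\<^sup>2 / of_int (Sc be (Suc i)))"
  by (induction q) (auto simp del: bm.simps(2) simp: qf_bm_Suc)

fun yrec :: "int \<Rightarrow> int \<Rightarrow> (nat \<Rightarrow> int) \<Rightarrow> (nat \<Rightarrow> nat \<Rightarrow> int) \<Rightarrow> (nat \<Rightarrow> int) \<Rightarrow> (nat \<Rightarrow> int) \<Rightarrow> nat \<Rightarrow> nat \<Rightarrow> int" where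
  "yrec G \<tau> t w be x 0 = (\<lambda>v. \<Sum>j<m. (if us j = v then G * (x v + int P * x (vs j)) else 0) + (if vs j = v then G * (x v + int P * x (us j)) else 0))"
| "yrec G \<tau> t w be x (Suc i) = (\<lambda>v. be i * yrec G \<tau> t w be x i v + w i v * (G * (\<Sum>v<n. w i v * x v) - \<tau> * t i))"

text \<open>\<open>G\<close> and \<open>\<tau>\<close> bring the matrix term and the guessed linear
  term to a common scale: power iteration uses \<open>G = 1\<close> and \<open>\<tau> = 0\<close>,
  Frank--Wolfe uses \<open>G = H\<close> and the number of points summed so far, at least 1.\<close>

lemma yrec_real:
  assumes "\<And>i. i < q \<Longrightarrow> be i > 0" "v < n"
  shows "of_int (yrec G \<tau> t w be x q v) = of_int (Sc be q) * (of_int G * mv n (bm w be q) (\<lambda>v. of_int (x v)) v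
     - of_int \<tau> * (\<Sum>i<q. of_int (t i) * of_int (w i v) / of_int (Sc be (Suc i))))"
  using assms
proof (induction q)
  case 0
  have "of_int (yrec G \<tau> t w be x 0 v) = of_int G * mv n b0 (\<lambda>v. of_int (x v)) v"
    unfolding mv_b0[OF 0(2)] by (simp only: yrec.simps of_int_sum sum_distrib_left, intro sum.cong refl, auto simp: distrib_left)
  thus ?case by (simp add: Sc_def)
next
  case (Suc q)
  have S: "Sc be (Suc q) = Sc be q * be q" by (simp add: Sc_def)
  have pos: "Sc be q > 0" "be q > 0" using Suc.prems Sc_pos[of q be] by auto
  have e: "of_int (yrec G \<tau> t w be x (Suc q) v) = of_int (be q) * of_int (yrec G \<tau> t w be x q v)
      + of_int (w q v) * (of_int G * ip n (\<lambda>v. of_int (w q v)) (\<lambda>v. of_int (x v)) - of_int \<tau> * of_int (t q))"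
    by (simp add: ip_def)
  have e2: "of_int (yrec G \<tau> t w be x q v) = of_int (Sc be q) * (of_int G * mv n (bm w be q) (\<lambda>v. of_int (x v)) v
     - of_int \<tau> * (\<Sum>i<q. of_int (t i) * of_int (w i v) / of_int (Sc be (Suc i))))"
    using Suc by auto
  show ?case unfolding e e2 mv_bm_Suc sum.lessThan_Suc
    using pos unfolding S by (simp add: field_simps)
qed

text \<open>\<open>U i\<close> bounds the integers of stage \<open>i\<close>; a stage at most raises them to the eighth power.\<close>

definition U :: "nat \<Rightarrow> int" where
  "U i = (int H ^ 7) ^ (8 ^ i)"

lemma U_ge: "U i \<ge> int H ^ 7" "U i \<ge> 1" "U (Suc i) = U i ^ 8"
proof -
  have H1: "int H ^ 7 \<ge> 1" using H_gt by simp
  have "(int H ^ 7) ^ 1 \<le> U i" unfolding U_def using H1 by (intro power_increasing) auto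
  thus "U i \<ge> int H ^ 7" by simp
  thus "U i \<ge> 1" using H1 by linarith
  show "U (Suc i) = U i ^ 8" unfolding U_def by (simp add: power_mult[symmetric] mult.commute)
qed

lemma U_mono: "i \<le> j \<Longrightarrow> U i \<le> U j"
proof (induction rule: dec_induct)
  case (step j)
  have "U j ^ 1 \<le> U j ^ 8" using U_ge(2)[of j] by (intro power_increasing) auto
  thus ?case using step U_ge(3)[of j] by simp
qed simp

lemma H_powers: "1 \<le> int H" "int n \<le> int H" "int m \<le> int H" "2 * (1 + int P) \<le> int H"
proof -
  show "1 \<le> int H" "int n \<le> int H" "int m \<le> int H" using H_gt by auto
  have "P \<le> P * P" using P by simp
  moreover have "2 * (1 + P) \<le> 1024 * x" if "P \<le> x" for x using P that by simp
  ultimately have "2 * (1 + P) \<le> 1024 * P\<^sup>2" unfolding power2_eq_square by blast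
  hence "2 * (1 + P) \<le> H" using H_gt(5) order_trans by blast
  hence "int (2 * (1 + P)) \<le> int H" by (simp only: of_nat_le_iff)
  thus "2 * (1 + int P) \<le> int H" by simp
qed

text \<open>Stated for partial sums, because these appear in memory during the loop over the
  edges.\<close>

lemma edge_sum_bound:
  assumes x: "\<And>v. v < n \<Longrightarrow> \<bar>G * x v\<bar> \<le> \<xi>" and v: "v < n" and k: "k \<le> m" and \<xi>: "0 \<le> \<xi>"
  shows "\<bar>\<Sum>j<k. (if us j = v then G * (x v + int P * x (vs j)) else 0) + (if vs j = v then G * (x v + int P * x (us j)) else 0)\<bar> \<le> int k * (2 * (1 + int P)) * \<xi>"
proof -
  have one: "\<bar>G * (x v + int P * x r)\<bar> \<le> (1 + int P) * \<xi>" if "r < n" for r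
  proof -
    have "\<bar>G * (x v + int P * x r)\<bar> \<le> \<bar>G * x v\<bar> + int P * \<bar>G * x r\<bar>"
      by (simp add: distrib_left abs_mult mult.left_commute[of G] order_trans[OF abs_triangle_ineq])
    also have "\<dots> \<le> \<xi> + int P * \<xi>" by (intro add_mono mult_left_mono x v that) auto
    finally show ?thesis by (simp add: distrib_right)
  qed
  have "\<bar>\<Sum>j<k. (if us j = v then G * (x v + int P * x (vs j)) else 0) + (if vs j = v then G * (x v + int P * x (us j)) else 0)\<bar>
     \<le> (\<Sum>j<k. (1 + int P) * \<xi> + (1 + int P) * \<xi>)"
  proof (rule order_trans[OF sum_abs], intro sum_mono order_trans[OF abs_triangle_ineq] add_mono)
    fix j assume "j \<in> {..<k}"
    hence "us j < n" "vs j < n" using edges k by auto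
    thus "\<bar>if us j = v then G * (x v + int P * x (vs j)) else 0\<bar> \<le> (1 + int P) * \<xi>"
      "\<bar>if vs j = v then G * (x v + int P * x (us j)) else 0\<bar> \<le> (1 + int P) * \<xi>"
      using one \<xi> by auto
  qed
  also have "\<dots> = int k * (2 * (1 + int P)) * \<xi>" by (simp add: algebra_simps)
  finally show ?thesis .
qed

text \<open>The square leaves room for what a stage produces: an entry of the new vector is at most
  \<open>U q * H ^ 3\<close>, and \<open>be q\<close> is a sum of \<open>n\<close> products with
  another \<open>H ^ 3\<close>, at most \<open>H ^ 7 * U q\<close>. This is also the origin of the
  exponent 7 in \<open>U\<close>.\<close>

definition wb_ok :: "nat \<Rightarrow> (nat \<Rightarrow> nat \<Rightarrow> int) \<Rightarrow> (nat \<Rightarrow> int) \<Rightarrow> bool" where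
  "wb_ok q w be \<longleftrightarrow> (\<forall>i<q. 0 < be i \<and> be i \<le> U i ^ 2 \<and> (\<forall>v<n. \<bar>w i v\<bar> \<le> U i ^ 2))"

lemma dot_bound:
  assumes "wb_ok q w be" "i < q" "k \<le> n" and x: "\<And>v. v < n \<Longrightarrow> \<bar>x v\<bar> \<le> \<xi>" and \<xi>: "0 \<le> \<xi>"
  shows "\<bar>\<Sum>v<k. w i v * x v\<bar> \<le> U i ^ 3 * \<xi>"
proof -
  have "\<bar>\<Sum>v<k. w i v * x v\<bar> \<le> (\<Sum>v<k. U i ^ 2 * \<xi>)"
  proof (rule order_trans[OF sum_abs], intro sum_mono)
    fix v assume "v \<in> {..<k}"
    hence "v < n" using assms(3) by auto
    thus "\<bar>w i v * x v\<bar> \<le> U i ^ 2 * \<xi>" unfolding abs_mult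
      using assms(1,2) x by (intro mult_mono) (auto simp: wb_ok_def)
  qed
  also have "\<dots> = int k * (U i ^ 2 * \<xi>)" by simp
  also have "\<dots> \<le> U i * (U i ^ 2 * \<xi>)"
  proof (intro mult_right_mono)
    have "int H ^ 1 \<le> int H ^ 7" using H_powers by (intro power_increasing) auto
    hence "int H \<le> int H ^ 7" by simp
    thus "int k \<le> U i" using assms(3) H_powers(2) U_ge(1)[of i] by linarith
  qed (use \<xi> in auto)
  also have "\<dots> = U i ^ 3 * \<xi>" by (simp add: power3_eq_cube power2_eq_square)
  finally show ?thesis .
qed

lemma coef_bound:
  assumes "wb_ok q w be" "i < q" and x: "\<And>v. v < n \<Longrightarrow> \<bar>G * x v\<bar> \<le> \<xi>" and \<xi>: "0 \<le> \<xi>"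
    and t: "\<bar>\<tau> * t i\<bar> \<le> \<xi>"
  shows "\<bar>G * (\<Sum>v<n. w i v * x v) - \<tau> * t i\<bar> \<le> 2 * U i ^ 3 * \<xi>"
proof -
  have "\<bar>G * (\<Sum>v<n. w i v * x v)\<bar> = \<bar>\<Sum>v<n. w i v * (G * x v)\<bar>" by (simp add: sum_distrib_left mult.left_commute)
  also have "\<dots> \<le> U i ^ 3 * \<xi>" by (rule dot_bound[OF assms(1,2) order_refl]) (use x \<xi> in auto)
  finally have 1: "\<bar>G * (\<Sum>v<n. w i v * x v)\<bar> \<le> U i ^ 3 * \<xi>" .
  have "1 * \<xi> \<le> U i ^ 3 * \<xi>" using U_ge(2)[of i] \<xi> by (intro mult_right_mono) (auto simp: one_le_power)
  thus ?thesis using 1 t by linarith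
qed

text \<open>With \<open>u = U i\<close>, a stage turns \<open>u * \<xi>\<close> into at most
  \<open>u ^ 2 * u * \<xi>\<close> from the rescaled old value plus
  \<open>u ^ 2 * (2 * u ^ 3 * \<xi>)\<close> from the rank one term; \<open>u ^ 8 * \<xi>\<close>
  dominates both.\<close>

lemma yrec_bound:
  assumes "wb_ok q w be" and x: "\<And>v. v < n \<Longrightarrow> \<bar>G * x v\<bar> \<le> \<xi>" and \<xi>: "0 \<le> \<xi>"
    and t: "\<And>i. i < q \<Longrightarrow> \<bar>\<tau> * t i\<bar> \<le> \<xi>" and v: "v < n" and i: "i \<le> q"
  shows "\<bar>yrec G \<tau> t w be x i v\<bar> \<le> U i * \<xi>"
  using i
proof (induction i)
  case 0
  have "\<bar>yrec G \<tau> t w be x 0 v\<bar> \<le> int m * (2 * (1 + int P)) * \<xi>"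
    unfolding yrec.simps by (rule edge_sum_bound[OF x v order_refl \<xi>])
  also have "\<dots> \<le> (int H * int H) * \<xi>" using H_powers \<xi> by (intro mult_right_mono mult_mono) auto
  also have "int H * int H \<le> U 0"
  proof -
    have "int H ^ 2 \<le> int H ^ 7" using H_powers by (intro power_increasing) auto
    thus ?thesis using U_ge(1)[of 0] by (simp add: power2_eq_square)
  qed
  hence "(int H * int H) * \<xi> \<le> U 0 * \<xi>" using \<xi> by (intro mult_right_mono) auto
  finally show ?case .
next
  case (Suc i)
  define u where "u = U i"
  have u2: "u \<ge> 2" and uH: "u \<ge> 1"
  proof -
    have "int H ^ 1 \<le> int H ^ 7" using H_powers by (intro power_increasing) auto
    hence "int H \<le> int H ^ 7" by simp
    moreover have "2 \<le> int H" using H_powers(4) P by simp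
    ultimately show "u \<ge> 2" using U_ge(1)[of i] unfolding u_def by linarith
  qed (use U_ge in \<open>simp add: u_def\<close>)
  have wb: "0 < be i" "be i \<le> u ^ 2" "\<bar>w i v\<bar> \<le> u ^ 2" using assms(1) v Suc.prems unfolding wb_ok_def u_def by auto
  have cb: "\<bar>G * (\<Sum>v<n. w i v * x v) - \<tau> * t i\<bar> \<le> 2 * u ^ 3 * \<xi>"
    unfolding u_def by (rule coef_bound[OF assms(1) _ x \<xi> t]) (use Suc.prems in auto)
  have "\<bar>yrec G \<tau> t w be x (Suc i) v\<bar> \<le> be i * \<bar>yrec G \<tau> t w be x i v\<bar> + \<bar>w i v\<bar> * \<bar>G * (\<Sum>v<n. w i v * x v) - \<tau> * t i\<bar>"
    using wb by (simp add: order_trans[OF abs_triangle_ineq] abs_mult)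
  also have "\<dots> \<le> u ^ 2 * (u * \<xi>) + u ^ 2 * (2 * u ^ 3 * \<xi>)"
    using wb Suc cb uH \<xi> unfolding u_def by (intro add_mono mult_mono) auto
  also have "\<dots> = (u ^ 3 + 2 * u ^ 5) * \<xi>" by (simp add: algebra_simps numeral_eq_Suc)
  also have "\<dots> \<le> (u ^ 8) * \<xi>"
  proof (intro mult_right_mono \<xi>)
    have "u ^ 3 \<le> u ^ 5" "u ^ 7 \<le> u ^ 8" using uH by (intro power_increasing; simp)+
    moreover have "2 * 2 * u ^ 5 \<le> (u * u) * u ^ 5" using u2 by (intro mult_right_mono mult_mono) auto
    moreover have "(u * u) * u ^ 5 = u ^ 7" by (simp add: numeral_eq_Suc)
    moreover have "0 \<le> u ^ 5" using uH by simp
    ultimately show "u ^ 3 + 2 * u ^ 5 \<le> u ^ 8" by linarith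
  qed
  finally show ?case unfolding U_ge(3) u_def .
qed

text \<open>Each update may raise the upper bound by \<open>1 / H\<close>, in total by at most 1, as
  there are at most \<open>n\<close> updates. The vectors vanish at isolated vertices so that
  Frank--Wolfe leaves these at 0.\<close>

definition stage_inv :: "nat \<Rightarrow> nat \<Rightarrow> (nat \<Rightarrow> nat \<Rightarrow> int) \<Rightarrow> (nat \<Rightarrow> int) \<Rightarrow> bool" where
  "stage_inv k q w be \<longleftrightarrow> q \<le> k \<and> wb_ok q w be \<and>
     (\<forall>i<q. \<forall>v<n. deg v = 0 \<longrightarrow> w i v = 0) \<and>
     (\<forall>y. qf n (bm w be q) y \<le> (real P + 1 + real q / real H) * wn y) \<and> codim_nonneg n (bm w be q) (k - q)"

lemma yrec_isolated:
  assumes "deg v = 0" "\<And>i. i < q \<Longrightarrow> w i v = 0"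
  shows "yrec G \<tau> t w be x q v = 0"
  using assms(2)
proof (induction q)
  case 0
  have "us j \<noteq> v \<and> vs j \<noteq> v" if "j < m" for j
    using assms(1) that unfolding deg_def by (auto split: if_splits)
  thus ?case by (auto intro!: sum.neutral)
qed simp

lemma stage_inv_0: "codim_nonneg n b0 k \<Longrightarrow> stage_inv k 0 w be"
  using qf_b0_bounds(1) by (simp add: stage_inv_def wb_ok_def add.commute[of 1])

lemma qf_bm_lower:
  assumes "wb_ok q w be"
  shows "- (real (P + 1) * wn y) \<le> qf n (bm w be q) y"
proof -
  have "(\<Sum>i<q. (ip n (\<lambda>v. of_int (w i v)) y)\<^sup>2 / of_int (Sc be (Suc i))) \<ge> 0"
  proof (intro sum_nonneg divide_nonneg_nonneg)
    fix i assume "i \<in> {..<q}"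
    hence "Sc be (Suc i) > 0" using assms by (intro Sc_pos) (auto simp: wb_ok_def)
    thus "0 \<le> real_of_int (Sc be (Suc i))" by simp
  qed auto
  thus ?thesis using qf_b0_bounds(2)[of y] unfolding qf_bm by linarith
qed

text \<open>Power iteration with shift \<open>2 * P\<close>, multiplied by
  \<open>2 * H * Sc be q\<close> per step. \<open>H\<close> clears the inverse degrees and
  \<open>Sc be q\<close> the deflation denominators; the 2 makes the growth rate
  \<open>2 * P + 1/2\<close> at eigenvalue -1/2 integral.\<close>

fun piter :: "(nat \<Rightarrow> nat \<Rightarrow> int) \<Rightarrow> (nat \<Rightarrow> int) \<Rightarrow> nat \<Rightarrow> (nat \<Rightarrow> int) \<Rightarrow> nat \<Rightarrow> nat \<Rightarrow> int" where
  "piter w be q z 0 = z"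
| "piter w be q z (Suc t) = (\<lambda>v. 4 * int P * int H * Sc be q * piter w be q z t v - 2 * int (hv v) * yrec 1 0 (\<lambda>_. 0) w be (piter w be q z t) q v)"

lemma piter_real:
  assumes "wb_ok q w be" "v < n"
  shows "of_int (piter w be q z t v) = power_iter (2 * real H * of_int (Sc be q)) (2 * real P) n (bm w be q) wt (\<lambda>v. of_int (z v)) t v"
  using assms(2)
proof (induction t arbitrary: v)
  case (Suc t)
  have be: "\<And>i. i < q \<Longrightarrow> be i > 0" using assms(1) by (auto simp: wb_ok_def)
  let ?X = "power_iter (2 * real H * of_int (Sc be q)) (2 * real P) n (bm w be q) wt (\<lambda>v. of_int (z v)) t"
  define M where "M = mv n (bm w be q) ?X v"
  have mv: "mv n (bm w be q) (\<lambda>v. of_int (piter w be q z t v)) = mv n (bm w be q) ?X"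
    by (rule mv_cong) (use Suc.IH in auto)
  have "of_int (yrec 1 0 (\<lambda>_. 0) w be (piter w be q z t) q v) = of_int (Sc be q) * M"
    using yrec_real[where q = q and be = be and v = v and G = 1 and \<tau> = 0 and t = "\<lambda>_. 0" and w = w and x = "piter w be q z t", OF be Suc.prems] unfolding mv M_def by simp
  hence "of_int (piter w be q z (Suc t) v) = 4 * real P * real H * of_int (Sc be q) * ?X v - 2 * real (hv v) * (of_int (Sc be q) * M)"
    unfolding piter.simps of_int_diff of_int_mult Suc.IH[OF Suc.prems, symmetric] by simp
  also have "\<dots> = 2 * real H * of_int (Sc be q) * (2 * real P * ?X v - M / wt v)"
  proof -
    have "M / wt v * real H = M * real (hv v)" using H_gt by (simp add: wt_def)
    moreover have "2 * real H * of_int (Sc be q) * (2 * real P * ?X v - M / wt v)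
       = 4 * real P * real H * of_int (Sc be q) * ?X v - 2 * of_int (Sc be q) * (M / wt v * real H)" by (simp add: algebra_simps)
    ultimately show ?thesis by (simp add: mult_ac)
  qed
  finally show ?case unfolding power_iter.simps M_def .
qed simp

text \<open>An eigenvalue below -1 gains per step at least the factor
  \<open>(2 * P + 1) / (2 * P + 1/2) = 1 + 1 / (4 * P + 1)\<close> over one above -1/2. So
  \<open>4 * P + 1\<close> steps double the ratio, and \<open>5 * lg + 2\<close> doublings reach
  \<open>4 * H ^ 5\<close>, enough for \<open>trial_progress\<close> with \<open>M = 2 * H\<close>
  and \<open>K = H ^ 3\<close>.\<close>

definition Nit :: nat where "Nit = (4 * P + 1) * (5 * lg + 2)"

definition thr :: "(nat \<Rightarrow> int) \<Rightarrow> nat \<Rightarrow> nat \<Rightarrow> int" where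
  "thr be q t = int H ^ 3 * ((4 * int P + 1) * int H * Sc be q) ^ t"

lemma thr_real: "2 * real H * of_int (Sc be q) * (2 * real P + 1/2) = of_int ((4 * int P + 1) * int H * Sc be q)"
  by (simp add: algebra_simps)

text \<open>Instance of \<open>accepted_trial\<close> with \<open>K = H ^ 3\<close>; the choice
  \<open>\<eta> = 1 / (16 * c^2 * H)\<close> makes the loss exactly the admissible
  \<open>1 / H\<close>. That \<open>Suc q\<close> is still at most \<open>k\<close> comes from
  \<open>codim_deflate\<close>: a negative vector exists only while functionals are left.\<close>

lemma stage_step:
  assumes inv: "stage_inv k q w be" and k: "k \<le> n" and n: "n > 0"
    and z: "\<And>v. v < n \<Longrightarrow> \<bar>z v\<bar> \<le> 1"
    and x: "\<And>v. v < n \<Longrightarrow> x v = piter w be q z Nit v"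
    and acc: "thr be q Nit \<le> (\<Sum>v<n. \<bar>x v\<bar>)"
    and u: "\<And>v. v < n \<Longrightarrow> u v = x v * int H ^ 3 div (1 + (\<Sum>v<n. \<bar>x v\<bar>))"
    and w': "\<And>v. v < n \<Longrightarrow> w' q v = yrec 1 0 (\<lambda>_. 0) w be u q v" "\<And>i v. i < q \<Longrightarrow> v < n \<Longrightarrow> w' i v = w i v"
    and be': "be' q = - (\<Sum>v<n. u v * w' q v)" "\<And>i. i < q \<Longrightarrow> be' i = be i"
  shows "stage_inv k (Suc q) w' be'" and "\<And>v. v < n \<Longrightarrow> \<bar>u v\<bar> \<le> int H ^ 3"
proof -
  define A where "A = (\<Sum>v<n. \<bar>x v\<bar>)"
  define b where "b = bm w be q"
  define Cq where "Cq = real P + 1 + real q / real H"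
  have wb: "wb_ok q w be" and q: "q \<le> k" using inv by (auto simp: stage_inv_def)
  have bepos: "\<And>i. i < q \<Longrightarrow> be i > 0" using wb by (auto simp: wb_ok_def)
  have S: "Sc be q \<ge> 1" using Sc_pos[of q be] bepos by force
  have A0: "A \<ge> 0" unfolding A_def by (intro sum_nonneg) auto
  have "real (1024 * P\<^sup>2) \<le> real H" using H_gt by (simp only: of_nat_le_iff)
  hence Hr: "real H \<ge> 1024 * (real P)\<^sup>2" "real H > 0" "real n \<le> real H" using H_gt by auto
  have P2: "real P \<ge> 2" using P by simp
  have P4: "(real P)\<^sup>2 \<ge> 4" using power_mono[OF P2, of 2] by simp
  have uabs: "\<bar>of_int (u v) - real H ^ 3 * of_int (x v) / (1 + of_int A)\<bar> \<le> 1" "\<bar>u v\<bar> \<le> int H ^ 3" if v: "v < n" for v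
  proof -
    define a where "a = x v * int H ^ 3"
    have ua: "u v = a div (1 + A)" using u[OF v] unfolding a_def A_def .
    have fl: "u v = \<lfloor>of_int a / of_int (1 + A) :: real\<rfloor>" unfolding ua by (rule floor_divide_of_int_eq[symmetric])
    have "\<bar>of_int (u v) - of_int a / of_int (1 + A)\<bar> \<le> (1::real)" unfolding fl by linarith
    thus "\<bar>of_int (u v) - real H ^ 3 * of_int (x v) / (1 + of_int A)\<bar> \<le> 1" by (simp add: a_def mult.commute)
    have "\<bar>x v\<bar> \<le> A" unfolding A_def using v by (intro member_le_sum[of v _ "\<lambda>v. \<bar>x v\<bar>"]) auto
    hence "\<bar>a\<bar> \<le> (1 + A) * int H ^ 3" unfolding a_def abs_mult by (auto intro: mult_right_mono)
    hence "\<bar>of_int a / of_int (1 + A)\<bar> \<le> (of_int (int H ^ 3) :: real)" using A0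
      by (simp add: abs_divide divide_le_eq mult.commute del: of_int_power of_int_add) (metis of_int_abs of_int_le_iff of_int_mult mult.commute)
    from abs_le_D1[OF this] abs_le_D2[OF this]
    have "- of_int (int H ^ 3) \<le> (of_int a / of_int (1 + A) :: real)" "(of_int a / of_int (1 + A) :: real) \<le> of_int (int H ^ 3)"
      by linarith+
    hence "- (int H ^ 3) \<le> u v" "u v \<le> int H ^ 3" unfolding fl by (simp_all add: le_floor_iff floor_le_iff)
    thus "\<bar>u v\<bar> \<le> int H ^ 3" by simp
  qed
  show u3: "\<And>v. v < n \<Longrightarrow> \<bar>u v\<bar> \<le> int H ^ 3" using uabs(2) .
  define \<kappa> where "\<kappa> = 2 * real H * of_int (Sc be q)"
  define c where "c = 2 * real P"
  define \<eta> where "\<eta> = 1 / (16 * c\<^sup>2 * real H)"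
  have rx: "of_int (x v) = power_iter \<kappa> c n b wt (\<lambda>v. of_int (z v)) Nit v" if "v < n" for v
    unfolding x[OF that] piter_real[OF wb that] \<kappa>_def c_def b_def ..
  have rA: "(\<Sum>v<n. \<bar>power_iter \<kappa> c n b wt (\<lambda>v. of_int (z v)) Nit v\<bar>) = of_int A"
    unfolding A_def of_int_sum by (intro sum.cong refl) (simp add: rx[symmetric])
  have qH: "real q / real H \<le> 1" using q k Hr by simp
  have Cc: "0 \<le> Cq" "Cq \<le> c" using qH P2 unfolding Cq_def c_def by (auto intro: add_nonneg_nonneg)
  have c1: "c \<ge> 1" "c > 0" using P2 by (auto simp: c_def)
  have H3: "1 \<le> real H ^ 3" using H_powers by (simp add: one_le_power)
  note acc' = accepted_trial[of n b wt "4 * real H" c Cq "\<lambda>v. of_int (z v)" \<kappa> "real H ^ 3" Nit "\<lambda>v. of_int (u v)" \<eta>]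
  have c2: "c\<^sup>2 = 4 * (real P)\<^sup>2" by (simp add: c_def power_mult_distrib)
  have f1: "symm n b" unfolding b_def by (rule symm_bm)
  have f2: "wt l \<ge> 1" for l by (rule wt_bounds)
  have f3: "(\<Sum>l<n. wt l) \<le> 4 * real H" by (rule sum_wt)
  have f4: "- c * (\<Sum>l<n. wt l * (y l)\<^sup>2) \<le> qf n b y" for y
  proof -
    have "- c * wn y \<le> - (real (P + 1) * wn y)" using wn_nonneg[of y] P2 unfolding c_def
      by (simp add: mult_right_mono)
    thus ?thesis using qf_bm_lower[OF wb, of y] unfolding b_def wn_def by linarith
  qed
  have f5: "qf n b y \<le> Cq * (\<Sum>l<n. wt l * (y l)\<^sup>2)" for y using inv unfolding stage_inv_def b_def Cq_def wn_def by blast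
  have f6: "\<bar>of_int (z l) :: real\<bar> \<le> 1" if "l < n" for l using z[OF that] by (metis of_int_1 of_int_abs of_int_le_iff)
  have f7: "1 \<le> \<kappa>"
  proof -
    have "1 * 1 \<le> (2 * real H) * of_int (Sc be q)" using S H_powers(1) by (intro mult_mono) auto
    thus ?thesis by (simp add: \<kappa>_def)
  qed
  have f8: "real H ^ 3 * (\<kappa> * (c + 1 / 2)) ^ Nit \<le> (\<Sum>l<n. \<bar>power_iter \<kappa> c n b wt (\<lambda>v. of_int (z v)) Nit l\<bar>)"
  proof -
    have "of_int (thr be q Nit) \<le> (of_int A :: real)" using acc unfolding A_def by (simp only: of_int_le_iff)
    thus ?thesis unfolding rA unfolding thr_def \<kappa>_def c_def thr_real by simp
  qed
  have f9: "\<bar>of_int (u l) - real H ^ 3 * power_iter \<kappa> c n b wt (\<lambda>v. of_int (z v)) Nit l / (1 + (\<Sum>l<n. \<bar>power_iter \<kappa> c n b wt (\<lambda>v. of_int (z v)) Nit l\<bar>))\<bar> \<le> 1" if "l < n" for l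
    using uabs(1)[OF that] unfolding rA rx[OF that] .
  have f10: "\<eta> > 0" unfolding \<eta>_def using c1 Hr by simp
  have f11: "\<eta> \<le> 1 / (8 * c)" unfolding \<eta>_def
  proof (intro divide_left_mono)
    have "8 * c * 1 \<le> 8 * c * (2 * c * real H)" using c1 H_powers by (intro mult_left_mono) (auto intro!: mult_ge1_I)
    thus "8 * c \<le> 16 * c\<^sup>2 * real H" by (simp add: power2_eq_square mult_ac)
  qed (use c1 Hr in auto)
  \<comment> \<open>The left side is \<open>16 * H\<close>. The bracket is at least
    \<open>H ^ 5 / 16\<close>, and \<open>H \<ge> 1024 * P^2\<close> compensates the small factor
    \<open>\<eta>^2\<close>.\<close>
  have f12: "4 * (4 * real H) \<le> \<eta>\<^sup>2 * ((real H ^ 3)\<^sup>2 / real (8 * n) - 4 * real H)"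
  proof -
    define h where "h = real H"
    have h: "h > 0" "h \<ge> 1024 * (real P)\<^sup>2" "h \<ge> 4096" using Hr P4 by (auto simp: h_def)
    have "(h ^ 3)\<^sup>2 / (8 * h) \<le> (h ^ 3)\<^sup>2 / real (8 * n)" using Hr n h by (intro divide_left_mono) (auto simp: h_def)
    moreover have "(h ^ 3)\<^sup>2 / (8 * h) = h ^ 5 / 8" using h by (simp add: field_simps numeral_eq_Suc)
    moreover have "4 * h \<le> h ^ 5 / 16"
    proof -
      have "64 * 1 \<le> h * h ^ 3" using h by (intro mult_mono one_le_power) auto
      hence "64 * h \<le> h * h ^ 3 * h" using h by (intro mult_right_mono) auto
      thus ?thesis by (simp add: numeral_eq_Suc mult_ac)
    qed
    ultimately have 1: "h ^ 5 / 16 \<le> (h ^ 3)\<^sup>2 / real (8 * n) - 4 * h" by linarith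
    have "16 * h \<le> \<eta>\<^sup>2 * (h ^ 5 / 16)"
    proof -
      have ce: "16 * c\<^sup>2 = 64 * (real P)\<^sup>2" unfolding c2 by simp
      have "(16 * c\<^sup>2)\<^sup>2 * 256 = (1024 * (real P)\<^sup>2)\<^sup>2" unfolding ce by (simp add: power_mult_distrib)
      also have "\<dots> \<le> h\<^sup>2" using h(2) by (intro power_mono) auto
      finally have "(16 * c\<^sup>2)\<^sup>2 * 256 * h\<^sup>2 * h \<le> h\<^sup>2 * h\<^sup>2 * h" using h by (intro mult_right_mono) auto
      hence "16 * h * (16 * (16 * c\<^sup>2 * h)\<^sup>2) \<le> h ^ 5" by (simp add: power_mult_distrib numeral_eq_Suc mult_ac)
      thus ?thesis unfolding \<eta>_def h_def[symmetric] using c1 h by (simp add: power_divide field_simps)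
    qed
    also have "\<dots> \<le> \<eta>\<^sup>2 * ((h ^ 3)\<^sup>2 / real (8 * n) - 4 * h)" using 1 by (intro mult_left_mono) auto
    finally show ?thesis unfolding h_def by simp
  qed
  have D: "qf n b (\<lambda>v. of_int (u v)) < 0" "\<And>y. qf n (deflate n b (\<lambda>v. of_int (u v))) y \<le> (Cq + 16 * c\<^sup>2 * \<eta>) * (\<Sum>l<n. wt l * (y l)\<^sup>2)"
    by (rule acc'[OF f1 f2 f3 n c1(1) f4 Cc(1) Cc(2) f5 f6 f7 f8 H3 f9 f10 f11 f12]; assumption)+
  have "16 * c\<^sup>2 * \<eta> = 1 / real H" unfolding \<eta>_def using c1 by simp
  hence up: "qf n (deflate n b (\<lambda>v. of_int (u v))) y \<le> (real P + 1 + real (Suc q) / real H) * wn y" for y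
    using D(2)[of y] unfolding wn_def Cq_def by (simp add: add_divide_distrib algebra_simps)
  have w'r: "of_int (w' q v) = of_int (Sc be q) * mv n b (\<lambda>v. of_int (u v)) v" if "v < n" for v
    unfolding w'(1)[OF that] using yrec_real[where q = q and be = be and v = v and G = 1 and \<tau> = 0 and t = "\<lambda>_. 0" and w = w and x = u, OF bepos that] by (simp add: b_def)
  have be'r: "of_int (be' q) = of_int (Sc be q) * (- qf n b (\<lambda>v. of_int (u v)))"
    unfolding be'(1) qf_def ip_def by (simp add: w'r sum_distrib_left mult_ac sum_negf[symmetric])
  have "0 < of_int (Sc be q) * (- qf n b (\<lambda>v. of_int (u v)))" using S D(1) by (intro mult_pos_pos) auto
  hence be'pos: "be' q > 0" unfolding be'r[symmetric] by simp
  have bm': "bm w' be' (Suc q) r v = deflate n b (\<lambda>v. of_int (u v)) r v" if "r < n" "v < n" for r v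
  proof -
    have "bm w' be' q r v = b r v" unfolding b_def by (rule bm_cong) (use w'(2) be'(2) that in auto)
    moreover have "Sc be' (Suc q) = Sc be q * be' q" unfolding Sc_def using be'(2) by simp
    moreover have "of_int (Sc be q) \<noteq> (0::real)" using S by simp
    ultimately show ?thesis using that by (simp add: deflate_def w'r be'r field_simps)
  qed
  have mv': "mv n (bm w' be' (Suc q)) y r = mv n (deflate n b (\<lambda>v. of_int (u v))) y r" if "r < n" for y r
    unfolding mv_def using bm' that by (intro sum.cong refl) (auto simp del: bm.simps)
  have qf': "qf n (bm w' be' (Suc q)) y = qf n (deflate n b (\<lambda>v. of_int (u v))) y" for y
    unfolding qf_def by (intro ip_cong refl) (simp add: mv' del: bm.simps)
  have "codim_nonneg n b (k - q)" using inv by (simp add: stage_inv_def b_def)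
  then obtain r' where r': "k - q = Suc r'" "codim_nonneg n (deflate n b (\<lambda>v. of_int (u v))) r'"
    using codim_deflate[OF _ _ D(1)] symm_bm unfolding b_def by blast
  have w'b: "\<bar>w' q v\<bar> \<le> U q * int H ^ 3" if "v < n" for v
    unfolding w'(1)[OF that] using u3 that by (intro yrec_bound[OF wb]) auto
  have U7: "int H ^ 7 \<le> U q" by (rule U_ge)
  have H37: "int H ^ 3 \<le> int H ^ 7" using H_powers by (intro power_increasing) auto
  have "w' q v \<le> U q ^ 2 \<and> - w' q v \<le> U q ^ 2" if "v < n" for v
  proof -
    have "U q * int H ^ 3 \<le> U q * U q" using U7 H37 U_ge(2)[of q] by (intro mult_left_mono) auto
    thus ?thesis using w'b[OF that] by (auto simp: power2_eq_square)
  qed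
  moreover have "be' q \<le> U q ^ 2"
  proof -
    have "be' q \<le> \<bar>\<Sum>v<n. u v * w' q v\<bar>" unfolding be'(1) by simp
    also have "\<dots> \<le> (\<Sum>v<n. int H ^ 3 * (U q * int H ^ 3))"
      by (rule order_trans[OF sum_abs], intro sum_mono, unfold abs_mult, intro mult_mono) (use u3 w'b in auto)
    also have "\<dots> = int n * (int H ^ 6 * U q)" by (simp add: numeral_eq_Suc mult_ac)
    also have "\<dots> \<le> int H * (int H ^ 6 * U q)" using H_powers U_ge(2)[of q] by (intro mult_right_mono) auto
    also have "\<dots> = int H ^ 7 * U q" by (simp add: numeral_eq_Suc mult_ac)
    also have "\<dots> \<le> U q * U q" using U7 U_ge(2)[of q] by (intro mult_right_mono) auto
    finally show ?thesis by (simp add: power2_eq_square)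
  qed
  ultimately have "wb_ok (Suc q) w' be'" using wb be'pos w'(2) be'(2) unfolding wb_ok_def
    by (auto simp: less_Suc_eq abs_le_iff)
  moreover have "codim_nonneg n (bm w' be' (Suc q)) (k - Suc q)"
  proof -
    have "k - Suc q = r'" using r' by simp
    thus ?thesis using r'(2) unfolding codim_nonneg_def qf' by simp
  qed
  moreover have "\<forall>i<Suc q. \<forall>v<n. deg v = 0 \<longrightarrow> w' i v = 0"
    using inv w' yrec_isolated[of _ q w] unfolding stage_inv_def by (auto simp: less_Suc_eq)
  ultimately show "stage_inv k (Suc q) w' be'" unfolding stage_inv_def qf' using up r' by auto
qed

lemma growth_factor: "2 * real n * (2 * real H) * real H ^ 3 * (2 * real P + 1/2) ^ Nit \<le> (2 * real P + 1) ^ Nit"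
proof -
  define M where "M = 4 * P + 1"
  define l where "l = 5 * lg + 2"
  have "1 + real M * (1 / real M) \<le> (1 + 1 / real M) ^ M"
    by (rule Bernoulli_inequality) (rule order_trans[of _ 0], auto)
  hence "2 \<le> (1 + 1 / real M) ^ M" by (simp add: M_def)
  hence "2 ^ l \<le> ((1 + 1 / real M) ^ M) ^ l" by (rule power_mono) auto
  also have "\<dots> = (1 + 1 / real M) ^ Nit" unfolding power_mult[symmetric] by (simp add: Nit_def M_def l_def)
  finally have 1: "2 ^ l \<le> (1 + 1 / real M) ^ Nit" .
  have "2 * real n * (2 * real H) * real H ^ 3 \<le> 2 * real H * (2 * real H) * real H ^ 3"
    using H_gt by (intro mult_right_mono) auto
  also have "\<dots> = 4 * real H ^ 5" by (simp add: numeral_eq_Suc)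
  also have "\<dots> = 2 ^ l" unfolding H(2) l_def by (simp add: power_add power_mult[symmetric] mult.commute)
  finally have 2: "2 * real n * (2 * real H) * real H ^ 3 \<le> (1 + 1 / real M) ^ Nit" using 1 by simp
  have "2 * real n * (2 * real H) * real H ^ 3 * (2 * real P + 1/2) ^ Nit \<le> (1 + 1 / real M) ^ Nit * (2 * real P + 1/2) ^ Nit"
    using 2 by (intro mult_right_mono) auto
  also have "\<dots> = ((1 + 1 / real M) * (2 * real P + 1/2)) ^ Nit" by (simp add: power_mult_distrib)
  also have "(1 + 1 / real M) * (2 * real P + 1/2) = 2 * real P + 1" by (simp add: M_def field_simps)
  finally show ?thesis .
qed

text \<open>Integer form of \<open>trial_progress\<close>. Changing the bit at \<open>j\<close>
  moves the linear form by at least \<open>1 / n\<close>, twice the distance from 0 that guarantees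
  acceptance.\<close>

lemma stage_progress:
  assumes wb: "wb_ok q w be" and n: "n > 0" and neg: "\<not> (\<forall>y. - wn y \<le> qf n (bm w be q) y)"
  shows "\<exists>a j. j < n \<and> \<bar>a j\<bar> \<ge> 1 / real n \<and> (\<forall>z :: nat \<Rightarrow> int. \<bar>\<Sum>v<n. a v * of_int (z v)\<bar> \<ge> 1 / (2 * real n) \<longrightarrow>
     thr be q Nit \<le> (\<Sum>v<n. \<bar>piter w be q z Nit v\<bar>))"
proof -
  obtain y where y: "qf n (bm w be q) y < - wn y" using neg by (auto simp: not_le)
  have bepos: "\<And>i. i < q \<Longrightarrow> be i > 0" using wb by (auto simp: wb_ok_def)
  have S: "Sc be q \<ge> 1" using Sc_pos[of q be] bepos by force
  define \<kappa> where "\<kappa> = 2 * real H * of_int (Sc be q)"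
  have \<kappa>: "1 \<le> \<kappa>"
  proof -
    have "1 * 1 \<le> (2 * real H) * of_int (Sc be q)" using S H_powers(1) by (intro mult_mono) auto
    thus ?thesis by (simp add: \<kappa>_def)
  qed
  have w: "1 \<le> wt l \<and> wt l \<le> 2 * real H" for l using wt_bounds by auto
  have c: "1 \<le> 2 * real P" and h: "1 \<le> 2 * real H" and K: "0 \<le> real H ^ 3" using P H_gt by auto
  obtain a j where aj: "j < n" "1 / real n \<le> \<bar>a j\<bar>"
    and pr: "\<And>z. 1 / real (2 * n) \<le> \<bar>\<Sum>l<n. a l * z l\<bar> \<Longrightarrow>
      real H ^ 3 * (\<kappa> * (2 * real P + 1 / 2)) ^ Nit \<le> (\<Sum>l<n. \<bar>power_iter \<kappa> (2 * real P) n (bm w be q) wt z Nit l\<bar>)"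
    using trial_progress[where n = n and b = "bm w be q" and d = wt and M = "2 * real H" and c = "2 * real P" and \<kappa> = \<kappa>
      and y = y and N = Nit and K = "real H ^ 3", OF symm_bm w n c \<kappa> h y[unfolded wn_def] growth_factor K] by auto
  have "thr be q Nit \<le> (\<Sum>v<n. \<bar>piter w be q z Nit v\<bar>)"
    if z: "1 / (2 * real n) \<le> \<bar>\<Sum>v<n. a v * of_int (z v)\<bar>" for z :: "nat \<Rightarrow> int"
  proof -
    have "(of_int (thr be q Nit) :: real) \<le> (\<Sum>l<n. \<bar>power_iter \<kappa> (2 * real P) n (bm w be q) wt (\<lambda>v. of_int (z v)) Nit l\<bar>)"
      using pr[of "\<lambda>v. of_int (z v)"] z unfolding thr_def \<kappa>_def thr_real by simp
    also have "\<dots> = of_int (\<Sum>v<n. \<bar>piter w be q z Nit v\<bar>)"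
      unfolding of_int_sum by (intro sum.cong refl) (simp add: piter_real[OF wb] \<kappa>_def)
    finally show ?thesis by (simp only: of_int_le_iff)
  qed
  thus ?thesis using aj by blast
qed

text \<open>Chosen such that \<open>2 * C * sqrt Tt \<le> Tt\<close> for curvature
  \<open>C \<le> 2 * P\<close>.\<close>

definition Tt :: nat where "Tt = 16 * P\<^sup>2"

text \<open>A minimizer of \<open>s * y\<close> over \<open>s\<close> in [-1, 1]. The value 0 at
  \<open>y = 0\<close> keeps isolated vertices at 0.\<close>

definition neg_sgn :: "int \<Rightarrow> int" where
  "neg_sgn y = (if y < 0 then 1 else 0) - (if 0 < y then 1 else 0)"

text \<open>The unnormalized iterate, that is \<open>i\<close> times the Frank--Wolfe average. Its
  gradient is scaled accordingly, and \<open>max 1 i\<close> keeps the guessed linear term in the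
  first step, where the sum is 0.\<close>

fun fwX :: "(nat \<Rightarrow> int) \<Rightarrow> (nat \<Rightarrow> nat \<Rightarrow> int) \<Rightarrow> (nat \<Rightarrow> int) \<Rightarrow> nat \<Rightarrow> nat \<Rightarrow> nat \<Rightarrow> int" where
  "fwX t w be q 0 = (\<lambda>_. 0)"
| "fwX t w be q (Suc i) = (\<lambda>v. fwX t w be q i v + neg_sgn (yrec (int H) (int (max 1 i)) t w be (fwX t w be q i) q v))"

lemma fwX_bound: "\<bar>fwX t w be q i v\<bar> \<le> int i"
  by (induction i) (auto simp: neg_sgn_def)

text \<open>By completing squares (\<open>comp\<close>) the objective is the original form plus the
  weighted squared errors of the guess, up to a constant. These errors are nonnegative at the
  computed point and at most \<open>m\<close> at \<open>y\<close>. Adding \<open>32 * m\<close> from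
  Frank--Wolfe and at most \<open>2 * m\<close> from the diagonal of the form, and dividing by
  \<open>2 * P\<close>, stays below \<open>18 * m / P\<close>.\<close>

lemma frank_wolfe_int:
  assumes inv: "stage_inv k q w be" and k: "k \<le> n"
    and succ: "\<And>y. - wn y \<le> qf n (bm w be q) y"
    and y: "\<And>v. v < n \<Longrightarrow> \<bar>y v\<bar> \<le> 1" "\<And>v. v < n \<Longrightarrow> deg v = 0 \<Longrightarrow> y v = 0"
    and err: "(\<Sum>i<q. (ip n (\<lambda>v. of_int (w i v)) y - of_int (t i) / real H)\<^sup>2 / of_int (Sc be (Suc i))) \<le> real m"
  shows "(\<Sum>j<m. of_int (fwX t w be q Tt (us j) * fwX t w be q Tt (vs j))) / (real Tt)\<^sup>2 \<le> (\<Sum>j<m. y (us j) * y (vs j)) + 18 * real m / real P"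
proof -
  have wb: "wb_ok q w be" and q: "q \<le> k" using inv by (auto simp: stage_inv_def)
  have bepos: "\<And>i. i < q \<Longrightarrow> be i > 0" using wb by (auto simp: wb_ok_def)
  have Spos: "Sc be i > 0" if "i \<le> q" for i using Sc_pos[of i be] bepos that by force
  define b where "b = bm w be q"
  define Cq where "Cq = real P + 1 + real q / real H"
  have "real q / real H \<le> 1" using q k H_gt by simp
  hence Cq: "0 \<le> Cq" "Cq \<le> 2 * real P" using P unfolding Cq_def by (auto intro: add_nonneg_nonneg)
  define r where "r i = of_int (t i) / real H" for i
  define g where "g v = (\<Sum>i<q. r i * of_int (w i v) / of_int (Sc be (Suc i)))" for v
  define X where "X = fwX t w be q"
  define x where "x i v = of_int (X i v) / real (max 1 i)" for i v
  define s where "s i v = (of_int (neg_sgn (yrec (int H) (int (max 1 i)) t w be (X i) q v)) :: real)" for i v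
  have ipg: "ip n g z = (\<Sum>i<q. r i * ip n (\<lambda>v. of_int (w i v)) z / of_int (Sc be (Suc i)))" for z
    unfolding ip_def g_def sum_distrib_right sum_distrib_left sum_divide_distrib
    by (subst sum.swap) (simp add: mult_ac)
  have comp: "qf n b z - 2 * ip n g z + (\<Sum>i<q. (r i)\<^sup>2 / of_int (Sc be (Suc i)))
     = qf n b0 z + (\<Sum>i<q. (ip n (\<lambda>v. of_int (w i v)) z - r i)\<^sup>2 / of_int (Sc be (Suc i)))" for z
    unfolding b_def qf_bm ipg sum_distrib_left
    by (simp add: power2_diff sum.distrib sum_subtractf add_divide_distrib diff_divide_distrib mult_ac)
  have yr: "of_int (yrec (int H) (int (max 1 i)) t w be (X i) q v) = of_int (Sc be q) * real H * real (max 1 i) * (mv n b (x i) v - g v)"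
    if v: "v < n" for i v
  proof -
    have H0: "real H > 0" using H_gt by simp
    have 1: "mv n b (\<lambda>v. of_int (X i v)) v = real (max 1 i) * mv n b (x i) v"
      using mv_scale[of n b "real (max 1 i)" "x i" v] unfolding x_def by simp
    have 2: "(\<Sum>i<q. of_int (t i) * of_int (w i v) / of_int (Sc be (Suc i))) = real H * g v"
      unfolding g_def r_def sum_distrib_left using H0 by (intro sum.cong refl) simp
    have 3: "of_int (yrec (int H) (int (max 1 i)) t w be (X i) q v) = of_int (Sc be q) * (real H * mv n b (\<lambda>v. of_int (X i v)) v
       - real (max 1 i) * (\<Sum>i<q. of_int (t i) * of_int (w i v) / of_int (Sc be (Suc i))))"
      using yrec_real[where q = q and be = be and v = v and G = "int H" and \<tau> = "int (max 1 i)" and t = t and w = w and x = "X i", OF bepos v]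
      by (simp add: b_def)
    show ?thesis unfolding 3 1 2 by (simp add: algebra_simps)
  qed
  have FRANK_WOLFE: "qf n b (x Tt) - 2 * ip n g (x Tt) \<le> qf n b y - 2 * ip n g y + 8 * (4 * real m)"
  proof (rule frank_wolfe[where d = wt and C = Cq and V = "{v. deg v > 0}" and s = s])
    show "symm n b" unfolding b_def by (rule symm_bm)
    show "0 \<le> wt l" for l using wt_bounds(2)[of l] by linarith
    show "- (\<Sum>l<n. wt l * (y l)\<^sup>2) \<le> qf n b y" for y using succ[of y] by (simp add: wn_def b_def)
    show "qf n b y \<le> Cq * (\<Sum>l<n. wt l * (y l)\<^sup>2)" for y using inv unfolding stage_inv_def b_def Cq_def wn_def by blast
    show "(\<Sum>l | l < n \<and> l \<in> {v. deg v > 0}. wt l) \<le> 4 * real m" using sum_wt(2) by simp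
    show "x 0 l = 0" for l by (simp add: x_def X_def)
    show "x (Suc i) l = x i l + (s i l - x i l) / real (Suc i)" for i l
    proof -
      have "real i * x i l = of_int (X i l)" by (cases i) (auto simp: x_def X_def)
      moreover have "real (Suc i) * x (Suc i) l = of_int (X i l) + s i l"
        by (simp add: x_def s_def X_def)
      ultimately have "real (Suc i) * x (Suc i) l = real (Suc i) * (x i l + (s i l - x i l) / real (Suc i))"
        by (simp add: field_simps)
      thus ?thesis by (metis mult_left_cancel of_nat_0_eq_iff nat.distinct(1))
    qed
    show "\<bar>s i l\<bar> \<le> 1" for i l unfolding s_def neg_sgn_def by simp
    show "s i l = 0" if "l < n" "l \<notin> {v. deg v > 0}" for i l
    proof -
      have "yrec (int H) (int (max 1 i)) t w be (X i) q l = 0"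
        using inv that by (intro yrec_isolated) (auto simp: stage_inv_def)
      thus ?thesis by (simp add: s_def neg_sgn_def)
    qed
    show "(mv n b (x i) l - g l) * s i l = - \<bar>mv n b (x i) l - g l\<bar>" if "l < n" for i l
    proof -
      define K where "K = of_int (Sc be q) * real H * real (max 1 i)"
      have K: "K > 0" unfolding K_def using Spos[of q] H_gt by (intro mult_pos_pos) auto
      have eq: "of_int (yrec (int H) (int (max 1 i)) t w be (X i) q l) = K * (mv n b (x i) l - g l)"
        unfolding yr[OF that] K_def ..
      have "yrec (int H) (int (max 1 i)) t w be (X i) q l < 0 \<longleftrightarrow> mv n b (x i) l - g l < 0"
        "0 < yrec (int H) (int (max 1 i)) t w be (X i) q l \<longleftrightarrow> 0 < mv n b (x i) l - g l"
        using K unfolding of_int_less_0_iff[where 'a = real, symmetric] of_int_0_less_iff[where 'a = real, symmetric] eq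
        by (auto simp: mult_less_0_iff zero_less_mult_iff)
      thus ?thesis unfolding s_def neg_sgn_def by auto
    qed
    show "2 * Cq * sqrt (real Tt) \<le> real Tt"
    proof -
      have "sqrt (real Tt) = 4 * real P" unfolding Tt_def by (simp add: real_sqrt_mult)
      moreover have "2 * Cq * (4 * real P) \<le> 2 * (2 * real P) * (4 * real P)" using Cq by (intro mult_right_mono mult_left_mono) auto
      ultimately show ?thesis by (simp add: Tt_def power2_eq_square)
    qed
    show "Tt > 0" using P by (simp add: Tt_def)
  qed (use y Cq in auto)
  have "2 * real P * (\<Sum>j<m. x Tt (us j) * x Tt (vs j)) \<le> qf n b0 (x Tt)"
    unfolding qf_b0 sum_distrib_left by (intro sum_mono) simp
  also have "\<dots> \<le> qf n b0 (x Tt) + (\<Sum>i<q. (ip n (\<lambda>v. of_int (w i v)) (x Tt) - r i)\<^sup>2 / of_int (Sc be (Suc i)))"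
    using Spos by (simp, intro sum_nonneg divide_nonneg_nonneg) (auto simp: less_imp_le Suc_leI)
  also have "\<dots> \<le> qf n b0 y + (\<Sum>i<q. (ip n (\<lambda>v. of_int (w i v)) y - r i)\<^sup>2 / of_int (Sc be (Suc i))) + 32 * real m"
    using FRANK_WOLFE unfolding comp[symmetric] by simp
  also have "\<dots> \<le> qf n b0 y + 33 * real m" using err by (simp add: r_def)
  also have "qf n b0 y \<le> (\<Sum>j<m. 2 + 2 * real P * (y (us j) * y (vs j)))"
    unfolding qf_b0
  proof (intro sum_mono)
    fix j assume "j \<in> {..<m}"
    hence "(y (us j))\<^sup>2 \<le> 1" "(y (vs j))\<^sup>2 \<le> 1" using edges y by (auto simp: abs_square_le_1)
    thus "(y (us j))\<^sup>2 + (y (vs j))\<^sup>2 + 2 * real P * (y (us j) * y (vs j)) \<le> 2 + 2 * real P * (y (us j) * y (vs j))" by simp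
  qed
  also have "\<dots> = 2 * real m + 2 * real P * (\<Sum>j<m. y (us j) * y (vs j))" by (simp add: sum.distrib sum_distrib_left)
  finally have "2 * real P * (\<Sum>j<m. x Tt (us j) * x Tt (vs j)) \<le> 2 * real P * (\<Sum>j<m. y (us j) * y (vs j)) + 36 * real m" by simp
  hence "2 * real P * (\<Sum>j<m. x Tt (us j) * x Tt (vs j)) \<le> 2 * real P * ((\<Sum>j<m. y (us j) * y (vs j)) + 18 * real m / real P)"
    using P by (simp add: distrib_left)
  hence "(\<Sum>j<m. x Tt (us j) * x Tt (vs j)) \<le> (\<Sum>j<m. y (us j) * y (vs j)) + 18 * real m / real P" using P by simp
  moreover have "max 1 Tt = Tt" using P by (simp add: Tt_def)
  ultimately show ?thesis unfolding x_def X_def by (simp add: sum_divide_distrib power2_eq_square)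
qed

end

section \<open>Coding of digit sequences by single numbers\<close>

function ones :: "nat \<Rightarrow> nat" where
  "ones e = (if odd e then Suc (ones (e div 2)) else 0)"
  by auto
termination by (relation "Wellfounded.measure id") (auto elim: oddE)

text \<open>\<open>ones\<close> reads a unary block at the low end of the binary expansion;
  \<open>rest\<close> is what remains behind the zero that ends this block.\<close>

function rest :: "nat \<Rightarrow> nat" where
  "rest e = (if odd e then rest (e div 2) else e div 2)"
  by auto
termination by (relation "Wellfounded.measure id") (auto elim: oddE)

declare ones.simps [simp del] rest.simps [simp del]

text \<open>The code \<open>e\<close> lists the digits \<open>c\<^sub>0, c\<^sub>1, \<dots>\<close>, each as \<open>c\<^sub>i mod R\<close> in base \<open>R\<close> followed by \<open>c\<^sub>i div R\<close> in
  unary. The number of guesses thus depends only on \<open>q\<close> and the sum of the digits, whereas a single digit may be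
  large.\<close>

fun dstate :: "nat \<Rightarrow> nat \<Rightarrow> nat \<Rightarrow> nat" where
  "dstate R e 0 = e"
| "dstate R e (Suc i) = rest (dstate R e i div R)"

definition dcode :: "nat \<Rightarrow> nat \<Rightarrow> nat \<Rightarrow> nat" where
  "dcode R e i = dstate R e i mod R + R * ones (dstate R e i div R)"

lemma ones_rest: "ones (2 ^ a - 1 + 2 ^ Suc a * e) = a" "rest (2 ^ a - 1 + 2 ^ Suc a * e) = e"
proof (induction a)
  case 0
  { case 1 show ?case by (simp add: ones.simps) next case 2 show ?case by (simp add: rest.simps) }
next
  case (Suc a)
  obtain p where p: "(2::nat) ^ a = Suc p" by (metis not0_implies_Suc power_not_zero zero_neq_numeral)
  have eq: "2 ^ Suc a - 1 + 2 ^ Suc (Suc a) * e = 2 * (2 ^ a - 1 + 2 ^ Suc a * e) + 1"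
    unfolding power_Suc p by simp
  { case 1 show ?case unfolding eq by (subst ones.simps) (use Suc(1) in simp)
  next case 2 show ?case unfolding eq by (subst rest.simps) (use Suc(2) in simp) }
qed

lemma dstate_shift: "dstate R e (Suc i) = dstate R (rest (e div R)) i"
  by (induction i) auto

text \<open>The code is built from the last digit backwards. A digit \<open>c\<close> multiplies the
  bound by \<open>R\<close> for its remainder and by \<open>2 ^ (1 + c div R)\<close> for its unary
  block, terminator included.\<close>

lemma dcode_exists:
  assumes "R > 0"
  shows "\<exists>e. (\<forall>i<q. dcode R e i = c i) \<and> e + 1 \<le> R ^ q * 2 ^ (q + (\<Sum>i<q. c i div R))"
proof (induction q arbitrary: c)
  case (Suc q)
  obtain e where e: "\<forall>i<q. dcode R e i = c (Suc i)" "e + 1 \<le> R ^ q * 2 ^ (q + (\<Sum>i<q. c (Suc i) div R))"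
    using Suc[of "\<lambda>i. c (Suc i)"] by blast
  define a where "a = c 0 div R"
  define f where "f = 2 ^ a - 1 + 2 ^ Suc a * e"
  define e' where "e' = c 0 mod R + R * f"
  have d: "e' div R = f" "e' mod R = c 0 mod R" using assms by (auto simp: e'_def)
  have o: "ones f = a" "rest f = e" unfolding f_def by (rule ones_rest)+
  have "dcode R e' i = c i" if "i < Suc q" for i
  proof (cases i)
    case 0
    thus ?thesis unfolding dcode_def using d o by (simp add: a_def)
  next
    case (Suc i')
    thus ?thesis using e(1) that unfolding dcode_def by (simp only: dstate_shift d o)
  qed
  moreover have "e' + 1 \<le> R ^ Suc q * 2 ^ (Suc q + (\<Sum>i<Suc q. c i div R))"
  proof -
    have "c 0 mod R < R" using assms by simp
    hence "e' + 1 \<le> R * (1 + f)" unfolding e'_def by simp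
    also have "1 + f = 2 ^ a * (1 + 2 * e)" unfolding f_def by (simp add: algebra_simps)
    also have "R * (2 ^ a * (1 + 2 * e)) \<le> R * (2 ^ a * (2 * (e + 1)))" by (intro mult_left_mono) auto
    also have "\<dots> \<le> R * (2 ^ a * (2 * (R ^ q * 2 ^ (q + (\<Sum>i<q. c (Suc i) div R)))))"
      using e(2) by (intro mult_left_mono) auto
    also have "\<dots> = R ^ Suc q * 2 ^ (Suc q + (\<Sum>i<Suc q. c i div R))"
      unfolding sum.lessThan_Suc_shift a_def[symmetric] by (simp add: power_add mult_ac)
    finally show ?thesis .
  qed
  ultimately show ?case by blast
qed simp

text \<open>The least significant bit of a digit is the sign.\<close>

definition dval :: "nat \<Rightarrow> int" where
  "dval c = int (c div 2) * (1 - 2 * int (c mod 2))"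

lemma dval_surj: "\<exists>c. dval c = j \<and> int c \<le> 2 * \<bar>j\<bar> + 1"
proof (cases "j \<ge> 0")
  case True
  thus ?thesis by (intro exI[of _ "2 * nat j"]) (simp add: dval_def)
next
  case False
  have "(2 * nat (- j) + 1) div 2 = nat (- j)" "(2 * nat (- j) + 1) mod 2 = 1" by simp_all
  thus ?thesis using False by (intro exI[of _ "2 * nat (- j) + 1"]) (simp add: dval_def)
qed

context graph_instance
begin

text \<open>With this step, rounding all of the \<open>q\<close> products \<open>\<langle>w\<^sub>i, x\<rangle>\<close> to the grid changes the sum of their
  weighted squares by at most the number of edges.\<close>

definition grid_step :: "int \<Rightarrow> nat \<Rightarrow> int" where
  "grid_step S q = 2 ^ (LEAST a. S * int m * int H ^ 2 < 4 * (2 ^ a)\<^sup>2 * int q)"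

text \<open>The \<open>q\<close> digits of a good guess add up to at most
  \<open>q * (128 * P + 197)\<close>, which is below \<open>q * digit_base\<close> as
  \<open>P \<ge> 2\<close>.\<close>

definition digit_base :: nat where "digit_base = 256 * P"

definition guess :: "(nat \<Rightarrow> int) \<Rightarrow> nat \<Rightarrow> nat \<Rightarrow> nat \<Rightarrow> int" where
  "guess be q e i = grid_step (Sc be (Suc i)) q * dval (dcode digit_base e i)"

lemma grid_step_exists:
  assumes "q > 0"
  shows "\<exists>a. S * int m * int H ^ 2 < 4 * (2 ^ a)\<^sup>2 * int q"
proof -
  define B where "B = S * int m * int H ^ 2"
  obtain a where a: "nat \<bar>B\<bar> < 2 ^ a" using less_exp by blast
  have "B \<le> int (nat \<bar>B\<bar>)" by simp
  also have "\<dots> < int (2 ^ a)" using a by (simp only: of_nat_less_iff)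
  also have "\<dots> \<le> 4 * (2 ^ a)\<^sup>2 * int q"
  proof -
    have "(1::int) * 2 ^ a * 1 \<le> 4 * (2 ^ a) * 2 ^ a" by (intro mult_mono) auto
    also have "\<dots> \<le> 4 * (2 ^ a) * 2 ^ a * int q" using assms by (simp add: mult_le_cancel_left1)
    finally show ?thesis by (simp add: power2_eq_square)
  qed
  finally show ?thesis unfolding B_def by blast
qed

text \<open>One estimate is the defining condition; the other is its failure at the previous power
  of two or, for exponent 0, the hypothesis on \<open>q\<close>.\<close>

lemma grid_step_bounds:
  assumes "q > 0" "int q \<le> S * int m * int H ^ 2"
  shows "grid_step S q \<ge> 1" "S * int m * int H ^ 2 < 4 * (grid_step S q)\<^sup>2 * int q" "(grid_step S q)\<^sup>2 * int q \<le> S * int m * int H ^ 2"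
proof -
  define Q where "Q a \<longleftrightarrow> S * int m * int H ^ 2 < 4 * (2 ^ a)\<^sup>2 * int q" for a :: nat
  obtain a0 where "Q a0" using grid_step_exists[OF assms(1)] unfolding Q_def by blast
  hence L: "Q (LEAST a. Q a)" by (rule LeastI)
  show "grid_step S q \<ge> 1" by (simp add: grid_step_def)
  show "S * int m * int H ^ 2 < 4 * (grid_step S q)\<^sup>2 * int q" using L unfolding grid_step_def Q_def .
  show "(grid_step S q)\<^sup>2 * int q \<le> S * int m * int H ^ 2"
  proof (cases "LEAST a. Q a")
    case 0
    thus ?thesis using assms unfolding grid_step_def Q_def by simp
  next
    case (Suc a)
    hence "\<not> Q a" by (intro not_less_Least) simp
    thus ?thesis using Suc unfolding grid_step_def Q_def[symmetric] unfolding Q_def by (simp add: power2_eq_square)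
  qed
qed

text \<open>The weighted squares of the products sum to the difference of the forms after and before
  the updates, hence to O(P m). Measured in grid steps their squares sum to O(P q), so the digits
  sum to at most \<open>q * digit_base\<close>. The unary blocks then take at most
  \<open>2 * q\<close> bits, which gives the factor 4 in
  \<open>1024 * P = 4 * digit_base\<close>.\<close>

lemma good_guess:
  assumes inv: "stage_inv k q w be" and k: "k \<le> n" and m: "m > 0"
    and y: "\<And>v. v < n \<Longrightarrow> \<bar>y v\<bar> \<le> 1" "\<And>v. v < n \<Longrightarrow> deg v = 0 \<Longrightarrow> y v = 0"
  shows "\<exists>e < (1024 * P) ^ q. (\<Sum>i<q. (ip n (\<lambda>v. of_int (w i v)) (\<lambda>v. of_int (y v :: int)) - of_int (guess be q e i) / real H)\<^sup>2 / of_int (Sc be (Suc i))) \<le> real m"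
proof (cases "q = 0")
  case False
  hence q: "q > 0" by simp
  have wb: "wb_ok q w be" and qk: "q \<le> k" using inv by (auto simp: stage_inv_def)
  have bepos: "\<And>i. i < q \<Longrightarrow> be i > 0" using wb by (auto simp: wb_ok_def)
  have Spos: "Sc be (Suc i) > 0" if "i < q" for i using Sc_pos[of "Suc i" be] bepos that by force
  define S where "S i = Sc be (Suc i)" for i
  define D where "D i = grid_step (S i) q" for i
  define a where "a i = (\<Sum>v<n. w i v * y v)" for i
  define \<alpha> where "\<alpha> i = (of_int (a i) :: real)" for i
  have ipa: "ip n (\<lambda>v. of_int (w i v)) (\<lambda>v. of_int (y v)) = \<alpha> i" for i unfolding ip_def a_def \<alpha>_def by simp
  have D: "D i \<ge> 1" "S i * int m * int H ^ 2 < 4 * (D i)\<^sup>2 * int q" "(D i)\<^sup>2 * int q \<le> S i * int m * int H ^ 2" if "i < q" for i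
  proof -
    have "int q \<le> int H" using qk k H_gt by simp
    also have "int H \<le> int H ^ 2" using H_gt by (simp add: power2_eq_square)
    also have "1 * int H ^ 2 \<le> (S i * int m) * int H ^ 2"
    proof (intro mult_right_mono)
      have "1 * 1 \<le> S i * int m" using Spos[OF that] m unfolding S_def by (intro mult_mono) auto
      thus "1 \<le> S i * int m" by simp
    qed auto
    finally have "int q \<le> S i * int m * int H ^ 2" by simp
    from grid_step_bounds[OF q this] show "D i \<ge> 1" "S i * int m * int H ^ 2 < 4 * (D i)\<^sup>2 * int q" "(D i)\<^sup>2 * int q \<le> S i * int m * int H ^ 2"
      unfolding D_def by auto
  qed
  define j where "j i = a i * int H div D i" for i
  have "\<exists>c. dval c = j i \<and> int c \<le> 2 * \<bar>j i\<bar> + 1" for i by (rule dval_surj)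
  then obtain c where c: "\<And>i. dval (c i) = j i" "\<And>i. int (c i) \<le> 2 * \<bar>j i\<bar> + 1" by metis
  have R: "digit_base > 0" using P by (simp add: digit_base_def)
  obtain e where e: "\<forall>i<q. dcode digit_base e i = c i" "e + 1 \<le> digit_base ^ q * 2 ^ (q + (\<Sum>i<q. c i div digit_base))"
    using dcode_exists[OF R, of q c] by blast
  have Hr: "real H > 0" and mr: "real m > 0" and qr: "real q > 0" using H_gt m q by auto
  have Sr: "of_int (S i) > (0::real)" if "i < q" for i using Spos[OF that] by (simp add: S_def)
  have Dr: "of_int (D i) \<ge> (1::real)" "of_int (S i) * real m * real H ^ 2 \<le> 4 * (of_int (D i))\<^sup>2 * real q"
    "(of_int (D i))\<^sup>2 * real q \<le> of_int (S i) * real m * real H ^ 2" if "i < q" for i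
  proof -
    show "of_int (D i) \<ge> (1::real)" using D(1)[OF that] by simp
    have "(of_int (S i * int m * int H ^ 2) :: real) \<le> of_int (4 * (D i)\<^sup>2 * int q)" using D(2)[OF that] by (simp only: of_int_le_iff)
    thus "of_int (S i) * real m * real H ^ 2 \<le> 4 * (of_int (D i))\<^sup>2 * real q" by simp
    have "(of_int ((D i)\<^sup>2 * int q) :: real) \<le> of_int (S i * int m * int H ^ 2)" using D(3)[OF that] by (simp only: of_int_le_iff)
    thus "(of_int (D i))\<^sup>2 * real q \<le> of_int (S i) * real m * real H ^ 2" by simp
  qed
  define \<rho> where "\<rho> i = \<alpha> i * real H / of_int (D i)" for i
  have fl: "of_int (j i) \<le> \<rho> i" "\<rho> i < of_int (j i) + 1" if "i < q" for i
  proof -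
    have "j i = \<lfloor>\<rho> i\<rfloor>" unfolding j_def \<rho>_def \<alpha>_def floor_divide_of_int_eq[symmetric, where 'a = real] by simp
    thus "of_int (j i) \<le> \<rho> i" "\<rho> i < of_int (j i) + 1" by linarith+
  qed
  have wny: "wn (\<lambda>v. of_int (y v)) \<le> 4 * real m"
  proof -
    have "wn (\<lambda>v. of_int (y v)) = (\<Sum>v | v < n \<and> deg v > 0. wt v * (of_int (y v))\<^sup>2)"
      unfolding wn_def by (rule sum.mono_neutral_right) (use y in auto)
    also have "\<dots> \<le> (\<Sum>v | v < n \<and> deg v > 0. wt v * 1)"
    proof (intro sum_mono mult_left_mono)
      fix v assume "v \<in> {v. v < n \<and> deg v > 0}"
      hence "\<bar>y v\<bar> \<le> 1" using y by auto
      hence "\<bar>of_int (y v) :: real\<bar> \<le> 1" by linarith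
      thus "(of_int (y v) :: real)\<^sup>2 \<le> 1" by (simp add: abs_square_le_1)
      show "0 \<le> wt v" using wt_bounds(2)[of v] by linarith
    qed
    finally show ?thesis using sum_wt(2) by simp
  qed
  have energy: "(\<Sum>i<q. (\<alpha> i)\<^sup>2 / of_int (S i)) \<le> (2 * real P + 3) * (4 * real m)"
  proof -
    let ?y = "\<lambda>v. of_int (y v) :: real"
    have "real q / real H \<le> 1" using qk k H_gt by simp
    hence "(real P + 1 + real q / real H) * wn ?y \<le> (real P + 2) * wn ?y" using wn_nonneg by (intro mult_right_mono) auto
    moreover have "qf n (bm w be q) ?y \<le> (real P + 1 + real q / real H) * wn ?y" using inv by (simp add: stage_inv_def)
    moreover have "(\<Sum>i<q. (\<alpha> i)\<^sup>2 / of_int (S i)) = qf n (bm w be q) ?y - qf n b0 ?y"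
      unfolding qf_bm ipa S_def by simp
    ultimately have "(\<Sum>i<q. (\<alpha> i)\<^sup>2 / of_int (S i)) \<le> (real P + 2) * wn ?y + (real P + 1) * wn ?y"
      using qf_b0_bounds(2)[of ?y] by (simp add: algebra_simps)
    also have "\<dots> = (2 * real P + 3) * wn ?y" by (simp add: algebra_simps)
    also have "\<dots> \<le> (2 * real P + 3) * (4 * real m)" using wny by (intro mult_left_mono) auto
    finally show ?thesis .
  qed
  have \<rho>2: "(\<Sum>i<q. (\<rho> i)\<^sup>2) \<le> 16 * real q * (2 * real P + 3)"
  proof -
    have "(\<rho> i)\<^sup>2 \<le> 4 * real q / real m * ((\<alpha> i)\<^sup>2 / of_int (S i))" if "i < q" for i
    proof -
      have "real H ^ 2 / (of_int (D i))\<^sup>2 \<le> 4 * real q / (real m * of_int (S i))"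
        using Dr[OF that] Sr[OF that] mr by (simp add: divide_le_eq le_divide_eq field_simps)
      from mult_left_mono[OF this, of "(\<alpha> i)\<^sup>2"] show ?thesis
        by (simp add: \<rho>_def power_mult_distrib power_divide mult_ac)
    qed
    hence "(\<Sum>i<q. (\<rho> i)\<^sup>2) \<le> (\<Sum>i<q. 4 * real q / real m * ((\<alpha> i)\<^sup>2 / of_int (S i)))" by (intro sum_mono) auto
    also have "\<dots> = 4 * real q / real m * (\<Sum>i<q. (\<alpha> i)\<^sup>2 / of_int (S i))" by (simp add: sum_distrib_left)
    also have "\<dots> \<le> 4 * real q / real m * ((2 * real P + 3) * (4 * real m))" using qr mr by (intro mult_left_mono energy) auto
    also have "\<dots> = 16 * real q * (2 * real P + 3)" using mr by simp
    finally show ?thesis .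
  qed
  \<comment> \<open>Digits are bounded by squares because only the sum of the squares is
    controlled.\<close>
  have j2: "real_of_int \<bar>j i\<bar> \<le> 2 * (\<rho> i)\<^sup>2 + 2" if "i < q" for i
  proof -
    have "\<bar>of_int (j i)\<bar> \<le> \<bar>\<rho> i\<bar> + 1" using fl[OF that] by linarith
    moreover have "\<bar>\<rho> i\<bar> \<le> (\<rho> i)\<^sup>2 + 1"
    proof (cases "\<bar>\<rho> i\<bar> \<le> 1")
      case False
      hence "\<bar>\<rho> i\<bar> * 1 \<le> \<bar>\<rho> i\<bar> * \<bar>\<rho> i\<bar>" by (intro mult_left_mono) auto
      also have "\<dots> = (\<rho> i)\<^sup>2" by (simp add: power2_eq_square)
      finally show ?thesis by simp
    qed (use zero_le_power2[of "\<rho> i"] in linarith)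
    moreover have "0 \<le> (\<rho> i)\<^sup>2" by simp
    ultimately show ?thesis unfolding of_int_abs by linarith
  qed
  have "(\<Sum>i<q. real (c i)) \<le> (\<Sum>i<q. 4 * (\<rho> i)\<^sup>2 + 5)"
  proof (intro sum_mono)
    fix i assume "i \<in> {..<q}"
    have "real (c i) \<le> 2 * real_of_int \<bar>j i\<bar> + 1" using c(2)[of i] by linarith
    also have "\<dots> \<le> 4 * (\<rho> i)\<^sup>2 + 5" using j2[of i] \<open>i \<in> {..<q}\<close> by auto
    finally show "real (c i) \<le> 4 * (\<rho> i)\<^sup>2 + 5" .
  qed
  also have "\<dots> = 4 * (\<Sum>i<q. (\<rho> i)\<^sup>2) + 5 * real q" by (simp add: sum.distrib sum_distrib_left)
  also have "\<dots> \<le> 4 * (16 * real q * (2 * real P + 3)) + 5 * real q" using \<rho>2 by simp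
  also have "\<dots> = real q * (128 * real P + 197)" by (simp add: algebra_simps)
  also have "\<dots> \<le> real q * real digit_base" using P by (intro mult_left_mono) (auto simp: digit_base_def)
  finally have "real (\<Sum>i<q. c i) \<le> real (q * digit_base)" by simp
  hence csum: "(\<Sum>i<q. c i) \<le> q * digit_base" by (simp only: of_nat_le_iff)
  have "digit_base * (\<Sum>i<q. c i div digit_base) \<le> (\<Sum>i<q. c i)" unfolding sum_distrib_left by (intro sum_mono) simp
  also have "\<dots> \<le> digit_base * q" using csum by (simp add: mult.commute)
  finally have "digit_base * (\<Sum>i<q. c i div digit_base) \<le> digit_base * q" .
  hence "(\<Sum>i<q. c i div digit_base) \<le> q" using R by simp
  hence "(2::nat) ^ (q + (\<Sum>i<q. c i div digit_base)) \<le> 2 ^ (2 * q)" by (intro power_increasing) auto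
  hence "e + 1 \<le> digit_base ^ q * 2 ^ (2 * q)" using e(2) by (meson le_trans mult_le_mono2)
  also have "(2::nat) ^ (2 * q) = 4 ^ q" by (subst power_mult) simp
  also have "digit_base ^ q * 4 ^ q = (digit_base * 4) ^ q" by (rule power_mult_distrib[symmetric])
  also have "digit_base * 4 = 1024 * P" by (simp add: digit_base_def)
  finally have elt: "e < (1024 * P) ^ q" by simp
  have "(\<Sum>i<q. (\<alpha> i - of_int (guess be q e i) / real H)\<^sup>2 / of_int (S i)) \<le> (\<Sum>i<q. real m / real q)"
  proof (intro sum_mono)
    fix i assume "i \<in> {..<q}"
    hence i: "i < q" by simp
    have g: "guess be q e i = D i * j i" unfolding guess_def D_def S_def using e(1) i c(1) by simp
    have eq: "\<alpha> i - of_int (guess be q e i) / real H = (\<rho> i - of_int (j i)) * (of_int (D i) / real H)"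
      using Dr(1)[OF i] Hr unfolding g \<rho>_def by (simp add: field_simps)
    have "\<bar>\<rho> i - of_int (j i)\<bar> \<le> 1" using fl[OF i] by linarith
    hence sq: "(\<rho> i - of_int (j i))\<^sup>2 \<le> 1" by (simp add: abs_square_le_1)
    have "(\<alpha> i - of_int (guess be q e i) / real H)\<^sup>2 \<le> 1 * (of_int (D i) / real H)\<^sup>2"
      unfolding eq power_mult_distrib by (intro mult_right_mono sq) auto
    also have "\<dots> \<le> of_int (S i) * real m / real q" using Dr(3)[OF i] Hr qr by (simp add: power_divide field_simps)
    finally have "(\<alpha> i - of_int (guess be q e i) / real H)\<^sup>2 \<le> of_int (S i) * (real m / real q)" by simp
    thus "(\<alpha> i - of_int (guess be q e i) / real H)\<^sup>2 / of_int (S i) \<le> real m / real q"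
      using Sr[OF i] by (simp add: divide_le_eq mult.commute)
  qed
  also have "\<dots> = real m" using qr by simp
  finally show ?thesis using elt unfolding S_def ipa by blast
qed (use m in auto)

lemma deg_pos: "j < m \<Longrightarrow> 1 \<le> deg (us j)" "j < m \<Longrightarrow> 1 \<le> deg (vs j)"
proof -
  assume j: "j < m"
  have le: "(if us j = v then 1 else 0) + (if vs j = v then 1 else 0) \<le> deg v" for v
    unfolding deg_def using j by (intro member_le_sum[of j _ "\<lambda>j. (if us j = v then 1 else 0) + (if vs j = v then 1 else 0)"]) auto
  show "1 \<le> deg (us j)" "1 \<le> deg (vs j)" using le[of "us j"] le[of "vs j"] by (auto split: if_splits)
qed

text \<open>Isolated vertices do not enter the objective, so the competitor is replaced by 0 there;
  this is what allows errors to be charged to \<open>m\<close> alone.\<close>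

theorem approximation:
  assumes inv: "stage_inv k q w be" and k: "k \<le> n" and m: "m > 0"
    and succ: "\<And>y. - wn y \<le> qf n (bm w be q) y" and x: "\<And>v. \<bar>x v\<bar> \<le> (1::int)"
  shows "\<exists>e < (1024 * P) ^ q. (\<Sum>j<m. of_int (fwX (guess be q e) w be q Tt (us j) * fwX (guess be q e) w be q Tt (vs j))) / (real Tt)\<^sup>2
      \<le> (\<Sum>j<m. of_int (x (us j) * x (vs j))) + 18 * real m / real P"
proof -
  define y where "y v = (if deg v = 0 then 0 else x v)" for v
  have y: "\<And>v. v < n \<Longrightarrow> \<bar>y v\<bar> \<le> 1" "\<And>v. v < n \<Longrightarrow> deg v = 0 \<Longrightarrow> y v = 0" using x by (auto simp: y_def)
  have xy: "x (us j) = y (us j)" "x (vs j) = y (vs j)" if "j < m" for j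
  proof -
    have "1 \<le> deg (us j)" "1 \<le> deg (vs j)" using deg_pos that by auto
    thus "x (us j) = y (us j)" "x (vs j) = y (vs j)" by (auto simp: y_def)
  qed
  obtain e where e: "e < (1024 * P) ^ q" "(\<Sum>i<q. (ip n (\<lambda>v. of_int (w i v)) (\<lambda>v. of_int (y v)) - of_int (guess be q e i) / real H)\<^sup>2 / of_int (Sc be (Suc i))) \<le> real m"
    using good_guess[where y = y, OF inv k m y] by blast
  have "(\<Sum>j<m. of_int (fwX (guess be q e) w be q Tt (us j) * fwX (guess be q e) w be q Tt (vs j))) / (real Tt)\<^sup>2
      \<le> (\<Sum>j<m. of_int (y (us j)) * of_int (y (vs j))) + 18 * real m / real P"
    by (rule frank_wolfe_int[OF inv k succ _ _ e(2)]) (use y in \<open>auto simp flip: of_int_abs\<close>)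
  also have "(\<Sum>j<m. of_int (y (us j)) * of_int (y (vs j))) = (\<Sum>j<m. of_int (x (us j) * x (vs j)))"
    by (intro sum.cong refl) (simp add: xy)
  finally show ?thesis using e(1) by auto
qed

end

section \<open>The edge set and the spectral hypothesis\<close>

locale edge_list_instance = graph_instance +
  fixes E :: "nat set set"
  assumes E: "E = (\<lambda>j. {us j, vs j}) ` {..<m}" "inj_on (\<lambda>j. {us j, vs j}) {..<m}"
begin

lemma sum_E: "(\<Sum>e\<in>E. f e) = (\<Sum>j<m. f {us j, vs j})"
  unfolding E(1) by (subst sum.reindex[OF E(2)]) simp

lemma finite_E: "finite E" unfolding E(1) by simp

lemma card_filter_E: "card {e\<in>E. Q e} = (\<Sum>j<m. if Q {us j, vs j} then 1 else 0)"
proof -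
  have "card {e\<in>E. Q e} = (\<Sum>e\<in>E. if Q e then 1 else 0)"
    unfolding card_eq_sum by (subst sum.inter_filter[OF finite_E]) simp
  thus ?thesis unfolding sum_E .
qed

lemma vertex_degree_eq: "vertex_degree E v = deg v"
  unfolding vertex_degree_def card_filter_E deg_def
proof (intro sum.cong refl)
  fix j assume "j \<in> {..<m}"
  hence "us j \<noteq> vs j" using edges(3) by simp
  thus "(if v \<in> {us j, vs j} then 1 else 0) = (if us j = v then 1 else 0) + (if vs j = v then 1 else 0 :: nat)" by auto
qed

lemma adjacency_eq: "(if {v, r} \<in> E then 1 else 0) = (\<Sum>j<m. (if us j = v \<and> vs j = r then 1 else 0) + (if vs j = v \<and> us j = r then 1 else 0 :: real))"
proof -
  have "(if {v, r} \<in> E then 1 else 0) = (\<Sum>e\<in>E. if e = {v, r} then 1 else 0 :: real)" using finite_E by (simp add: sum.delta)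
  also have "\<dots> = (\<Sum>j<m. if {us j, vs j} = {v, r} then 1 else 0)" by (rule sum_E)
  also have "\<dots> = (\<Sum>j<m. (if us j = v \<and> vs j = r then 1 else 0) + (if vs j = v \<and> us j = r then 1 else 0 :: real))"
  proof (intro sum.cong refl)
    fix j assume "j \<in> {..<m}"
    hence "us j \<noteq> vs j" using edges(3) by simp
    thus "(if {us j, vs j} = {v, r} then 1 else 0) = (if us j = v \<and> vs j = r then 1 else 0) + (if vs j = v \<and> us j = r then 1 else 0 :: real)"
      by (auto simp: doubleton_eq_iff)
  qed
  finally show ?thesis .
qed

definition na :: "nat \<Rightarrow> nat \<Rightarrow> real" where
  "na v r = (if {v, r} \<in> E then 1 else 0) / (sqrt (real (deg v)) * sqrt (real (deg r)))"

lemma normalized_adjacency_eq: "normalized_adjacency n E = Matrix.mat n n (\<lambda>(i, j). na i j)"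
proof -
  have A: "adjacency_matrix n E \<in> carrier_mat n n" by (simp add: adjacency_matrix_def)
  have DA: "degree_inv_sqrt n E * adjacency_matrix n E = Matrix.mat n n (\<lambda>(i, j). 1 / sqrt (real (deg i)) * (if {i, j} \<in> E then 1 else 0))"
    unfolding degree_inv_sqrt_def by (subst mat_diag_mult_left[OF A]) (auto simp: adjacency_matrix_def vertex_degree_eq intro!: eq_matI)
  show ?thesis unfolding normalized_adjacency_def DA unfolding degree_inv_sqrt_def
    by (subst mat_diag_mult_right[of _ n n]) (auto simp: na_def vertex_degree_eq intro!: eq_matI)
qed

text \<open>For \<open>s y = D^(1/2) y\<close> the form is the squared norm of \<open>s y\<close>
  plus \<open>P\<close> times the normalized adjacency form at \<open>s y\<close>. If the components
  of \<open>s y\<close> on eigenvectors below \<open>- \<epsilon>\<close> vanish, this is at least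
  \<open>1 - \<epsilon> * P\<close> times the squared norm. These components are the
  \<open>k\<close> functionals.\<close>

lemma codim_b0:
  assumes eps: "\<epsilon> * real P \<le> 1"
  defines "k \<equiv> neg_threshold_rank \<epsilon> (normalized_adjacency n E)"
  shows "codim_nonneg n b0 k" "k \<le> n"
proof -
  have nsym: "na i j = na j i" for i j by (simp add: na_def insert_commute mult.commute)
  obtain e \<mu> where e: "\<forall>i<n. \<forall>j<n. ip n (e i) (e j) = (if i = j then 1 else 0)"
     "\<forall>i<n. \<forall>l<n. mv n na (e i) l = \<mu> i * e i l"
    using spectral_theorem[of n na] nsym by blast
  interpret wb: weighted_basis n na "\<lambda>_. 1" e \<mu>
    using e orthonormal_complete[OF e(1)] nsym by unfold_locales (auto simp: ip_def)
  define I where "I = {i. i < n \<and> \<mu> i < - \<epsilon>}"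
  have fin: "finite I" "I \<subseteq> {..<n}" by (auto simp: I_def)
  have kI: "k = card I" unfolding k_def normalized_adjacency_eq I_def by (rule neg_threshold_rank_eq[OF e])
  show "k \<le> n" using card_mono[OF _ fin(2)] kI by simp
  obtain f where f: "bij_betw f {..<k} I" using ex_bij_betw_nat_finite[OF fin(1)] kI by (auto simp: lessThan_atLeast0)
  define s where "s y v = sqrt (real (deg v)) * y v" for y :: "nat \<Rightarrow> real" and v
  have qna: "qf n b0 y = (\<Sum>v<n. (s y v)\<^sup>2) + real P * qf n na (s y)" for y
  proof -
    have "qf n na (s y) = (\<Sum>v<n. \<Sum>r<n. (if {v, r} \<in> E then 1 else 0) * (y v * y r))"
      unfolding qf_def ip_def mv_def sum_distrib_left
    proof (intro sum.cong refl)
      fix v r assume "v \<in> {..<n}" "r \<in> {..<n}"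
      \<comment> \<open>For an isolated vertex \<open>na\<close> contains a division by 0; on edges
        the square roots cancel only because both degrees are positive.\<close>
      have "deg v > 0 \<and> deg r > 0" if ed: "{v, r} \<in> E"
      proof -
        obtain j where j: "j < m" "{v, r} = {us j, vs j}" using ed E(1) by blast
        have "1 \<le> deg (us j)" "1 \<le> deg (vs j)" using deg_pos j(1) by auto
        moreover have "(v = us j \<and> r = vs j) \<or> (v = vs j \<and> r = us j)" using j(2) by (simp add: doubleton_eq_iff)
        ultimately show ?thesis by auto
      qed
      thus "s y v * (na v r * s y r) = (if {v, r} \<in> E then 1 else 0) * (y v * y r)"
        by (auto simp: s_def na_def)
    qed
    also have "\<dots> = (\<Sum>v<n. \<Sum>r<n. \<Sum>j<m. (if r = vs j then (if us j = v then y v * y r else 0) else 0) + (if r = us j then (if vs j = v then y v * y r else 0) else 0))"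
      unfolding adjacency_eq sum_distrib_right by (intro sum.cong refl) auto
    also have "\<dots> = (\<Sum>v<n. \<Sum>j<m. \<Sum>r<n. (if r = vs j then (if us j = v then y v * y r else 0) else 0) + (if r = us j then (if vs j = v then y v * y r else 0) else 0))"
      by (rule sum.cong[OF refl], rule sum.swap)
    also have "\<dots> = (\<Sum>v<n. \<Sum>j<m. (if v = us j then y v * y (vs j) else 0) + (if v = vs j then y v * y (us j) else 0))"
      using edges by (intro sum.cong refl) (auto simp: sum.distrib sum.delta)
    also have "\<dots> = (\<Sum>j<m. \<Sum>v<n. (if v = us j then y v * y (vs j) else 0) + (if v = vs j then y v * y (us j) else 0))"
      by (rule sum.swap)
    also have "\<dots> = (\<Sum>j<m. 2 * (y (us j) * y (vs j)))"
      using edges by (intro sum.cong refl) (simp add: sum.distrib sum.delta)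
    finally have 1: "qf n na (s y) = (\<Sum>j<m. 2 * (y (us j) * y (vs j)))" .
    have "(\<Sum>v<n. (s y v)\<^sup>2) = (\<Sum>v<n. real (deg v) * (y v)\<^sup>2)" by (simp add: s_def power_mult_distrib)
    also have "\<dots> = (\<Sum>j<m. (y (us j))\<^sup>2 + (y (vs j))\<^sup>2)" by (rule sum_deg)
    finally show ?thesis unfolding 1 qf_b0 by (simp add: sum.distrib sum_distrib_left mult_ac)
  qed
  show "codim_nonneg n b0 k" unfolding codim_nonneg_def
  proof (intro exI[of _ "\<lambda>i y. wb.co (f i) (s y)"] conjI allI impI)
    fix i assume "i < k"
    have "s (\<lambda>l. x l + c * y l) = (\<lambda>l. s x l + c * s y l)" for x c y by (auto simp: s_def algebra_simps)
    thus "lin (\<lambda>y. wb.co (f i) (s y))" unfolding lin_def using wb.co_lin by simp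
  next
    fix y assume "\<forall>i<k. wb.co (f i) (s y) = 0"
    hence z: "wb.co i (s y) = 0" if "i \<in> I" for i using f that unfolding bij_betw_def by auto
    have "- \<epsilon> * (\<Sum>v<n. (s y v)\<^sup>2) = (\<Sum>i<n. - \<epsilon> * (wb.co i (s y))\<^sup>2)"
      using wb.wn_co[of "s y"] by (simp add: sum_distrib_left)
    also have "\<dots> \<le> (\<Sum>i<n. \<mu> i * (wb.co i (s y))\<^sup>2)"
    proof (intro sum_mono)
      fix i assume "i \<in> {..<n}"
      show "- \<epsilon> * (wb.co i (s y))\<^sup>2 \<le> \<mu> i * (wb.co i (s y))\<^sup>2"
      proof (cases "i \<in> I")
        case False
        thus ?thesis using \<open>i \<in> {..<n}\<close> by (intro mult_right_mono) (auto simp: I_def)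
      qed (use z in simp)
    qed
    also have "\<dots> = qf n na (s y)" by (rule wb.qf_co[symmetric])
    finally have "real P * (- \<epsilon> * (\<Sum>v<n. (s y v)\<^sup>2)) \<le> real P * qf n na (s y)" by (intro mult_left_mono) auto
    moreover have "(\<epsilon> * real P) * (\<Sum>v<n. (s y v)\<^sup>2) \<le> 1 * (\<Sum>v<n. (s y v)\<^sup>2)" using eps by (intro mult_right_mono sum_nonneg) auto
    ultimately show "0 \<le> qf n b0 y" unfolding qna by (simp add: mult_ac)
  qed
qed

end

section \<open>Memory layout and matrix-vector products\<close>

text \<open>The weight of the program text. Time is at most executions times \<open>psz\<close>
  times \<open>b^2\<close>, so the constant of the final program never has to be evaluated.\<close>

fun psz :: "prog \<Rightarrow> nat" where
  "psz (Store a e) = wc a + wc e + wl a + wl e"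
| "psz (Flip a) = wc a + wl a + 1"
| "psz (Seq p q) = psz p + psz q"
| "psz (prog.If a p q) = wc a + wl a + psz p + psz q"
| "psz (While a p) = wc a + wl a + psz p"

text \<open>\<open>K\<close> bounds how often any part of \<open>p\<close> is executed.\<close>

definition okK :: "nat \<Rightarrow> nat \<Rightarrow> prog \<Rightarrow> memory \<Rightarrow> (memory \<Rightarrow> bool) \<Rightarrow> (memory \<Rightarrow> real) \<Rightarrow> real \<Rightarrow> bool" where
  "okK b K p s Q f x \<longleftrightarrow> okE b p s (K * psz p) Q f x"

abbreviation okD :: "nat \<Rightarrow> nat \<Rightarrow> prog \<Rightarrow> memory \<Rightarrow> (memory \<Rightarrow> bool) \<Rightarrow> bool" where
  "okD b K p s Q \<equiv> okK b K p s Q (\<lambda>_. 0) 0"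

lemma okK_conseq:
  assumes "okK b K p s Q f x" "K \<le> K'" "\<And>s'. bnd b s' \<Longrightarrow> Q s' \<Longrightarrow> Q' s' \<and> f s' \<le> f' s'" "x' \<le> x"
  shows "okK b K' p s Q' f' x'"
  using assms(1) unfolding okK_def
proof (rule okE_conseq)
  show "K * psz p \<le> K' * psz p" using assms(2) by simp
qed (use assms(3,4) in blast)+

lemma okD_conseq:
  assumes "okD b K p s Q" "K \<le> K'" "\<And>s'. bnd b s' \<Longrightarrow> Q s' \<Longrightarrow> Q' s'"
  shows "okD b K' p s Q'"
  by (rule okK_conseq[OF assms(1,2)]) (use assms(3) in auto)

lemma okD_imp_okK:
  assumes "okD b K p s Q" "\<And>s'. bnd b s' \<Longrightarrow> Q s' \<Longrightarrow> x \<le> f s'"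
  shows "okK b K p s Q f x"
  using assms unfolding okK_def by (rule ok_imp_okE)

text \<open>The multiplicity \<open>K\<close> is shared by both parts and does not add up, since
  \<open>psz\<close> is additive.\<close>

lemma okK_Seq:
  assumes "okK b K p1 s R g x" "\<And>s'. bnd b s' \<Longrightarrow> R s' \<Longrightarrow> okK b K p2 s' Q f (g s')"
  shows "okK b K (Seq p1 p2) s Q f x"
  using okE_Seq[of b p1 s "K * psz p1" R g x p2 "K * psz p2" Q f] assms
  unfolding okK_def by (simp add: add_mult_distrib2)

lemma okK_If:
  assumes "bnd b s" "b > 0" "K \<ge> 1" "okK b K (if val a s \<noteq> 0 then p1 else p2) s Q f x"
  shows "okK b K (prog.If a p1 p2) s Q f x"
proof -
  have *: "wc a + wl a + K * (psz p1 + psz p2) \<le> K * psz (prog.If a p1 p2)"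
    using mult_le_mono1[OF assms(3), of "wc a + wl a"] by (simp add: add_mult_distrib2)
  have "okE b (if val a s \<noteq> 0 then p1 else p2) s (K * (psz p1 + psz p2)) Q f x"
    using assms(4) unfolding okK_def by (rule okE_conseq) (auto intro!: mult_le_mono2)
  from okE_If[OF assms(1,2) this] show ?thesis unfolding okK_def
    by (rule okE_conseq) (use * in \<open>auto simp: add.assoc\<close>)
qed

lemma okK_While:
  assumes "\<And>j s. J (j::nat) s \<Longrightarrow> bnd b s \<Longrightarrow> val a s \<noteq> 0 \<Longrightarrow> \<exists>j'. j = Suc j' \<and> okK b K p s (J j') \<phi> (\<phi> s)"
    and "\<And>j s. J j s \<Longrightarrow> bnd b s \<Longrightarrow> val a s = 0 \<Longrightarrow> Q s \<and> \<phi> s \<le> f s"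
    and "J j s" "bnd b s" "b > 0" "x \<le> \<phi> s" "K \<ge> 1"
  shows "okK b ((j + 1) * K) (While a p) s Q f x"
proof -
  have "okE b (While a p) s ((j + 1) * (wc a + wl a) + j * (K * psz p)) Q f x"
    by (rule okE_While[where J = J and \<phi> = \<phi>]) (use assms in \<open>auto simp: okK_def\<close>)
  moreover have "(j + 1) * (wc a + wl a) + j * (K * psz p) \<le> (j + 1) * K * psz (While a p)"
  proof -
    have "(j + 1) * (wc a + wl a) * 1 \<le> (j + 1) * (wc a + wl a) * K" using assms(7) by (intro mult_le_mono2) auto
    moreover have "j * (K * psz p) \<le> (j + 1) * (K * psz p)" by simp
    ultimately have "(j + 1) * (wc a + wl a) + j * (K * psz p) \<le> (j + 1) * (wc a + wl a) * K + (j + 1) * (K * psz p)" by linarith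
    also have "\<dots> = (j + 1) * K * psz (While a p)" by (simp add: algebra_simps)
    finally show ?thesis .
  qed
  ultimately show ?thesis unfolding okK_def by (rule okE_conseq) auto
qed

text \<open>The scratch arrays are interleaved in the negative cells, away from the input and output.\<close>

definition adr :: "nat \<Rightarrow> nat \<Rightarrow> int" where
  "adr a i = - 1 - int a - 64 * int i"

definition rd :: "memory \<Rightarrow> nat \<Rightarrow> nat \<Rightarrow> int" where
  "rd s a i = s (adr a i)"

definition inp :: "memory \<Rightarrow> nat \<Rightarrow> int" where
  "inp s j = s (int j)"

definition upd :: "memory \<Rightarrow> nat \<Rightarrow> nat \<Rightarrow> int \<Rightarrow> memory" where
  "upd s a i x = s(adr a i := x)"

lemma adr_eq_iff: "a < 64 \<Longrightarrow> c < 64 \<Longrightarrow> adr a i = adr c j \<longleftrightarrow> a = c \<and> i = j"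
proof
  assume ac: "a < 64" "c < 64" and eq: "adr a i = adr c j"
  have "int (a + i * 64) = int (c + j * 64)" using eq by (simp add: adr_def)
  hence e: "a + i * 64 = c + j * 64" by (simp only: of_nat_eq_iff)
  have "a = (a + i * 64) mod 64" "c = (c + j * 64) mod 64" using ac by simp_all
  hence "a = c" using e by metis
  thus "a = c \<and> i = j" using e by simp
qed simp

lemma rd_upd [simp]: "a < 64 \<Longrightarrow> c < 64 \<Longrightarrow> rd (upd s a i x) c j = (if a = c \<and> i = j then x else rd s c j)"
  by (auto simp: rd_def upd_def adr_eq_iff)

lemma inp_upd [simp]: "inp (upd s a i x) = inp s"
  by (auto simp: inp_def upd_def adr_def)

definition eqx :: "nat set \<Rightarrow> memory \<Rightarrow> memory \<Rightarrow> bool" where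
  "eqx U s s' \<longleftrightarrow> inp s' = inp s \<and> (\<forall>a<64. a \<notin> U \<longrightarrow> rd s' a = rd s a)"

lemma eqx_refl [simp]: "eqx U s s" by (simp add: eqx_def)

lemma eqx_trans: "eqx U s s' \<Longrightarrow> eqx U s' s'' \<Longrightarrow> eqx U s s''" by (simp add: eqx_def)

lemma eqx_mono: "eqx U s s' \<Longrightarrow> U \<subseteq> U' \<Longrightarrow> eqx U' s s'" by (auto simp: eqx_def)

lemma eqx_rd: "eqx U s s' \<Longrightarrow> a < 64 \<Longrightarrow> a \<notin> U \<Longrightarrow> rd s' a = rd s a" by (simp add: eqx_def)

lemma eqx_inp: "eqx U s s' \<Longrightarrow> inp s' = inp s" by (simp add: eqx_def)

lemma eqx_upd [simp]: "eqx U s s' \<Longrightarrow> a \<in> U \<Longrightarrow> a < 64 \<Longrightarrow> eqx U s (upd s' a i x)"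
  unfolding eqx_def by (auto intro!: ext)

definition V :: "nat \<Rightarrow> expr" where "V a = Load (Const (adr a 0))"

definition AD :: "nat \<Rightarrow> expr \<Rightarrow> expr" where "AD a e = Sub (Const (- 1 - int a)) (Mul (Const 64) e)"

definition AR :: "nat \<Rightarrow> expr \<Rightarrow> expr" where "AR a e = Load (AD a e)"

definition SV :: "nat \<Rightarrow> expr \<Rightarrow> prog" where "SV a e = Store (Const (adr a 0)) e"

definition SA :: "nat \<Rightarrow> expr \<Rightarrow> expr \<Rightarrow> prog" where "SA a i e = Store (AD a i) e"

lemma val_V [simp]: "val (V a) s = rd s a 0" by (simp add: V_def rd_def)

lemma val_AD: "0 \<le> val e s \<Longrightarrow> val (AD a e) s = adr a (nat (val e s))" by (simp add: AD_def adr_def)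

lemma val_AR [simp]: "0 \<le> val e s \<Longrightarrow> val (AR a e) s = rd s a (nat (val e s))"
  unfolding AR_def by (simp add: val_AD rd_def)

lemma okK_SV:
  assumes "bnd b s" "b > 0" "K \<ge> 1" "len (val e s) \<le> b" "Q (upd s a 0 (val e s))" "x \<le> f (upd s a 0 (val e s))"
  shows "okK b K (SV a e) s Q f x"
  unfolding okK_def SV_def
  by (rule okE_conseq[OF okE_Store[where Q = Q and f = f and x = x]]) (use assms in \<open>auto simp: upd_def\<close>)

lemma okK_SA:
  assumes "bnd b s" "b > 0" "K \<ge> 1" "val ie s = int i" "len (val e s) \<le> b" "Q (upd s a i (val e s))" "x \<le> f (upd s a i (val e s))"
  shows "okK b K (SA a ie e) s Q f x"
  unfolding okK_def SA_def
  by (rule okE_conseq[OF okE_Store[where Q = Q and f = f and x = x]]) (use assms in \<open>auto simp: upd_def val_AD\<close>)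

lemmas okD_SV = okK_SV[where f = "\<lambda>_. 0" and x = 0, simplified]
lemmas okD_SA = okK_SA[where f = "\<lambda>_. 0" and x = 0, simplified]

lemma bnd_rd: "bnd b s \<Longrightarrow> len (rd s a i) \<le> b" by (simp add: bnd_def rd_def)

definition For :: "nat \<Rightarrow> expr \<Rightarrow> prog \<Rightarrow> prog" where
  "For i ub body = Seq (SV i (Const 0)) (While (Less (V i) ub) (Seq body (SV i (Add (V i) (Const 1)))))"

lemma len_0: "len 0 = 1" and len_1: "len 1 = 2"
  by (simp_all add: len_def bitlen_def floorlog_def)

text \<open>\<open>Iu\<close> makes the invariant and the potential insensitive to the counter cell,
  which the body must leave unchanged. The factor \<open>N + 1\<close> accounts for the last
  evaluation of the guard.\<close>

lemma okK_For:
  assumes b: "bnd b s" "b \<ge> 2" and i: "i < 64" and N: "len (int N) \<le> b" and K: "K \<ge> 1"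
    and I0: "I 0 s" and x: "x \<le> \<phi> 0 s"
    and Iu: "\<And>j s x. I j s \<Longrightarrow> I j (upd s i 0 x) \<and> \<phi> j (upd s i 0 x) = \<phi> j s"
    and ub: "\<And>j s. j \<le> N \<Longrightarrow> I j s \<Longrightarrow> val ub s = int N"
    and step: "\<And>j s. j < N \<Longrightarrow> I j s \<Longrightarrow> rd s i 0 = int j \<Longrightarrow> bnd b s \<Longrightarrow>
      okK b K body s (\<lambda>s'. I (Suc j) s' \<and> rd s' i 0 = int j) (\<phi> (Suc j)) (\<phi> j s)"
  shows "okK b ((N + 1) * K) (For i ub body) s (\<lambda>s'. I N s' \<and> rd s' i 0 = int N) (\<phi> N) x"
  unfolding For_def
proof (rule okK_Seq)
  let ?J = "\<lambda>r s. \<exists>t\<le>N. r = N - t \<and> I t s \<and> rd s i 0 = int t"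
  let ?\<phi> = "\<lambda>s. \<phi> (nat (rd s i 0)) s"
  show "okK b ((N + 1) * K) (SV i (Const 0)) s (?J N) ?\<phi> x"
    by (rule okK_SV) (use b K I0 Iu x i in \<open>auto simp: len_0\<close>)
  fix s' assume s': "bnd b s'" "?J N s'"
  show "okK b ((N + 1) * K) (While (Less (V i) ub) (Seq body (SV i (Add (V i) (Const 1))))) s' (\<lambda>s'. I N s' \<and> rd s' i 0 = int N) (\<phi> N) (?\<phi> s')"
  proof (rule okK_While[where J = ?J and \<phi> = ?\<phi>])
    fix r s assume J: "?J r s" and bs: "bnd b s" and v: "val (Less (V i) ub) s \<noteq> 0"
    obtain t where t: "t \<le> N" "r = N - t" "I t s" "rd s i 0 = int t" using J by blast
    have tN: "t < N" using v ub[OF t(1,3)] t by (auto split: if_splits)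
    have \<phi>t: "?\<phi> s = \<phi> t s" using t by simp
    have "okK b K (Seq body (SV i (Add (V i) (Const 1)))) s (?J (N - Suc t)) ?\<phi> (?\<phi> s)"
      unfolding \<phi>t
    proof (rule okK_Seq[OF step[OF tN t(3,4) bs]])
      fix s' assume s': "bnd b s'" "I (Suc t) s' \<and> rd s' i 0 = int t"
      have "len (int t + 1) \<le> b" using len_abs_mono[of "int t + 1" "int N"] tN N by simp
      moreover have "nat (int t + 1) = Suc t" by simp
      ultimately show "okK b K (SV i (Add (V i) (Const 1))) s' (?J (N - Suc t)) ?\<phi> (\<phi> (Suc t) s')"
        by (intro okK_SV) (use s' b K Iu i tN in \<open>auto simp: intro!: exI[of _ "Suc t"]\<close>)
    qed
    moreover have "r = Suc (N - Suc t)" using t tN by simp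
    ultimately show "\<exists>j'. r = Suc j' \<and> okK b K (Seq body (SV i (Add (V i) (Const 1)))) s (?J j') ?\<phi> (?\<phi> s)" by blast
  next
    fix r s assume J: "?J r s" and v: "val (Less (V i) ub) s = 0"
    obtain t where t: "t \<le> N" "r = N - t" "I t s" "rd s i 0 = int t" using J by blast
    have "t = N" using v ub[OF t(1,3)] t by (auto split: if_splits)
    thus "(I N s \<and> rd s i 0 = int N) \<and> ?\<phi> s \<le> \<phi> N s" using t by simp
  qed (use s' b K in auto)
qed

lemma okD_For:
  assumes "bnd b s" "b \<ge> 2" "i < 64" "len (int N) \<le> b" "K \<ge> 1" "I 0 s"
    and "\<And>j s x. I j s \<Longrightarrow> I j (upd s i 0 x)"
    and "\<And>j s. j \<le> N \<Longrightarrow> I j s \<Longrightarrow> val ub s = int N"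
    and "\<And>j s. j < N \<Longrightarrow> I j s \<Longrightarrow> rd s i 0 = int j \<Longrightarrow> bnd b s \<Longrightarrow> okD b K body s (\<lambda>s'. I (Suc j) s' \<and> rd s' i 0 = int j)"
  shows "okD b ((N + 1) * K) (For i ub body) s (\<lambda>s'. I N s' \<and> rd s' i 0 = int N)"
  by (rule okK_For[where \<phi> = "\<lambda>_ _. 0"]) (use assms in auto)

lemma okK_Flip:
  assumes "bnd b s" "b \<ge> 2" "K \<ge> 1" "val ie s = int i" "Q (upd s a i 0)" "Q (upd s a i 1)"
    "f (upd s a i 0) \<ge> 0" "f (upd s a i 1) \<ge> 0" "x \<le> (f (upd s a i 0) + f (upd s a i 1)) / 2"
  shows "okK b K (Flip (AD a ie)) s Q f x"
proof -
  have "okE b (Flip (AD a ie)) s (wc (AD a ie) + wl (AD a ie) + 1) Q f x"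
    by (rule okE_Flip) (use assms in \<open>auto simp: upd_def val_AD\<close>)
  thus ?thesis unfolding okK_def
    by (rule okE_conseq) (use mult_le_mono1[OF assms(3), of "psz (Flip (AD a ie))"] in auto)
qed

text \<open>Prefix \<open>n\<close> marks scalars, \<open>c\<close> loop counters and \<open>a\<close> arrays.\<close>

abbreviation (input) "nN \<equiv> 0 :: nat"
abbreviation (input) "nM \<equiv> 1 :: nat"
abbreviation (input) "nL \<equiv> 2 :: nat"
abbreviation (input) "nP \<equiv> 3 :: nat"
abbreviation (input) "nH \<equiv> 4 :: nat"
abbreviation (input) "nIt \<equiv> 5 :: nat"
abbreviation (input) "nS \<equiv> 6 :: nat"
abbreviation (input) "nQ \<equiv> 7 :: nat"
abbreviation (input) "nG \<equiv> 10 :: nat"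
abbreviation (input) "nTau \<equiv> 11 :: nat"
abbreviation (input) "cV \<equiv> 25 :: nat"
abbreviation (input) "cE \<equiv> 26 :: nat"
abbreviation (input) "cI \<equiv> 27 :: nat"
abbreviation (input) "cW \<equiv> 28 :: nat"
abbreviation (input) "nDot \<equiv> 29 :: nat"
abbreviation (input) "aX \<equiv> 34 :: nat"
abbreviation (input) "aY \<equiv> 35 :: nat"
abbreviation (input) "aW \<equiv> 36 :: nat"
abbreviation (input) "aB \<equiv> 37 :: nat"
abbreviation (input) "aS \<equiv> 38 :: nat"
abbreviation (input) "aT \<equiv> 39 :: nat"

definition EU :: expr where "EU = Load (Add (Const 3) (Mul (Const 2) (V cE)))"
definition EV :: expr where "EV = Load (Add (Const 4) (Mul (Const 2) (V cE)))"

lemma val_EU [simp]: "rd s cE 0 = int j \<Longrightarrow> val EU s = inp s (3 + 2 * j)"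
  and val_EV [simp]: "rd s cE 0 = int j \<Longrightarrow> val EV s = inp s (4 + 2 * j)"
  by (simp_all add: EU_def EV_def inp_def)

definition addE :: "expr \<Rightarrow> expr \<Rightarrow> prog" where
  "addE x y = SA aY x (Add (AR aY x) (Mul (V nG) (Add (AR aX x) (Mul (V nP) (AR aX y)))))"

text \<open>The vectors \<open>w i\<close> lie in one array, row after row with row length
  \<open>n\<close>.\<close>

definition IV :: expr where "IV = Add (Mul (V cI) (V nN)) (V cW)"

lemma val_IV: "rd s cI 0 = int i \<Longrightarrow> rd s nN 0 = int n \<Longrightarrow> rd s cW 0 = int v \<Longrightarrow> val IV s = int (i * n + v)"
  by (simp add: IV_def)

abbreviation (input) "DOT_STEP \<equiv> For cW (V nN) (SV nDot (Add (V nDot) (Mul (AR aW IV) (AR aX (V cW)))))"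
abbreviation (input) "COEFFICIENT_STEP \<equiv> SV nDot (Sub (Mul (V nG) (V nDot)) (Mul (V nTau) (AR aT (V cI))))"
abbreviation (input) "ADD_STEP \<equiv> For cW (V nN) (SA aY (V cW) (Add (Mul (AR aB (V cI)) (AR aY (V cW))) (Mul (AR aW IV) (V nDot))))"

definition MATVEC :: prog where
  "MATVEC = Seq (For cV (V nN) (SA aY (V cV) (Const 0)))
       (Seq (For cE (V nM) (Seq (addE EU EV) (addE EV EU)))
            (For cI (V nQ)
              (Seq (SV nDot (Const 0)) (Seq DOT_STEP (Seq COEFFICIENT_STEP ADD_STEP)))))"

context graph_instance
begin

definition env :: "memory \<Rightarrow> bool" where
  "env s \<longleftrightarrow> rd s nN 0 = int n \<and> rd s nM 0 = int m \<and> rd s nP 0 = int P \<and>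
     (\<forall>j<m. inp s (3 + 2 * j) = int (us j) \<and> inp s (4 + 2 * j) = int (vs j))"

lemma env_eqx: "env s \<Longrightarrow> eqx M s s' \<Longrightarrow> nN \<notin> M \<Longrightarrow> nM \<notin> M \<Longrightarrow> nP \<notin> M \<Longrightarrow> env s'"
  unfolding env_def eqx_def by auto

definition st_mat :: "memory \<Rightarrow> nat \<Rightarrow> (nat \<Rightarrow> nat \<Rightarrow> int) \<Rightarrow> (nat \<Rightarrow> int) \<Rightarrow> bool" where
  "st_mat s q w be \<longleftrightarrow> rd s nQ 0 = int q \<and> (\<forall>i<q. rd s aB i = be i \<and> (\<forall>v<n. rd s aW (i * n + v) = w i v))"

abbreviation "modMV \<equiv> {cV, cE, cI, cW, nDot, aY}"

text \<open>\<open>\<xi>\<close> bounds the scaled input and the scaled guess. Every value stored on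
  the way, partial sums included, is then at most \<open>U q * \<xi>\<close>, so one assumption
  about \<open>b\<close> covers all stores. The factor \<open>q + 1\<close> rather than
  \<open>n\<close> comes from keeping the update as \<open>q\<close> rank one terms.\<close>

lemma ok_MATVEC:
  assumes b: "bnd b s" "b \<ge> 2" and env: "env s" and st: "st_mat s q w be" and wb: "wb_ok q w be"
    and G: "rd s nG 0 = G" and tau: "rd s nTau 0 = \<tau>" and t: "\<And>i. i < q \<Longrightarrow> rd s aT i = t i" and x: "\<And>v. v < n \<Longrightarrow> rd s aX v = x v"
    and x\<xi>: "\<And>v. v < n \<Longrightarrow> \<bar>G * x v\<bar> \<le> \<xi>" "\<And>v. v < n \<Longrightarrow> \<bar>x v\<bar> \<le> \<xi>" and \<xi>: "0 \<le> \<xi>"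
    and t\<xi>: "\<And>i. i < q \<Longrightarrow> \<bar>\<tau> * t i\<bar> \<le> \<xi>"
    and B: "\<And>z. \<bar>z\<bar> \<le> U q * \<xi> \<Longrightarrow> len z \<le> b"
  shows "okD b ((q + 1) * (n + m + 1)) MATVEC s (\<lambda>s'. eqx modMV s s' \<and> (\<forall>v<n. rd s' aY v = yrec G \<tau> t w be x q v))"
proof -
  have b0: "b > 0" using b by simp
  have lenn: "len (int n) \<le> b" and lenm: "len (int m) \<le> b"
    using bnd_rd[OF b(1), of nN 0] bnd_rd[OF b(1), of nM 0] env by (auto simp: env_def)
  have lenq: "len (int q) \<le> b" using bnd_rd[OF b(1), of nQ 0] st by (auto simp: st_mat_def)
  define y0 where "y0 k v = (\<Sum>j<k. (if us j = v then G * (x v + int P * x (vs j)) else 0) + (if vs j = v then G * (x v + int P * x (us j)) else 0))" for k v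
  have y0b: "len (y0 k v) \<le> b" if "k \<le> m" "v < n" for k v
  proof -
    have "\<bar>y0 k v\<bar> \<le> int k * (2 * (1 + int P)) * \<xi>" unfolding y0_def by (rule edge_sum_bound[OF x\<xi>(1) that(2,1) \<xi>])
    also have "\<dots> \<le> (int H * int H) * \<xi>" using H_powers \<xi> that by (intro mult_right_mono mult_mono) auto
    also have "int H * int H \<le> U q"
    proof -
      have "int H ^ 2 \<le> int H ^ 7" using H_powers by (intro power_increasing) auto
      thus ?thesis using U_ge(1)[of q] by (simp add: power2_eq_square)
    qed
    hence "(int H * int H) * \<xi> \<le> U q * \<xi>" using \<xi> by (intro mult_right_mono) auto
    finally show ?thesis by (rule B)
  qed
  let ?K = "(q + 1) * (n + m + 1)"
  have L1: "okD b ((n + 1) * 1) (For cV (V nN) (SA aY (V cV) (Const 0))) s (\<lambda>s'. (eqx modMV s s' \<and> (\<forall>v<n. rd s' aY v = 0)) \<and> rd s' cV 0 = int n)"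
  proof (rule okD_For[where I = "\<lambda>j s'. eqx modMV s s' \<and> (\<forall>v<j. rd s' aY v = 0)"])
    fix j s' assume a: "j < n" "eqx modMV s s' \<and> (\<forall>v<j. rd s' aY v = 0)" "rd s' cV 0 = int j" "bnd b s'"
    show "okD b 1 (SA aY (V cV) (Const 0)) s' (\<lambda>s'. (eqx modMV s s' \<and> (\<forall>v<Suc j. rd s' aY v = 0)) \<and> rd s' cV 0 = int j)"
      by (rule okD_SA[where i = j]) (use a b b0 in \<open>auto simp: len_0 less_Suc_eq\<close>)
  qed (use b lenn env in \<open>auto simp: env_def eqx_rd\<close>)
  have L2: "okD b ((m + 1) * 1) (For cE (V nM) (Seq (addE EU EV) (addE EV EU))) s1 (\<lambda>s'. (eqx modMV s s' \<and> (\<forall>v<n. rd s' aY v = y0 m v)) \<and> rd s' cE 0 = int m)"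
    if s1: "bnd b s1" "eqx modMV s s1" "\<forall>v<n. rd s1 aY v = 0" for s1
  proof (rule okD_For[where I = "\<lambda>k s'. eqx modMV s s' \<and> (\<forall>v<n. rd s' aY v = y0 k v)"])
    fix k s' assume k: "k < m" and I: "eqx modMV s s' \<and> (\<forall>v<n. rd s' aY v = y0 k v)" and c: "rd s' cE 0 = int k" and bs: "bnd b s'"
    have e: "inp s' (3 + 2 * k) = int (us k)" "inp s' (4 + 2 * k) = int (vs k)" "rd s' nG 0 = G" "rd s' nP 0 = int P"
      "\<And>v. v < n \<Longrightarrow> rd s' aX v = x v"
      using I k env G x by (auto simp: env_def eqx_inp eqx_rd)
    have uv: "us k < n" "vs k < n" "us k \<noteq> vs k" using edges k by auto
    have yS: "y0 (Suc k) (us k) = y0 k (us k) + G * (x (us k) + int P * x (vs k))"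
      "y0 (Suc k) (vs k) = y0 k (vs k) + G * (x (vs k) + int P * x (us k))"
      "\<And>v. v \<noteq> us k \<Longrightarrow> v \<noteq> vs k \<Longrightarrow> y0 (Suc k) v = y0 k v"
      using uv by (auto simp: y0_def)
    show "okD b 1 (Seq (addE EU EV) (addE EV EU)) s' (\<lambda>s'. (eqx modMV s s' \<and> (\<forall>v<n. rd s' aY v = y0 (Suc k) v)) \<and> rd s' cE 0 = int k)"
    proof (rule okK_Seq[where R = "\<lambda>s''. s'' = upd s' aY (us k) (y0 (Suc k) (us k))" and g = "\<lambda>_. 0"])
      show "okD b 1 (addE EU EV) s' (\<lambda>s''. s'' = upd s' aY (us k) (y0 (Suc k) (us k)))"
        unfolding addE_def
        by (rule okD_SA[where i = "us k"]) (use I c bs e uv b0 y0b[of "Suc k" "us k"] k in \<open>auto simp: yS(1)\<close>)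
    next
      fix s2 assume s2: "bnd b s2" "s2 = upd s' aY (us k) (y0 (Suc k) (us k))"
      show "okD b 1 (addE EV EU) s2 (\<lambda>s'. (eqx modMV s s' \<and> (\<forall>v<n. rd s' aY v = y0 (Suc k) v)) \<and> rd s' cE 0 = int k)"
        unfolding addE_def
        by (rule okD_SA[where i = "vs k"]) (use I c s2 e uv b0 y0b[of "Suc k" "vs k"] k yS(3) in \<open>auto simp: yS(2)\<close>)
    qed
  qed (use s1 b lenm env in \<open>auto simp: env_def eqx_rd y0_def\<close>)
  have L3: "okD b ((q + 1) * (n + 1)) (For cI (V nQ)
              (Seq (SV nDot (Const 0)) (Seq DOT_STEP (Seq COEFFICIENT_STEP ADD_STEP)))) s2
       (\<lambda>s'. (eqx modMV s s' \<and> (\<forall>v<n. rd s' aY v = yrec G \<tau> t w be x q v)) \<and> rd s' cI 0 = int q)"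
    if s2: "bnd b s2" "eqx modMV s s2" "\<forall>v<n. rd s2 aY v = y0 m v" for s2
  proof (rule okD_For[where I = "\<lambda>i s'. eqx modMV s s' \<and> (\<forall>v<n. rd s' aY v = yrec G \<tau> t w be x i v)"])
    fix i s' assume i: "i < q" and I: "eqx modMV s s' \<and> (\<forall>v<n. rd s' aY v = yrec G \<tau> t w be x i v)" and c: "rd s' cI 0 = int i" and bs: "bnd b s'"
    have e: "rd s' nG 0 = G" "rd s' nTau 0 = \<tau>" "rd s' aT i = t i" "rd s' aB i = be i" "rd s' nN 0 = int n"
      "\<And>v. v < n \<Longrightarrow> rd s' aX v = x v" "\<And>v. v < n \<Longrightarrow> rd s' aW (i * n + v) = w i v"
      using I i env G x tau t st by (auto simp: env_def eqx_rd st_mat_def)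
    have Umono: "U (Suc i) * \<xi> \<le> U q * \<xi>" using U_mono[of "Suc i" q] i \<xi> by (intro mult_right_mono) auto
    have U38: "2 * U i ^ 3 \<le> U (Suc i)" "U i ^ 3 \<le> U (Suc i)"
    proof -
      have "2 \<le> U i"
      proof -
        have "int H ^ 1 \<le> int H ^ 7" using H_powers by (intro power_increasing) auto
        hence "int H \<le> int H ^ 7" by simp
        moreover have "2 \<le> int H" using H_powers(4) P by simp
        ultimately show ?thesis using U_ge(1)[of i] by linarith
      qed
      hence "2 * U i ^ 3 \<le> U i * U i ^ 3" by (intro mult_right_mono) auto
      also have "\<dots> = U i ^ 4" by (simp add: numeral_eq_Suc)
      also have "\<dots> \<le> U i ^ 8" using U_ge(2) by (intro power_increasing) auto
      finally show "2 * U i ^ 3 \<le> U (Suc i)" unfolding U_ge(3) .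
      moreover have "0 \<le> U i ^ 3" using U_ge(2)[of i] by simp
      ultimately show "U i ^ 3 \<le> U (Suc i)" by linarith
    qed
    have dotb: "len (\<Sum>v<k. w i v * x v) \<le> b" if "k \<le> n" for k
    proof (rule B)
      have "\<bar>\<Sum>v<k. w i v * x v\<bar> \<le> U i ^ 3 * \<xi>" by (rule dot_bound[OF wb i that x\<xi>(2) \<xi>])
      also have "\<dots> \<le> U (Suc i) * \<xi>" using U38 \<xi> by (intro mult_right_mono) auto
      finally show "\<bar>\<Sum>v<k. w i v * x v\<bar> \<le> U q * \<xi>" using Umono by linarith
    qed
    define co where "co = G * (\<Sum>v<n. w i v * x v) - \<tau> * t i"
    have cob: "len co \<le> b"
    proof (rule B)
      have "\<bar>co\<bar> \<le> 2 * U i ^ 3 * \<xi>" unfolding co_def by (rule coef_bound[where t = t and i = i, OF wb i x\<xi>(1) \<xi> t\<xi>[OF i]])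
      also have "\<dots> \<le> U (Suc i) * \<xi>" using U38 \<xi> by (intro mult_right_mono) auto
      finally show "\<bar>co\<bar> \<le> U q * \<xi>" using Umono by linarith
    qed
    have yb: "len (yrec G \<tau> t w be x (Suc i) v) \<le> b" if "v < n" for v
    proof (rule B)
      have "\<bar>yrec G \<tau> t w be x (Suc i) v\<bar> \<le> U (Suc i) * \<xi>" by (rule yrec_bound[OF wb x\<xi>(1) \<xi> t\<xi> that]) (use i in auto)
      thus "\<bar>yrec G \<tau> t w be x (Suc i) v\<bar> \<le> U q * \<xi>" using Umono by linarith
    qed
    have yS: "yrec G \<tau> t w be x (Suc i) v = be i * yrec G \<tau> t w be x i v + w i v * co" for v by (simp add: co_def)
    let ?U = "{cW, nDot, aY}"
    show "okD b (n + 1) (Seq (SV nDot (Const 0)) (Seq DOT_STEP (Seq COEFFICIENT_STEP ADD_STEP))) s'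
          (\<lambda>s'. (eqx modMV s s' \<and> (\<forall>v<n. rd s' aY v = yrec G \<tau> t w be x (Suc i) v)) \<and> rd s' cI 0 = int i)"
    proof (rule okK_Seq[where R = "\<lambda>s''. s'' = upd s' nDot 0 0" and g = "\<lambda>_. 0"])
      show "okD b (n + 1) (SV nDot (Const 0)) s' (\<lambda>s''. s'' = upd s' nDot 0 0)"
        by (rule okD_SV) (use bs b0 in \<open>auto simp: len_0\<close>)
      fix s3 assume s3: "bnd b s3" "s3 = upd s' nDot 0 0"
      show "okD b (n + 1) (Seq DOT_STEP (Seq COEFFICIENT_STEP ADD_STEP)) s3
          (\<lambda>s'. (eqx modMV s s' \<and> (\<forall>v<n. rd s' aY v = yrec G \<tau> t w be x (Suc i) v)) \<and> rd s' cI 0 = int i)"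
      proof (rule okK_Seq[where R = "\<lambda>s''. (eqx {cW, nDot} s' s'' \<and> rd s'' nDot 0 = (\<Sum>v<n. w i v * x v)) \<and> rd s'' cW 0 = int n" and g = "\<lambda>_. 0"])
        have "okD b ((n + 1) * 1) DOT_STEP s3
           (\<lambda>s''. (eqx {cW, nDot} s' s'' \<and> rd s'' nDot 0 = (\<Sum>v<n. w i v * x v)) \<and> rd s'' cW 0 = int n)"
        proof (rule okD_For[where I = "\<lambda>k s''. eqx {cW, nDot} s' s'' \<and> rd s'' nDot 0 = (\<Sum>v<k. w i v * x v)"])
          fix k s4 assume k: "k < n" and I4: "eqx {cW, nDot} s' s4 \<and> rd s4 nDot 0 = (\<Sum>v<k. w i v * x v)" and c4: "rd s4 cW 0 = int k" and b4: "bnd b s4"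
          have e4: "rd s4 nN 0 = int n" "rd s4 cI 0 = int i" "rd s4 aX k = x k" "rd s4 aW (i * n + k) = w i k" using I4 e c k by (auto simp: eqx_rd)
          note v4 = val_IV[OF e4(2,1) c4]
          show "okD b 1 (SV nDot (Add (V nDot) (Mul (AR aW IV) (AR aX (V cW))))) s4 (\<lambda>s''. (eqx {cW, nDot} s' s'' \<and> rd s'' nDot 0 = (\<Sum>v<Suc k. w i v * x v)) \<and> rd s'' cW 0 = int k)"
            by (rule okD_SV) (use b4 b0 I4 c4 e4 dotb[of "Suc k"] k in \<open>auto simp: v4 simp del: of_nat_add of_nat_mult\<close>)
        qed (use s3 b lenn e in \<open>auto simp: eqx_rd\<close>)
        thus "okD b (n + 1) DOT_STEP s3
           (\<lambda>s''. (eqx {cW, nDot} s' s'' \<and> rd s'' nDot 0 = (\<Sum>v<n. w i v * x v)) \<and> rd s'' cW 0 = int n)" by simp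
        fix s5 assume s5: "bnd b s5" "(eqx {cW, nDot} s' s5 \<and> rd s5 nDot 0 = (\<Sum>v<n. w i v * x v)) \<and> rd s5 cW 0 = int n"
        show "okD b (n + 1) (Seq COEFFICIENT_STEP ADD_STEP) s5
          (\<lambda>s'. (eqx modMV s s' \<and> (\<forall>v<n. rd s' aY v = yrec G \<tau> t w be x (Suc i) v)) \<and> rd s' cI 0 = int i)"
        proof (rule okK_Seq[where R = "\<lambda>s''. eqx {cW, nDot} s' s'' \<and> rd s'' nDot 0 = co" and g = "\<lambda>_. 0"])
          show "okD b (n + 1) COEFFICIENT_STEP s5 (\<lambda>s''. eqx {cW, nDot} s' s'' \<and> rd s'' nDot 0 = co)"
            by (rule okD_SV) (use s5 b0 cob e c in \<open>auto simp: eqx_rd co_def\<close>)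
          fix s6 assume s6: "bnd b s6" "eqx {cW, nDot} s' s6 \<and> rd s6 nDot 0 = co"
          have "okD b ((n + 1) * 1) ADD_STEP s6
             (\<lambda>s''. (eqx ?U s' s'' \<and> rd s'' nDot 0 = co \<and> (\<forall>v<n. rd s'' aY v = (if v < n then yrec G \<tau> t w be x (Suc i) v else yrec G \<tau> t w be x i v))) \<and> rd s'' cW 0 = int n)"
          proof (rule okD_For[where I = "\<lambda>k s''. eqx ?U s' s'' \<and> rd s'' nDot 0 = co \<and> (\<forall>v<n. rd s'' aY v = (if v < k then yrec G \<tau> t w be x (Suc i) v else yrec G \<tau> t w be x i v))"])
            fix k s7 assume k: "k < n" and I7: "eqx ?U s' s7 \<and> rd s7 nDot 0 = co \<and> (\<forall>v<n. rd s7 aY v = (if v < k then yrec G \<tau> t w be x (Suc i) v else yrec G \<tau> t w be x i v))"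
              and c7: "rd s7 cW 0 = int k" and b7: "bnd b s7"
            have e7: "rd s7 nN 0 = int n" "rd s7 cI 0 = int i" "rd s7 aB i = be i" "rd s7 aW (i * n + k) = w i k" using I7 e c k by (auto simp: eqx_rd)
            note v7 = val_IV[OF e7(2,1) c7]
            show "okD b 1 (SA aY (V cW) (Add (Mul (AR aB (V cI)) (AR aY (V cW))) (Mul (AR aW IV) (V nDot)))) s7
              (\<lambda>s''. (eqx ?U s' s'' \<and> rd s'' nDot 0 = co \<and> (\<forall>v<n. rd s'' aY v = (if v < Suc k then yrec G \<tau> t w be x (Suc i) v else yrec G \<tau> t w be x i v))) \<and> rd s'' cW 0 = int k)"
              by (rule okD_SA[where i = k]) (use b7 b0 I7 c7 e7 yb[of k] k in \<open>auto simp: v7 yS simp del: of_nat_add of_nat_mult yrec.simps\<close>)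
          qed (use s6 b lenn e I in \<open>auto simp: eqx_rd intro: eqx_mono\<close>)
          thus "okD b (n + 1) ADD_STEP s6
            (\<lambda>s'. (eqx modMV s s' \<and> (\<forall>v<n. rd s' aY v = yrec G \<tau> t w be x (Suc i) v)) \<and> rd s' cI 0 = int i)"
          proof (rule okD_conseq)
            fix s8 assume s8: "(eqx ?U s' s8 \<and> rd s8 nDot 0 = co \<and> (\<forall>v<n. rd s8 aY v = (if v < n then yrec G \<tau> t w be x (Suc i) v else yrec G \<tau> t w be x i v))) \<and> rd s8 cW 0 = int n"
            hence "eqx modMV s' s8" by (auto intro: eqx_mono)
            hence "eqx modMV s s8" using I eqx_trans by blast
            moreover have "rd s8 cI 0 = int i" using s8 c by (auto simp: eqx_rd)
            ultimately show "(eqx modMV s s8 \<and> (\<forall>v<n. rd s8 aY v = yrec G \<tau> t w be x (Suc i) v)) \<and> rd s8 cI 0 = int i"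
              using s8 by (simp del: yrec.simps)
          qed simp
        qed
      qed
    qed
  qed (use s2 b lenq st in \<open>auto simp: st_mat_def eqx_rd y0_def\<close>)
  show ?thesis unfolding MATVEC_def
  proof (rule okK_Seq[OF okK_conseq[OF L1]])
    show "(n + 1) * 1 \<le> ?K" by simp
    fix s1 assume s1: "bnd b s1" "(eqx modMV s s1 \<and> (\<forall>v<n. rd s1 aY v = 0)) \<and> rd s1 cV 0 = int n"
    show "okD b ?K (Seq (For cE (V nM) (Seq (addE EU EV) (addE EV EU)))
            (For cI (V nQ)
              (Seq (SV nDot (Const 0)) (Seq DOT_STEP (Seq COEFFICIENT_STEP ADD_STEP))))) s1
       (\<lambda>s'. eqx modMV s s' \<and> (\<forall>v<n. rd s' aY v = yrec G \<tau> t w be x q v))"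
    proof (rule okK_Seq[OF okK_conseq[OF L2]])
      show "(m + 1) * 1 \<le> ?K" by simp
      fix s2 assume s2: "bnd b s2" "(eqx modMV s s2 \<and> (\<forall>v<n. rd s2 aY v = y0 m v)) \<and> rd s2 cE 0 = int m"
      show "okD b ?K (For cI (V nQ)
              (Seq (SV nDot (Const 0)) (Seq DOT_STEP (Seq COEFFICIENT_STEP ADD_STEP)))) s2
         (\<lambda>s'. eqx modMV s s' \<and> (\<forall>v<n. rd s' aY v = yrec G \<tau> t w be x q v))"
        by (rule okK_conseq[OF L3]) (use s2 in \<open>auto simp: add_mult_distrib2 simp del: yrec.simps\<close>)
    qed (use s1 in auto)
  qed auto
qed

end

section \<open>Spectral stages\<close>

abbreviation (input) "nMM \<equiv> 8 :: nat"
abbreviation (input) "nF \<equiv> 9 :: nat"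
abbreviation (input) "nThr \<equiv> 12 :: nat"
abbreviation (input) "nA \<equiv> 13 :: nat"
abbreviation (input) "nBeta \<equiv> 14 :: nat"
abbreviation (input) "nBest \<equiv> 15 :: nat"
abbreviation (input) "cIt \<equiv> 24 :: nat"
abbreviation (input) "aHv \<equiv> 33 :: nat"
abbreviation (input) "aBX \<equiv> 40 :: nat"

definition absE :: "expr \<Rightarrow> expr" where
  "absE e = Mul e (Sub (Const 1) (Mul (Const 2) (Less e (Const 0))))"

lemma val_absE [simp]: "val (absE e) s = \<bar>val e s\<bar>" by (simp add: absE_def)

definition HCUBE :: expr where "HCUBE = Mul (V nH) (Mul (V nH) (V nH))"

lemma val_HCUBE [simp]: "val HCUBE s = rd s nH 0 ^ 3" by (simp add: HCUBE_def numeral_eq_Suc)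

definition POWER_STEP :: prog where
  "POWER_STEP = For cV (V nN) (SA aX (V cV) (Sub (Mul (Mul (Mul (Mul (Const 4) (V nP)) (V nH)) (V nS)) (AR aX (V cV)))
      (Mul (Mul (Const 2) (AR aHv (V cV))) (AR aY (V cV)))))"

definition THRESHOLD_STEP :: prog where
  "THRESHOLD_STEP = SV nThr (Mul (V nThr) (Mul (Mul (Add (Mul (Const 4) (V nP)) (Const 1)) (V nH)) (V nS)))"

definition POWER_ITERATION :: prog where
  "POWER_ITERATION = Seq (SV nThr HCUBE) (For cIt (V nIt) (Seq MATVEC (Seq POWER_STEP THRESHOLD_STEP)))"

definition NORM_X :: prog where
  "NORM_X = Seq (SV nA (Const 0)) (For cV (V nN) (SV nA (Add (V nA) (absE (AR aX (V cV))))))"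

definition SCALE :: prog where
  "SCALE = For cV (V nN) (SA aX (V cV) (Div (Mul (AR aX (V cV)) HCUBE) (Add (Const 1) (V nA))))"

definition QV :: expr where "QV = Add (Mul (V nQ) (V nN)) (V cV)"

lemma val_QV: "rd s nQ 0 = int q \<Longrightarrow> rd s nN 0 = int n \<Longrightarrow> rd s cV 0 = int v \<Longrightarrow> val QV s = int (q * n + v)"
  by (simp add: QV_def)

definition STORE_W :: prog where
  "STORE_W = Seq (SV nBeta (Const 0)) (For cV (V nN) (Seq (SA aW QV (AR aY (V cV)))
      (SV nBeta (Sub (V nBeta) (Mul (AR aX (V cV)) (AR aY (V cV)))))))"

definition NEXT_STAGE :: prog where
  "NEXT_STAGE = Seq (SA aB (V nQ) (V nBeta)) (Seq (SV nS (Mul (V nS) (V nBeta))) (Seq (SA aS (V nQ) (V nS))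
      (Seq (SV nQ (Add (V nQ) (Const 1))) (Seq (SV nMM (Mul (V nMM) (Mul (Const 1024) (V nP)))) (SV nF (Const 0))))))"

definition ACCEPT :: prog where "ACCEPT = Seq SCALE (Seq MATVEC (Seq STORE_W NEXT_STAGE))"

definition FLIPS :: prog where "FLIPS = For cV (V nN) (Flip (AD aX (V cV)))"

abbreviation (input) "JUDGE \<equiv> prog.If (Less (V nA) (V nThr)) (SV nF (Add (V nF) (Const 1))) ACCEPT"

definition TRIAL :: prog where
  "TRIAL = Seq FLIPS (Seq POWER_ITERATION (Seq NORM_X JUDGE))"

text \<open>The number of tolerated failures grows with the stage so that the failure probabilities
  of all stages form a geometric series.\<close>

definition SPECTRAL :: prog where
  "SPECTRAL = While (Less (V nF) (Add (V nP) (V nQ))) TRIAL"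

text \<open>After \<open>t\<close> steps an iterate is at most \<open>U q ^ (2 * t)\<close>. The
  matrix product, the threshold and the norm add at most one more factor \<open>U q\<close>, which
  the exponent \<open>2 * Nit + 3\<close> covers.\<close>

locale machine = graph_instance +
  fixes b k :: nat
  assumes b2: "b \<ge> 2" and kn: "k \<le> n" and Bz: "\<And>z. \<bar>z\<bar> \<le> U k ^ (2 * Nit + 3) \<Longrightarrow> len z \<le> b"
begin

lemma b0: "b > 0" using b2 by simp

lemma len_le_of_U_power: "\<bar>z\<bar> \<le> U k ^ j \<Longrightarrow> j \<le> 2 * Nit + 3 \<Longrightarrow> len z \<le> b"
proof (rule Bz)
  assume a: "\<bar>z\<bar> \<le> U k ^ j" "j \<le> 2 * Nit + 3"
  have "U k ^ j \<le> U k ^ (2 * Nit + 3)" using a U_ge(2) by (intro power_increasing) auto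
  thus "\<bar>z\<bar> \<le> U k ^ (2 * Nit + 3)" using a by linarith
qed

lemma H_le_U: "int H \<le> U i" "int H ^ 3 \<le> U i" "2 * int H ^ 2 \<le> U i" "2 \<le> int H" "j \<le> 7 \<Longrightarrow> int H ^ j \<le> U i"
proof -
  show H2: "2 \<le> int H" using H_powers(4) P by simp
  show pw: "j \<le> 7 \<Longrightarrow> int H ^ j \<le> U i" for j
    by (rule order_trans[OF power_increasing[of j 7 "int H"] U_ge(1)]) (use H_powers in auto)
  from pw[of 1] pw[of 3] show "int H \<le> U i" "int H ^ 3 \<le> U i" by auto
  have "2 * int H ^ 2 \<le> int H * int H ^ 2" using H2 by (intro mult_right_mono) auto
  also have "\<dots> = int H ^ 3" by (simp add: numeral_eq_Suc)
  finally show "2 * int H ^ 2 \<le> U i" using pw[of 3] by simp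
qed

lemma Sc_le_U: "wb_ok q w be \<Longrightarrow> i \<le> q \<Longrightarrow> Sc be i \<le> U i"
proof (induction i)
  case 0
  thus ?case using U_ge(2)[of 0] by (simp add: Sc_def)
next
  case (Suc i)
  have be: "0 < be i" "be i \<le> U i ^ 2" using Suc.prems by (auto simp: wb_ok_def)
  have "Sc be (Suc i) = Sc be i * be i" by (simp add: Sc_def)
  also have "\<dots> \<le> U i * U i ^ 2" using Suc be U_ge(2)[of i] by (intro mult_mono) auto
  also have "\<dots> = U i ^ 3" by (simp add: numeral_eq_Suc)
  also have "\<dots> \<le> U i ^ 8" using U_ge(2) by (intro power_increasing) auto
  finally show ?case unfolding U_ge(3) .
qed

text \<open>A step multiplies the bound by at most \<open>2 * H ^ 2 * U q\<close>, hence by at most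
  \<open>U q ^ 2\<close>.\<close>

lemma piter_bound:
  assumes wb: "wb_ok q w be" and z: "\<And>v. v < n \<Longrightarrow> \<bar>z v\<bar> \<le> 1" and v: "v < n"
  shows "\<bar>piter w be q z t v\<bar> \<le> U q ^ (2 * t)"
  using v
proof (induction t arbitrary: v)
  case (Suc t)
  define \<xi> where "\<xi> = U q ^ (2 * t)"
  have \<xi>: "0 \<le> \<xi>" using U_ge(2)[of q] by (simp add: \<xi>_def)
  have S: "0 < Sc be q" "Sc be q \<le> U q" using Sc_pos[of q be] Sc_le_U[OF wb, of q] wb by (auto simp: wb_ok_def)
  have y: "\<bar>yrec 1 0 (\<lambda>_. 0) w be (piter w be q z t) q v\<bar> \<le> U q * \<xi>"
    by (rule yrec_bound[OF wb _ \<xi> _ Suc.prems]) (use Suc \<xi> in \<open>auto simp: \<xi>_def\<close>)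
  have hvH: "int (hv v) \<le> int H" unfolding hv_def by simp
  have P4: "4 * int P \<le> int H"
  proof -
    have "4 * int P \<le> 1024 * int (P * P)" using P by simp
    hence "4 * int P \<le> 1024 * int (P\<^sup>2)" by (simp add: power2_eq_square)
    also have "\<dots> = int (1024 * P\<^sup>2)" by simp
    also have "\<dots> \<le> int H" using H_gt(5) by (simp only: of_nat_le_iff)
    finally show ?thesis .
  qed
  have 1: "\<bar>4 * int P * int H * Sc be q * piter w be q z t v\<bar> \<le> int H * int H * U q * \<xi>"
    unfolding abs_mult using S P4 Suc \<xi> U_ge(2)[of q] by (intro mult_mono) (auto simp: \<xi>_def)
  have 2: "\<bar>2 * int (hv v) * yrec 1 0 (\<lambda>_. 0) w be (piter w be q z t) q v\<bar> \<le> int H * int H * (U q * \<xi>)"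
    unfolding abs_mult using y hvH H_le_U(4) U_ge(2)[of q] \<xi> by (intro mult_mono) auto
  have "\<bar>piter w be q z (Suc t) v\<bar> \<le> int H * int H * U q * \<xi> + int H * int H * (U q * \<xi>)"
    unfolding piter.simps using 1 2 by linarith
  also have "\<dots> = (2 * int H ^ 2) * (U q * \<xi>)" by (simp add: power2_eq_square algebra_simps)
  also have "\<dots> \<le> U q * (U q * \<xi>)" using H_le_U(3) U_ge(2)[of q] \<xi> by (intro mult_right_mono) auto
  also have "\<dots> = U q ^ (2 * Suc t)" by (simp add: \<xi>_def)
  finally show ?case .
qed (use z in simp)

lemma four_P_le_H: "4 * int P + 1 \<le> int H"
proof -
  have "P \<le> P * P" using P by simp
  moreover have "4 * P + 1 \<le> 1024 * x" if "P \<le> x" for x using that P by simp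
  ultimately have "4 * P + 1 \<le> 1024 * (P * P)" by blast
  hence "4 * P + 1 \<le> H" using H_gt(5) unfolding power2_eq_square by linarith
  thus ?thesis by simp
qed

lemma thr_bound:
  assumes wb: "wb_ok q w be"
  shows "0 < thr be q t" "thr be q t \<le> U q ^ (2 * t + 1)"
proof -
  have S: "0 < Sc be q" "Sc be q \<le> U q" using Sc_pos[of q be] Sc_le_U[OF wb, of q] wb by (auto simp: wb_ok_def)
  have fp: "0 < (4 * int P + 1) * int H * Sc be q" using S H_gt by simp
  thus "0 < thr be q t" unfolding thr_def using H_gt by simp
  have "(4 * int P + 1) * int H * Sc be q \<le> int H * int H * U q" using four_P_le_H S by (intro mult_mono) auto
  also have "int H * int H * U q \<le> U q * U q"
    using H_le_U(5)[of 2 q] U_ge(2)[of q] by (intro mult_right_mono) (auto simp: power2_eq_square)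
  finally have "((4 * int P + 1) * int H * Sc be q) ^ t \<le> (U q * U q) ^ t" using fp by (intro power_mono) auto
  hence "thr be q t \<le> U q * (U q * U q) ^ t" unfolding thr_def using H_le_U(2)[of q] fp U_ge(2)[of q] by (intro mult_mono) auto
  also have "U q * (U q * U q) ^ t = U q ^ (2 * t + 1)" by (simp add: power_mult power2_eq_square)
  finally show "thr be q t \<le> U q ^ (2 * t + 1)" .
qed

text \<open>During the spectral stages \<open>\<tau>\<close> is 0, so the contents of the array of
  guesses do not have to be tracked.\<close>

lemma yrec_tau0: "yrec G 0 t w be x q v = yrec G 0 (\<lambda>_. 0) w be x q v"
  by (induction q arbitrary: v) auto

definition base :: "memory \<Rightarrow> bool" where
  "base s \<longleftrightarrow> env s \<and> rd s nH 0 = int H \<and> rd s nIt 0 = int Nit \<and> (\<forall>v<n. rd s aHv v = int (hv v)) \<and> rd s nG 0 = 1 \<and> rd s nTau 0 = 0"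

definition wS :: "memory \<Rightarrow> nat \<Rightarrow> nat \<Rightarrow> int" where "wS s i v = rd s aW (i * n + v)"
definition bS :: "memory \<Rightarrow> nat \<Rightarrow> int" where "bS s i = rd s aB i"

text \<open>The state between two trials. The zero best vector with value 0 is prepared for the
  enumeration: its rounding is a uniformly random cut.\<close>

definition specI :: "memory \<Rightarrow> nat \<Rightarrow> bool" where
  "specI s q \<longleftrightarrow> base s \<and> rd s nQ 0 = int q \<and> rd s nS 0 = Sc (bS s) q \<and> (\<forall>i<q. rd s aS i = Sc (bS s) (Suc i)) \<and>
     rd s nMM 0 = (1024 * int P) ^ q \<and> stage_inv k q (wS s) (bS s) \<and> (\<forall>i. rd s aBX i = 0) \<and> rd s nBest 0 = 0"

abbreviation "modS \<equiv> {cV, cE, cI, cW, nDot, aY, aX, nThr, nA, nBeta, nF, cIt}"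

lemma specI_eqx:
  assumes "specI s q" "eqx modS s s'"
  shows "specI s' q" "wS s' = wS s" "bS s' = bS s"
proof -
  show e: "wS s' = wS s" "bS s' = bS s" using assms(2) by (auto simp: wS_def bS_def eqx_rd intro!: ext)
  have "env s'" using assms by (intro env_eqx[OF _ assms(2)]) (auto simp: specI_def base_def)
  thus "specI s' q" using assms unfolding specI_def base_def e by (simp add: eqx_rd[OF assms(2)])
qed

lemma specI_mat: "specI s q \<Longrightarrow> st_mat s q (wS s) (bS s)"
  by (simp add: specI_def st_mat_def wS_def bS_def)

lemma specI_wb: "specI s q \<Longrightarrow> wb_ok q (wS s) (bS s)" "specI s q \<Longrightarrow> q \<le> k"
  by (auto simp: specI_def stage_inv_def)

lemma specI_len: "specI s q \<Longrightarrow> bnd b s \<Longrightarrow> len (int n) \<le> b" "specI s q \<Longrightarrow> bnd b s \<Longrightarrow> len (int Nit) \<le> b"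
  using bnd_rd[of b s nN 0] bnd_rd[of b s nIt 0] by (auto simp: specI_def base_def env_def)

lemma U_pow_le: "q \<le> k \<Longrightarrow> i \<le> j \<Longrightarrow> U q ^ i \<le> U k ^ j"
proof -
  assume a: "q \<le> k" "i \<le> j"
  have "U q ^ i \<le> U k ^ i" using U_mono[OF a(1)] U_ge(2)[of q] by (intro power_mono) auto
  also have "\<dots> \<le> U k ^ j" using a(2) U_ge(2)[of k] by (intro power_increasing) auto
  finally show ?thesis .
qed

abbreviation "modP \<equiv> {cV, cE, cI, cW, nDot, aY, aX, nThr, cIt}"

lemma eqx_modP: "eqx modP s s' \<Longrightarrow> eqx modS s s'"
  by (rule eqx_mono) auto

lemma ok_POWER_ITERATION:
  assumes s: "specI s q" "bnd b s" and z: "\<And>v. v < n \<Longrightarrow> rd s aX v = z v" "\<And>v. v < n \<Longrightarrow> \<bar>z v\<bar> \<le> 1"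
  shows "okD b ((Nit + 1) * ((q + 1) * (n + m + 1))) POWER_ITERATION s (\<lambda>s'. eqx modP s s' \<and>
      (\<forall>v<n. rd s' aX v = piter (wS s) (bS s) q z Nit v) \<and> rd s' nThr 0 = thr (bS s) q Nit)"
  unfolding POWER_ITERATION_def
proof (rule okK_Seq[where R = "\<lambda>s'. s' = upd s nThr 0 (int H ^ 3)" and g = "\<lambda>_. 0"])
  note wb = specI_wb(1)[OF s(1)] and qk = specI_wb(2)[OF s(1)]
  let ?w = "wS s" and ?be = "bS s"
  have Hs: "rd s nH 0 = int H" using s by (simp add: specI_def base_def)
  have len_le_of_H_power: "len (int H ^ 3) \<le> b" by (rule len_le_of_U_power[of _ 1]) (use H_le_U(2)[of k] in auto)
  show "okD b ((Nit + 1) * ((q + 1) * (n + m + 1))) (SV nThr HCUBE) s (\<lambda>s'. s' = upd s nThr 0 (int H ^ 3))"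
    by (rule okD_SV) (use s b0 Hs len_le_of_H_power in simp_all)
  fix s1 assume s1: "bnd b s1" "s1 = upd s nThr 0 (int H ^ 3)"
  let ?I = "\<lambda>t s'. eqx modP s s' \<and> (\<forall>v<n. rd s' aX v = piter ?w ?be q z t v) \<and> rd s' nThr 0 = thr ?be q t"
  have "okD b ((Nit + 1) * ((q + 1) * (n + m + 1))) (For cIt (V nIt) (Seq MATVEC (Seq POWER_STEP THRESHOLD_STEP))) s1 (\<lambda>s'. ?I Nit s' \<and> rd s' cIt 0 = int Nit)"
  proof (rule okD_For[where I = ?I])
    fix t s2 assume t: "t < Nit" and I: "?I t s2" and c: "rd s2 cIt 0 = int t" and b2': "bnd b s2"
    have sp: "specI s2 q" and w2: "wS s2 = ?w" "bS s2 = ?be" using specI_eqx[OF s(1) eqx_modP[OF conjunct1[OF I]]] by auto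
    define \<xi> where "\<xi> = U q ^ (2 * t)"
    define x where "x = piter ?w ?be q z t"
    have \<xi>: "0 \<le> \<xi>" using U_ge(2)[of q] by (simp add: \<xi>_def)
    have xb: "\<bar>x v\<bar> \<le> \<xi>" if "v < n" for v unfolding x_def \<xi>_def by (rule piter_bound[OF wb z(2) that])
    have mv: "okD b ((q + 1) * (n + m + 1)) MATVEC s2 (\<lambda>s'. eqx modMV s2 s' \<and> (\<forall>v<n. rd s' aY v = yrec 1 0 (rd s2 aT) ?w ?be x q v))"
    proof (rule ok_MATVEC[where \<xi> = \<xi>])
      show "st_mat s2 q ?w ?be" using specI_mat[OF sp] w2 by simp
      fix z' assume "\<bar>z'\<bar> \<le> U q * \<xi>"
      also have "\<dots> = U q ^ (2 * t + 1)" by (simp add: \<xi>_def)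
      also have "\<dots> \<le> U k ^ (2 * Nit + 3)" using t by (intro U_pow_le qk) auto
      finally show "len z' \<le> b" by (rule Bz)
    qed (use b2' b2 sp wb I xb \<xi> in \<open>auto simp: specI_def base_def x_def\<close>)
    show "okD b ((q + 1) * (n + m + 1)) (Seq MATVEC (Seq POWER_STEP THRESHOLD_STEP)) s2 (\<lambda>s'. ?I (Suc t) s' \<and> rd s' cIt 0 = int t)"
    proof (rule okK_Seq[OF mv])
      fix s3 assume s3: "bnd b s3" "eqx modMV s2 s3 \<and> (\<forall>v<n. rd s3 aY v = yrec 1 0 (rd s2 aT) ?w ?be x q v)"
      have e23: "eqx modP s2 s3" using s3 by (auto intro: eqx_mono)
      have sp3: "specI s3 q" "bS s3 = ?be" using specI_eqx[OF sp eqx_modP[OF e23]] w2 by auto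
      have x3: "rd s3 aX v = x v" if "v < n" for v using s3 I that by (auto simp: eqx_rd x_def)
      have y3: "rd s3 aY v = yrec 1 0 (\<lambda>_. 0) ?w ?be x q v" if "v < n" for v using s3 that yrec_tau0[of 1 "rd s2 aT" ?w ?be x q v] by simp
      let ?J = "\<lambda>j s'. eqx {cV, aX} s3 s' \<and> (\<forall>v<n. rd s' aX v = (if v < j then piter ?w ?be q z (Suc t) v else x v))"
      have "okD b ((n + 1) * 1) POWER_STEP s3 (\<lambda>s'. ?J n s' \<and> rd s' cV 0 = int n)"
        unfolding POWER_STEP_def
      proof (rule okD_For[where I = ?J])
        fix j s4 assume j: "j < n" and J: "?J j s4" and c4: "rd s4 cV 0 = int j" and b4: "bnd b s4"
        have e4: "rd s4 nP 0 = int P" "rd s4 nH 0 = int H" "rd s4 nS 0 = Sc ?be q" "rd s4 aHv j = int (hv j)" "rd s4 aY j = yrec 1 0 (\<lambda>_. 0) ?w ?be x q j"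
          "rd s4 aX j = x j"
          using J sp3 y3 j by (auto simp: eqx_rd specI_def base_def env_def)
        have bb: "len (piter ?w ?be q z (Suc t) j) \<le> b"
        proof (rule Bz)
          have "\<bar>piter ?w ?be q z (Suc t) j\<bar> \<le> U q ^ (2 * Suc t)" by (rule piter_bound[OF wb z(2) j])
          also have "\<dots> \<le> U k ^ (2 * Nit + 3)" using t by (intro U_pow_le qk) auto
          finally show "\<bar>piter ?w ?be q z (Suc t) j\<bar> \<le> U k ^ (2 * Nit + 3)" .
        qed
        show "okD b 1 (SA aX (V cV) (Sub (Mul (Mul (Mul (Mul (Const 4) (V nP)) (V nH)) (V nS)) (AR aX (V cV)))
            (Mul (Mul (Const 2) (AR aHv (V cV))) (AR aY (V cV))))) s4 (\<lambda>s'. ?J (Suc j) s' \<and> rd s' cV 0 = int j)"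
          by (rule okD_SA[where i = j]) (use b4 b0 J c4 e4 bb j in \<open>auto simp: x_def less_Suc_eq\<close>)
      qed (use s3 b2 sp3 specI_len[OF sp3(1) s3(1)] x3 in \<open>auto simp: eqx_rd specI_def base_def env_def\<close>)
      hence pwx: "okD b ((q + 1) * (n + m + 1)) POWER_STEP s3 (\<lambda>s'. ?J n s' \<and> rd s' cV 0 = int n)"
        by (rule okD_conseq) auto
      show "okD b ((q + 1) * (n + m + 1)) (Seq POWER_STEP THRESHOLD_STEP) s3 (\<lambda>s'. ?I (Suc t) s' \<and> rd s' cIt 0 = int t)"
      proof (rule okK_Seq[OF pwx])
        fix s5 assume s5: "bnd b s5" "?J n s5 \<and> rd s5 cV 0 = int n"
        have "eqx modP s3 s5" using s5 by (auto intro: eqx_mono)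
        hence e5: "eqx modP s s5" using I e23 eqx_trans by blast
        have r5: "rd s5 nP 0 = int P" "rd s5 nH 0 = int H" "rd s5 nS 0 = Sc ?be q" "rd s5 nThr 0 = thr ?be q t" "rd s5 cIt 0 = int t"
          using s5 sp3 s3 I c by (auto simp: eqx_rd specI_def base_def env_def)
        have tS: "thr ?be q t * ((4 * int P + 1) * int H * Sc ?be q) = thr ?be q (Suc t)" by (simp add: thr_def)
        have tb: "len (thr ?be q (Suc t)) \<le> b"
        proof (rule Bz)
          have "\<bar>thr ?be q (Suc t)\<bar> \<le> U q ^ (2 * Suc t + 1)" using thr_bound[OF wb, of "Suc t"] by simp
          also have "\<dots> \<le> U k ^ (2 * Nit + 3)" using t by (intro U_pow_le qk) auto
          finally show "\<bar>thr ?be q (Suc t)\<bar> \<le> U k ^ (2 * Nit + 3)" .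
        qed
        show "okD b ((q + 1) * (n + m + 1)) THRESHOLD_STEP s5 (\<lambda>s'. ?I (Suc t) s' \<and> rd s' cIt 0 = int t)"
          unfolding THRESHOLD_STEP_def
          by (rule okD_SV) (use s5 b0 r5 tb tS e5 in \<open>auto simp del: piter.simps\<close>)
      qed
    qed
  qed (use s1 b2 s specI_len[OF s] z Hs in \<open>auto simp: thr_def eqx_rd specI_def base_def\<close>)
  thus "okD b ((Nit + 1) * ((q + 1) * (n + m + 1))) (For cIt (V nIt) (Seq MATVEC (Seq POWER_STEP THRESHOLD_STEP))) s1 (\<lambda>s'. ?I Nit s')"
    by (rule okD_conseq) auto
qed

lemma ok_NORM_X:
  assumes s: "specI s q" "bnd b s" and x: "\<And>v. v < n \<Longrightarrow> rd s aX v = x v" "\<And>v. v < n \<Longrightarrow> \<bar>x v\<bar> \<le> U q ^ (2 * Nit)"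
  shows "okD b (n + 1) NORM_X s (\<lambda>s'. eqx {cV, nA} s s' \<and> rd s' nA 0 = (\<Sum>v<n. \<bar>x v\<bar>))"
  unfolding NORM_X_def
proof (rule okK_Seq[where R = "\<lambda>s'. s' = upd s nA 0 0" and g = "\<lambda>_. 0"])
  show "okD b (n + 1) (SV nA (Const 0)) s (\<lambda>s'. s' = upd s nA 0 0)"
    by (rule okD_SV) (use s b2 in \<open>auto simp: len_0\<close>)
  fix s1 assume s1: "bnd b s1" "s1 = upd s nA 0 0"
  let ?I = "\<lambda>j s'. eqx {cV, nA} s s' \<and> rd s' nA 0 = (\<Sum>v<j. \<bar>x v\<bar>)"
  have "okD b ((n + 1) * 1) (For cV (V nN) (SV nA (Add (V nA) (absE (AR aX (V cV)))))) s1 (\<lambda>s'. ?I n s' \<and> rd s' cV 0 = int n)"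
  proof (rule okD_For[where I = ?I])
    fix j s2 assume j: "j < n" and I: "?I j s2" and c: "rd s2 cV 0 = int j" and b2': "bnd b s2"
    have bb: "len (\<Sum>v<Suc j. \<bar>x v\<bar>) \<le> b"
    proof (rule len_le_of_U_power)
      have "\<bar>\<Sum>v<Suc j. \<bar>x v\<bar>\<bar> \<le> (\<Sum>v<Suc j. U q ^ (2 * Nit))"
        by (rule order_trans[OF sum_abs], intro sum_mono) (use x j in auto)
      also have "\<dots> = int (Suc j) * U q ^ (2 * Nit)" by simp
      also have "\<dots> \<le> U q * U q ^ (2 * Nit)" using j H_powers(2) H_le_U(1)[of q] U_ge(2)[of q] by (intro mult_right_mono) auto
      also have "\<dots> = U q ^ (2 * Nit + 1)" by simp
      also have "\<dots> \<le> U k ^ (2 * Nit + 1)" by (intro U_pow_le specI_wb[OF s(1)]) auto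
      finally show "\<bar>\<Sum>v<Suc j. \<bar>x v\<bar>\<bar> \<le> U k ^ (2 * Nit + 1)" .
    qed simp
    show "okD b 1 (SV nA (Add (V nA) (absE (AR aX (V cV))))) s2 (\<lambda>s'. ?I (Suc j) s' \<and> rd s' cV 0 = int j)"
      by (rule okD_SV) (use b2' b0 I c bb x j in \<open>auto simp: eqx_rd\<close>)
  qed (use s1 b2 s specI_len[OF s] in \<open>auto simp: eqx_rd specI_def base_def env_def\<close>)
  thus "okD b (n + 1) (For cV (V nN) (SV nA (Add (V nA) (absE (AR aX (V cV)))))) s1 (\<lambda>s'. ?I n s')"
    by (rule okD_conseq) auto
qed

end

text \<open>Expectation of \<open>h\<close> at a linear form in the coins, when \<open>r\<close>
  coins are still to come and the earlier ones contribute \<open>c\<close>. The backward recursion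
  makes it a potential for the loop that flips them.\<close>

fun ev :: "(real \<Rightarrow> real) \<Rightarrow> (nat \<Rightarrow> real) \<Rightarrow> nat \<Rightarrow> nat \<Rightarrow> real \<Rightarrow> real" where
  "ev h a N 0 c = h c"
| "ev h a N (Suc r) c = (ev h a N r c + ev h a N r (c + a (N - Suc r))) / 2"

lemma ev_nonneg: "(\<And>c. h c \<ge> 0) \<Longrightarrow> ev h a N r c \<ge> 0"
  by (induction r arbitrary: c) auto

lemma ev_const: "ev (\<lambda>_. x) a N r c = x"
  by (induction r arbitrary: c) auto

text \<open>A coupling: both evaluations see the same remaining coins, so their arguments always
  differ by \<open>d\<close>.\<close>

lemma ev_pair:
  assumes "\<And>c. h c + h (c + d) \<ge> x"
  shows "ev h a N r c + ev h a N r (c + d) \<ge> x"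
proof (induction r arbitrary: c)
  case (Suc r)
  have "ev h a N r c + ev h a N r (c + d) \<ge> x" "ev h a N r (c + a (N - Suc r)) + ev h a N r (c + d + a (N - Suc r)) \<ge> x"
    using Suc[of c] Suc[of "c + a (N - Suc r)"] by (simp_all add: add_ac)
  thus ?case unfolding ev.simps by argo
qed (use assms in simp)

text \<open>Flipping the coin at position \<open>j\<close> moves the linear form by at least \<open>2 * \<theta>\<close>, so at most one of
  the two outcomes is bad.\<close>

lemma ev_lower:
  assumes h: "\<And>c. h c = (if \<bar>c\<bar> \<ge> \<theta> then hi else lo)" and hl: "hi \<ge> lo" and j: "j < N" "\<bar>a j\<bar> \<ge> 2 * \<theta>"
  shows "N - r \<le> j \<Longrightarrow> r \<le> N \<Longrightarrow> ev h a N r c \<ge> (hi + lo) / 2"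
proof (induction r arbitrary: c)
  case (Suc r)
  show ?case
  proof (cases "N - Suc r = j")
    case True
    have "h c + h (c + a j) \<ge> hi + lo" for c using hl j(2) unfolding h by auto
    from ev_pair[where h = h and d = "a j" and x = "hi + lo" and a = a and N = N and r = r and c = c, OF this] show ?thesis using True by simp
  next
    case False
    hence "N - r \<le> j" "r \<le> N" using Suc.prems by auto
    from Suc.IH[OF this, of c] Suc.IH[OF this, of "c + a (N - Suc r)"] show ?thesis by simp
  qed
qed (use j in simp)

context graph_instance
begin

lemma qf_bm_cong:
  assumes "\<And>i v. i < q \<Longrightarrow> v < n \<Longrightarrow> w i v = w' i v" "\<And>i. i < q \<Longrightarrow> be i = be' i"
  shows "qf n (bm w be q) y = qf n (bm w' be' q) y"
proof -
  have "bm w be q u v = bm w' be' q u v" if "u < n" "v < n" for u v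
    by (rule bm_cong) (use assms that in auto)
  thus ?thesis unfolding qf_def ip_def mv_def by simp
qed

lemma stage_inv_cong:
  assumes "stage_inv k q w be" "\<And>i v. i < q \<Longrightarrow> v < n \<Longrightarrow> w i v = w' i v" "\<And>i. i < q \<Longrightarrow> be i = be' i"
  shows "stage_inv k q w' be'"
proof -
  have "qf n (bm w be q) = qf n (bm w' be' q)" by (rule ext, rule qf_bm_cong) (use assms in auto)
  thus ?thesis using assms unfolding stage_inv_def wb_ok_def codim_nonneg_def by simp
qed

lemma Sc_cong: "(\<And>i. i < q \<Longrightarrow> be i = be' i) \<Longrightarrow> Sc be q = Sc be' q"
  unfolding Sc_def by (intro prod.cong) auto

end

context machine
begin

lemma base_eqx: "base s \<Longrightarrow> eqx M s s' \<Longrightarrow> {nN, nM, nP, nH, nIt, aHv, nG, nTau} \<inter> M = {} \<Longrightarrow> base s'"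
  using env_eqx[of s M s'] by (simp add: base_def eqx_rd)

lemma guess_count_le_U: "q \<le> k \<Longrightarrow> (1024 * int P) ^ q \<le> U k"
proof -
  assume q: "q \<le> k"
  have "1024 * P \<le> 1024 * P\<^sup>2" using P by (simp add: power2_eq_square)
  hence "1024 * P \<le> H" using H_gt(5) by linarith
  hence "(1024 * int P) ^ q \<le> int H ^ q" by (intro power_mono) auto
  also have "\<dots> \<le> int H ^ (7 * 8 ^ k)"
  proof (intro power_increasing)
    have "k < 8 ^ k" by (rule less_le_trans[OF less_exp]) (intro power_mono, auto)
    thus "q \<le> 7 * 8 ^ k" using q by linarith
  qed (use H_powers in auto)
  also have "\<dots> = U k" unfolding U_def by (simp add: power_mult)
  finally show ?thesis .
qed

lemma ok_FLIPS:
  assumes s: "specI s q" "bnd b s" and h: "\<And>c. h c \<ge> 0"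
  shows "okK b (n + 1) FLIPS s (\<lambda>s'. eqx {cV, aX} s s' \<and> (\<forall>v<n. rd s' aX v = 0 \<or> rd s' aX v = 1))
     (\<lambda>s'. h (\<Sum>v<n. a v * of_int (rd s' aX v))) (ev h a n n 0)"
proof -
  let ?I = "\<lambda>j s'. eqx {cV, aX} s s' \<and> (\<forall>v<j. rd s' aX v = 0 \<or> rd s' aX v = 1)"
  let ?\<phi> = "\<lambda>j s'. ev h a n (n - j) (\<Sum>v<j. a v * of_int (rd s' aX v))"
  have "okK b ((n + 1) * 1) FLIPS s (\<lambda>s'. ?I n s' \<and> rd s' cV 0 = int n) (?\<phi> n) (ev h a n n 0)"
    unfolding FLIPS_def
  proof (rule okK_For[where I = ?I and \<phi> = ?\<phi>])
    fix j s1 assume j: "j < n" and I: "?I j s1" and c: "rd s1 cV 0 = int j" and b1: "bnd b s1"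
    have nj: "n - j = Suc (n - Suc j)" "n - Suc (n - Suc j) = j" using j by auto
    have S: "(\<Sum>v<Suc j. a v * of_int (rd (upd s1 aX j x) aX v)) = (\<Sum>v<j. a v * of_int (rd s1 aX v)) + a j * of_int x" for x
      by (simp add: sum.lessThan_Suc)
    show "okK b 1 (Flip (AD aX (V cV))) s1 (\<lambda>s'. ?I (Suc j) s' \<and> rd s' cV 0 = int j) (?\<phi> (Suc j)) (?\<phi> j s1)"
    proof (rule okK_Flip[where i = j])
      show "?\<phi> j s1 \<le> (?\<phi> (Suc j) (upd s1 aX j 0) + ?\<phi> (Suc j) (upd s1 aX j 1)) / 2"
        unfolding S nj(1) ev.simps nj(2) by simp
    qed (use b1 b2 I c ev_nonneg[of h] h in \<open>auto simp: less_Suc_eq\<close>)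
  qed (use s b2 specI_len[OF s] in \<open>auto simp: eqx_rd specI_def base_def env_def\<close>)
  thus ?thesis by (rule okK_conseq) auto
qed

definition scaled :: "(nat \<Rightarrow> int) \<Rightarrow> nat \<Rightarrow> int" where
  "scaled x v = x v * int H ^ 3 div (1 + (\<Sum>v<n. \<bar>x v\<bar>))"

text \<open>The program never compares \<open>q\<close> with \<open>k\<close>. That the new data
  still fit into \<open>b\<close> bits rests on \<open>Suc q \<le> k\<close>, which
  \<open>stage_step\<close> derives from the acceptance itself.\<close>

lemma ok_ACCEPT:
  assumes s: "specI s q" "bnd b s" and x: "\<And>v. v < n \<Longrightarrow> rd s aX v = x v" "rd s nA 0 = (\<Sum>v<n. \<bar>x v\<bar>)"
    and xp: "\<And>v. v < n \<Longrightarrow> x v = piter (wS s) (bS s) q z Nit v" and z: "\<And>v. v < n \<Longrightarrow> \<bar>z v\<bar> \<le> 1"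
    and acc: "thr (bS s) q Nit \<le> (\<Sum>v<n. \<bar>x v\<bar>)"
  shows "okD b ((q + 1) * (n + m + 1)) ACCEPT s (\<lambda>s'. specI s' (Suc q) \<and> rd s' nF 0 = 0)"
proof -
  let ?w = "wS s" and ?be = "bS s" and ?K = "(q + 1) * (n + m + 1)"
  note wb = specI_wb(1)[OF s(1)] and qk = specI_wb(2)[OF s(1)]
  have K1: "?K \<ge> 1" "n + 1 \<le> ?K" by auto
  have n0: "n > 0" using thr_bound(1)[OF wb, of Nit] acc by (cases n) auto
  define u where "u = scaled x"
  define Y where "Y = yrec 1 0 (\<lambda>_. 0) ?w ?be u q"
  define w' where "w' i v = (if i = q then Y v else ?w i v)" for i v
  define be' where "be' i = (if i = q then - (\<Sum>v<n. u v * Y v) else ?be i)" for i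
  note ST = stage_step[of k q ?w ?be z x u w' be', OF _ kn n0 z xp acc]
  have inv': "stage_inv k (Suc q) w' be'" and u3: "\<And>v. v < n \<Longrightarrow> \<bar>u v\<bar> \<le> int H ^ 3"
    using ST s(1) by (auto simp: specI_def u_def scaled_def w'_def be'_def Y_def)
  have wb': "wb_ok (Suc q) w' be'" and qk': "Suc q \<le> k" using inv' by (auto simp: stage_inv_def)
  have Yb: "\<bar>Y v\<bar> \<le> U q ^ 2" if "v < n" for v using wb' that by (auto simp: wb_ok_def w'_def)
  have beb: "0 < be' q" "be' q \<le> U q ^ 2" using wb' by (auto simp: wb_ok_def)
  have lenn: "len (int n) \<le> b" by (rule specI_len[OF s])
  have rs: "rd s nN 0 = int n" "rd s nH 0 = int H" "rd s nQ 0 = int q" "rd s nP 0 = int P" "rd s nS 0 = Sc ?be q" "rd s nMM 0 = (1024 * int P) ^ q"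
    using s by (auto simp: specI_def base_def env_def)
  let ?I1 = "\<lambda>j s'. eqx {cV, aX} s s' \<and> (\<forall>v<n. rd s' aX v = (if v < j then u v else x v))"
  have sc: "okD b ?K SCALE s (\<lambda>s'. ?I1 n s' \<and> rd s' cV 0 = int n)"
  proof (rule okD_conseq)
    show "okD b ((n + 1) * 1) SCALE s (\<lambda>s'. ?I1 n s' \<and> rd s' cV 0 = int n)"
      unfolding SCALE_def
    proof (rule okD_For[where I = ?I1])
      fix j s1 assume j: "j < n" and I: "?I1 j s1" and c: "rd s1 cV 0 = int j" and b1: "bnd b s1"
      have e: "rd s1 nH 0 = int H" "rd s1 nA 0 = (\<Sum>v<n. \<bar>x v\<bar>)" "rd s1 aX j = x j" using I j rs x by (auto simp: eqx_rd)
      have lu: "len (u j) \<le> b" by (rule len_le_of_U_power[of _ 1]) (use u3[OF j] H_le_U(2)[of k] in auto)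
      show "okD b 1 (SA aX (V cV) (Div (Mul (AR aX (V cV)) HCUBE) (Add (Const 1) (V nA)))) s1 (\<lambda>s'. ?I1 (Suc j) s' \<and> rd s' cV 0 = int j)"
        by (rule okD_SA[where i = j]) (use b1 b0 I c e lu j in \<open>auto simp: u_def scaled_def less_Suc_eq\<close>)
    qed (use s b2 lenn rs x in \<open>auto simp: eqx_rd\<close>)
  qed (use K1 in auto)
  show ?thesis unfolding ACCEPT_def
  proof (rule okK_Seq[OF sc])
    fix s1 assume s1: "bnd b s1" "?I1 n s1 \<and> rd s1 cV 0 = int n"
    have e1: "eqx modS s s1" using s1 by (auto intro: eqx_mono)
    note sp1 = specI_eqx[OF s(1) e1]
    have x1: "rd s1 aX v = u v" if "v < n" for v using s1 that by auto
    have mv: "okD b ?K MATVEC s1 (\<lambda>s'. eqx modMV s1 s' \<and> (\<forall>v<n. rd s' aY v = yrec 1 0 (rd s1 aT) ?w ?be u q v))"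
    proof (rule ok_MATVEC[where \<xi> = "int H ^ 3"])
      show "st_mat s1 q ?w ?be" using specI_mat[OF sp1(1)] sp1 by simp
      fix z' assume "\<bar>z'\<bar> \<le> U q * int H ^ 3"
      also have "\<dots> \<le> U q * U q" using H_le_U(2)[of q] U_ge(2)[of q] by (intro mult_left_mono) auto
      also have "\<dots> = U q ^ 2" by (simp add: power2_eq_square)
      also have "\<dots> \<le> U k ^ (2 * Nit + 3)" by (intro U_pow_le qk) auto
      finally show "len z' \<le> b" by (rule Bz)
    qed (use s1 b2 sp1 wb u3 x1 in \<open>auto simp: specI_def base_def\<close>)
    show "okD b ?K (Seq MATVEC (Seq STORE_W NEXT_STAGE)) s1 (\<lambda>s'. specI s' (Suc q) \<and> rd s' nF 0 = 0)"
    proof (rule okK_Seq[OF mv])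
      fix s2 assume s2: "bnd b s2" "eqx modMV s1 s2 \<and> (\<forall>v<n. rd s2 aY v = yrec 1 0 (rd s1 aT) ?w ?be u q v)"
      have e12: "eqx modS s1 s2" using s2 by (auto intro: eqx_mono)
      have e2: "eqx modS s s2" using e1 e12 eqx_trans by blast
      note sp2 = specI_eqx[OF s(1) e2]
      have y2: "rd s2 aY v = Y v" if "v < n" for v using s2 that yrec_tau0[of 1 "rd s1 aT" ?w ?be u q v] by (simp add: Y_def)
      have x2: "rd s2 aX v = u v" if "v < n" for v using x1[OF that] by (simp add: eqx_rd[OF conjunct1[OF s2(2)]])
      have rs2: "rd s2 nN 0 = int n" "rd s2 nQ 0 = int q" "rd s2 nP 0 = int P" "rd s2 nS 0 = Sc ?be q" "rd s2 nMM 0 = (1024 * int P) ^ q"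
        using rs by (simp_all add: eqx_rd[OF e2])
      \<comment> \<open>The array is described at every flat index, so the rows of earlier stages
        are known to survive.\<close>
      let ?I2 = "\<lambda>j s'. eqx {cV, aW, nBeta} s2 s' \<and> rd s' nBeta 0 = - (\<Sum>v<j. u v * Y v) \<and>
          (\<forall>l. rd s' aW l = (if q * n \<le> l \<and> l < q * n + j then Y (l - q * n) else rd s2 aW l))"
      have stw: "okD b ?K STORE_W s2 (\<lambda>s'. ?I2 n s' \<and> rd s' cV 0 = int n)"
        unfolding STORE_W_def
      proof (rule okK_Seq[where R = "\<lambda>s'. s' = upd s2 nBeta 0 0" and g = "\<lambda>_. 0"])
        show "okD b ?K (SV nBeta (Const 0)) s2 (\<lambda>s'. s' = upd s2 nBeta 0 0)"
          by (rule okD_SV) (use s2 b2 K1 in \<open>simp_all add: len_0\<close>)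
        fix s3 assume s3: "bnd b s3" "s3 = upd s2 nBeta 0 0"
        have "okD b ((n + 1) * 1) (For cV (V nN) (Seq (SA aW QV (AR aY (V cV)))
          (SV nBeta (Sub (V nBeta) (Mul (AR aX (V cV)) (AR aY (V cV))))))) s3 (\<lambda>s'. ?I2 n s' \<and> rd s' cV 0 = int n)"
        proof (rule okD_For[where I = ?I2])
          fix j s4 assume j: "j < n" and I: "?I2 j s4" and c: "rd s4 cV 0 = int j" and b4: "bnd b s4"
          have e4: "rd s4 nN 0 = int n" "rd s4 nQ 0 = int q" "rd s4 aX j = u j" "rd s4 aY j = Y j"
            using I j rs2 x2 y2 by (auto simp: eqx_rd)
          have lY: "len (Y j) \<le> b"
          proof (rule len_le_of_U_power[of _ 2])
            have "U q ^ 2 \<le> U k ^ 2" by (intro U_pow_le qk) auto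
            thus "\<bar>Y j\<bar> \<le> U k ^ 2" using Yb[OF j] by linarith
          qed simp
          have lS: "len (- (\<Sum>v<Suc j. u v * Y v)) \<le> b"
          proof (rule len_le_of_U_power[of _ 4])
            have "\<bar>- (\<Sum>v<Suc j. u v * Y v)\<bar> \<le> (\<Sum>v<Suc j. int H ^ 3 * U q ^ 2)"
              unfolding abs_minus_cancel by (rule order_trans[OF sum_abs], intro sum_mono, unfold abs_mult, intro mult_mono) (use u3 Yb j in auto)
            also have "\<dots> = int (Suc j) * (int H ^ 3 * U q ^ 2)" by simp
            also have "\<dots> \<le> U q * (U q * U q ^ 2)"
              using j H_powers(2) H_le_U(1,2)[of q] U_ge(2)[of q] by (intro mult_mono mult_right_mono) auto
            also have "\<dots> = U q ^ 4" by (simp add: numeral_eq_Suc)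
            also have "\<dots> \<le> U k ^ 4" by (intro U_pow_le qk) auto
            finally show "\<bar>- (\<Sum>v<Suc j. u v * Y v)\<bar> \<le> U k ^ 4" .
          qed (simp add: Nit_def)
          note vQ = val_QV[OF e4(2,1) c]
          show "okD b 1 (Seq (SA aW QV (AR aY (V cV))) (SV nBeta (Sub (V nBeta) (Mul (AR aX (V cV)) (AR aY (V cV)))))) s4
             (\<lambda>s'. ?I2 (Suc j) s' \<and> rd s' cV 0 = int j)"
          proof (rule okK_Seq[where R = "\<lambda>s'. s' = upd s4 aW (q * n + j) (Y j)" and g = "\<lambda>_. 0"])
            show "okD b 1 (SA aW QV (AR aY (V cV))) s4 (\<lambda>s'. s' = upd s4 aW (q * n + j) (Y j))"
              by (rule okD_SA[where i = "q * n + j"]) (use b4 b0 e4 c vQ lY in simp_all)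
            fix s5 assume s5: "bnd b s5" "s5 = upd s4 aW (q * n + j) (Y j)"
            have v5: "val (Sub (V nBeta) (Mul (AR aX (V cV)) (AR aY (V cV)))) s5 = - (\<Sum>v<Suc j. u v * Y v)"
              using s5(2) I e4 c by simp
            show "okD b 1 (SV nBeta (Sub (V nBeta) (Mul (AR aX (V cV)) (AR aY (V cV))))) s5 (\<lambda>s'. ?I2 (Suc j) s' \<and> rd s' cV 0 = int j)"
            proof (rule okD_SV)
              show "?I2 (Suc j) (upd s5 nBeta 0 (val (Sub (V nBeta) (Mul (AR aX (V cV)) (AR aY (V cV)))) s5)) \<and>
                rd (upd s5 nBeta 0 (val (Sub (V nBeta) (Mul (AR aX (V cV)) (AR aY (V cV)))) s5)) cV 0 = int j"
                unfolding v5 using s5(2) I c by (auto simp: less_Suc_eq)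
            qed (use s5(1) b0 lS v5 in simp_all)
          qed
        qed (use s3 b2 lenn rs2 in \<open>auto simp: eqx_rd\<close>)
        thus "okD b ?K (For cV (V nN) (Seq (SA aW QV (AR aY (V cV)))
          (SV nBeta (Sub (V nBeta) (Mul (AR aX (V cV)) (AR aY (V cV))))))) s3 (\<lambda>s'. ?I2 n s' \<and> rd s' cV 0 = int n)"
          by (rule okD_conseq) (use K1 in auto)
      qed
      show "okD b ?K (Seq STORE_W NEXT_STAGE) s2 (\<lambda>s'. specI s' (Suc q) \<and> rd s' nF 0 = 0)"
      proof (rule okK_Seq[OF stw])
        fix s3 assume s3: "bnd b s3" "?I2 n s3 \<and> rd s3 cV 0 = int n"
        have e23: "eqx {cV, aW, nBeta} s2 s3" using s3 by blast
        have r3: "rd s3 nQ 0 = int q" "rd s3 nP 0 = int P" "rd s3 nS 0 = Sc ?be q" "rd s3 nMM 0 = (1024 * int P) ^ q" "rd s3 nBeta 0 = be' q"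
          using rs2 s3 by (simp_all add: eqx_rd[OF e23] be'_def)
        have beS: "Sc ?be q * be' q = Sc be' (Suc q)"
        proof -
          have "Sc ?be q = Sc be' q" by (rule Sc_cong) (simp add: be'_def)
          thus ?thesis by (simp add: Sc_def)
        qed
        have MS: "(1024 * int P) ^ q * (1024 * int P) = (1024 * int P) ^ Suc q" by simp
        have l1: "len (be' q) \<le> b"
        proof (rule len_le_of_U_power[of _ 2])
          have "U q ^ 2 \<le> U k ^ 2" by (intro U_pow_le qk) auto
          thus "\<bar>be' q\<bar> \<le> U k ^ 2" using beb by linarith
        qed simp
        have l2: "len (Sc be' (Suc q)) \<le> b"
        proof (rule len_le_of_U_power[of _ 1])
          have "Sc be' (Suc q) \<le> U (Suc q)" "0 < Sc be' (Suc q)" using Sc_le_U[OF wb' order_refl] Sc_pos[of "Suc q" be'] wb' by (auto simp: wb_ok_def)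
          thus "\<bar>Sc be' (Suc q)\<bar> \<le> U k ^ 1" using U_mono[OF qk'] by simp
        qed simp
        have l3: "len (int q + 1) \<le> b"
        proof (rule len_le_of_U_power[of _ 1])
          have "int q + 1 \<le> int H" using qk' kn H_gt by simp
          thus "\<bar>int q + 1\<bar> \<le> U k ^ 1" using H_le_U(1)[of k] by simp
        qed simp
        have l4: "len ((1024 * int P) ^ Suc q) \<le> b" by (rule len_le_of_U_power[of _ 1]) (use guess_count_le_U[OF qk'] in auto)
        define s4 where "s4 = upd s3 aB q (be' q)"
        define s5 where "s5 = upd s4 nS 0 (Sc be' (Suc q))"
        define s6 where "s6 = upd s5 aS q (Sc be' (Suc q))"
        define s7 where "s7 = upd s6 nQ 0 (int q + 1)"
        define s8 where "s8 = upd s7 nMM 0 ((1024 * int P) ^ Suc q)"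
        define s9 where "s9 = upd s8 nF 0 0"
        have r4: "rd s4 nQ 0 = int q" "rd s4 nS 0 = Sc ?be q" "rd s4 nBeta 0 = be' q" using r3 by (simp_all add: s4_def)
        have r5: "rd s5 nQ 0 = int q" "rd s5 nS 0 = Sc be' (Suc q)" using r4 by (simp_all add: s5_def)
        have r6: "rd s6 nQ 0 = int q" using r5 by (simp add: s6_def)
        have r7: "rd s7 nMM 0 = (1024 * int P) ^ q" "rd s7 nP 0 = int P" using r3 by (simp_all add: s7_def s6_def s5_def s4_def)
        have okU: "okD b ?K NEXT_STAGE s3 (\<lambda>s'. s' = s9)"
          unfolding NEXT_STAGE_def
        proof (rule okK_Seq[where R = "\<lambda>s'. s' = s4" and g = "\<lambda>_. 0"])
          show "okD b ?K (SA aB (V nQ) (V nBeta)) s3 (\<lambda>s'. s' = s4)"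
            by (rule okD_SA[where i = q]) (use s3 b0 K1 r3 l1 in \<open>simp_all add: s4_def\<close>)
        next
          fix s' assume a: "bnd b s'" "s' = s4"
          show "okD b ?K (Seq (SV nS (Mul (V nS) (V nBeta))) (Seq (SA aS (V nQ) (V nS)) (Seq (SV nQ (Add (V nQ) (Const 1))) (Seq (SV nMM (Mul (V nMM) (Mul (Const 1024) (V nP)))) (SV nF (Const 0)))))) s' (\<lambda>s'. s' = s9)"
          proof (rule okK_Seq[where R = "\<lambda>s'. s' = s5" and g = "\<lambda>_. 0"])
            show "okD b ?K (SV nS (Mul (V nS) (V nBeta))) s' (\<lambda>s'. s' = s5)"
              by (rule okD_SV) (use a b0 K1 r4 l2 in \<open>simp_all add: s5_def beS\<close>)
          next
            fix s' assume a: "bnd b s'" "s' = s5"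
            show "okD b ?K (Seq (SA aS (V nQ) (V nS)) (Seq (SV nQ (Add (V nQ) (Const 1))) (Seq (SV nMM (Mul (V nMM) (Mul (Const 1024) (V nP)))) (SV nF (Const 0))))) s' (\<lambda>s'. s' = s9)"
            proof (rule okK_Seq[where R = "\<lambda>s'. s' = s6" and g = "\<lambda>_. 0"])
              show "okD b ?K (SA aS (V nQ) (V nS)) s' (\<lambda>s'. s' = s6)"
                by (rule okD_SA[where i = q]) (use a b0 K1 r5 l2 in \<open>simp_all add: s6_def\<close>)
            next
              fix s' assume a: "bnd b s'" "s' = s6"
              show "okD b ?K (Seq (SV nQ (Add (V nQ) (Const 1))) (Seq (SV nMM (Mul (V nMM) (Mul (Const 1024) (V nP)))) (SV nF (Const 0)))) s' (\<lambda>s'. s' = s9)"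
              proof (rule okK_Seq[where R = "\<lambda>s'. s' = s7" and g = "\<lambda>_. 0"])
                show "okD b ?K (SV nQ (Add (V nQ) (Const 1))) s' (\<lambda>s'. s' = s7)"
                  by (rule okD_SV) (use a b0 K1 r6 l3 in \<open>simp_all add: s7_def\<close>)
              next
                fix s' assume a: "bnd b s'" "s' = s7"
                show "okD b ?K (Seq (SV nMM (Mul (V nMM) (Mul (Const 1024) (V nP)))) (SV nF (Const 0))) s' (\<lambda>s'. s' = s9)"
                proof (rule okK_Seq[where R = "\<lambda>s'. s' = s8" and g = "\<lambda>_. 0"])
                  have "val (Mul (V nMM) (Mul (Const 1024) (V nP))) s' = (1024 * int P) ^ Suc q" using a(2) r7 by simp
                  thus "okD b ?K (SV nMM (Mul (V nMM) (Mul (Const 1024) (V nP)))) s' (\<lambda>s'. s' = s8)"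
                    by (intro okD_SV) (use a b0 K1 l4 in \<open>simp_all only: s8_def\<close>)
                next
                  fix s' assume a: "bnd b s'" "s' = s8"
                  show "okD b ?K (SV nF (Const 0)) s' (\<lambda>s'. s' = s9)"
                    by (rule okD_SV) (use a b2 K1 in \<open>simp_all add: s9_def len_0\<close>)
                qed
              qed
            qed
          qed
        qed
        have e39: "eqx {cV, aW, nBeta, aB, nS, aS, nQ, nMM, nF} s2 s9"
          unfolding s9_def s8_def s7_def s6_def s5_def s4_def using eqx_mono[OF e23] by simp
        have w9: "wS s9 i v = w' i v" if "i < Suc q" "v < n" for i v
        proof -
          have a9: "rd s9 aW l = (if q * n \<le> l \<and> l < q * n + n then Y (l - q * n) else rd s2 aW l)" for l
            unfolding s9_def s8_def s7_def s6_def s5_def s4_def using s3 by simp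
          show ?thesis
          proof (cases "i = q")
            case True
            thus ?thesis unfolding wS_def a9 w'_def using that by simp
          next
            case False
            \<comment> \<open>Row \<open>i\<close> ends before the new row \<open>q\<close>
              begins.\<close>
            hence "Suc i * n \<le> q * n" using that by (intro mult_le_mono1) auto
            hence "i * n + v < q * n" using that by simp
            moreover have "wS s2 i v = ?w i v" using sp2 by simp
            ultimately show ?thesis unfolding wS_def a9 w'_def using False by (simp add: wS_def)
          qed
        qed
        have b9: "bS s9 i = be' i" if "i < Suc q" for i
        proof -
          have "rd s9 aB i = (if i = q then be' q else rd s2 aB i)"
            unfolding s9_def s8_def s7_def s6_def s5_def s4_def using eqx_rd[OF e23, of aB] by simp
          moreover have "rd s2 aB i = ?be i" using sp2(3) by (metis bS_def)
          ultimately show ?thesis unfolding bS_def[of s9] using that by (auto simp: be'_def)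
        qed
        have S9: "Sc (bS s9) i = Sc be' i" if "i \<le> Suc q" for i by (rule Sc_cong) (use b9 that in auto)
        have "specI s9 (Suc q)" unfolding specI_def
        proof (intro conjI allI impI)
          show "base s9" by (rule base_eqx[OF _ e39]) (use sp2(1) in \<open>auto simp: specI_def\<close>)
          show "rd s9 nQ 0 = int (Suc q)" by (simp add: s9_def s8_def s7_def)
          show "rd s9 nS 0 = Sc (bS s9) (Suc q)" unfolding S9[OF order_refl] by (simp add: s9_def s8_def s7_def s6_def s5_def)
          show "rd s9 nMM 0 = (1024 * int P) ^ Suc q" by (simp add: s9_def s8_def)
          show "rd s9 aBX i = 0" for i using sp2(1) by (simp add: specI_def eqx_rd[OF e39])
          show "rd s9 nBest 0 = 0" using sp2(1) by (simp add: specI_def eqx_rd[OF e39])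
          show "stage_inv k (Suc q) (wS s9) (bS s9)" by (rule stage_inv_cong[OF inv']) (use w9 b9 in auto)
          fix i assume i: "i < Suc q"
          have "rd s9 aS i = (if i = q then Sc be' (Suc q) else rd s2 aS i)"
            unfolding s9_def s8_def s7_def s6_def s5_def s4_def using eqx_rd[OF e23, of aS] by simp
          moreover have "rd s2 aS i = Sc be' (Suc i)" if "i < q"
          proof -
            have "rd s2 aS i = Sc (bS s2) (Suc i)" using sp2(1) that by (simp add: specI_def)
            also have "\<dots> = Sc be' (Suc i)" unfolding sp2(3) by (rule Sc_cong) (use that in \<open>auto simp: be'_def\<close>)
            finally show ?thesis .
          qed
          ultimately show "rd s9 aS i = Sc (bS s9) (Suc i)" using i S9[of "Suc i"] by auto
        qed
        moreover have "rd s9 nF 0 = 0" by (simp add: s9_def)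
        ultimately show "okD b ?K NEXT_STAGE s3 (\<lambda>s'. specI s' (Suc q) \<and> rd s' nF 0 = 0)"
          by (intro okD_conseq[OF okU]) auto
      qed
    qed
  qed
qed

end

section \<open>Success probability of the spectral stages\<close>

context machine
begin

definition good :: "memory \<Rightarrow> nat \<Rightarrow> bool" where
  "good s q \<longleftrightarrow> (\<forall>y. - wn y \<le> qf n (bm (wS s) (bS s) q) y)"

text \<open>Lower bound for the probability that the loop ends in a \<open>good\<close> state, after \<open>F\<close> consecutive
  failures in stage \<open>q\<close>.\<close>

definition pot :: "bool \<Rightarrow> nat \<Rightarrow> nat \<Rightarrow> real" where
  "pot g q F = max 0 ((if g then 1 else 1 - (1/2) ^ (P + q - F)) - (1/2) ^ (P + q))"

definition potm :: "memory \<Rightarrow> real" where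
  "potm s = (let q = nat (rd s nQ 0) in pot (good s q) q (nat (rd s nF 0)))"

lemma pot_nonneg: "0 \<le> pot g q F" by (simp add: pot_def)

text \<open>With \<open>t = (1/2) ^ (P + q)\<close>, the new stage fails with probability at most
  \<open>t / 2\<close>, and all later ones together with at most \<open>t / 2\<close>.\<close>

lemma pot_next: "pot g (Suc q) 0 \<ge> 1 - (1/2) ^ (P + q)"
proof -
  define t where "t = (1/2 :: real) ^ (P + q)"
  have t: "0 \<le> t" "(1/2) ^ (P + Suc q) = t / 2" unfolding t_def by auto
  show ?thesis unfolding pot_def minus_nat.diff_0 t(2) t_def[symmetric] using t(1) by (auto simp: le_max_iff_disj)
qed

lemma potm_specI: "specI s q \<Longrightarrow> rd s nF 0 = int F \<Longrightarrow> potm s = pot (good s q) q F"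
  by (simp add: potm_def specI_def)

text \<open>In a bad state a fair coin decides at worst between an acceptance, worth
  \<open>1 - (1/2) ^ (P + q)\<close>, and one more failure. In a good state a failure costs nothing,
  as it only leads towards the correct exit.\<close>

lemma pot_step:
  assumes "F < P + q"
  shows "pot False q F \<le> ((1 - (1/2) ^ (P + q)) + pot False q (Suc F)) / 2"
    "pot g q (Suc F) \<le> 1 - (1/2) ^ (P + q)" "pot True q F \<le> pot True q (Suc F)"
proof -
  obtain r where r: "P + q - F = Suc r" "P + q - Suc F = r" using assms by (metis Suc_diff_Suc)
  define t where "t = (1/2 :: real) ^ (P + q)"
  have t: "0 \<le> t" "t \<le> 1" unfolding t_def by (auto simp: power_le_one)
  have r0: "0 \<le> (1/2 :: real) ^ r" by simp
  show "pot False q F \<le> ((1 - (1/2) ^ (P + q)) + pot False q (Suc F)) / 2"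
    unfolding pot_def r t_def[symmetric] using t r0 by (simp add: max_def)
  show "pot g q (Suc F) \<le> 1 - (1/2) ^ (P + q)"
    unfolding pot_def r t_def[symmetric] using t r0 by (auto simp: max_def)
  show "pot True q F \<le> pot True q (Suc F)" by (simp add: pot_def)
qed

lemma good_eqx: "specI s q \<Longrightarrow> eqx modS s s' \<Longrightarrow> good s' q = good s q"
  unfolding good_def by (simp add: specI_eqx(2,3)[of s q s'])

text \<open>Once the coins are flipped the trial is deterministic, so its branch is determined by
  the start vector \<open>z\<close>.\<close>

lemma ok_TRIAL_tail:
  assumes s: "specI s q" "bnd b s" and F: "rd s nF 0 = int F" "F < P + q"
    and z: "\<And>v. v < n \<Longrightarrow> rd s aX v = z v" "\<And>v. v < n \<Longrightarrow> \<bar>z v\<bar> \<le> 1"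
  shows "okD b ((Nit + 1) * ((q + 1) * (n + m + 1)))
     (Seq POWER_ITERATION (Seq NORM_X JUDGE)) s
     (\<lambda>s'. if thr (bS s) q Nit \<le> (\<Sum>v<n. \<bar>piter (wS s) (bS s) q z Nit v\<bar>)
        then specI s' (Suc q) \<and> rd s' nF 0 = 0
        else specI s' q \<and> rd s' nF 0 = int (Suc F) \<and> good s' q = good s q)"
    (is "okD b ?K _ s ?Q")
proof -
  let ?x = "piter (wS s) (bS s) q z Nit" and ?K1 = "(q + 1) * (n + m + 1)"
  note wb = specI_wb(1)[OF s(1)] and qk = specI_wb(2)[OF s(1)]
  have K1: "1 \<le> ?K1" "n + 1 \<le> ?K1" by auto
  have KK: "?K1 \<le> ?K" by simp
  have K: "1 \<le> ?K" "n + 1 \<le> ?K" using K1 KK by linarith+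
  show ?thesis
  proof (rule okK_Seq[OF ok_POWER_ITERATION[OF s z]])
    fix s1 assume s1: "bnd b s1" "eqx modP s s1 \<and> (\<forall>v<n. rd s1 aX v = ?x v) \<and> rd s1 nThr 0 = thr (bS s) q Nit"
    hence p1: "eqx modP s s1" by blast
    note e1 = eqx_modP[OF p1]
    note sp1 = specI_eqx[OF s(1) e1]
    have xb: "\<bar>?x v\<bar> \<le> U q ^ (2 * Nit)" if "v < n" for v by (rule piter_bound[OF wb z(2) that])
    have sum: "okD b (n + 1) NORM_X s1 (\<lambda>s'. eqx {cV, nA} s1 s' \<and> rd s' nA 0 = (\<Sum>v<n. \<bar>?x v\<bar>))"
      by (rule ok_NORM_X[OF sp1(1) s1(1)]) (use s1 xb in auto)
    have F1: "rd s1 nF 0 = int F"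
      using F by (simp add: eqx_rd[OF p1])
    show "okD b ?K (Seq NORM_X JUDGE) s1 ?Q"
    proof (rule okK_Seq[where R = "\<lambda>s'. eqx {cV, nA} s1 s' \<and> rd s' nA 0 = (\<Sum>v<n. \<bar>?x v\<bar>)" and g = "\<lambda>_. 0"])
      show "okD b ?K NORM_X s1 (\<lambda>s'. eqx {cV, nA} s1 s' \<and> rd s' nA 0 = (\<Sum>v<n. \<bar>?x v\<bar>))"
        by (rule okD_conseq[OF sum K(2)])
    next
      fix s2 assume s2: "bnd b s2" "eqx {cV, nA} s1 s2 \<and> rd s2 nA 0 = (\<Sum>v<n. \<bar>?x v\<bar>)"
      hence e12: "eqx {cV, nA} s1 s2" by blast
      have e12': "eqx modS s1 s2" by (rule eqx_mono[OF e12]) auto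
      have e2: "eqx modS s s2" using e1 e12' eqx_trans by blast
      note sp2 = specI_eqx[OF s(1) e2]
      have r2: "rd s2 nThr 0 = thr (bS s) q Nit" "rd s2 nF 0 = int F" "\<And>v. v < n \<Longrightarrow> rd s2 aX v = ?x v"
        using s1 F1 by (simp_all add: eqx_rd[OF e12])
      show "okD b ?K JUDGE s2 ?Q"
      proof (rule okK_If)
        show "okD b ?K (if val (Less (V nA) (V nThr)) s2 \<noteq> 0 then SV nF (Add (V nF) (Const 1)) else ACCEPT) s2 ?Q"
        proof (cases "thr (bS s) q Nit \<le> (\<Sum>v<n. \<bar>?x v\<bar>)")
          case True
          have "okD b ?K1 ACCEPT s2 (\<lambda>s'. specI s' (Suc q) \<and> rd s' nF 0 = 0)"
            by (rule ok_ACCEPT[where x = ?x and z = z]) (use s2 sp2 r2 z True in auto)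
          hence "okD b ?K ACCEPT s2 ?Q" by (rule okD_conseq[OF _ KK]) (use True in auto)
          thus ?thesis using True s2 r2 by simp
        next
          case False
          have v: "val (Add (V nF) (Const 1)) s2 = int (Suc F)" using r2(2) by simp
          have l: "len (int (Suc F)) \<le> b"
          proof (rule len_le_of_U_power[of _ 1])
            have "int (Suc F) \<le> int (P + q)" using F(2) by simp
            also have "\<dots> \<le> int H + int H" using qk kn H_gt four_P_le_H by simp
            also have "\<dots> \<le> U k" 
            proof -
              have "2 * int H \<le> int H * int H" using H_le_U(4) by (intro mult_right_mono) auto
              also have "\<dots> \<le> U k" using H_le_U(5)[of 2 k] by (simp add: power2_eq_square)
              finally show ?thesis by simp
            qed
            finally show "\<bar>int (Suc F)\<bar> \<le> U k ^ 1" by simp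
          qed simp
          have eF: "eqx modS s (upd s2 nF 0 (int (Suc F)))" using e2 by simp
          have "okD b ?K (SV nF (Add (V nF) (Const 1))) s2 ?Q"
          proof (rule okD_SV)
            show "?Q (upd s2 nF 0 (val (Add (V nF) (Const 1)) s2))"
              unfolding v using specI_eqx[OF s(1) eF] good_eqx[OF s(1) eF] False by simp
          qed (use s2 b0 K l v in \<open>simp_all only:\<close>)
          thus ?thesis using False s2 r2 by simp
        qed
      qed (use s2 b0 K in simp_all)
    qed
  qed
qed

text \<open>The potential of the coins is propagated by \<open>ok_FLIPS\<close>, and the
  deterministic rest is judged on their outcome. In a good state every outcome keeps the potential.
  Otherwise \<open>stage_progress\<close> and \<open>ev_lower\<close> make at least half of the
  outcomes accepted ones.\<close>

lemma ok_TRIAL: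
  assumes s: "specI s q" "bnd b s" and F: "rd s nF 0 = int F" "F < P + q"
  shows "okK b ((Nit + 1) * ((k + 1) * (n + m + 1))) TRIAL s
     (\<lambda>s'. (specI s' (Suc q) \<and> rd s' nF 0 = 0) \<or> (specI s' q \<and> rd s' nF 0 = int (Suc F))) potm (potm s)"
    (is "okK b ?K _ s ?Q _ _")
proof -
  note wb = specI_wb(1)[OF s(1)] and qk = specI_wb(2)[OF s(1)]
  have KK: "(Nit + 1) * ((q + 1) * (n + m + 1)) \<le> ?K" using qk by (intro mult_le_mono mult_le_mono1) auto
  have nK: "n + 1 \<le> ?K"
  proof -
    have "n + 1 \<le> 1 * (1 * (n + m + 1))" by simp
    also have "\<dots> \<le> ?K" by (intro mult_le_mono) auto
    finally show ?thesis .
  qed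
  define acc where "acc z \<longleftrightarrow> thr (bS s) q Nit \<le> (\<Sum>v<n. \<bar>piter (wS s) (bS s) q z Nit v\<bar>)" for z
  \<comment> \<open>\<open>hi\<close> is what an acceptance is worth at least, and \<open>lo\<close>
    the potential after one more failure.\<close>
  define hi where "hi = 1 - (1/2 :: real) ^ (P + q)"
  define lo where "lo = pot (good s q) q (Suc F)"
  have hl: "lo \<le> hi" "0 \<le> lo" unfolding hi_def lo_def using pot_step(2)[OF F(2)] pot_nonneg by auto
  have ps: "potm s = pot (good s q) q F" using s F by (intro potm_specI) auto
  have tail: "okK b ?K (Seq POWER_ITERATION (Seq NORM_X JUDGE)) s1 ?Q potm x"
    if s1: "bnd b s1" "eqx {cV, aX} s s1" "\<forall>v<n. rd s1 aX v = 0 \<or> rd s1 aX v = 1" and x: "x \<le> (if acc (rd s1 aX) then hi else lo)" for s1 x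
  proof -
    have e1: "eqx modS s s1" using s1(2) by (rule eqx_mono) auto
    note sp1 = specI_eqx[OF s(1) e1]
    have ge: "good s1 q = good s q" by (rule good_eqx[OF s(1) e1])
    have zb: "\<bar>rd s1 aX v\<bar> \<le> 1" if "v < n" for v using s1(3) that by force
    have F1: "rd s1 nF 0 = int F" using F(1) by (simp add: eqx_rd[OF s1(2)])
    note T = ok_TRIAL_tail[OF sp1(1) s1(1) F1 F(2), of "rd s1 aX", OF refl zb, unfolded sp1(2,3) acc_def[symmetric] ge]
    let ?Post = "\<lambda>s'. if acc (rd s1 aX) then specI s' (Suc q) \<and> rd s' nF 0 = 0
        else specI s' q \<and> rd s' nF 0 = int (Suc F) \<and> good s' q = good s q"
    have D: "okD b ?K (Seq POWER_ITERATION (Seq NORM_X JUDGE)) s1 ?Post"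
      by (rule okD_conseq[OF T KK])
    have Q0: "?Q s' \<and> x \<le> potm s'" if Q: "?Post s'" for s'
    proof (cases "acc (rd s1 aX)")
      case True
      hence a: "specI s' (Suc q) \<and> rd s' nF 0 = 0" using Q by simp
      hence "potm s' = pot (good s' (Suc q)) (Suc q) 0" by (intro potm_specI) auto
      thus ?thesis using True x a pot_next[of q "good s' (Suc q)"] by (simp add: hi_def)
    next
      case False
      hence a: "specI s' q \<and> rd s' nF 0 = int (Suc F) \<and> good s' q = good s q" using Q by simp
      hence "potm s' = pot (good s q) q (Suc F)" using potm_specI[of s' q "Suc F"] by simp
      thus ?thesis using False x a by (simp add: lo_def)
    qed
    have E: "okK b ?K (Seq POWER_ITERATION (Seq NORM_X JUDGE)) s1 ?Post potm x"
      by (rule okD_imp_okK[OF D]) (use Q0 in blast)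
    have C: "?Q s' \<and> potm s' \<le> potm s'" if "bnd b s'" "?Post s'" for s' using Q0[OF that(2)] by blast
    show ?thesis by (rule okK_conseq[OF E order_refl C order_refl])
  qed
  show ?thesis
  proof (cases "good s q")
    case True
    have fl: "okK b (n + 1) FLIPS s (\<lambda>s'. eqx {cV, aX} s s' \<and> (\<forall>v<n. rd s' aX v = 0 \<or> rd s' aX v = 1)) (\<lambda>_. lo) (potm s)"
    proof (rule okK_conseq[OF ok_FLIPS[OF s, of "\<lambda>_. lo" "\<lambda>_. 0"]])
      show "potm s \<le> ev (\<lambda>_. lo) (\<lambda>_. 0) n n 0" unfolding ev_const ps lo_def using True pot_step(3)[OF F(2)] by simp
    qed (use hl in auto)
    show ?thesis unfolding TRIAL_def
      by (rule okK_Seq[OF okK_conseq[OF fl nK]]) (use tail hl in auto)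
  next
    case False
    have n0: "n > 0"
    proof (rule ccontr)
      assume "\<not> n > 0"
      hence e: "{..<n} = {}" by simp
      have "good s q" unfolding good_def wn_def qf_def ip_def e by simp
      thus False using False by simp
    qed
    obtain a j where aj: "j < n" "\<bar>a j\<bar> \<ge> 1 / real n"
      and ac: "\<And>z :: nat \<Rightarrow> int. \<bar>\<Sum>v<n. a v * of_int (z v)\<bar> \<ge> 1 / (2 * real n) \<Longrightarrow> acc z"
      using stage_progress[OF wb n0] False unfolding good_def acc_def by blast
    define h where "h c = (if \<bar>c\<bar> \<ge> 1 / (2 * real n) then hi else lo)" for c :: real
    have "ev h a n n 0 \<ge> (hi + lo) / 2"
      by (rule ev_lower[where \<theta> = "1 / (2 * real n)" and j = j]) (use hl aj in \<open>auto simp: h_def\<close>)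
    hence x: "potm s \<le> ev h a n n 0" unfolding ps hi_def lo_def using False pot_step(1)[OF F(2)] by simp
    have fl: "okK b (n + 1) FLIPS s (\<lambda>s'. eqx {cV, aX} s s' \<and> (\<forall>v<n. rd s' aX v = 0 \<or> rd s' aX v = 1))
       (\<lambda>s'. h (\<Sum>v<n. a v * of_int (rd s' aX v))) (potm s)"
      by (rule okK_conseq[OF ok_FLIPS[OF s, of h a]]) (use hl x in \<open>auto simp: h_def\<close>)
    show ?thesis unfolding TRIAL_def
    proof (rule okK_Seq[OF okK_conseq[OF fl nK]])
      fix s' assume s': "bnd b s'" "eqx {cV, aX} s s' \<and> (\<forall>v<n. rd s' aX v = 0 \<or> rd s' aX v = 1)"
      have "h (\<Sum>v<n. a v * of_int (rd s' aX v)) \<le> (if acc (rd s' aX) then hi else lo)"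
        using ac[of "rd s' aX"] hl by (auto simp: h_def)
      thus "okK b ?K (Seq POWER_ITERATION (Seq NORM_X JUDGE)) s' ?Q potm
        (h (\<Sum>v<n. a v * of_int (rd s' aX v)))"
        using tail s' by blast
    qed auto
  qed
qed

definition Kspec :: nat where
  "Kspec = (k * (P + k + 1) + P + 1) * ((Nit + 1) * ((k + 1) * (n + m + 1)))"

text \<open>Stage \<open>q\<close> has at most \<open>P + q\<close> failures, and the rank counts
  these down together with the stages still possible. At the exit \<open>F = P + q\<close>, where
  the potential of a bad state is 0; it is therefore a lower bound for the indicator of a good
  state.\<close>

lemma ok_SPECTRAL:
  assumes s: "specI s 0" "bnd b s" "rd s nF 0 = 0"
  shows "okK b Kspec SPECTRAL s (\<lambda>s'. \<exists>q. specI s' q)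
     (\<lambda>s'. if good s' (nat (rd s' nQ 0)) then 1 else 0) (1 - 2 * (1/2) ^ P)"
  unfolding SPECTRAL_def Kspec_def
proof (rule okK_While)
  let ?J = "\<lambda>r s. \<exists>q F. specI s q \<and> rd s nF 0 = int F \<and> F \<le> P + q \<and> (k - q) * (P + k + 1) + (P + q - F) \<le> r"
  let ?K = "(Nit + 1) * ((k + 1) * (n + m + 1))"
  fix r s assume J: "?J r s" and bs: "bnd b s" and v: "val (Less (V nF) (Add (V nP) (V nQ))) s \<noteq> 0"
  obtain q F where qF: "specI s q" "rd s nF 0 = int F" "F \<le> P + q" "(k - q) * (P + k + 1) + (P + q - F) \<le> r" using J by blast
  have "rd s nP 0 = int P" "rd s nQ 0 = int q" using qF(1) by (auto simp: specI_def base_def env_def)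
  hence FP: "F < P + q" using v qF(2) by (auto split: if_splits)
  hence "r > 0" using qF(4) by simp
  then obtain r' where r': "r = Suc r'" by (cases r) auto
  have "okK b ?K TRIAL s (?J r') potm (potm s)"
  proof (rule okK_conseq[OF ok_TRIAL[OF qF(1) bs qF(2) FP]])
    fix s' assume "(specI s' (Suc q) \<and> rd s' nF 0 = 0) \<or> (specI s' q \<and> rd s' nF 0 = int (Suc F))"
    thus "?J r' s' \<and> potm s' \<le> potm s'"
    proof
      assume a: "specI s' (Suc q) \<and> rd s' nF 0 = 0"
      hence qk: "Suc q \<le> k" using specI_wb(2) by blast
      have "(k - Suc q) * (P + k + 1) + (P + Suc q - 0) \<le> r'"
      proof -
        have "k - q = Suc (k - Suc q)" using qk by simp
        hence "(k - q) * (P + k + 1) = (k - Suc q) * (P + k + 1) + (P + k + 1)" by simp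
        thus ?thesis using qF(4) FP r' qk by linarith
      qed
      thus ?thesis using a by (intro conjI exI[of _ "Suc q"] exI[of _ 0]) auto
    next
      assume a: "specI s' q \<and> rd s' nF 0 = int (Suc F)"
      have "(k - q) * (P + k + 1) + (P + q - Suc F) \<le> r'" using qF(4) FP r' by linarith
      thus ?thesis using a FP by (intro conjI exI[of _ q] exI[of _ "Suc F"]) auto
    qed
  qed auto
  thus "\<exists>r'. r = Suc r' \<and> okK b ?K TRIAL s (?J r') potm (potm s)" using r' by blast
next
  fix r s assume J: "\<exists>q F. specI s q \<and> rd s nF 0 = int F \<and> F \<le> P + q \<and> (k - q) * (P + k + 1) + (P + q - F) \<le> r"
    and v: "val (Less (V nF) (Add (V nP) (V nQ))) s = 0"
  obtain q F where qF: "specI s q" "rd s nF 0 = int F" "F \<le> P + q" using J by blast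
  have rs: "rd s nP 0 = int P" "rd s nQ 0 = int q" using qF(1) by (auto simp: specI_def base_def env_def)
  hence FP: "F = P + q" using v qF(2,3) by (auto split: if_splits)
  show "(\<exists>q. specI s q) \<and> potm s \<le> (if good s (nat (rd s nQ 0)) then 1 else 0)"
    using qF rs FP by (auto simp: potm_def pot_def)
next
  show "\<exists>q F. specI s q \<and> rd s nF 0 = int F \<and> F \<le> P + q \<and> (k - q) * (P + k + 1) + (P + q - F) \<le> k * (P + k + 1) + P"
    using s by (intro exI[of _ 0]) auto
  have t0: "0 \<le> (1/2 :: real) ^ P" by simp
  have "potm s = pot (good s 0) 0 0" using s by (intro potm_specI) auto
  thus "1 - 2 * (1/2) ^ P \<le> potm s" using t0 by (auto simp: pot_def le_max_iff_disj)
qed (use s b0 in auto)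

end

section \<open>Enumeration of the guesses\<close>

abbreviation (input) "nVal \<equiv> 16 :: nat"
abbreviation (input) "nE \<equiv> 17 :: nat"
abbreviation (input) "nEE \<equiv> 18 :: nat"
abbreviation (input) "nDl \<equiv> 19 :: nat"
abbreviation (input) "nCC \<equiv> 20 :: nat"
abbreviation (input) "cT \<equiv> 21 :: nat"
abbreviation (input) "cK \<equiv> 30 :: nat"

text \<open>Adding 1 on the right expresses the negation of the strict inequality in
  \<open>grid_step\<close> by the available test \<open>Less\<close>.\<close>

definition GRID_STEP :: prog where
  "GRID_STEP = Seq (SV nDl (Const 1)) (While
     (Less (Mul (Mul (Const 4) (Mul (V nDl) (V nDl))) (V nQ)) (Add (Mul (AR aS (V cK)) (Mul (V nM) (Mul (V nH) (V nH)))) (Const 1)))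
     (SV nDl (Mul (Const 2) (V nDl))))"

definition oddE :: "expr \<Rightarrow> expr" where "oddE e = Sub e (Mul (Const 2) (Div e (Const 2)))"

lemma val_oddE [simp]: "val (oddE e) s = val e s mod 2"
  by (simp add: oddE_def minus_mult_div_eq_mod)

definition RE :: expr where "RE = Mul (Const 256) (V nP)"

definition NEXT_DIGIT :: prog where
  "NEXT_DIGIT = Seq (SV nCC (Sub (V nEE) (Mul RE (Div (V nEE) RE)))) (Seq (SV nEE (Div (V nEE) RE))
     (Seq (While (oddE (V nEE)) (Seq (SV nCC (Add (V nCC) RE)) (SV nEE (Div (V nEE) (Const 2)))))
          (SV nEE (Div (V nEE) (Const 2)))))"

definition DECODE :: prog where
  "DECODE = For cK (V nQ) (Seq GRID_STEP (Seq NEXT_DIGIT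
     (SA aT (V cK) (Mul (V nDl) (Mul (Div (V nCC) (Const 2)) (Sub (Const 1) (Mul (Const 2) (oddE (V nCC)))))))))"

text \<open>The matrix at the end of the spectral stages. Only size bounds are assumed, not that it
  is good, because the time bound must hold after an unlucky run as well.\<close>

locale staged = machine +
  fixes q :: nat and w :: "nat \<Rightarrow> nat \<Rightarrow> int" and be :: "nat \<Rightarrow> int"
  assumes wb: "wb_ok q w be" and qk: "q \<le> k"
begin

definition eI :: "memory \<Rightarrow> bool" where
  "eI s \<longleftrightarrow> env s \<and> st_mat s q w be \<and> rd s nH 0 = int H \<and> rd s nG 0 = int H \<and> rd s nMM 0 = (1024 * int P) ^ q \<and>
     (\<forall>i<q. rd s aS i = Sc be (Suc i))"

lemma eI_eqx: "eI s \<Longrightarrow> eqx M s s' \<Longrightarrow> {nN, nM, nP, nH, nG, nMM, nQ, aB, aW, aS} \<inter> M = {} \<Longrightarrow> eI s'"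
  using env_eqx[of s M s'] by (simp add: eI_def st_mat_def eqx_rd)

lemma eI_rd:
  assumes "eI s"
  shows "rd s nN 0 = int n" "rd s nM 0 = int m" "rd s nP 0 = int P" "rd s nQ 0 = int q" "rd s nH 0 = int H" "rd s nG 0 = int H"
    "i < q \<Longrightarrow> rd s aS i = Sc be (Suc i)" "rd s nMM 0 = (1024 * int P) ^ q"
  using assms by (auto simp: eI_def env_def st_mat_def)

lemma len_parameters_le: "len (int n) \<le> b" "len (int m) \<le> b" "len (int q) \<le> b" "len (int P) \<le> b"
proof -
  have le: "j \<le> H \<Longrightarrow> len (int j) \<le> b" for j by (rule len_le_of_U_power[of _ 1]) (use H_le_U(1)[of k] in auto)
  have "P \<le> H" using four_P_le_H by simp
  thus "len (int n) \<le> b" "len (int m) \<le> b" "len (int q) \<le> b" "len (int P) \<le> b"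
    using le[of n] le[of m] le[of q] le[of P] H_gt qk kn by auto
qed

text \<open>Makes room for exponents up to \<open>39 = 2 * 18 + 3\<close> in the size estimates of
  the enumeration.\<close>

lemma Nit_ge_18: "Nit \<ge> 18"
proof -
  have "(4 * P + 1) * (5 * lg + 2) \<ge> 9 * 2" using P by (intro mult_mono) auto
  thus ?thesis by (simp add: Nit_def)
qed

lemma len_le_of_U_small_power: "\<bar>z\<bar> \<le> U k ^ j \<Longrightarrow> j \<le> 39 \<Longrightarrow> len z \<le> b"
  using len_le_of_U_power[of z j] Nit_ge_18 by simp

lemma U_k_ge_1: "1 \<le> U k" "1 \<le> U k ^ j" using U_ge(2)[of k] by auto

text \<open>Stated for all smaller powers too, since the doubling loop passes through them. For
  \<open>m = 0\<close> the step is 1.\<close>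

lemma grid_step_le:
  assumes i: "i < q" and a: "a \<le> (LEAST a. Sc be (Suc i) * int m * int H ^ 2 < 4 * (2 ^ a)\<^sup>2 * int q)"
  shows "2 ^ a \<le> U k ^ 2"
proof -
  have q: "q > 0" using i by simp
  have d: "2 ^ a \<le> grid_step (Sc be (Suc i)) q" unfolding grid_step_def using a by (intro power_increasing) auto
  have S: "1 \<le> Sc be (Suc i)" "Sc be (Suc i) \<le> U k"
    using Sc_pos[of "Suc i" be] Sc_le_U[OF wb, of "Suc i"] wb i U_mono[of "Suc i" k] qk by (auto simp: wb_ok_def)
  have "grid_step (Sc be (Suc i)) q \<le> U k ^ 2"
  proof (cases "m = 0")
    case True
    have "(LEAST a. Sc be (Suc i) * int m * int H ^ 2 < 4 * (2 ^ a)\<^sup>2 * int q) \<le> 0"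
      by (rule Least_le) (use True q in simp)
    thus ?thesis unfolding grid_step_def using U_k_ge_1(2)[of 2] by simp
  next
    case False
    have H0: "0 \<le> int H" by simp
    have "q \<le> H" using qk kn H_gt by simp
    hence "int q * 1 \<le> int H * int H" using H_powers(1) by (intro mult_mono) auto
    also have "\<dots> = int H ^ 2" by (simp add: power2_eq_square)
    also have "1 * 1 * int H ^ 2 \<le> Sc be (Suc i) * int m * int H ^ 2" using S False by (intro mult_right_mono mult_mono) auto
    finally have q': "int q \<le> Sc be (Suc i) * int m * int H ^ 2" by simp
    note db = grid_step_bounds[OF q q']
    have "grid_step (Sc be (Suc i)) q * 1 \<le> (grid_step (Sc be (Suc i)) q)\<^sup>2 * int q"
    proof -
      have "1 * 1 \<le> grid_step (Sc be (Suc i)) q * int q" using db(1) q by (intro mult_mono) auto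
      hence "grid_step (Sc be (Suc i)) q * 1 \<le> grid_step (Sc be (Suc i)) q * (grid_step (Sc be (Suc i)) q * int q)" using db(1) by (intro mult_left_mono) auto
      thus ?thesis by (simp add: power2_eq_square mult.assoc)
    qed
    also have "\<dots> \<le> Sc be (Suc i) * int m * int H ^ 2" by (rule db(3))
    also have "\<dots> \<le> U k * int H * int H ^ 2" using S H_powers(3) by (intro mult_right_mono mult_mono) auto
    also have "\<dots> = U k * int H ^ 3" by (simp add: numeral_eq_Suc)
    also have "\<dots> \<le> U k * U k" using H_le_U(2)[of k] U_k_ge_1 by (intro mult_left_mono) auto
    finally show ?thesis by (simp add: power2_eq_square)
  qed
  thus ?thesis using d by linarith
qed

text \<open>The result fits into \<open>b\<close> bits, so fewer than \<open>b\<close> doublings are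
  made.\<close>

lemma ok_GRID_STEP:
  assumes s: "eI s" "bnd b s" "rd s cK 0 = int i" "i < q"
  shows "okD b (b + 1) GRID_STEP s (\<lambda>s'. eqx {nDl} s s' \<and> rd s' nDl 0 = grid_step (Sc be (Suc i)) q)"
  unfolding GRID_STEP_def
proof (rule okK_Seq[where R = "\<lambda>s'. s' = upd s nDl 0 1" and g = "\<lambda>_. 0"])
  show "okD b (b + 1) (SV nDl (Const 1)) s (\<lambda>s'. s' = upd s nDl 0 1)"
    by (rule okD_SV) (use s b2 in \<open>auto simp: len_1\<close>)
  define N where "N a \<longleftrightarrow> Sc be (Suc i) * int m * int H ^ 2 < 4 * (2 ^ a)\<^sup>2 * int q" for a :: nat
  define L where "L = (LEAST a. N a)"
  have dL: "grid_step (Sc be (Suc i)) q = 2 ^ L" unfolding grid_step_def L_def N_def ..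
  have bl: "len (2 ^ a :: int) \<le> b" if "a \<le> L" for a
  proof (rule len_le_of_U_small_power)
    show "\<bar>2 ^ a :: int\<bar> \<le> U k ^ 2" using grid_step_le[OF s(4), of a] that unfolding L_def N_def by simp
  qed simp
  have Lb: "L + 1 \<le> b"
  proof -
    obtain c where c: "b = Suc c" using b2 by (cases b) auto
    have "\<bar>2 ^ L :: int\<bar> < 2 ^ c" using bl[of L] unfolding c len_le_iff by simp
    hence "L < c" by simp
    thus ?thesis using c by simp
  qed
  have "q > 0" using s(4) by simp
  then obtain a0 where "N a0" unfolding N_def using grid_step_exists by blast
  hence NL: "N L" unfolding L_def by (rule LeastI)
  fix s1 assume s1: "bnd b s1" "s1 = upd s nDl 0 1"
  let ?J = "\<lambda>r s'. \<exists>a\<le>L. r = L - a \<and> eqx {nDl} s s' \<and> rd s' nDl 0 = 2 ^ a"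
  let ?c = "Less (Mul (Mul (Const 4) (Mul (V nDl) (V nDl))) (V nQ)) (Add (Mul (AR aS (V cK)) (Mul (V nM) (Mul (V nH) (V nH)))) (Const 1))"
  have val: "val ?c s' \<noteq> 0 \<longleftrightarrow> \<not> N a" if "eqx {nDl} s s'" "rd s' nDl 0 = 2 ^ a" for s' a
  proof -
    have "eI s'" using eI_eqx[OF s(1) that(1)] by simp
    note r = eI_rd[OF this]
    have c: "rd s' cK 0 = int i" using that s by (simp add: eqx_rd)
    show ?thesis using r s(4) that c unfolding N_def by (auto simp: power2_eq_square mult.assoc)
  qed
  have "okD b ((L + 1) * 1) (While ?c (SV nDl (Mul (Const 2) (V nDl)))) s1 (\<lambda>s'. eqx {nDl} s s' \<and> rd s' nDl 0 = 2 ^ L)"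
  proof (rule okK_While[where J = ?J and \<phi> = "\<lambda>_. 0"])
    fix r s2 assume J: "?J r s2" and b': "bnd b s2" and v: "val ?c s2 \<noteq> 0"
    obtain a where a: "a \<le> L" "r = L - a" "eqx {nDl} s s2" "rd s2 nDl 0 = 2 ^ a" using J by blast
    have "a \<noteq> L" using val[OF a(3,4)] v NL by auto
    hence aL: "a < L" using a by simp
    have "okD b 1 (SV nDl (Mul (Const 2) (V nDl))) s2 (?J (L - Suc a))"
      by (rule okD_SV) (use b' b0 a aL bl[of "Suc a"] in \<open>auto intro!: exI[of _ "Suc a"]\<close>)
    thus "\<exists>j'. r = Suc j' \<and> okD b 1 (SV nDl (Mul (Const 2) (V nDl))) s2 (?J j')" using a aL by (intro exI[of _ "L - Suc a"]) auto
  next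
    fix r s2 assume J: "?J r s2" and v: "val ?c s2 = 0"
    obtain a where a: "a \<le> L" "r = L - a" "eqx {nDl} s s2" "rd s2 nDl 0 = 2 ^ a" using J by blast
    have "N a" using val[OF a(3,4)] v by auto
    hence "L \<le> a" unfolding L_def by (rule Least_le)
    thus "(eqx {nDl} s s2 \<and> rd s2 nDl 0 = 2 ^ L) \<and> (0::real) \<le> 0" using a by simp
  next
    show "?J L s1" using s1 by (intro exI[of _ 0]) auto
  qed (use s1 b0 in auto)
  thus "okD b (b + 1) (While ?c (SV nDl (Mul (Const 2) (V nDl)))) s1 (\<lambda>s'. eqx {nDl} s s' \<and> rd s' nDl 0 = grid_step (Sc be (Suc i)) q)"
    unfolding dL by (rule okD_conseq) (use Lb in auto)
qed

lemma rest_le: "rest e \<le> e" and ones_le: "ones e \<le> e"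
proof (induction e rule: less_induct)
  case (less e)
  { case 1 show ?case
    proof (cases "odd e")
      case True
      hence "e div 2 < e" by (cases e) auto
      thus ?thesis using less(1)[of "e div 2"] True by (subst rest.simps) simp
    qed (subst rest.simps, simp) }
  { case 2 show ?case
    proof (cases "odd e")
      case True
      hence "e div 2 < e" by (cases e) auto
      thus ?thesis using less(2)[of "e div 2"] True by (subst ones.simps) simp
    qed (subst ones.simps, simp) }
qed

lemma dstate_le: "dstate R e i \<le> e"
proof (induction i)
  case (Suc i)
  have "rest (dstate R e i div R) \<le> dstate R e i div R" by (rule rest_le)
  also have "\<dots> \<le> dstate R e i" by simp
  finally show ?case using Suc by simp
qed simp

lemma dcode_le: "R > 0 \<Longrightarrow> dcode R e i \<le> R + e"
proof -
  assume R: "R > 0"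
  have "dstate R e i mod R < R" using R by simp
  moreover have "R * ones (dstate R e i div R) \<le> R * (dstate R e i div R)" using ones_le by simp
  moreover have "R * (dstate R e i div R) \<le> dstate R e i" by simp
  ultimately show ?thesis unfolding dcode_def using dstate_le[of R e i] by linarith
qed

lemma digit_base_bounds: "digit_base > 0" "int digit_base \<le> U k"
proof -
  show "digit_base > 0" using P by (simp add: digit_base_def)
  have "P \<le> P\<^sup>2" using P by (simp add: power2_eq_square)
  hence "digit_base \<le> H" using H_gt(5) unfolding digit_base_def by linarith
  thus "int digit_base \<le> U k" using H_le_U(1)[of k] by linarith
qed

lemma digit_base_add_le: "int e \<le> U k \<Longrightarrow> x \<le> digit_base + e \<Longrightarrow> int x \<le> U k ^ 2"
proof -
  assume a: "int e \<le> U k" "x \<le> digit_base + e"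
  have "int x \<le> 2 * U k" using a digit_base_bounds(2) by simp
  also have "\<dots> \<le> U k * U k" using H_le_U(1)[of k] H_le_U(4) by (intro mult_right_mono) auto
  finally show ?thesis by (simp add: power2_eq_square)
qed

text \<open>A round of the inner loop trades one trailing one for \<open>digit_base\<close> in the
  digit: \<open>c + digit_base * ones x\<close> and \<open>rest x\<close> are invariant. As
  \<open>x\<close> is halved each time, the bit length limits the rounds.\<close>

lemma ok_NEXT_DIGIT:
  assumes s: "eI s" "bnd b s" "rd s nEE 0 = int (dstate digit_base e i)" and e: "int e \<le> U k"
  shows "okD b (b + 1) NEXT_DIGIT s (\<lambda>s'. eqx {nEE, nCC} s s' \<and> rd s' nCC 0 = int (dcode digit_base e i) \<and> rd s' nEE 0 = int (dstate digit_base e (Suc i)))"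
  unfolding NEXT_DIGIT_def
proof -
  define d where "d = dstate digit_base e i"
  define c0 where "c0 = d mod digit_base"
  define d1 where "d1 = d div digit_base"
  have de: "d \<le> e" unfolding d_def by (rule dstate_le)
  have d1e: "d1 \<le> e" unfolding d1_def using de div_le_dividend order_trans by blast
  have le: "len (int x) \<le> b" if "x \<le> e" for x by (rule len_le_of_U_small_power[of _ 1]) (use that e in auto)
  have lc: "len (int x) \<le> b" if "x \<le> digit_base + e" for x
    using len_le_of_U_small_power[of "int x" 2] digit_base_add_le[OF e that] by simp
  have cd: "dcode digit_base e i = c0 + digit_base * ones d1" "dstate digit_base e (Suc i) = rest d1" by (simp_all add: dcode_def c0_def d1_def d_def)
  let ?Q = "\<lambda>s'. eqx {nEE, nCC} s s' \<and> rd s' nCC 0 = int (dcode digit_base e i) \<and> rd s' nEE 0 = int (dstate digit_base e (Suc i))"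
  let ?W = "While (oddE (V nEE)) (Seq (SV nCC (Add (V nCC) RE)) (SV nEE (Div (V nEE) (Const 2))))"
  have RE: "val RE s' = int digit_base" if "eqx {nEE, nCC} s s'" for s'
    using eI_rd(3)[OF eI_eqx[OF s(1) that]] by (simp add: RE_def digit_base_def)
  have bW: "d1 < 2 ^ b"
  proof -
    obtain c where c: "b = Suc c" using b2 by (cases b) auto
    have "\<bar>int d1\<bar> < 2 ^ c" using le[OF d1e] unfolding c len_le_iff by simp
    hence "int d1 < int (2 ^ c)" by simp
    hence "d1 < 2 ^ c" by (simp only: of_nat_less_iff)
    also have "\<dots> \<le> 2 ^ b" by (simp add: c)
    finally show ?thesis .
  qed
  let ?I = "\<lambda>c x s'. eqx {nEE, nCC} s s' \<and> rd s' nCC 0 = int c \<and> rd s' nEE 0 = int x \<and> c + digit_base * ones x = dcode digit_base e i \<and> rest x = rest d1"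
  note dle = dcode_le[OF digit_base_bounds(1), of e i]
  have W: "okD b ((b + 1) * 1) ?W s1 (\<lambda>s'. \<exists>x. eqx {nEE, nCC} s s' \<and> rd s' nCC 0 = int (dcode digit_base e i) \<and> rd s' nEE 0 = int x \<and> x div 2 = rest d1 \<and> x \<le> e)"
    if s1: "bnd b s1" "?I c0 d1 s1" for s1
  proof (rule okK_While[where J = "\<lambda>r s'. \<exists>c x. ?I c x s' \<and> x < 2 ^ r \<and> x \<le> e" and \<phi> = "\<lambda>_. 0"])
    fix r s2 assume J: "\<exists>c x. ?I c x s2 \<and> x < 2 ^ r \<and> x \<le> e" and b': "bnd b s2" and v: "val (oddE (V nEE)) s2 \<noteq> 0"
    obtain c x where x: "?I c x s2" "x < 2 ^ r" "x \<le> e" using J by blast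
    have "int x mod 2 \<noteq> 0" using v x(1) by simp
    hence ox: "odd x" by presburger
    have "r \<noteq> 0" using ox x(2) by (intro notI) auto
    then obtain r' where r': "r = Suc r'" by (cases r) auto
    have st: "ones x = Suc (ones (x div 2))" "rest x = rest (x div 2)"
      using ox ones.simps[of x] rest.simps[of x] by simp_all
    have I': "(c + digit_base) + digit_base * ones (x div 2) = dcode digit_base e i" using x(1) st(1) by simp
    have x2: "x div 2 < 2 ^ r'" "x div 2 \<le> e" using x r' by auto
    have RE2: "val RE s2 = int digit_base" using RE x(1) by blast
    have "okD b 1 (Seq (SV nCC (Add (V nCC) RE)) (SV nEE (Div (V nEE) (Const 2)))) s2 (\<lambda>s'. ?I (c + digit_base) (x div 2) s')"
    proof (rule okK_Seq[where R = "\<lambda>s'. s' = upd s2 nCC 0 (int (c + digit_base))" and g = "\<lambda>_. 0"])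
      show "okD b 1 (SV nCC (Add (V nCC) RE)) s2 (\<lambda>s'. s' = upd s2 nCC 0 (int (c + digit_base)))"
        by (rule okD_SV) (use b' b0 x RE2 lc[of "c + digit_base"] I' dle in auto)
      fix s3 assume s3: "bnd b s3" "s3 = upd s2 nCC 0 (int (c + digit_base))"
      show "okD b 1 (SV nEE (Div (V nEE) (Const 2))) s3 (\<lambda>s'. ?I (c + digit_base) (x div 2) s')"
        by (rule okD_SV) (use s3 b0 x I' st le[OF x2(2)] in \<open>auto simp: zdiv_int\<close>)
    qed
    hence "okD b 1 (Seq (SV nCC (Add (V nCC) RE)) (SV nEE (Div (V nEE) (Const 2)))) s2 (\<lambda>s'. \<exists>c x. ?I c x s' \<and> x < 2 ^ r' \<and> x \<le> e)"
      by (rule okD_conseq) (use x2 in blast)+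
    thus "\<exists>r'. r = Suc r' \<and> okD b 1 (Seq (SV nCC (Add (V nCC) RE)) (SV nEE (Div (V nEE) (Const 2)))) s2 (\<lambda>s'. \<exists>c x. ?I c x s' \<and> x < 2 ^ r' \<and> x \<le> e)"
      using r' by blast
  next
    fix r s2 assume J: "\<exists>c x. ?I c x s2 \<and> x < 2 ^ r \<and> x \<le> e" and b': "bnd b s2" and v: "val (oddE (V nEE)) s2 = 0"
    obtain c x where x: "?I c x s2" "x < 2 ^ r" "x \<le> e" using J by blast
    have "int x mod 2 = 0" using v x(1) by simp
    hence ex: "even x" by presburger
    have st: "ones x = 0" "rest x = x div 2" using ex ones.simps[of x] rest.simps[of x] by simp_all
    show "(\<exists>x. eqx {nEE, nCC} s s2 \<and> rd s2 nCC 0 = int (dcode digit_base e i) \<and> rd s2 nEE 0 = int x \<and> x div 2 = rest d1 \<and> x \<le> e) \<and> (0::real) \<le> 0"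
      using x st by auto
  next
    show "\<exists>c x. ?I c x s1 \<and> x < 2 ^ b \<and> x \<le> e" using s1 bW d1e by blast
  qed (use s1 b0 in auto)
  show "okD b (b + 1) (Seq (SV nCC (Sub (V nEE) (Mul RE (Div (V nEE) RE)))) (Seq (SV nEE (Div (V nEE) RE)) (Seq ?W (SV nEE (Div (V nEE) (Const 2)))))) s ?Q"
  proof (rule okK_Seq[where R = "\<lambda>s'. s' = upd s nCC 0 (int c0)" and g = "\<lambda>_. 0"])
    have c0v: "int d - int digit_base * (int d div int digit_base) = int c0" unfolding c0_def zmod_int minus_mult_div_eq_mod ..
    have "c0 \<le> e" unfolding c0_def using de mod_less_eq_dividend order_trans by blast
    thus "okD b (b + 1) (SV nCC (Sub (V nEE) (Mul RE (Div (V nEE) RE)))) s (\<lambda>s'. s' = upd s nCC 0 (int c0))"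
      by (intro okD_SV) (use s b0 RE[of s] le[of c0] c0v in \<open>auto simp: d_def\<close>)
    fix s1 assume s1: "bnd b s1" "s1 = upd s nCC 0 (int c0)"
    show "okD b (b + 1) (Seq (SV nEE (Div (V nEE) RE)) (Seq ?W (SV nEE (Div (V nEE) (Const 2))))) s1 ?Q"
    proof (rule okK_Seq[where R = "\<lambda>s'. ?I c0 d1 s'" and g = "\<lambda>_. 0"])
      show "okD b (b + 1) (SV nEE (Div (V nEE) RE)) s1 (\<lambda>s'. ?I c0 d1 s')"
        by (rule okD_SV) (use s1 s b0 RE[of s1] le[OF d1e] cd in \<open>auto simp: d_def d1_def zdiv_int\<close>)
      fix s2 assume s2: "bnd b s2" "?I c0 d1 s2"
      show "okD b (b + 1) (Seq ?W (SV nEE (Div (V nEE) (Const 2)))) s2 ?Q"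
      proof (rule okK_Seq[OF okK_conseq[OF W[OF s2]]])
        fix s3 assume s3: "bnd b s3" "\<exists>x. eqx {nEE, nCC} s s3 \<and> rd s3 nCC 0 = int (dcode digit_base e i) \<and> rd s3 nEE 0 = int x \<and> x div 2 = rest d1 \<and> x \<le> e"
        then obtain x where x: "eqx {nEE, nCC} s s3" "rd s3 nCC 0 = int (dcode digit_base e i)" "rd s3 nEE 0 = int x" "x div 2 = rest d1" "x \<le> e" by blast
        have xr: "int x div 2 = int (rest d1)" using x(4) zdiv_int[of x 2] by simp
        have "rest d1 \<le> e" using rest_le[of d1] d1e by simp
        note lr = le[OF this]
        show "okD b (b + 1) (SV nEE (Div (V nEE) (Const 2))) s3 ?Q"
          by (rule okD_SV) (use s3 b0 x(1-3) xr cd lr in auto)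
      qed auto
    qed
  qed
qed

end

section \<open>Frank--Wolfe runs and the best fractional cut\<close>

definition FRANK_WOLFE :: prog where
  "FRANK_WOLFE = Seq (For cV (V nN) (SA aX (V cV) (Const 0)))
     (For cT (Mul (Const 16) (Mul (V nP) (V nP))) (Seq (SV nTau (Add (V cT) (Less (V cT) (Const 1)))) (Seq MATVEC
        (For cV (V nN) (SA aX (V cV) (Add (AR aX (V cV)) (Sub (Less (AR aY (V cV)) (Const 0)) (Less (Const 0) (AR aY (V cV))))))))))"

definition EVALUATE :: prog where
  "EVALUATE = Seq (SV nVal (Const 0)) (For cE (V nM) (SV nVal (Add (V nVal) (Mul (AR aX EU) (AR aX EV)))))"

text \<open>Assigning \<open>nBest\<close> to itself plays the part of an empty statement, which the
  language does not have.\<close>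

definition KEEP_BEST :: prog where
  "KEEP_BEST = prog.If (Less (V nVal) (V nBest))
     (Seq (SV nBest (V nVal)) (For cV (V nN) (SA aBX (V cV) (AR aX (V cV))))) (SV nBest (V nBest))"

definition ENUM :: prog where
  "ENUM = For nE (V nMM) (Seq (SV nEE (V nE)) (Seq DECODE (Seq FRANK_WOLFE (Seq EVALUATE KEEP_BEST))))"

context graph_instance
begin

definition VAL :: "(nat \<Rightarrow> int) \<Rightarrow> int" where "VAL x = (\<Sum>j<m. x (us j) * x (vs j))"

lemma VAL_cong: "(\<And>v. v < n \<Longrightarrow> x v = y v) \<Longrightarrow> VAL x = VAL y"
  unfolding VAL_def using edges by (intro sum.cong) auto

end

context staged
begin

lemma guess_le:
  assumes i: "i < q" and e: "int e \<le> U k"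
  shows "\<bar>guess be q e i\<bar> \<le> U k ^ 4"
proof -
  define c where "c = dcode digit_base e i"
  have "int c \<le> U k ^ 2" unfolding c_def by (rule digit_base_add_le[OF e dcode_le[OF digit_base_bounds(1)]])
  moreover have "\<bar>dval c\<bar> \<le> int c"
  proof -
    have "c mod 2 = 0 \<or> c mod 2 = 1" by auto
    thus ?thesis by (auto simp: dval_def)
  qed
  moreover have "\<bar>grid_step (Sc be (Suc i)) q\<bar> \<le> U k ^ 2" using grid_step_le[OF i order_refl] unfolding grid_step_def by simp
  ultimately have "\<bar>guess be q e i\<bar> \<le> U k ^ 2 * U k ^ 2"
    unfolding guess_def abs_mult c_def[symmetric] by (intro mult_mono) auto
  also have "\<dots> = U k ^ 4" by (simp add: power_add[symmetric])
  finally show ?thesis .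
qed

abbreviation "modD \<equiv> {cK, nDl, nCC, nEE, aT}"

lemma ok_DECODE:
  assumes s: "eI s" "bnd b s" "rd s nEE 0 = int e" and e: "int e \<le> U k"
  shows "okD b ((q + 1) * (b + 1)) DECODE s (\<lambda>s'. eqx modD s s' \<and> (\<forall>i<q. rd s' aT i = guess be q e i))"
proof -
  let ?I = "\<lambda>j s'. eqx modD s s' \<and> rd s' nEE 0 = int (dstate digit_base e j) \<and> (\<forall>i<j. rd s' aT i = guess be q e i)"
  let ?T = "SA aT (V cK) (Mul (V nDl) (Mul (Div (V nCC) (Const 2)) (Sub (Const 1) (Mul (Const 2) (oddE (V nCC))))))"
  have "okD b ((q + 1) * (b + 1)) DECODE s (\<lambda>s'. ?I q s' \<and> rd s' cK 0 = int q)"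
    unfolding DECODE_def
  proof (rule okD_For[where I = ?I])
    fix i s1 assume i: "i < q" and I: "?I i s1" and c: "rd s1 cK 0 = int i" and b1: "bnd b s1"
    have e1: "eI s1" using eI_eqx[OF s(1) conjunct1[OF I]] by simp
    show "okD b (b + 1) (Seq GRID_STEP (Seq NEXT_DIGIT ?T)) s1 (\<lambda>s'. ?I (Suc i) s' \<and> rd s' cK 0 = int i)"
    proof (rule okK_Seq[OF ok_GRID_STEP[OF e1 b1 c i]])
      fix s2 assume s2: "bnd b s2" "eqx {nDl} s1 s2 \<and> rd s2 nDl 0 = grid_step (Sc be (Suc i)) q"
      have e2: "eI s2" using eI_eqx[OF e1 conjunct1[OF s2(2)]] by simp
      have d2: "rd s2 nEE 0 = int (dstate digit_base e i)" using eqx_rd[OF conjunct1[OF s2(2)], of nEE] I by simp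
      show "okD b (b + 1) (Seq NEXT_DIGIT ?T) s2 (\<lambda>s'. ?I (Suc i) s' \<and> rd s' cK 0 = int i)"
      proof (rule okK_Seq[OF ok_NEXT_DIGIT[OF e2 s2(1) d2 e]])
        fix s3 assume s3: "bnd b s3" "eqx {nEE, nCC} s2 s3 \<and> rd s3 nCC 0 = int (dcode digit_base e i) \<and> rd s3 nEE 0 = int (dstate digit_base e (Suc i))"
        have "eqx modD s1 s2" "eqx modD s2 s3" using s2 s3 by (auto intro: eqx_mono)
        hence es3: "eqx modD s s3" using I eqx_trans by blast
        have r3: "rd s3 cK 0 = int i" "rd s3 nDl 0 = grid_step (Sc be (Suc i)) q" "\<forall>j<i. rd s3 aT j = guess be q e j"
          using s2 s3 c I by (auto simp: eqx_rd)
        let ?g = "Mul (V nDl) (Mul (Div (V nCC) (Const 2)) (Sub (Const 1) (Mul (Const 2) (oddE (V nCC)))))"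
        have vg: "val ?g s3 = guess be q e i" using r3 s3 by (simp add: guess_def dval_def zdiv_int zmod_int)
        have gl: "len (guess be q e i) \<le> b" by (rule len_le_of_U_small_power[OF guess_le[OF i e]]) simp
        show "okD b (b + 1) ?T s3 (\<lambda>s'. ?I (Suc i) s' \<and> rd s' cK 0 = int i)"
          by (rule okD_SA[where i = i], unfold vg) (use s3 b0 r3 es3 gl in \<open>auto simp: less_Suc_eq simp del: dstate.simps\<close>)
      qed
    qed
  qed (use s b2 len_parameters_le eI_rd(4)[OF eI_eqx[OF s(1)]] in auto)
  thus ?thesis by (rule okD_conseq) auto
qed

abbreviation "modF \<equiv> {cV, aX, cT, nTau, cE, cI, cW, nDot, aY}"

lemma Tt_le_U: "int Tt \<le> U k"
proof -
  have "Tt \<le> H" using H_gt(5) unfolding Tt_def by linarith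
  thus ?thesis using H_le_U(1)[of k] by linarith
qed

lemma ok_FRANK_WOLFE:
  assumes s: "eI s" "bnd b s" and t: "\<And>i. i < q \<Longrightarrow> rd s aT i = t i" "\<And>i. i < q \<Longrightarrow> \<bar>t i\<bar> \<le> U k ^ 4"
  shows "okD b ((Tt + 1) * ((q + 1) * (n + m + 1))) FRANK_WOLFE s (\<lambda>s'. eqx modF s s' \<and> (\<forall>v<n. rd s' aX v = fwX t w be q Tt v))"
  unfolding FRANK_WOLFE_def
proof -
  let ?K = "(q + 1) * (n + m + 1)"
  let ?L = "For cV (V nN) (SA aX (V cV) (Add (AR aX (V cV)) (Sub (Less (AR aY (V cV)) (Const 0)) (Less (Const 0) (AR aY (V cV))))))"
  let ?S = "SV nTau (Add (V cT) (Less (V cT) (Const 1)))"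
  let ?I = "\<lambda>j s'. eqx modF s s' \<and> (\<forall>v<n. rd s' aX v = fwX t w be q j v)"
  have lb: "len z \<le> b" if "\<bar>z\<bar> \<le> int Tt" for z
    by (rule len_le_of_U_small_power[of _ 1]) (use that Tt_le_U in auto)
  have K1: "okD b ((n + 1) * 1) (For cV (V nN) (SA aX (V cV) (Const 0))) s
     (\<lambda>s'. (eqx modF s s' \<and> (\<forall>v<n. rd s' aX v = 0)) \<and> rd s' cV 0 = int n)"
  proof (rule okD_For[where I = "\<lambda>j s'. eqx modF s s' \<and> (\<forall>v<j. rd s' aX v = 0)"])
    fix j s' assume a: "j < n" "eqx modF s s' \<and> (\<forall>v<j. rd s' aX v = 0)" "rd s' cV 0 = int j" "bnd b s'"
    show "okD b 1 (SA aX (V cV) (Const 0)) s' (\<lambda>s'. (eqx modF s s' \<and> (\<forall>v<Suc j. rd s' aX v = 0)) \<and> rd s' cV 0 = int j)"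
      by (rule okD_SA[where i = j]) (use a b0 b2 in \<open>auto simp: len_0 less_Suc_eq\<close>)
  qed (use s b2 len_parameters_le eI_rd(1)[OF eI_eqx[OF s(1)]] in auto)
  have main: "okD b ((Tt + 1) * ?K) (For cT (Mul (Const 16) (Mul (V nP) (V nP))) (Seq ?S (Seq MATVEC ?L))) s1 (\<lambda>s'. ?I Tt s' \<and> rd s' cT 0 = int Tt)"
    if s1: "bnd b s1" "?I 0 s1" for s1
  proof (rule okD_For[where I = ?I])
    fix j s2 assume j: "j < Tt" and I: "?I j s2" and c: "rd s2 cT 0 = int j" and b2': "bnd b s2"
    let ?\<tau> = "int (max 1 j)"
    define x where "x = fwX t w be q j"
    have xT: "\<bar>x v\<bar> \<le> int Tt" for v using fwX_bound[of t w be q j v] j unfolding x_def by linarith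
    show "okD b ?K (Seq ?S (Seq MATVEC ?L)) s2 (\<lambda>s'. ?I (Suc j) s' \<and> rd s' cT 0 = int j)"
    proof (rule okK_Seq[where R = "\<lambda>s'. s' = upd s2 nTau 0 ?\<tau>" and g = "\<lambda>_. 0"])
      have "val (Add (V cT) (Less (V cT) (Const 1))) s2 = ?\<tau>" using c by (cases j) auto
      moreover have "len ?\<tau> \<le> b" by (rule lb) (use j in auto)
      ultimately show "okD b ?K ?S s2 (\<lambda>s'. s' = upd s2 nTau 0 ?\<tau>)"
        by (intro okD_SV) (use b2' b0 in auto)
      fix s3 assume s3: "bnd b s3" "s3 = upd s2 nTau 0 ?\<tau>"
      have es3: "eqx modF s s3" using I s3(2) by simp
      have e3: "eI s3" using eI_eqx[OF s(1) es3] by simp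
      have x3: "rd s3 aX v = x v" if "v < n" for v using I s3 that by (simp add: x_def)
      have t3: "rd s3 aT i = t i" if "i < q" for i using eqx_rd[OF es3, of aT] t(1)[OF that] by simp
      \<comment> \<open>Large enough for the scaled sums, at most \<open>H * Tt\<close>, and for the
        scaled guesses, at most \<open>Tt * U k ^ 4\<close>.\<close>
      define \<xi> where "\<xi> = U k ^ 5"
      have \<xi>: "0 \<le> \<xi>" using U_k_ge_1(1) by (simp add: \<xi>_def)
      have x2: "U k ^ 2 \<le> \<xi>" unfolding \<xi>_def using U_k_ge_1 by (intro power_increasing) auto
      have HT: "int H * int Tt \<le> U k ^ 2" unfolding power2_eq_square using H_le_U(1)[of k] Tt_le_U by (intro mult_mono) auto
      have mv: "okD b ?K MATVEC s3 (\<lambda>s'. eqx modMV s3 s' \<and> (\<forall>v<n. rd s' aY v = yrec (int H) ?\<tau> t w be x q v))"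
      proof (rule ok_MATVEC[where \<xi> = \<xi>])
        fix v assume "v < n"
        have "\<bar>int H * x v\<bar> \<le> int H * int Tt" unfolding abs_mult using xT by (intro mult_mono) auto
        thus "\<bar>int H * x v\<bar> \<le> \<xi>" using HT x2 by linarith
        have "1 * int Tt \<le> int H * int Tt" using H_gt(1) by (intro mult_right_mono) auto
        thus "\<bar>x v\<bar> \<le> \<xi>" using xT[of v] HT x2 by linarith
      next
        fix i assume i: "i < q"
        have "\<bar>?\<tau> * t i\<bar> \<le> U k * U k ^ 4" unfolding abs_mult using t(2)[OF i] Tt_le_U j by (intro mult_mono) auto
        also have "\<dots> = \<xi>" by (simp add: \<xi>_def numeral_eq_Suc)
        finally show "\<bar>?\<tau> * t i\<bar> \<le> \<xi>" .
      next
        fix z assume "\<bar>z\<bar> \<le> U q * \<xi>"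
        also have "\<dots> \<le> U k * \<xi>" using U_mono[OF qk] \<xi> by (intro mult_right_mono) auto
        also have "\<dots> = U k ^ 6" by (simp add: \<xi>_def numeral_eq_Suc)
        finally show "len z \<le> b" by (rule len_le_of_U_small_power) simp
      qed (use s3(1) b2 e3 wb \<xi> x3 t3 in \<open>auto simp: eI_def\<close>, simp add: s3(2))
      show "okD b ?K (Seq MATVEC ?L) s3 (\<lambda>s'. ?I (Suc j) s' \<and> rd s' cT 0 = int j)"
      proof (rule okK_Seq[OF mv])
        fix s4 assume s4: "bnd b s4" "eqx modMV s3 s4 \<and> (\<forall>v<n. rd s4 aY v = yrec (int H) ?\<tau> t w be x q v)"
        have "eqx modF s3 s4" using s4 by (auto intro: eqx_mono)
        hence es4: "eqx modF s s4" using es3 eqx_trans by blast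
        have r4: "rd s4 cT 0 = int j" "\<forall>v<n. rd s4 aX v = x v" using s4 s3 c x3 by (auto simp: eqx_rd)
        let ?J = "\<lambda>i s'. eqx modF s s' \<and> rd s' cT 0 = int j \<and> rd s' aY = rd s4 aY \<and> (\<forall>v<n. rd s' aX v = (if v < i then fwX t w be q (Suc j) v else x v))"
        have "okD b ((n + 1) * 1) ?L s4 (\<lambda>s'. ?J n s' \<and> rd s' cV 0 = int n)"
        proof (rule okD_For[where I = ?J])
          fix i s5 assume i: "i < n" and J: "?J i s5" and c5: "rd s5 cV 0 = int i" and b5: "bnd b s5"
          have y5: "rd s5 aY i = yrec (int H) ?\<tau> t w be x q i" using J s4 i by simp
          have xS: "fwX t w be q (Suc j) i = x i + neg_sgn (yrec (int H) ?\<tau> t w be x q i)" by (simp add: x_def)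
          have "len (fwX t w be q (Suc j) i) \<le> b" by (rule lb) (use fwX_bound[of t w be q "Suc j" i] j in linarith)
          thus "okD b 1 (SA aX (V cV) (Add (AR aX (V cV)) (Sub (Less (AR aY (V cV)) (Const 0)) (Less (Const 0) (AR aY (V cV)))))) s5
             (\<lambda>s'. ?J (Suc i) s' \<and> rd s' cV 0 = int i)"
            unfolding xS
            by (intro okD_SA[where i = i]) (use b5 b0 J c5 y5 i in \<open>auto simp: neg_sgn_def xS simp del: fwX.simps yrec.simps intro!: ext\<close>)
        qed (use s4 b2 r4 es4 len_parameters_le eI_rd(1)[OF eI_eqx[OF s(1)]] in \<open>auto intro!: ext\<close>)
        thus "okD b ?K ?L s4 (\<lambda>s'. ?I (Suc j) s' \<and> rd s' cT 0 = int j)"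
          by (rule okD_conseq) (auto simp del: fwX.simps)
      qed
    qed
  next
    fix j s2 assume I: "?I j s2"
    show "val (Mul (Const 16) (Mul (V nP) (V nP))) s2 = int Tt" using eI_rd(3)[OF eI_eqx[OF s(1) conjunct1[OF I]]] by (simp add: Tt_def power2_eq_square)
  qed (use s1 b2 lb[of "int Tt"] in auto)
  show "okD b ((Tt + 1) * ?K) (Seq (For cV (V nN) (SA aX (V cV) (Const 0))) (For cT (Mul (Const 16) (Mul (V nP) (V nP))) (Seq ?S (Seq MATVEC ?L)))) s (?I Tt)"
  proof (rule okK_Seq[OF okK_conseq[OF K1]])
    show "(n + 1) * 1 \<le> (Tt + 1) * ?K"
    proof -
      have "1 * (n + 1) \<le> ((Tt + 1) * (q + 1)) * (n + m + 1)" by (intro mult_mono) auto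
      thus ?thesis by (simp add: mult.assoc)
    qed
    fix s1 assume "bnd b s1" "(eqx modF s s1 \<and> (\<forall>v<n. rd s1 aX v = 0)) \<and> rd s1 cV 0 = int n"
    hence "bnd b s1" "?I 0 s1" by auto
    from main[OF this] show "okD b ((Tt + 1) * ?K) (For cT (Mul (Const 16) (Mul (V nP) (V nP))) (Seq ?S (Seq MATVEC ?L))) s1 (?I Tt)"
      by (rule okD_conseq) auto
  qed auto
qed

lemma sum_prod_le:
  assumes x: "\<And>v. v < n \<Longrightarrow> \<bar>x v\<bar> \<le> int Tt" and j: "j \<le> m"
  shows "\<bar>\<Sum>i<j. x (us i) * x (vs i)\<bar> \<le> U k ^ 3"
proof -
  have "\<bar>\<Sum>i<j. x (us i) * x (vs i)\<bar> \<le> (\<Sum>i<j. U k * U k)"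
  proof (rule order_trans[OF sum_abs], intro sum_mono)
    fix i assume "i \<in> {..<j}"
    hence "us i < n" "vs i < n" using edges j by auto
    hence "\<bar>x (us i)\<bar> \<le> U k" "\<bar>x (vs i)\<bar> \<le> U k" using x Tt_le_U order_trans by blast+
    thus "\<bar>x (us i) * x (vs i)\<bar> \<le> U k * U k" unfolding abs_mult using U_k_ge_1 by (intro mult_mono) auto
  qed
  also have "\<dots> = int j * (U k * U k)" by simp
  also have "\<dots> \<le> U k * (U k * U k)" using j H_powers(3) H_le_U(1)[of k] by (intro mult_right_mono) auto
  finally show ?thesis by (simp add: numeral_eq_Suc)
qed

lemma ok_EVALUATE:
  assumes s: "eI s" "bnd b s" and x: "\<And>v. v < n \<Longrightarrow> rd s aX v = x v" "\<And>v. v < n \<Longrightarrow> \<bar>x v\<bar> \<le> int Tt"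
  shows "okD b (m + 1) EVALUATE s (\<lambda>s'. eqx {nVal, cE} s s' \<and> rd s' nVal 0 = VAL x)"
  unfolding EVALUATE_def VAL_def
proof (rule okK_Seq[where R = "\<lambda>s'. s' = upd s nVal 0 0" and g = "\<lambda>_. 0"])
  show "okD b (m + 1) (SV nVal (Const 0)) s (\<lambda>s'. s' = upd s nVal 0 0)"
    by (rule okD_SV) (use s b2 in \<open>auto simp: len_0\<close>)
  fix s1 assume s1: "bnd b s1" "s1 = upd s nVal 0 0"
  let ?I = "\<lambda>j s'. eqx {nVal, cE} s s' \<and> rd s' nVal 0 = (\<Sum>i<j. x (us i) * x (vs i))"
  have "okD b ((m + 1) * 1) (For cE (V nM) (SV nVal (Add (V nVal) (Mul (AR aX EU) (AR aX EV))))) s1 (\<lambda>s'. ?I m s' \<and> rd s' cE 0 = int m)"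
  proof (rule okD_For[where I = ?I])
    fix j s2 assume j: "j < m" and I: "?I j s2" and c: "rd s2 cE 0 = int j" and b2': "bnd b s2"
    have "eI s2" using eI_eqx[OF s(1) conjunct1[OF I]] by simp
    hence i2: "inp s2 (3 + 2 * j) = int (us j)" "inp s2 (4 + 2 * j) = int (vs j)" using j by (auto simp: eI_def env_def)
    have "us j < n" "vs j < n" using edges j by auto
    hence x2: "rd s2 aX (us j) = x (us j)" "rd s2 aX (vs j) = x (vs j)" using I x by (auto simp: eqx_rd)
    have "len (\<Sum>i<Suc j. x (us i) * x (vs i)) \<le> b" by (rule len_le_of_U_small_power[OF sum_prod_le[OF x(2)]]) (use j in auto)
    thus "okD b 1 (SV nVal (Add (V nVal) (Mul (AR aX EU) (AR aX EV)))) s2 (\<lambda>s'. ?I (Suc j) s' \<and> rd s' cE 0 = int j)"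
      by (intro okD_SV) (use b2' b0 I c i2 x2 in auto)
  qed (use s1 b2 len_parameters_le eI_rd(2)[OF eI_eqx[OF s(1)]] in auto)
  thus "okD b (m + 1) (For cE (V nM) (SV nVal (Add (V nVal) (Mul (AR aX EU) (AR aX EV))))) s1 (?I m)"
    by (rule okD_conseq) auto
qed

text \<open>The best value is never positive, so even if all guesses are useless the rounded cut has
  expectation at least \<open>m / 2\<close>. The bound \<open>Tt\<close> on the entries makes them
  numerators of probabilities after a shift.\<close>

definition bI :: "memory \<Rightarrow> bool" where
  "bI s \<longleftrightarrow> rd s nBest 0 = VAL (rd s aBX) \<and> VAL (rd s aBX) \<le> 0 \<and> (\<forall>v<n. \<bar>rd s aBX v\<bar> \<le> int Tt)"

lemma ok_KEEP_BEST:
  assumes s: "eI s" "bnd b s" "bI s" "rd s nVal 0 = VAL (rd s aX)" "\<And>v. v < n \<Longrightarrow> \<bar>rd s aX v\<bar> \<le> int Tt"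
  shows "okD b (n + 1) KEEP_BEST s (\<lambda>s'. eqx {nBest, cV, aBX} s s' \<and> bI s' \<and> rd s' nBest 0 \<le> rd s nBest 0 \<and> rd s' nBest 0 \<le> VAL (rd s aX))"
  unfolding KEEP_BEST_def
proof (rule okK_If)
  let ?Q = "\<lambda>s'. eqx {nBest, cV, aBX} s s' \<and> bI s' \<and> rd s' nBest 0 \<le> rd s nBest 0 \<and> rd s' nBest 0 \<le> VAL (rd s aX)"
  have bb: "len (rd s nVal 0) \<le> b" "len (rd s nBest 0) \<le> b" using bnd_rd[OF s(2)] by auto
  show "okD b (n + 1) (if val (Less (V nVal) (V nBest)) s \<noteq> 0 then Seq (SV nBest (V nVal)) (For cV (V nN) (SA aBX (V cV) (AR aX (V cV)))) else SV nBest (V nBest)) s ?Q"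
  proof (cases "rd s nVal 0 < rd s nBest 0")
    case False
    have "okD b (n + 1) (SV nBest (V nBest)) s ?Q"
      by (rule okD_SV) (use s b0 bb False in \<open>auto simp: bI_def fun_eq_iff cong: VAL_cong\<close>)
    thus ?thesis using False by simp
  next
    case True
    have "okD b (n + 1) (Seq (SV nBest (V nVal)) (For cV (V nN) (SA aBX (V cV) (AR aX (V cV))))) s ?Q"
    proof (rule okK_Seq[where R = "\<lambda>s'. s' = upd s nBest 0 (VAL (rd s aX))" and g = "\<lambda>_. 0"])
      show "okD b (n + 1) (SV nBest (V nVal)) s (\<lambda>s'. s' = upd s nBest 0 (VAL (rd s aX)))"
        by (rule okD_SV) (use s b0 bb in auto)
      fix s1 assume s1: "bnd b s1" "s1 = upd s nBest 0 (VAL (rd s aX))"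
      let ?I = "\<lambda>j s'. eqx {nBest, cV, aBX} s s' \<and> rd s' nBest 0 = VAL (rd s aX) \<and> (\<forall>v<j. rd s' aBX v = rd s aX v)"
      have "okD b ((n + 1) * 1) (For cV (V nN) (SA aBX (V cV) (AR aX (V cV)))) s1 (\<lambda>s'. ?I n s' \<and> rd s' cV 0 = int n)"
      proof (rule okD_For[where I = ?I])
        fix j s2 assume j: "j < n" and I: "?I j s2" and c: "rd s2 cV 0 = int j" and b2': "bnd b s2"
        show "okD b 1 (SA aBX (V cV) (AR aX (V cV))) s2 (\<lambda>s'. ?I (Suc j) s' \<and> rd s' cV 0 = int j)"
          by (rule okD_SA[where i = j]) (use b2' b0 I c bnd_rd[OF s(2), of aX j] in \<open>auto simp: eqx_rd less_Suc_eq\<close>)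
      qed (use s1 b2 len_parameters_le eI_rd(1)[OF eI_eqx[OF s(1)]] in auto)
      thus "okD b (n + 1) (For cV (V nN) (SA aBX (V cV) (AR aX (V cV)))) s1 ?Q"
      proof (rule okD_conseq)
        fix s2 assume a: "?I n s2 \<and> rd s2 cV 0 = int n"
        have "VAL (rd s2 aBX) = VAL (rd s aX)" by (rule VAL_cong) (use a in auto)
        thus "?Q s2" using a True s(3,4,5) by (auto simp: bI_def)
      qed auto
    qed
    thus ?thesis using True by simp
  qed
qed (use s b0 in auto)

definition Kenum :: nat where
  "Kenum = (q + 1) * (b + 1) + (Tt + 1) * ((q + 1) * (n + m + 1))"

lemma ok_ENUM:
  assumes s: "eI s" "bnd b s" "bI s"
  shows "okD b (((1024 * P) ^ q + 1) * Kenum) ENUM s (\<lambda>s'. eI s' \<and> bI s' \<and>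
     (\<forall>e<(1024 * P) ^ q. VAL (rd s' aBX) \<le> VAL (fwX (guess be q e) w be q Tt)))"
proof -
  let ?M = "(1024 * P) ^ q"
  let ?B = "Seq (SV nEE (V nE)) (Seq DECODE (Seq FRANK_WOLFE (Seq EVALUATE KEEP_BEST)))"
  let ?I = "\<lambda>e s'. eI s' \<and> bI s' \<and> (\<forall>e'<e. rd s' nBest 0 \<le> VAL (fwX (guess be q e') w be q Tt))"
  have MU: "int ?M \<le> U k" using guess_count_le_U[OF qk] by simp
  have K: "(q + 1) * (b + 1) \<le> Kenum" "(Tt + 1) * ((q + 1) * (n + m + 1)) \<le> Kenum" "m + 1 \<le> Kenum" "n + 1 \<le> Kenum" "1 \<le> Kenum"
  proof -
    have "1 * (n + m + 1) \<le> ((Tt + 1) * (q + 1)) * (n + m + 1)" by (intro mult_right_mono) auto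
    also have "\<dots> \<le> Kenum" unfolding Kenum_def mult.assoc by (rule le_add2)
    finally show "m + 1 \<le> Kenum" "n + 1 \<le> Kenum" "1 \<le> Kenum" by auto
  qed (auto simp: Kenum_def)
  have "okD b ((?M + 1) * Kenum) ENUM s (\<lambda>s'. ?I ?M s' \<and> rd s' nE 0 = int ?M)"
    unfolding ENUM_def
  proof (rule okD_For[where I = ?I])
    fix e s1 assume e: "e < ?M" and I: "?I e s1" and c: "rd s1 nE 0 = int e" and b1: "bnd b s1"
    have eU: "int e \<le> U k" using e MU by linarith
    show "okD b Kenum ?B s1 (\<lambda>s'. ?I (Suc e) s' \<and> rd s' nE 0 = int e)"
    proof (rule okK_Seq[where R = "\<lambda>s'. s' = upd s1 nEE 0 (int e)" and g = "\<lambda>_. 0"])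
      show "okD b Kenum (SV nEE (V nE)) s1 (\<lambda>s'. s' = upd s1 nEE 0 (int e))"
        by (rule okD_SV) (use b1 b0 K c bnd_rd[OF b1, of nE 0] in auto)
      fix s2 assume s2: "bnd b s2" "s2 = upd s1 nEE 0 (int e)"
      have e12: "eqx {nEE} s1 s2" using s2 by simp
      have e2: "eI s2" using eI_eqx[OF _ e12] I by simp
      have r2: "rd s2 nEE 0 = int e" using s2 by simp
      show "okD b Kenum (Seq DECODE (Seq FRANK_WOLFE (Seq EVALUATE KEEP_BEST))) s2 (\<lambda>s'. ?I (Suc e) s' \<and> rd s' nE 0 = int e)"
      proof (rule okK_Seq[OF okK_conseq[OF ok_DECODE[OF e2 s2(1) r2 eU] K(1)]])
        fix s3 assume s3: "bnd b s3" "eqx modD s2 s3 \<and> (\<forall>i<q. rd s3 aT i = guess be q e i)"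
        have e3: "eI s3" using eI_eqx[OF e2 conjunct1[OF s3(2)]] by simp
        define X where "X = fwX (guess be q e) w be q Tt"
        have fw: "okD b ((Tt + 1) * ((q + 1) * (n + m + 1))) FRANK_WOLFE s3 (\<lambda>s'. eqx modF s3 s' \<and> (\<forall>v<n. rd s' aX v = X v))"
          unfolding X_def by (rule ok_FRANK_WOLFE[OF e3 s3(1)]) (use s3 guess_le eU in auto)
        show "okD b Kenum (Seq FRANK_WOLFE (Seq EVALUATE KEEP_BEST)) s3 (\<lambda>s'. ?I (Suc e) s' \<and> rd s' nE 0 = int e)"
        proof (rule okK_Seq[OF okK_conseq[OF fw K(2)]])
          fix s4 assume s4: "bnd b s4" "eqx modF s3 s4 \<and> (\<forall>v<n. rd s4 aX v = X v)"
          have e4: "eI s4" using eI_eqx[OF e3 conjunct1[OF s4(2)]] by simp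
          have X: "\<bar>X v\<bar> \<le> int Tt" for v unfolding X_def by (rule fwX_bound)
          have vx: "okD b (m + 1) EVALUATE s4 (\<lambda>s'. eqx {nVal, cE} s4 s' \<and> rd s' nVal 0 = VAL X)"
            by (rule ok_EVALUATE[OF e4 s4(1)]) (use s4 X in auto)
          show "okD b Kenum (Seq EVALUATE KEEP_BEST) s4 (\<lambda>s'. ?I (Suc e) s' \<and> rd s' nE 0 = int e)"
          proof (rule okK_Seq[OF okK_conseq[OF vx K(3)]])
            fix s5 assume s5: "bnd b s5" "eqx {nVal, cE} s4 s5 \<and> rd s5 nVal 0 = VAL X"
            have e5: "eI s5" using eI_eqx[OF e4 conjunct1[OF s5(2)]] by simp
            have r5: "rd s5 aBX = rd s1 aBX" "rd s5 nBest = rd s1 nBest" "rd s5 nE = rd s1 nE" "rd s5 aX = rd s4 aX"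
              using s5 s4 s3 s2 by (auto simp: eqx_def)
            have b5: "bI s5" using I by (simp add: bI_def r5)
            have X5: "VAL (rd s5 aX) = VAL X" by (rule VAL_cong) (use s4 r5 in auto)
            have "okD b (n + 1) KEEP_BEST s5 (\<lambda>s'. eqx {nBest, cV, aBX} s5 s' \<and> bI s' \<and> rd s' nBest 0 \<le> rd s5 nBest 0 \<and> rd s' nBest 0 \<le> VAL (rd s5 aX))"
              by (rule ok_KEEP_BEST[OF e5 s5(1) b5]) (use s5 X5 X r5 s4 in auto)
            thus "okD b Kenum KEEP_BEST s5 (\<lambda>s'. ?I (Suc e) s' \<and> rd s' nE 0 = int e)"
            proof (rule okD_conseq[OF _ K(4)])
              fix s6 assume a: "eqx {nBest, cV, aBX} s5 s6 \<and> bI s6 \<and> rd s6 nBest 0 \<le> rd s5 nBest 0 \<and> rd s6 nBest 0 \<le> VAL (rd s5 aX)"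
              have "eI s6" using eI_eqx[OF e5 conjunct1[OF a]] by simp
              moreover have "rd s6 nBest 0 \<le> VAL (fwX (guess be q e') w be q Tt)" if "e' < Suc e" for e'
              proof (cases "e' = e")
                case True
                thus ?thesis using a X5 by (simp add: X_def)
              next
                case False
                hence "rd s1 nBest 0 \<le> VAL (fwX (guess be q e') w be q Tt)" using I that by auto
                thus ?thesis using a r5 by simp
              qed
              moreover have "rd s6 nE 0 = int e" using eqx_rd[OF conjunct1[OF a], of nE] r5 c by simp
              ultimately show "?I (Suc e) s6 \<and> rd s6 nE 0 = int e" using a by blast
            qed
          qed auto
        qed auto
      qed auto
    qed
  next
    fix j s' x assume "?I j s'"
    moreover from this have "eI (upd s' nE 0 x)" using eI_eqx[of s' "{nE}" "upd s' nE 0 x"] by simp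
    ultimately show "?I j (upd s' nE 0 x)" by (auto simp: bI_def fun_eq_iff cong: VAL_cong)
  next
    show "len (int ?M) \<le> b" by (rule len_le_of_U_small_power[of _ 1]) (use MU in auto)
  qed (use s b2 K eI_rd in auto)
  thus ?thesis by (rule okD_conseq) (auto simp: bI_def)
qed

end

section \<open>Randomized rounding\<close>

abbreviation (input) "nYr \<equiv> 31 :: nat"
abbreviation (input) "nWd \<equiv> 22 :: nat"
abbreviation (input) "nBit \<equiv> 41 :: nat"

text \<open>A coin halves the denominator and rounds an odd numerator up or down, so that 1 results
  with exactly the prescribed probability. The denominator must be a power of two; this is why
  \<open>P\<close> is one.\<close>

definition ROUND_VERTEX :: prog where
  "ROUND_VERTEX = While (Less (Const 1) (V nWd)) (Seq (Flip (AD nBit (Const 0)))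
     (Seq (SV nYr (Div (Add (V nYr) (V nBit)) (Const 2))) (SV nWd (Div (V nWd) (Const 2)))))"

definition TE :: expr where "TE = Mul (Const 16) (Mul (V nP) (V nP))"

text \<open>The results overwrite input cells, in general also the edge list. By now everything that
  is still read lies in the negative cells.\<close>

definition ROUND :: prog where
  "ROUND = For cT (V nN) (Seq (SV nYr (Add (AR aBX (V cT)) TE)) (Seq (SV nWd (Mul (Const 2) TE))
     (Seq ROUND_VERTEX (Store (V cT) (V nYr)))))"

definition updi :: "memory \<Rightarrow> nat \<Rightarrow> int \<Rightarrow> memory" where
  "updi s i x = s(int i := x)"

lemma rd_updi [simp]: "rd (updi s i x) = rd s"
  by (auto simp: rd_def updi_def adr_def intro!: ext)

lemma inp_updi [simp]: "inp (updi s i x) = (inp s)(i := x)"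
  by (auto simp: inp_def updi_def intro!: ext)

lemma okK_Store_inp:
  assumes "bnd b s" "b > 0" "K \<ge> 1" "val ie s = int i" "len (val e s) \<le> b" "Q (updi s i (val e s))" "x \<le> f (updi s i (val e s))"
  shows "okK b K (Store ie e) s Q f x"
  unfolding okK_def
  by (rule okE_conseq[OF okE_Store[where Q = Q and f = f and x = x]]) (use assms in \<open>auto simp: updi_def\<close>)

text \<open>Turns the success probability of the spectral stages into a share of the value that the
  later phases guarantee upon success.\<close>

lemma okK_scale:
  assumes "okK b K p s Q f x" "c \<ge> 0"
  shows "okK b K p s Q (\<lambda>s. c * f s) (c * x)"
proof -
  have "ennreal c * ennreal x \<le> ennreal c * (\<integral>\<^sup>+ r. ennreal (f (fst r)) \<partial>measure_spmf (exec p s))"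
    using assms by (intro mult_left_mono) (auto simp: okK_def okE_def)
  also have "\<dots> = (\<integral>\<^sup>+ r. ennreal (c * f (fst r)) \<partial>measure_spmf (exec p s))"
    by (subst nn_integral_cmult[symmetric]) (auto simp: ennreal_mult'[OF assms(2)])
  finally have "ennreal (c * x) \<le> (\<integral>\<^sup>+ r. ennreal (c * f (fst r)) \<partial>measure_spmf (exec p s))"
    by (simp add: ennreal_mult'[OF assms(2)])
  thus ?thesis using assms(1) by (auto simp: okK_def okE_def)
qed

context graph_instance
begin

text \<open>The multilinear extension of the cut value, in which rounding a coordinate keeps the expectation.\<close>

definition cutp :: "(nat \<Rightarrow> real) \<Rightarrow> real" where
  "cutp z = (\<Sum>j<m. z (us j) + z (vs j) - 2 * (z (us j) * z (vs j)))"

lemma cutp_cong: "(\<And>v. v < n \<Longrightarrow> z v = y v) \<Longrightarrow> cutp z = cutp y"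
  unfolding cutp_def using edges by (intro sum.cong) auto

text \<open>Each summand is affine in each coordinate because the endpoints of an edge are
  distinct.\<close>

lemma cutp_mid: "cutp (z(v := (a + b) / 2)) = (cutp (z(v := a)) + cutp (z(v := b))) / 2"
  unfolding cutp_def sum.distrib[symmetric] sum_divide_distrib
proof (intro sum.cong refl)
  fix j assume "j \<in> {..<m}"
  hence "us j \<noteq> vs j" using edges(3) by simp
  thus "(z(v := (a + b) / 2)) (us j) + (z(v := (a + b) / 2)) (vs j) - 2 * ((z(v := (a + b) / 2)) (us j) * (z(v := (a + b) / 2)) (vs j)) =
     ((z(v := a)) (us j) + (z(v := a)) (vs j) - 2 * ((z(v := a)) (us j) * (z(v := a)) (vs j)) +
      ((z(v := b)) (us j) + (z(v := b)) (vs j) - 2 * ((z(v := b)) (us j) * (z(v := b)) (vs j)))) / 2"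
    by (cases "us j = v"; cases "vs j = v") (auto simp: field_simps)
qed

lemma cutp_VAL: "T \<noteq> 0 \<Longrightarrow> cutp (\<lambda>v. (of_int (x v) + T) / (2 * T)) = real m / 2 - of_int (VAL x) / (2 * T\<^sup>2)"
proof -
  assume T: "T \<noteq> 0"
  have e: "(a + T) / (2 * T) + (c + T) / (2 * T) - 2 * ((a + T) / (2 * T) * ((c + T) / (2 * T))) = 1 / 2 - a * c / (2 * T\<^sup>2)" for a c :: real
    using T by (simp add: field_simps power2_eq_square)
  show ?thesis unfolding cutp_def e VAL_def by (simp add: sum_subtractf sum_divide_distrib)
qed

lemma Tt_pos: "Tt > 0" using P by (simp add: Tt_def)

end

context machine
begin

text \<open>\<open>y div 2 + (y + 1) div 2 = y\<close> makes the fraction a martingale, and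
  \<open>cutp\<close> is affine in it. The maximum with 0, needed for a nonnegative potential, is
  convex and so preserves the inequality.\<close>

lemma ok_ROUND_VERTEX:
  assumes s: "bnd b s" "0 \<le> rd s nYr 0" "rd s nYr 0 \<le> 2 ^ r" "rd s nWd 0 = 2 ^ r"
  shows "okK b (r + 1) ROUND_VERTEX s (\<lambda>s'. eqx {nYr, nWd, nBit} s s' \<and> (rd s' nYr 0 = 0 \<or> rd s' nYr 0 = 1))
     (\<lambda>s'. max 0 (cutp (z(v := of_int (rd s' nYr 0))))) (max 0 (cutp (z(v := of_int (rd s nYr 0) / 2 ^ r))))"
proof -
  let ?\<phi> = "\<lambda>s'. max 0 (cutp (z(v := of_int (rd s' nYr 0) / of_int (rd s' nWd 0))))"
  let ?J = "\<lambda>r s'. eqx {nYr, nWd, nBit} s s' \<and> 0 \<le> rd s' nYr 0 \<and> rd s' nYr 0 \<le> 2 ^ r \<and> rd s' nWd 0 = 2 ^ r"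
  have "okK b ((r + 1) * 1) ROUND_VERTEX s (\<lambda>s'. eqx {nYr, nWd, nBit} s s' \<and> (rd s' nYr 0 = 0 \<or> rd s' nYr 0 = 1))
     (\<lambda>s'. max 0 (cutp (z(v := of_int (rd s' nYr 0))))) (max 0 (cutp (z(v := of_int (rd s nYr 0) / 2 ^ r))))"
    unfolding ROUND_VERTEX_def
  proof (rule okK_While[where J = ?J and \<phi> = ?\<phi>])
    fix r s1 assume J: "?J r s1" and b1: "bnd b s1" and v: "val (Less (Const 1) (V nWd)) s1 \<noteq> 0"
    have "r \<noteq> 0" using J v by (intro notI) (auto split: if_splits)
    then obtain r' where r': "r = Suc r'" by (cases r) auto
    define y where "y = rd s1 nYr 0"
    have y: "0 \<le> y" "y \<le> 2 * 2 ^ r'" "rd s1 nWd 0 = 2 * 2 ^ r'" using J r' by (auto simp: y_def)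
    have yd: "0 \<le> (y + c) div 2 \<and> (y + c) div 2 \<le> 2 ^ r'" if "c = 0 \<or> c = 1" for c using that y by auto
    define h where "h c = max 0 (cutp (z(v := of_int ((y + c) div 2) / 2 ^ r')))" for c :: int
    have mid: "?\<phi> s1 \<le> (h 0 + h 1) / 2"
    proof -
      define a c where "a = (of_int (y div 2) / 2 ^ r' :: real)" and "c = (of_int ((y + 1) div 2) / 2 ^ r' :: real)"
      have "y div 2 + (y + 1) div 2 = y" by presburger
      hence "real_of_int (y div 2) + real_of_int ((y + 1) div 2) = of_int y" by (metis of_int_add)
      hence "(of_int y / of_int (2 * 2 ^ r') :: real) = (a + c) / 2" unfolding a_def c_def by (simp add: add_divide_distrib[symmetric])
      hence "cutp (z(v := of_int y / of_int (2 * 2 ^ r'))) = (cutp (z(v := a)) + cutp (z(v := c))) / 2" by (simp only: cutp_mid)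
      thus ?thesis unfolding h_def y(3) y_def[symmetric] a_def c_def by (auto simp: max_def)
    qed
    let ?R = "\<lambda>s2. \<exists>c. (c = 0 \<or> c = 1) \<and> s2 = upd s1 nBit 0 c"
    let ?g = "\<lambda>s2. h (rd s2 nBit 0)"
    have "okK b 1 (Seq (Flip (AD nBit (Const 0))) (Seq (SV nYr (Div (Add (V nYr) (V nBit)) (Const 2))) (SV nWd (Div (V nWd) (Const 2)))))
        s1 (?J r') ?\<phi> (?\<phi> s1)"
    proof (rule okK_Seq[where R = ?R and g = ?g])
      show "okK b 1 (Flip (AD nBit (Const 0))) s1 ?R ?g (?\<phi> s1)"
        by (rule okK_Flip[where i = 0]) (use b1 b2 mid in \<open>auto simp: h_def\<close>)
      fix s2 assume s2: "bnd b s2" "?R s2"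
      then obtain c where c: "c = 0 \<or> c = 1" "s2 = upd s1 nBit 0 c" by blast
      note yc = yd[OF c(1)]
      have bY: "len ((y + c) div 2) \<le> b" "len (2 ^ r' :: int) \<le> b"
      proof -
        have w: "len (2 ^ r' :: int) \<le> len (2 * 2 ^ r' :: int)" by (intro len_abs_mono) auto
        also have "\<dots> \<le> b" using bnd_rd[OF b1, of nWd 0] y(3) by simp
        finally show "len (2 ^ r' :: int) \<le> b" .
        moreover have "len ((y + c) div 2) \<le> len (2 ^ r' :: int)" by (intro len_abs_mono) (use yc in auto)
        ultimately show "len ((y + c) div 2) \<le> b" by simp
      qed
      show "okK b 1 (Seq (SV nYr (Div (Add (V nYr) (V nBit)) (Const 2))) (SV nWd (Div (V nWd) (Const 2)))) s2 (?J r') ?\<phi> (?g s2)"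
      proof (rule okK_Seq[where R = "\<lambda>s'. s' = upd s2 nYr 0 ((y + c) div 2)" and g = "\<lambda>_. h c"])
        show "okK b 1 (SV nYr (Div (Add (V nYr) (V nBit)) (Const 2))) s2 (\<lambda>s'. s' = upd s2 nYr 0 ((y + c) div 2)) (\<lambda>_. h c) (?g s2)"
          by (rule okK_SV) (use s2(1) b0 bY c in \<open>auto simp: y_def\<close>)
        fix s3 assume s3: "bnd b s3" "s3 = upd s2 nYr 0 ((y + c) div 2)"
        show "okK b 1 (SV nWd (Div (V nWd) (Const 2))) s3 (?J r') ?\<phi> (h c)"
          by (rule okK_SV) (use s3 b0 bY c(2) y J yc in \<open>auto simp: h_def\<close>)
      qed
    qed
    thus "\<exists>r'. r = Suc r' \<and> okK b 1 (Seq (Flip (AD nBit (Const 0))) (Seq (SV nYr (Div (Add (V nYr) (V nBit)) (Const 2))) (SV nWd (Div (V nWd) (Const 2)))))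
        s1 (?J r') ?\<phi> (?\<phi> s1)" using r' by blast
  next
    fix r s1 assume J: "?J r s1" and b1: "bnd b s1" and v: "val (Less (Const 1) (V nWd)) s1 = 0"
    have "\<not> 1 < (2 :: int) ^ r" using J v by (auto split: if_splits)
    hence "r = 0" by (cases "r = 0") auto
    thus "(eqx {nYr, nWd, nBit} s s1 \<and> (rd s1 nYr 0 = 0 \<or> rd s1 nYr 0 = 1)) \<and> ?\<phi> s1 \<le> max 0 (cutp (z(v := of_int (rd s1 nYr 0))))"
      using J by auto
  qed (use s b0 in auto)
  thus ?thesis by simp
qed

lemma ok_ROUND:
  assumes s: "bnd b s" "rd s nN 0 = int n" "rd s nP 0 = int P" "\<And>v. v < n \<Longrightarrow> \<bar>rd s aBX v\<bar> \<le> int Tt" and P2: "P = 2 ^ p"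
  shows "okK b ((n + 1) * (b + 1)) ROUND s (\<lambda>s'. \<forall>v<n. inp s' v = 0 \<or> inp s' v = 1)
     (\<lambda>s'. max 0 (cutp (\<lambda>v. of_int (inp s' v)))) (real m / 2 - of_int (VAL (rd s aBX)) / (2 * (real Tt)\<^sup>2))"
proof -
  define x where "x = rd s aBX"
  define pv where "pv v = (of_int (x v) + real Tt) / (2 * real Tt)" for v
  \<comment> \<open>Coordinates below \<open>j\<close> are rounded and read from the output cells;
    the others are still fractional, and their cells may hold remains of the input.\<close>
  define Z where "Z j s' v = (if v < j then of_int (inp s' v) else pv v)" for j s' v
  let ?I = "\<lambda>j s'. rd s' nN 0 = int n \<and> rd s' nP 0 = int P \<and> rd s' aBX = x \<and> (\<forall>v<j. inp s' v = 0 \<or> inp s' v = 1)"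
  let ?\<phi> = "\<lambda>j s'. max 0 (cutp (Z j s'))"
  \<comment> \<open>From \<open>2 * Tt = 32 * P^2\<close> and \<open>P = 2 ^ p\<close>.\<close>
  define r where "r = 2 * p + 5"
  have T2: "2 * int Tt = 2 ^ r" "2 * real Tt = 2 ^ r" unfolding Tt_def unfolding P2 r_def by (simp_all add: power_mult power_add power2_eq_square power_mult_distrib[symmetric])
  have T2b: "len (2 * int Tt) \<le> b"
  proof (rule len_le_of_U_power[of _ 1])
    have "2 * Tt \<le> H" using H_gt(5) unfolding Tt_def by linarith
    thus "\<bar>2 * int Tt\<bar> \<le> U k ^ 1" using H_le_U(1)[of k] by simp
  qed simp
  have rb: "r + 1 \<le> b"
  proof -
    obtain c where c: "b = Suc c" using b2 by (cases b) auto
    have "\<bar>2 ^ r :: int\<bar> < 2 ^ c" using T2b unfolding T2(1) c len_le_iff .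
    hence "r < c" by simp
    thus ?thesis using c by simp
  qed
  have nb: "len (int n) \<le> b" using bnd_rd[OF s(1), of nN 0] s(2) by simp
  have "okK b ((n + 1) * (b + 1)) ROUND s (\<lambda>s'. ?I n s' \<and> rd s' cT 0 = int n) (?\<phi> n) (real m / 2 - of_int (VAL x) / (2 * (real Tt)\<^sup>2))"
    unfolding ROUND_def
  proof (rule okK_For[where I = ?I and \<phi> = ?\<phi>])
    have "cutp (Z 0 s) = real m / 2 - of_int (VAL x) / (2 * (real Tt)\<^sup>2)"
      unfolding Z_def pv_def using cutp_VAL[of "real Tt" x] Tt_pos by simp
    thus "real m / 2 - of_int (VAL x) / (2 * (real Tt)\<^sup>2) \<le> ?\<phi> 0 s" by simp
  next
    fix j s1 assume j: "j < n" and I: "?I j s1" and c: "rd s1 cT 0 = int j" and b1: "bnd b s1"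
    have TE: "val TE s' = int Tt" if "rd s' nP 0 = int P" for s' using that by (simp add: TE_def Tt_def power2_eq_square)
    have xj: "\<bar>x j\<bar> \<le> int Tt" using s(4)[OF j] by (simp add: x_def)
    let ?Q = "\<lambda>s'. ?I (Suc j) s' \<and> rd s' cT 0 = int j"
    have lx: "len (x j + int Tt) \<le> b" using len_abs_mono[of "x j + int Tt" "2 * int Tt"] T2b xj by linarith
    show "okK b (b + 1) (Seq (SV nYr (Add (AR aBX (V cT)) TE)) (Seq (SV nWd (Mul (Const 2) TE)) (Seq ROUND_VERTEX (Store (V cT) (V nYr))))) s1
        ?Q (?\<phi> (Suc j)) (?\<phi> j s1)"
    proof (rule okK_Seq[where R = "\<lambda>s'. s' = upd s1 nYr 0 (x j + int Tt)" and g = "\<lambda>_. ?\<phi> j s1"])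
      show "okK b (b + 1) (SV nYr (Add (AR aBX (V cT)) TE)) s1 (\<lambda>s'. s' = upd s1 nYr 0 (x j + int Tt)) (\<lambda>_. ?\<phi> j s1) (?\<phi> j s1)"
        by (rule okK_SV) (use b1 b0 I c TE[of s1] lx in auto)
      fix s2 assume s2: "bnd b s2" "s2 = upd s1 nYr 0 (x j + int Tt)"
      show "okK b (b + 1) (Seq (SV nWd (Mul (Const 2) TE)) (Seq ROUND_VERTEX (Store (V cT) (V nYr)))) s2 ?Q (?\<phi> (Suc j)) (?\<phi> j s1)"
      proof (rule okK_Seq[where R = "\<lambda>s'. s' = upd s2 nWd 0 (2 ^ r)" and g = "\<lambda>_. ?\<phi> j s1"])
        have "val (Mul (Const 2) TE) s2 = 2 * int Tt" using s2 I TE[of s2] by simp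
        thus "okK b (b + 1) (SV nWd (Mul (Const 2) TE)) s2 (\<lambda>s'. s' = upd s2 nWd 0 (2 ^ r)) (\<lambda>_. ?\<phi> j s1) (?\<phi> j s1)"
          by (intro okK_SV) (use s2(1) b0 T2b T2(1) in auto)
        fix s3 assume s3: "bnd b s3" "s3 = upd s2 nWd 0 (2 ^ r)"
        have y3: "rd s3 nYr 0 = x j + int Tt" "rd s3 nWd 0 = 2 ^ r" using s3 s2 by auto
        have y3': "0 \<le> rd s3 nYr 0" "rd s3 nYr 0 \<le> 2 ^ r" unfolding y3 T2(1)[symmetric] using xj by auto
        have Zj: "(Z j s1)(j := of_int (rd s3 nYr 0) / 2 ^ r) = Z j s1"
          unfolding y3 T2(2)[symmetric] by (auto simp: Z_def pv_def intro!: ext)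
        show "okK b (b + 1) (Seq ROUND_VERTEX (Store (V cT) (V nYr))) s3 ?Q (?\<phi> (Suc j)) (?\<phi> j s1)"
        proof (rule okK_Seq[OF okK_conseq[OF ok_ROUND_VERTEX[OF s3(1) y3' y3(2), where z = "Z j s1" and v = j]]])
          show "r + 1 \<le> b + 1" using rb by simp
          show "max 0 (cutp (Z j s1)) \<le> max 0 (cutp ((Z j s1)(j := of_int (rd s3 nYr 0) / 2 ^ r)))" unfolding Zj ..
          fix s4 assume s4: "bnd b s4" "eqx {nYr, nWd, nBit} s3 s4 \<and> (rd s4 nYr 0 = 0 \<or> rd s4 nYr 0 = 1)"
          have e4: "rd s4 nN 0 = int n" "rd s4 nP 0 = int P" "rd s4 aBX = x" "rd s4 cT 0 = int j" "inp s4 = inp s1"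
            using s4(2) s3 s2 I c by (auto simp: eqx_rd eqx_inp intro!: ext)
          have Z4: "Z (Suc j) (updi s4 j (rd s4 nYr 0)) = (Z j s1)(j := of_int (rd s4 nYr 0))"
            by (auto simp: Z_def e4 less_Suc_eq intro!: ext)
          show "okK b (b + 1) (Store (V cT) (V nYr)) s4 ?Q (?\<phi> (Suc j)) (max 0 (cutp ((Z j s1)(j := of_int (rd s4 nYr 0)))))"
            by (rule okK_Store_inp[where i = j]) (use s4 b0 e4 I bnd_rd[OF s4(1), of nYr 0] in \<open>auto simp: Z4 less_Suc_eq\<close>)
        qed auto
      qed
    qed
  next
    fix j s1 y assume I: "?I j s1"
    have "Z j (upd s1 cT 0 y) = Z j s1" by (auto simp: Z_def intro!: ext)
    thus "?I j (upd s1 cT 0 y) \<and> ?\<phi> j (upd s1 cT 0 y) = ?\<phi> j s1" using I by (auto intro!: ext)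
  qed (use s b2 nb in \<open>auto simp: x_def\<close>)
  thus ?thesis unfolding x_def[symmetric]
  proof (rule okK_conseq)
    fix s' assume a: "?I n s' \<and> rd s' cT 0 = int n"
    have "cutp (Z n s') = cutp (\<lambda>v. of_int (inp s' v))" by (rule cutp_cong) (simp add: Z_def)
    thus "(\<forall>v<n. inp s' v = 0 \<or> inp s' v = 1) \<and> ?\<phi> n s' \<le> max 0 (cutp (\<lambda>v. of_int (inp s' v)))" using a by auto
  qed auto
qed

end

section \<open>The complete program\<close>

abbreviation (input) "aDeg \<equiv> 32 :: nat"

definition COMPUTE_P :: prog where
  "COMPUTE_P = While (Less (Mul (Const 2) (V nP)) (Add (V nL) (Const 1))) (SV nP (Mul (Const 2) (V nP)))"

text \<open>\<open>nA\<close> counts the doublings and thus ends at \<open>lg\<close>, from which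
  the number of power iterations is computed.\<close>

definition COMPUTE_H :: prog where
  "COMPUTE_H = While (Less (V nH) (Mul (Mul (Const 2048) (Mul (V nP) (V nP))) (Add (Add (V nN) (V nM)) (Const 1))))
     (Seq (SV nA (Add (V nA) (Const 1))) (SV nH (Mul (Const 2) (V nH))))"

definition DEGREES :: prog where
  "DEGREES = For cE (V nM) (Seq (SA aDeg EU (Add (AR aDeg EU) (Const 1))) (SA aDeg EV (Add (AR aDeg EV) (Const 1))))"

definition INVERSE_DEGREES :: prog where
  "INVERSE_DEGREES = For cV (V nN) (SA aHv (V cV) (Div (V nH) (Add (AR aDeg (V cV)) (Less (AR aDeg (V cV)) (Const 1)))))"

definition SETUP :: prog where
  "SETUP = Seq (SV nN (Load (Const 0))) (Seq (SV nM (Load (Const 1))) (Seq (SV nL (Load (Const 2))) (Seq (SV nP (Const 1))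
     (Seq COMPUTE_P (Seq (SV nH (Const 1)) (Seq COMPUTE_H
     (Seq (SV nIt (Mul (Add (Mul (Const 4) (V nP)) (Const 1)) (Add (Mul (Const 5) (V nA)) (Const 2))))
     (Seq DEGREES (Seq INVERSE_DEGREES (Seq (SV nS (Const 1)) (Seq (SV nMM (Const 1)) (SV nG (Const 1)))))))))))))"

definition MAIN :: prog where
  "MAIN = Seq SETUP (Seq SPECTRAL (Seq (SV nG (V nH)) (Seq ENUM ROUND)))"

lemma okK_SV_Seq:
  assumes "bnd b s" "b > 0" "K \<ge> 1" "len (val e s) \<le> b" "bnd b (upd s a 0 (val e s)) \<Longrightarrow> okK b K p (upd s a 0 (val e s)) Q f x"
  shows "okK b K (Seq (SV a e) p) s Q f x"
  by (rule okK_Seq[where R = "\<lambda>s'. s' = upd s a 0 (val e s)" and g = "\<lambda>_. x"], rule okK_SV) (use assms in auto)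

text \<open>Minimality of \<open>lg\<close> identifies \<open>H\<close> as the result of the
  doubling loop and keeps \<open>lg\<close> logarithmic in \<open>n + m\<close>.\<close>

locale main = machine +
  fixes p L :: nat
  assumes Pp: "P = 2 ^ p" and PL: "P \<le> L" "L < 2 * P" and lgm: "\<And>l. l < lg \<Longrightarrow> 2 ^ l < 2048 * P\<^sup>2 * (n + m + 1)"
    and codim: "codim_nonneg n b0 k"
begin

definition init :: "memory \<Rightarrow> bool" where
  "init s \<longleftrightarrow> inp s 0 = int n \<and> inp s 1 = int m \<and> inp s 2 = int L \<and> (\<forall>a<64. \<forall>i. rd s a i = 0) \<and>
     (\<forall>j<m. inp s (3 + 2 * j) = int (us j) \<and> inp s (4 + 2 * j) = int (vs j))"

lemma len_le_of_H_power: "j \<le> int H ^ 7 \<Longrightarrow> 0 \<le> j \<Longrightarrow> len j \<le> b"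
  by (rule len_le_of_U_power[of _ 1]) (use H_le_U(5)[of 7 k] in auto)

lemma len_le_of_H: "j \<le> H \<Longrightarrow> len (int j) \<le> b"
  using len_le_of_H_power[of "int j"] H_powers(1) power_increasing[of 1 7 "int H"] by simp

lemma P_L_le_H: "2 * P \<le> H" "L \<le> H"
proof -
  show "2 * P \<le> H" using four_P_le_H by simp
  thus "L \<le> H" using PL by simp
qed

text \<open>Bounds the rounds of a doubling loop by the bit length \<open>b\<close>.\<close>

lemma pow_len: "2 ^ a \<le> H \<Longrightarrow> a + 1 \<le> b"
proof -
  assume a: "2 ^ a \<le> H"
  obtain c where c: "b = Suc c" using b2 by (cases b) auto
  have "\<bar>int (2 ^ a)\<bar> < 2 ^ c" using len_le_of_H[OF a] unfolding c len_le_iff .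
  hence "a < c" by simp
  thus ?thesis using c by simp
qed

lemma ok_COMPUTE_P:
  assumes s: "bnd b s" "rd s nL 0 = int L" "rd s nP 0 = 1"
  shows "okD b (b + 1) COMPUTE_P s (\<lambda>s'. eqx {nP} s s' \<and> rd s' nP 0 = int P)"
proof -
  let ?J = "\<lambda>r s'. \<exists>a\<le>p. r = p - a \<and> eqx {nP} s s' \<and> rd s' nP 0 = 2 ^ a"
  have "okD b ((p + 1) * 1) COMPUTE_P s (\<lambda>s'. eqx {nP} s s' \<and> rd s' nP 0 = int P)"
    unfolding COMPUTE_P_def
  proof (rule okK_While[where J = ?J and \<phi> = "\<lambda>_. 0"])
    fix r s1 assume J: "?J r s1" and b1: "bnd b s1" and v: "val (Less (Mul (Const 2) (V nP)) (Add (V nL) (Const 1))) s1 \<noteq> 0"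
    obtain a where a: "a \<le> p" "r = p - a" "eqx {nP} s s1" "rd s1 nP 0 = 2 ^ a" using J by blast
    have "rd s1 nL 0 = int L" using a(3) s by (simp add: eqx_rd)
    hence "2 * 2 ^ a < int L + 1" using v a by (auto split: if_splits)
    hence "int (2 * 2 ^ a) < int (L + 1)" by simp
    hence "2 * 2 ^ a < L + 1" by (simp only: of_nat_less_iff)
    hence "a \<noteq> p" using PL(2) Pp by (intro notI) simp
    hence ap: "a < p" using a by simp
    have "2 ^ Suc a \<le> P" unfolding Pp using ap by (intro power_increasing) auto
    hence "len (int (2 ^ Suc a)) \<le> b" using P_L_le_H by (intro len_le_of_H) simp
    hence "okD b 1 (SV nP (Mul (Const 2) (V nP))) s1 (?J (p - Suc a))"
      by (intro okD_SV) (use b1 b0 a ap in \<open>auto intro!: exI[of _ "Suc a"]\<close>)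
    thus "\<exists>j'. r = Suc j' \<and> okD b 1 (SV nP (Mul (Const 2) (V nP))) s1 (?J j')" using a ap by (intro exI[of _ "p - Suc a"]) auto
  next
    fix r s1 assume J: "?J r s1" and v: "val (Less (Mul (Const 2) (V nP)) (Add (V nL) (Const 1))) s1 = 0"
    obtain a where a: "a \<le> p" "r = p - a" "eqx {nP} s s1" "rd s1 nP 0 = 2 ^ a" using J by blast
    have "rd s1 nL 0 = int L" using a(3) s by (simp add: eqx_rd)
    hence "\<not> 2 * 2 ^ a < int L + 1" using v a by (auto split: if_splits)
    hence "int L < int (2 ^ Suc a)" by simp
    hence "L < 2 ^ Suc a" by (simp only: of_nat_less_iff)
    hence "(2::nat) ^ p < 2 ^ Suc a" using PL(1) unfolding Pp by linarith
    hence "p < Suc a" using power_less_imp_less_exp[of 2 p "Suc a"] by simp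
    hence "a = p" using a(1) by simp
    thus "(eqx {nP} s s1 \<and> rd s1 nP 0 = int P) \<and> (0::real) \<le> 0" using a by (simp add: Pp)
  next
    show "?J p s" using s by (intro exI[of _ 0]) auto
  qed (use s b0 in auto)
  thus ?thesis by (rule okD_conseq) (use pow_len[of p] P_L_le_H Pp in auto)
qed

lemma ok_COMPUTE_H:
  assumes s: "bnd b s" "rd s nN 0 = int n" "rd s nM 0 = int m" "rd s nP 0 = int P" "rd s nH 0 = 1" "rd s nA 0 = 0"
  shows "okD b (b + 1) COMPUTE_H s (\<lambda>s'. eqx {nH, nA} s s' \<and> rd s' nH 0 = int H \<and> rd s' nA 0 = int lg)"
proof -
  let ?c = "Less (V nH) (Mul (Mul (Const 2048) (Mul (V nP) (V nP))) (Add (Add (V nN) (V nM)) (Const 1)))"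
  let ?b = "Seq (SV nA (Add (V nA) (Const 1))) (SV nH (Mul (Const 2) (V nH)))"
  let ?J = "\<lambda>r s'. \<exists>a\<le>lg. r = lg - a \<and> eqx {nH, nA} s s' \<and> rd s' nH 0 = 2 ^ a \<and> rd s' nA 0 = int a"
  have vc: "val ?c s' \<noteq> 0 \<longleftrightarrow> 2 ^ a < 2048 * P\<^sup>2 * (n + m + 1)" if "eqx {nH, nA} s s'" "rd s' nH 0 = 2 ^ a" for s' a
  proof -
    have r: "rd s' nN 0 = int n" "rd s' nM 0 = int m" "rd s' nP 0 = int P" using that(1) s by (auto simp: eqx_rd)
    have "val ?c s' \<noteq> 0 \<longleftrightarrow> int (2 ^ a) < int (2048 * P\<^sup>2 * (n + m + 1))" using r that(2) by (auto simp: power2_eq_square algebra_simps)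
    thus ?thesis by (simp only: of_nat_less_iff)
  qed
  have lgb: "lg + 1 \<le> b" by (rule pow_len) (simp add: H(2))
  have "okD b ((lg + 1) * 1) COMPUTE_H s (\<lambda>s'. eqx {nH, nA} s s' \<and> rd s' nH 0 = int H \<and> rd s' nA 0 = int lg)"
    unfolding COMPUTE_H_def
  proof (rule okK_While[where J = ?J and \<phi> = "\<lambda>_. 0"])
    fix r s1 assume J: "?J r s1" and b1: "bnd b s1" and v: "val ?c s1 \<noteq> 0"
    obtain a where a: "a \<le> lg" "r = lg - a" "eqx {nH, nA} s s1" "rd s1 nH 0 = 2 ^ a" "rd s1 nA 0 = int a" using J by blast
    have "2 ^ a < 2048 * P\<^sup>2 * (n + m + 1)" using vc[OF a(3,4)] v by simp
    hence "(2::nat) ^ a < 2 ^ lg" using H by linarith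
    hence al: "a < lg" by simp
    have "2 ^ Suc a \<le> H" unfolding H(2) using al by (intro power_increasing) auto
    hence l1: "len (int (2 ^ Suc a)) \<le> b" by (rule len_le_of_H)
    have "Suc a \<le> lg" "lg < H" using al H(2) less_exp[of lg] by auto
    hence l2: "len (int (Suc a)) \<le> b" by (intro len_le_of_H) simp
    have "okD b 1 ?b s1 (?J (lg - Suc a))"
    proof (rule okK_SV_Seq)
      show "len (val (Add (V nA) (Const 1)) s1) \<le> b" using l2 a(5) by (simp add: add.commute)
      assume "bnd b (upd s1 nA 0 (val (Add (V nA) (Const 1)) s1))"
      thus "okD b 1 (SV nH (Mul (Const 2) (V nH))) (upd s1 nA 0 (val (Add (V nA) (Const 1)) s1)) (?J (lg - Suc a))"
        by (rule okD_SV) (use b0 a al l1 in \<open>auto intro!: exI[of _ "Suc a"]\<close>)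
    qed (use b1 b0 in auto)
    thus "\<exists>j'. r = Suc j' \<and> okD b 1 ?b s1 (?J j')" using a al by (intro exI[of _ "lg - Suc a"]) auto
  next
    fix r s1 assume J: "?J r s1" and v: "val ?c s1 = 0"
    obtain a where a: "a \<le> lg" "r = lg - a" "eqx {nH, nA} s s1" "rd s1 nH 0 = 2 ^ a" "rd s1 nA 0 = int a" using J by blast
    have "\<not> 2 ^ a < 2048 * P\<^sup>2 * (n + m + 1)" using vc[OF a(3,4)] v by simp
    hence "\<not> a < lg" using lgm by blast
    hence "a = lg" using a(1) by simp
    thus "(eqx {nH, nA} s s1 \<and> rd s1 nH 0 = int H \<and> rd s1 nA 0 = int lg) \<and> (0::real) \<le> 0" using a by (simp add: H(2))
  next
    show "?J lg s" using s by (intro exI[of _ 0]) auto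
  qed (use s b0 in auto)
  thus ?thesis by (rule okD_conseq) (use lgb in auto)
qed

lemma ok_DEGREES:
  assumes s: "bnd b s" "env s" "\<And>v. rd s aDeg v = 0"
  shows "okD b (m + 1) DEGREES s (\<lambda>s'. eqx {cE, aDeg} s s' \<and> (\<forall>v<n. rd s' aDeg v = int (deg v)))"
proof -
  define d where "d i v = (\<Sum>j<i. (if us j = v then 1 else 0) + (if vs j = v then 1 else 0 :: nat))" for i v
  let ?I = "\<lambda>i s'. eqx {cE, aDeg} s s' \<and> (\<forall>v<n. rd s' aDeg v = int (d i v))"
  have env': "env s'" if "eqx {cE, aDeg} s s'" for s' using env_eqx[OF s(2) that] by simp
  have dl: "len (int (d i v)) \<le> b" if "i \<le> m" for i v
  proof (rule len_le_of_H)
    have "d i v \<le> (\<Sum>j<i. 2)" unfolding d_def by (intro sum_mono) auto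
    thus "d i v \<le> H" using that H_gt(4) by simp
  qed
  have "okD b ((m + 1) * 1) DEGREES s (\<lambda>s'. ?I m s' \<and> rd s' cE 0 = int m)"
    unfolding DEGREES_def
  proof (rule okD_For[where I = ?I])
    fix j s1 assume j: "j < m" and I: "?I j s1" and c: "rd s1 cE 0 = int j" and b1: "bnd b s1"
    have i1: "inp s1 (3 + 2 * j) = int (us j)" "inp s1 (4 + 2 * j) = int (vs j)" using env'[OF conjunct1[OF I]] j by (auto simp: env_def)
    have uv: "us j < n" "vs j < n" "us j \<noteq> vs j" using edges j by auto
    have dS: "d (Suc j) (us j) = d j (us j) + 1" "d (Suc j) (vs j) = d j (vs j) + 1" "v \<noteq> us j \<Longrightarrow> v \<noteq> vs j \<Longrightarrow> d (Suc j) v = d j v" for v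
      using uv by (auto simp: d_def)
    show "okD b 1 (Seq (SA aDeg EU (Add (AR aDeg EU) (Const 1))) (SA aDeg EV (Add (AR aDeg EV) (Const 1)))) s1 (\<lambda>s'. ?I (Suc j) s' \<and> rd s' cE 0 = int j)"
    proof (rule okK_Seq[where R = "\<lambda>s'. s' = upd s1 aDeg (us j) (int (d (Suc j) (us j)))" and g = "\<lambda>_. 0"])
      show "okD b 1 (SA aDeg EU (Add (AR aDeg EU) (Const 1))) s1 (\<lambda>s'. s' = upd s1 aDeg (us j) (int (d (Suc j) (us j))))"
        by (rule okD_SA[where i = "us j"]) (use b1 b0 I c i1 uv dl[of "Suc j" "us j"] j in \<open>auto simp: dS(1) add.commute\<close>)
      fix s2 assume s2: "bnd b s2" "s2 = upd s1 aDeg (us j) (int (d (Suc j) (us j)))"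
      show "okD b 1 (SA aDeg EV (Add (AR aDeg EV) (Const 1))) s2 (\<lambda>s'. ?I (Suc j) s' \<and> rd s' cE 0 = int j)"
        by (rule okD_SA[where i = "vs j"]) (use s2 b0 I c i1 uv dl[of "Suc j" "vs j"] j dS(3) in \<open>auto simp: dS(1,2) add.commute\<close>)
    qed
  qed (use s b2 env' len_le_of_H[of m] H_gt in \<open>auto simp: d_def env_def\<close>)
  moreover have "d m = deg" by (auto simp: d_def deg_def intro!: ext)
  ultimately show ?thesis by (elim okD_conseq) auto
qed

lemma ok_INVERSE_DEGREES:
  assumes s: "bnd b s" "rd s nN 0 = int n" "rd s nH 0 = int H" "\<And>v. v < n \<Longrightarrow> rd s aDeg v = int (deg v)"
  shows "okD b (n + 1) INVERSE_DEGREES s (\<lambda>s'. eqx {cV, aHv} s s' \<and> (\<forall>v<n. rd s' aHv v = int (hv v)))"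
proof -
  let ?I = "\<lambda>i s'. eqx {cV, aHv} s s' \<and> (\<forall>v<i. rd s' aHv v = int (hv v))"
  have "okD b ((n + 1) * 1) INVERSE_DEGREES s (\<lambda>s'. ?I n s' \<and> rd s' cV 0 = int n)"
    unfolding INVERSE_DEGREES_def
  proof (rule okD_For[where I = ?I])
    fix j s1 assume j: "j < n" and I: "?I j s1" and c: "rd s1 cV 0 = int j" and b1: "bnd b s1"
    have r: "rd s1 nH 0 = int H" "rd s1 aDeg j = int (deg j)" using I s j by (auto simp: eqx_rd)
    have v: "val (Div (V nH) (Add (AR aDeg (V cV)) (Less (AR aDeg (V cV)) (Const 1)))) s1 = int (hv j)"
      using r c by (cases "deg j") (auto simp: hv_def zdiv_int)
    have "hv j \<le> H" by (simp add: hv_def)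
    note lh = len_le_of_H[OF this]
    show "okD b 1 (SA aHv (V cV) (Div (V nH) (Add (AR aDeg (V cV)) (Less (AR aDeg (V cV)) (Const 1))))) s1 (\<lambda>s'. ?I (Suc j) s' \<and> rd s' cV 0 = int j)"
      by (rule okD_SA[where i = j], unfold v) (use b1 b0 I c lh in \<open>auto simp: less_Suc_eq\<close>)
  qed (use s b2 len_le_of_H[of n] H_gt in \<open>auto simp: eqx_rd\<close>)
  thus ?thesis by (rule okD_conseq) auto
qed

lemma Nit_le: "int Nit \<le> int H ^ 7"
proof -
  have "lg < H" using H(2) less_exp[of lg] by simp
  hence "5 * lg + 2 \<le> 7 * H" using H_gt(1) by linarith
  moreover have "7 \<le> H" "4 * P + 1 \<le> H" using four_P_le_H P by auto
  ultimately have "Nit \<le> H * (H * H)" unfolding Nit_def by (intro mult_mono) (auto intro: order_trans[OF _ mult_right_mono])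
  hence "int Nit \<le> int (H * (H * H))" by (simp only: of_nat_le_iff)
  also have "\<dots> = int H ^ 3" by (simp add: numeral_eq_Suc)
  also have "\<dots> \<le> int H ^ 7" using H_powers(1) by (intro power_increasing) auto
  finally show ?thesis .
qed

lemma ok_SETUP:
  assumes s: "init s" "bnd b s"
  shows "okD b (b + n + m + 1) SETUP s (\<lambda>s'. specI s' 0 \<and> rd s' nF 0 = 0)"
  unfolding SETUP_def
proof -
  let ?K = "b + n + m + 1"
  let ?Q = "\<lambda>s'. specI s' 0 \<and> rd s' nF 0 = 0"
  let ?T3 = "Seq (SV nS (Const 1)) (Seq (SV nMM (Const 1)) (SV nG (Const 1)))"
  let ?T2 = "Seq (SV nIt (Mul (Add (Mul (Const 4) (V nP)) (Const 1)) (Add (Mul (Const 5) (V nA)) (Const 2)))) (Seq DEGREES (Seq INVERSE_DEGREES ?T3))"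
  note i0 = s(1)[unfolded init_def]
  have ld: "val (Load (Const 0)) s' = inp s' 0" "val (Load (Const 1)) s' = inp s' 1" "val (Load (Const 2)) s' = inp s' 2" for s'
    by (simp_all add: inp_def)
  have l1: "len 1 \<le> b" using b2 by (simp add: len_1)
  have lnml: "len (int n) \<le> b" "len (int m) \<le> b" "len (int L) \<le> b" using len_le_of_H H_gt P_L_le_H by auto
  let ?A = "\<lambda>s'. eqx {nN, nM, nL, nP, nH, nA} s s' \<and> rd s' nN 0 = int n \<and> rd s' nM 0 = int m \<and> rd s' nL 0 = int L"
  have T3: "okD b ?K ?T3 s' ?Q" if b': "bnd b s'" and a: "eqx {nN, nM, nL, nP, nH, nA, nIt, cE, aDeg, cV, aHv} s s'"
     "env s'" "rd s' nH 0 = int H" "rd s' nIt 0 = int Nit" "\<forall>v<n. rd s' aHv v = int (hv v)" for s'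
  proof (rule okK_SV_Seq)
    assume "bnd b (upd s' nS 0 (val (Const 1) s'))"
    thus "okD b ?K (Seq (SV nMM (Const 1)) (SV nG (Const 1))) (upd s' nS 0 (val (Const 1) s')) ?Q"
    proof (rule okK_SV_Seq)
      let ?s = "upd (upd s' nS 0 (val (Const 1) s')) nMM 0 (val (Const 1) (upd s' nS 0 (val (Const 1) s')))"
      assume "bnd b ?s"
      thus "okD b ?K (SV nG (Const 1)) ?s ?Q"
      proof (rule okD_SV)
        let ?t = "upd ?s nG 0 (val (Const 1) ?s)"
        have "env ?t" using env_eqx[OF a(2), of "{nS, nMM, nG}" ?t] by simp
        moreover have "rd s' nTau 0 = 0" "rd s' nQ 0 = 0" "\<forall>i. rd s' aBX i = 0" "rd s' nBest 0 = 0" "rd s' nF 0 = 0"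
          using i0 by (auto simp: eqx_rd[OF a(1)])
        moreover have "stage_inv k 0 (wS ?t) (bS ?t)" by (rule stage_inv_0[OF codim])
        ultimately show "?Q ?t" using a(3-5) by (simp add: specI_def base_def Sc_def)
      qed (use b0 l1 in auto)
    qed (use b0 l1 in auto)
  qed (use b' b0 l1 in auto)
  have T2: "okD b ?K ?T2 s1 ?Q" if b1: "bnd b s1" and a: "?A s1 \<and> rd s1 nP 0 = int P \<and> rd s1 nH 0 = int H \<and> rd s1 nA 0 = int lg" for s1
  proof (rule okK_SV_Seq)
    have v: "val (Mul (Add (Mul (Const 4) (V nP)) (Const 1)) (Add (Mul (Const 5) (V nA)) (Const 2))) s1 = int Nit"
      using a by (simp add: Nit_def algebra_simps)
    show "len (val (Mul (Add (Mul (Const 4) (V nP)) (Const 1)) (Add (Mul (Const 5) (V nA)) (Const 2))) s1) \<le> b"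
      unfolding v by (rule len_le_of_H_power[OF Nit_le]) simp
    let ?s = "upd s1 nIt 0 (val (Mul (Add (Mul (Const 4) (V nP)) (Const 1)) (Add (Mul (Const 5) (V nA)) (Const 2))) s1)"
    assume b2': "bnd b ?s"
    define s2 where "s2 = ?s"
    have e2: "eqx {nN, nM, nL, nP, nH, nA, nIt} s s2" unfolding s2_def by (rule eqx_upd, rule eqx_mono[OF conjunct1[OF conjunct1[OF a]]]) auto
    have r2: "rd s2 nN 0 = int n" "rd s2 nM 0 = int m" "rd s2 nP 0 = int P" "rd s2 nH 0 = int H" "rd s2 nIt 0 = int Nit"
      using a v by (auto simp: s2_def)
    have env2: "env s2" using r2 i0 by (auto simp: env_def eqx_inp[OF e2])
    have d2: "rd s2 aDeg v = 0" for v using i0 by (simp add: eqx_rd[OF e2])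
    have "okD b ?K (Seq DEGREES (Seq INVERSE_DEGREES ?T3)) s2 ?Q"
    proof (rule okK_Seq[OF okK_conseq[OF ok_DEGREES[OF b2'[folded s2_def] env2 d2]]])
      fix s3 assume s3: "bnd b s3" "eqx {cE, aDeg} s2 s3 \<and> (\<forall>v<n. rd s3 aDeg v = int (deg v))"
      note e3 = conjunct1[OF s3(2)]
      have r3: "rd s3 nN 0 = int n" "rd s3 nH 0 = int H" "rd s3 nIt 0 = int Nit" using r2 by (auto simp: eqx_rd[OF e3])
      have d3: "v < n \<Longrightarrow> rd s3 aDeg v = int (deg v)" for v using s3 by simp
      show "okD b ?K (Seq INVERSE_DEGREES ?T3) s3 ?Q"
      proof (rule okK_Seq[OF okK_conseq[OF ok_INVERSE_DEGREES[OF s3(1) r3(1,2) d3]]])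
        fix s4 assume s4: "bnd b s4" "eqx {cV, aHv} s3 s4 \<and> (\<forall>v<n. rd s4 aHv v = int (hv v))"
        note e4 = conjunct1[OF s4(2)]
        let ?M = "{nN, nM, nL, nP, nH, nA, nIt, cE, aDeg, cV, aHv}"
        have "eqx ?M s s2" "eqx ?M s2 s3" "eqx ?M s3 s4" using e2 e3 e4 by (auto elim!: eqx_mono)
        hence e: "eqx ?M s s4" using eqx_trans by blast
        have "env s4" using env_eqx[OF env_eqx[OF env2 e3] e4] by simp
        thus "okD b ?K ?T3 s4 ?Q" using r3 s4 by (intro T3[OF s4(1) e]) (auto simp: eqx_rd[OF e4])
      qed auto
    qed auto
    thus "okD b ?K (Seq DEGREES (Seq INVERSE_DEGREES ?T3)) ?s ?Q" unfolding s2_def .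
  qed (use b1 b0 in auto)
  have T1: "okD b ?K (Seq (SV nH (Const 1)) (Seq COMPUTE_H ?T2)) s1 ?Q" if b1: "bnd b s1" and a: "?A s1 \<and> rd s1 nP 0 = int P" "rd s1 nA 0 = 0" for s1
  proof (rule okK_SV_Seq)
    assume b': "bnd b (upd s1 nH 0 (val (Const 1) s1))"
    let ?s = "upd s1 nH 0 (val (Const 1) s1)"
    have r: "rd ?s nN 0 = int n" "rd ?s nM 0 = int m" "rd ?s nP 0 = int P" "rd ?s nH 0 = 1" "rd ?s nA 0 = 0" using a by auto
    show "okD b ?K (Seq COMPUTE_H ?T2) ?s ?Q"
    proof (rule okK_Seq[OF okK_conseq[OF ok_COMPUTE_H[OF b' r]]])
      fix s2 assume s2: "bnd b s2" "eqx {nH, nA} ?s s2 \<and> rd s2 nH 0 = int H \<and> rd s2 nA 0 = int lg"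
      note e2 = conjunct1[OF s2(2)]
      have "eqx {nN, nM, nL, nP, nH, nA} s ?s" using a by simp
      moreover have "eqx {nN, nM, nL, nP, nH, nA} ?s s2" by (rule eqx_mono[OF e2]) auto
      ultimately have "eqx {nN, nM, nL, nP, nH, nA} s s2" using eqx_trans by blast
      thus "okD b ?K ?T2 s2 ?Q" using a s2(2) r by (intro T2[OF s2(1)]) (auto simp: eqx_rd[OF e2])
    qed auto
  qed (use b1 b0 l1 in auto)
  have T0: "okD b ?K (Seq COMPUTE_P (Seq (SV nH (Const 1)) (Seq COMPUTE_H ?T2))) s1 ?Q" if b1: "bnd b s1" and a: "?A s1" "rd s1 nP 0 = 1" "rd s1 nA 0 = 0" for s1
  proof -
    have rL: "rd s1 nL 0 = int L" using a by simp
    show ?thesis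
    proof (rule okK_Seq[OF okK_conseq[OF ok_COMPUTE_P[OF b1 rL a(2)]]])
      fix s2 assume s2: "bnd b s2" "eqx {nP} s1 s2 \<and> rd s2 nP 0 = int P"
      note e2 = conjunct1[OF s2(2)]
      have "eqx {nN, nM, nL, nP, nH, nA} s1 s2" by (rule eqx_mono[OF e2]) auto
      hence "eqx {nN, nM, nL, nP, nH, nA} s s2" using a eqx_trans by blast
      thus "okD b ?K (Seq (SV nH (Const 1)) (Seq COMPUTE_H ?T2)) s2 ?Q" using a s2(2) by (intro T1[OF s2(1)]) (auto simp: eqx_rd[OF e2])
    qed auto
  qed
  show "okD b ?K (Seq (SV nN (Load (Const 0))) (Seq (SV nM (Load (Const 1))) (Seq (SV nL (Load (Const 2))) (Seq (SV nP (Const 1))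
     (Seq COMPUTE_P (Seq (SV nH (Const 1)) (Seq COMPUTE_H ?T2))))))) s ?Q"
    apply (rule okK_SV_Seq[OF s(2) b0 _ _ okK_SV_Seq[OF _ b0 _ _ okK_SV_Seq[OF _ b0 _ _ okK_SV_Seq[OF _ b0 _ _ T0]]]])
    using i0 lnml l1 unfolding ld by simp_all
qed

end

context main
begin

definition Kmain :: nat where
  "Kmain = (b + n + m + 1) + Kspec + ((1024 * P) ^ k + 1) * ((k + 1) * (b + 1) + (Tt + 1) * ((k + 1) * (n + m + 1))) + (n + 1) * (b + 1)"

text \<open>\<open>x\<close> is an arbitrary sign vector, later an optimal cut. The value
  \<open>max 0 ...\<close> is guaranteed if the spectral stages end in a good state; otherwise only
  nonnegativity is used, so the success probability appears as a factor.\<close>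

lemma ok_MAIN:
  assumes s: "init s" "bnd b s" and x: "\<And>v. \<bar>x v\<bar> \<le> (1::int)"
  shows "okK b Kmain MAIN s (\<lambda>s'. \<forall>v<n. inp s' v = 0 \<or> inp s' v = 1)
     (\<lambda>s'. max 0 (cutp (\<lambda>v. of_int (inp s' v)))) (max 0 (real m / 2 - of_int (VAL x) / 2 - 9 * real m / real P) * (1 - 2 * (1/2) ^ P))"
proof -
  define W where "W = max 0 (real m / 2 - of_int (VAL x) / 2 - 9 * real m / real P)"
  have W0: "W \<ge> 0" by (simp add: W_def)
  let ?Q = "\<lambda>s'. \<forall>v<n. inp s' v = 0 \<or> inp s' v = 1"
  let ?f = "\<lambda>s'. max 0 (cutp (\<lambda>v. of_int (inp s' v)))"
  have K1: "1 \<le> Kmain" "b + n + m + 1 \<le> Kmain" "Kspec \<le> Kmain" "(n + 1) * (b + 1) \<le> Kmain" by (auto simp: Kmain_def)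
  show ?thesis unfolding MAIN_def W_def[symmetric]
  proof (rule okK_Seq[where R = "\<lambda>s'. specI s' 0 \<and> rd s' nF 0 = 0" and g = "\<lambda>_. W * (1 - 2 * (1/2) ^ P)"])
    show "okK b Kmain SETUP s (\<lambda>s'. specI s' 0 \<and> rd s' nF 0 = 0) (\<lambda>_. W * (1 - 2 * (1/2) ^ P)) (W * (1 - 2 * (1/2) ^ P))"
      by (rule okD_imp_okK[OF okD_conseq[OF ok_SETUP[OF s] K1(2)]]) auto
    fix s0 assume s0: "bnd b s0" "specI s0 0 \<and> rd s0 nF 0 = 0"
    note sp = okK_scale[OF ok_SPECTRAL[OF conjunct1[OF s0(2)] s0(1) conjunct2[OF s0(2)]] W0]
    show "okK b Kmain (Seq SPECTRAL (Seq (SV nG (V nH)) (Seq ENUM ROUND))) s0 ?Q ?f (W * (1 - 2 * (1/2) ^ P))"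
    proof (rule okK_Seq[OF okK_conseq[OF sp K1(3)]])
      fix s1 assume s1: "bnd b s1" "\<exists>q. specI s1 q"
      then obtain q where q: "specI s1 q" by blast
      have wb: "wb_ok q (wS s1) (bS s1)" "q \<le> k" using specI_wb[OF q] by auto
      interpret st: staged n m us vs P H lg b k q "wS s1" "bS s1" by unfold_locales (use wb in auto)
      have nq: "nat (rd s1 nQ 0) = q" using q by (simp add: specI_def)
      let ?g = "W * (if good s1 (nat (rd s1 nQ 0)) then 1 else 0)"
      have bH: "len (val (V nH) s1) \<le> b" using bnd_rd[OF s1(1)] by simp
      show "okK b Kmain (Seq (SV nG (V nH)) (Seq ENUM ROUND)) s1 ?Q ?f ?g"
      proof (rule okK_SV_Seq[OF s1(1) b0 K1(1) bH])
        define s2 where "s2 = upd s1 nG 0 (val (V nH) s1)"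
        assume "bnd b (upd s1 nG 0 (val (V nH) s1))"
        hence b2': "bnd b s2" by (simp add: s2_def)
        have e12: "eqx {nG} s1 s2" by (simp add: s2_def)
        have eI: "st.eI s2" unfolding st.eI_def
        proof (intro conjI)
          show "env s2" using env_eqx[OF _ e12] q by (simp add: specI_def base_def)
          show "st_mat s2 q (wS s1) (bS s1)" using specI_mat[OF q] by (simp add: st_mat_def s2_def)
        qed (use q in \<open>auto simp: s2_def specI_def base_def\<close>)
        have BX0: "rd s2 aBX = (\<lambda>_. 0)" using q by (auto simp: s2_def specI_def intro!: ext)
        have bI: "st.bI s2" using q by (simp add: st.bI_def BX0 VAL_def) (simp add: s2_def specI_def)
        have KE: "((1024 * P) ^ q + 1) * st.Kenum \<le> Kmain"
        proof -
          have "1 \<le> 1024 * P" using P by simp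
          hence "(1024 * P) ^ q \<le> (1024 * P) ^ k" using wb(2) by (intro power_increasing) auto
          moreover have "st.Kenum \<le> (k + 1) * (b + 1) + (Tt + 1) * ((k + 1) * (n + m + 1))"
            unfolding st.Kenum_def using wb(2) by (intro add_mono mult_mono) auto
          ultimately have "((1024 * P) ^ q + 1) * st.Kenum \<le> ((1024 * P) ^ k + 1) * ((k + 1) * (b + 1) + (Tt + 1) * ((k + 1) * (n + m + 1)))"
            by (intro mult_mono add_mono) auto
          thus ?thesis unfolding Kmain_def by linarith
        qed
        let ?R = "\<lambda>s'. st.eI s' \<and> st.bI s' \<and> (\<forall>e<(1024 * P) ^ q. VAL (rd s' aBX) \<le> VAL (fwX (guess (bS s1) q e) (wS s1) (bS s1) q Tt))"
        have "okK b Kmain (Seq ENUM ROUND) s2 ?Q ?f ?g"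
        proof (rule okK_Seq[where R = ?R and g = "\<lambda>_. ?g"])
          show "okK b Kmain ENUM s2 ?R (\<lambda>_. ?g) ?g"
            by (rule okD_imp_okK[OF okD_conseq[OF st.ok_ENUM[OF eI b2' bI] KE]]) auto
          fix s3 assume s3: "bnd b s3" "?R s3"
          have r3: "rd s3 nN 0 = int n" "rd s3 nP 0 = int P" "\<And>v. v < n \<Longrightarrow> \<bar>rd s3 aBX v\<bar> \<le> int Tt"
            using st.eI_rd s3(2) by (auto simp: st.bI_def)
          let ?y = "real m / 2 - of_int (VAL (rd s3 aBX)) / (2 * (real Tt)\<^sup>2)"
          have T0: "real Tt > 0" using Tt_pos by simp
          have "?g \<le> ?y"
          \<comment> \<open>For \<open>m = 0\<close> the guarantee \<open>W\<close> is 0, so this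
            case is treated like a failed one.\<close>
          proof (cases "good s1 q \<and> m > 0")
            case True
            have inv: "stage_inv k q (wS s1) (bS s1)" using q by (simp add: specI_def)
            have gd: "\<And>y. - wn y \<le> qf n (bm (wS s1) (bS s1) q) y" using True by (simp add: good_def)
            have m0: "m > 0" using True by simp
            obtain e where e: "e < (1024 * P) ^ q"
              "(\<Sum>j<m. of_int (fwX (guess (bS s1) q e) (wS s1) (bS s1) q Tt (us j) * fwX (guess (bS s1) q e) (wS s1) (bS s1) q Tt (vs j))) / (real Tt)\<^sup>2
                 \<le> (\<Sum>j<m. of_int (x (us j) * x (vs j))) + 18 * real m / real P"
              using approximation[where x = x, OF inv kn m0 gd x] by blast
            have "of_int (VAL (rd s3 aBX)) / (real Tt)\<^sup>2 \<le> of_int (VAL (fwX (guess (bS s1) q e) (wS s1) (bS s1) q Tt)) / (real Tt)\<^sup>2"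
              using s3(2) e(1) by (intro divide_right_mono) auto
            also have "\<dots> \<le> of_int (VAL x) + 18 * real m / real P" using e(2) by (simp add: VAL_def)
            finally have "of_int (VAL (rd s3 aBX)) / (2 * (real Tt)\<^sup>2) \<le> of_int (VAL x) / 2 + 9 * real m / real P" by simp
            moreover have "of_int (VAL (rd s3 aBX)) / (2 * (real Tt)\<^sup>2) \<le> 0" using s3(2) by (intro divide_nonpos_nonneg) (auto simp: st.bI_def)
            ultimately have "W \<le> ?y" unfolding W_def by simp
            thus ?thesis using True nq by simp
          next
            case False
            have "of_int (VAL (rd s3 aBX)) / (2 * (real Tt)\<^sup>2) \<le> 0" using s3(2) by (intro divide_nonpos_nonneg) (auto simp: st.bI_def)
            hence y: "0 \<le> ?y" by simp
            have g: "?g = 0" using False nq by (auto simp: W_def VAL_def)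
            show ?thesis unfolding g by (rule y)
          qed
          thus "okK b Kmain ROUND s3 ?Q ?f ?g"
            by (intro okK_conseq[OF ok_ROUND[OF s3(1) r3 Pp] K1(4)]) auto
        qed
        thus "okK b Kmain (Seq ENUM ROUND) (upd s1 nG 0 (val (V nH) s1)) ?Q ?f ?g" unfolding s2_def .
      qed
    qed auto
  qed
qed

end

section \<open>Running time and expected cut value\<close>

text \<open>All dependence on \<open>P\<close> and \<open>k\<close> is absorbed into powers of
  \<open>Q = P ^ (k + 1)\<close>. Since \<open>P \<ge> 2\<close>, it dominates \<open>P\<close> and
  \<open>k + 1\<close>, and \<open>8 ^ k \<le> Q ^ 3\<close> and
  \<open>(1024 * P) ^ k \<le> Q ^ 11\<close>. The bit length \<open>b\<close> contributes
  \<open>lam^2\<close>; it is squared in the unit of cost and occurs once more in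
  \<open>Kmain\<close>, whence \<open>lam ^ 6\<close>.\<close>

lemma time_bound:
  fixes P p k N lam lg Nit b Tt Kspec Kmain :: nat
  assumes P: "P = 2 ^ p" "P \<ge> 2" and lam: "N + 1 \<le> 2 ^ lam" "lam \<ge> 1"
    and lg: "\<And>l. l < lg \<Longrightarrow> 2 ^ l < 2048 * P\<^sup>2 * (N + 1)"
    and Nit: "Nit = (4 * P + 1) * (5 * lg + 2)"
    and b: "b = lg * 7 * 8 ^ k * (2 * Nit + 3) + 2"
    and Tt: "Tt = 16 * P\<^sup>2"
    and Kspec: "Kspec = (k * (P + k + 1) + P + 1) * ((Nit + 1) * ((k + 1) * (N + 1)))"
    and Kmain: "Kmain \<le> (b + N + 1) + Kspec + ((1024 * P) ^ k + 1) * ((k + 1) * (b + 1) + (Tt + 1) * ((k + 1) * (N + 1))) + (N + 1) * (b + 1)"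
  shows "Kmain * b\<^sup>2 \<le> 10 ^ 20 * (P ^ (k + 1)) ^ 30 * (lam ^ 6 * (N + 1))"
proof -
  define Q where "Q = P ^ (k + 1)"
  have P1: "1 \<le> P" using P(2) by simp
  have Q1: "1 \<le> Q" unfolding Q_def using P1 by simp
  have PQ: "P \<le> Q" unfolding Q_def using P1 self_le_power[of P "k + 1"] by simp
  have kQ: "k + 1 \<le> Q"
  proof -
    have "k + 1 < 2 ^ (k + 1)" by (rule less_exp)
    also have "\<dots> \<le> Q" unfolding Q_def by (rule power_mono) (use P(2) in auto)
    finally show ?thesis by simp
  qed
  have Q2: "P * P \<le> Q * Q" by (rule mult_mono) (use PQ in auto)
  have k8: "8 ^ k \<le> Q ^ 3"
  proof -
    have "(2::nat) ^ 3 \<le> P ^ 3" using P(2) by (rule power_mono) simp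
    hence "(8::nat) ^ k \<le> (P ^ 3) ^ k" by (intro power_mono) auto
    also have "\<dots> = (P ^ k) ^ 3" by (simp add: power_mult[symmetric] mult.commute)
    also have "\<dots> \<le> Q ^ 3" unfolding Q_def by (intro power_mono power_increasing) (use P1 in auto)
    finally show ?thesis .
  qed
  have MQ: "(1024 * P) ^ k \<le> Q ^ 11"
  proof -
    have "(2::nat) ^ 10 \<le> P ^ 10" using P(2) by (rule power_mono) simp
    hence "1024 * P \<le> P ^ 10 * P" by (intro mult_mono) auto
    also have "\<dots> = P ^ 11" by (simp add: numeral_eq_Suc)
    finally have "(1024 * P) ^ k \<le> (P ^ 11) ^ k" by (intro power_mono) auto
    also have "\<dots> = (P ^ k) ^ 11" by (simp add: power_mult[symmetric] mult.commute)
    also have "\<dots> \<le> Q ^ 11" unfolding Q_def by (intro power_mono power_increasing) (use P1 in auto)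
    finally show ?thesis .
  qed
  have Ql: "1 \<le> Q * lam" "Q \<le> Q * lam" "lam \<le> Q * lam" using Q1 lam(2) by auto
  have lgQ: "lg \<le> 14 * (Q * lam)"
  proof -
    have "\<not> 11 + 2 * p + lam < lg"
    proof
      assume "11 + 2 * p + lam < lg"
      hence "2 ^ (11 + 2 * p + lam) < 2048 * P\<^sup>2 * (N + 1)" by (rule lg)
      moreover have "2048 * P\<^sup>2 * (N + 1) \<le> 2048 * P\<^sup>2 * 2 ^ lam" using lam(1) by (rule mult_le_mono2)
      moreover have "2048 * P\<^sup>2 * 2 ^ lam = (2::nat) ^ (11 + 2 * p + lam)" unfolding P(1) by (simp add: power_add power_mult power2_eq_square power_mult_distrib[symmetric])
      ultimately show False by linarith
    qed
    moreover have "p \<le> Q" using less_imp_le[OF less_exp[of p]] PQ unfolding P(1) by (rule order_trans)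
    ultimately have "lg \<le> 11 * 1 + 2 * Q + lam" by linarith
    thus ?thesis using Ql by linarith
  qed
  have qs: "x\<^sup>2 = x * x" "x ^ 3 = x * (x * x)" "x ^ 4 = x * (x * (x * x))" "x ^ 5 = x * (x * (x * (x * x)))" for x :: nat
    by (simp_all add: numeral_eq_Suc)
  define R where "R = Q * lam"
  have R1: "1 \<le> R" using Ql(1) by (simp add: R_def)
  have QR: "Q \<le> Q * R" "1 \<le> Q * R" "R \<le> Q * R" using R1 Q1 by auto
  have Nit': "Nit \<le> 360 * (Q * R)"
  proof -
    have "5 * lg + 2 \<le> 72 * R" using lgQ[folded R_def] R1 by linarith
    moreover have "4 * P + 1 \<le> 5 * Q" using PQ Q1 by linarith
    ultimately have "Nit \<le> (5 * Q) * (72 * R)" unfolding Nit by (intro mult_mono) auto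
    thus ?thesis by simp
  qed
  define B where "B = 71000 * (Q ^ 4 * R\<^sup>2)"
  have b': "b + 1 \<le> B"
  proof -
    have "lg * 7 * 8 ^ k * (2 * Nit + 3) \<le> (14 * R) * 7 * Q ^ 3 * (723 * (Q * R))"
    proof -
      have "2 * Nit + 3 \<le> 723 * (Q * R)" using Nit' QR by linarith
      thus ?thesis using lgQ[folded R_def] k8 by (intro mult_mono) auto
    qed
    also have "\<dots> = 70854 * (Q ^ 4 * R\<^sup>2)" by (simp add: qs algebra_simps)
    finally have "b \<le> 70854 * (Q ^ 4 * R\<^sup>2) + 2" unfolding b by simp
    moreover have "1 \<le> Q ^ 4 * R\<^sup>2" using Q1 R1 by simp
    ultimately show ?thesis unfolding B_def by linarith
  qed
  have Tt': "Tt + 1 \<le> 17 * Q\<^sup>2"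
  proof -
    have "1 \<le> Q * Q" using Q1 by simp
    thus ?thesis unfolding Tt power2_eq_square using Q2 by linarith
  qed
  have N1: "1 \<le> N + 1" by simp
  define X where "X = Q ^ 16 * R\<^sup>2 * (N + 1)"
  have pw: "i \<le> j \<Longrightarrow> Q ^ i \<le> Q ^ j" for i j using Q1 by (intro power_increasing) auto
  have T1: "b + N + 1 \<le> B * (N + 1)"
  proof -
    have "b + N + 1 \<le> (b + 1) * (N + 1)" by simp
    also have "\<dots> \<le> B * (N + 1)" using b' by (rule mult_le_mono1)
    finally show ?thesis .
  qed
  have BX: "B * (N + 1) \<le> 71000 * X"
    unfolding B_def X_def mult.assoc by (intro mult_mono pw) auto
  have T2: "Kspec \<le> 1444 * X"
  proof -
    have a: "k * (P + k + 1) \<le> Q * (2 * Q)" using kQ PQ by (intro mult_mono) auto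
    have "1 * Q \<le> Q * Q" using Q1 by (rule mult_le_mono1)
    hence "P + 1 \<le> 2 * (Q * Q)" using PQ Q1 by linarith
    moreover have "Q * (2 * Q) = 2 * (Q * Q)" by simp
    ultimately have "k * (P + k + 1) + P + 1 \<le> 4 * (Q * Q)" using a by linarith
    moreover have "Nit + 1 \<le> 361 * (Q * R)" using Nit' QR by linarith
    ultimately have "Kspec \<le> (4 * (Q * Q)) * ((361 * (Q * R)) * (Q * (N + 1)))"
      unfolding Kspec using kQ by (intro mult_mono) auto
    also have "\<dots> = 1444 * (Q ^ 4 * R * (N + 1))" by (simp add: qs algebra_simps)
    also have "\<dots> \<le> 1444 * X" unfolding X_def
      by (intro mult_mono pw) (use R1 in \<open>auto simp: power2_eq_square\<close>)
    finally show ?thesis .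
  qed
  have T3: "((1024 * P) ^ k + 1) * ((k + 1) * (b + 1) + (Tt + 1) * ((k + 1) * (N + 1))) \<le> 142034 * X"
  proof -
    have m: "(1024 * P) ^ k + 1 \<le> 2 * Q ^ 11" using MQ one_le_power[OF Q1, of 11] by linarith
    have a: "(k + 1) * (b + 1) \<le> Q * B" using kQ b' by (rule mult_mono) auto
    also have "\<dots> = 71000 * (Q ^ 5 * R\<^sup>2)" by (simp add: B_def qs algebra_simps)
    also have "\<dots> \<le> 71000 * (Q ^ 5 * R\<^sup>2 * (N + 1))" by simp
    finally have a: "(k + 1) * (b + 1) \<le> 71000 * (Q ^ 5 * R\<^sup>2 * (N + 1))" .
    have "(Tt + 1) * ((k + 1) * (N + 1)) \<le> (17 * Q\<^sup>2) * (Q * (N + 1))" using Tt' kQ by (intro mult_mono) auto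
    also have "\<dots> = 17 * (Q ^ 3 * 1 * (N + 1))" by (simp add: qs algebra_simps)
    also have "\<dots> \<le> 17 * (Q ^ 5 * R\<^sup>2 * (N + 1))" by (intro mult_mono pw) (use R1 in auto)
    finally have "(k + 1) * (b + 1) + (Tt + 1) * ((k + 1) * (N + 1)) \<le> 71017 * (Q ^ 5 * R\<^sup>2 * (N + 1))" using a by linarith
    hence "((1024 * P) ^ k + 1) * ((k + 1) * (b + 1) + (Tt + 1) * ((k + 1) * (N + 1))) \<le> (2 * Q ^ 11) * (71017 * (Q ^ 5 * R\<^sup>2 * (N + 1)))"
      using m by (intro mult_mono) auto
    also have "\<dots> = 142034 * X"
    proof -
      have "Q ^ 16 = Q ^ 11 * Q ^ 5" by (simp add: power_add[symmetric])
      thus ?thesis unfolding X_def by (simp add: algebra_simps)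
    qed
    finally show ?thesis .
  qed
  have T4: "(N + 1) * (b + 1) \<le> 71000 * X"
    using order_trans[OF mult_le_mono2[OF b', of "N + 1"]] BX by (simp add: mult.commute)
  have KX: "Kmain \<le> 300000 * X" using Kmain T1 BX T2 T3 T4 by linarith
  have "Kmain * b\<^sup>2 \<le> (300000 * X) * B\<^sup>2" using KX b' by (intro mult_mono power_mono) auto
  also have "\<dots> = (300000 * 71000 * 71000) * (Q ^ 24 * R ^ 6 * (N + 1))"
  proof -
    have e: "Q ^ 24 = Q ^ 16 * (Q ^ 4)\<^sup>2" "R ^ 6 = R\<^sup>2 * (R\<^sup>2)\<^sup>2" by (simp_all add: power_add[symmetric] power_mult[symmetric])
    show ?thesis unfolding X_def B_def e power_mult_distrib by (simp add: algebra_simps)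
  qed
  also have "\<dots> \<le> 10 ^ 20 * (Q ^ 24 * R ^ 6 * (N + 1))" by (intro mult_right_mono) auto
  also have "Q ^ 24 * R ^ 6 * (N + 1) = Q ^ 30 * (lam ^ 6 * (N + 1))"
  proof -
    have e: "Q ^ 30 = Q ^ 24 * Q ^ 6" by (simp add: power_add[symmetric])
    show ?thesis unfolding R_def power_mult_distrib e by (simp only: mult_ac)
  qed
  finally show ?thesis unfolding Q_def by (simp add: mult_ac)
qed

definition time_factor :: "real \<Rightarrow> nat \<Rightarrow> real" where
  "time_factor c N = c * ((3 + log 2 (real N + 1)) ^ 6 * (real N + 1))"

lemma time_factor_soft_O: "time_factor c \<in> soft_O (\<lambda>N. real N)"
proof -
  have "(\<lambda>N::nat. c * ((3 + log 2 (real N + 1)) ^ 6 * (real N + 1))) \<in> O(\<lambda>N. real N * ln (real N) ^ 6)"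
    by real_asymp
  thus ?thesis unfolding soft_O_def time_factor_def by blast
qed

lemma lam_exists:
  obtains lam :: nat where "N + 1 \<le> 2 ^ lam" "lam \<ge> 1" "real lam \<le> 3 + log 2 (real N + 1)"
proof -
  define lam where "lam = nat \<lceil>log 2 (real N + 1)\<rceil> + 1"
  have l: "log 2 (real N + 1) \<ge> 0" by simp
  have le: "log 2 (real N + 1) \<le> real lam" "real lam \<le> 3 + log 2 (real N + 1)" unfolding lam_def using l by linarith+
  have "real N + 1 = 2 powr (log 2 (real N + 1))" by simp
  also have "\<dots> \<le> 2 powr (real lam)" using le by (intro powr_mono) auto
  also have "\<dots> = 2 ^ lam" by (simp add: powr_realpow)
  finally have "real (N + 1) \<le> real (2 ^ lam)" by simp
  hence "N + 1 \<le> 2 ^ lam" by (simp only: of_nat_le_iff)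
  thus ?thesis using that[of lam] le by (simp add: lam_def)
qed

text \<open>Passes from the truncated nonnegative integral of the logic to the integral of the
  specification; boundedness of \<open>g\<close> provides integrability.\<close>

lemma integral_ge_of_okE:
  assumes ok: "okE b p s N Q f x" and eq: "\<And>s'. Q s' \<Longrightarrow> f s' = g s'" and g: "\<And>s'. 0 \<le> g s'" "\<And>s'. g s' \<le> c"
  shows "x \<le> (\<integral>r. g (fst r) \<partial>measure_spmf (exec p s))"
proof -
  let ?M = "measure_spmf (exec p s)"
  have int: "integrable ?M (\<lambda>r. g (fst r))"
    by (rule measure_spmf.integrable_const_bound[where B = c]) (use g in auto)
  have "ennreal x \<le> (\<integral>\<^sup>+ r. ennreal (f (fst r)) \<partial>?M)" using ok by (simp add: okE_def)
  also have "\<dots> = (\<integral>\<^sup>+ r. ennreal (g (fst r)) \<partial>?M)"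
    using ok eq by (intro nn_integral_cong_AE) (auto simp: AE_measure_spmf_iff okE_def)
  also have "\<dots> = ennreal (\<integral>r. g (fst r) \<partial>?M)" by (rule nn_integral_eq_integral[OF int]) (use g in auto)
  finally show ?thesis by (rule ennreal_le_iff[THEN iffD1, rotated]) (use g in \<open>auto intro!: integral_nonneg_AE\<close>)
qed

lemma runs_in_time_of_okE:
  assumes "okE b p s N Q f x" "real (N * b\<^sup>2) \<le> T"
  shows "runs_in_time p s T"
  using assms unfolding okE_def runs_in_time_def by (fastforce simp flip: of_nat_le_iff[where 'a = real])

lemma concat_pairs:
  "length (concat (map (\<lambda>(u, v). [int u, int v]) es)) = 2 * length es"
  "j < length es \<Longrightarrow> concat (map (\<lambda>(u, v). [int u, int v]) es) ! (2 * j) = int (fst (es ! j))"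
  "j < length es \<Longrightarrow> concat (map (\<lambda>(u, v). [int u, int v]) es) ! (2 * j + 1) = int (snd (es ! j))"
proof (induction es arbitrary: j)
  case (Cons e es)
  { case 1 show ?case using Cons(1) by (cases e) simp
  next case 2 show ?case using Cons(2)[of "j - 1"] 2 by (cases e; cases j) auto
  next case 3 show ?case using Cons(3)[of "j - 1"] 3 by (cases e; cases j) auto }
qed auto

lemma input_memory_inp:
  "inp (input_memory \<epsilon> n es) 0 = int n" "inp (input_memory \<epsilon> n es) 1 = int (length es)" "inp (input_memory \<epsilon> n es) 2 = \<lfloor>1 / \<epsilon>\<rfloor>"
  "j < length es \<Longrightarrow> inp (input_memory \<epsilon> n es) (3 + 2 * j) = int (fst (es ! j))"
  "j < length es \<Longrightarrow> inp (input_memory \<epsilon> n es) (4 + 2 * j) = int (snd (es ! j))"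
proof -
  let ?c = "concat (map (\<lambda>(u, v). [int u, int v]) es)"
  show "inp (input_memory \<epsilon> n es) 0 = int n" "inp (input_memory \<epsilon> n es) 1 = int (length es)" "inp (input_memory \<epsilon> n es) 2 = \<lfloor>1 / \<epsilon>\<rfloor>"
    by (simp_all add: inp_def input_memory_def Let_def)
  assume j: "j < length es"
  have n: "nat (3 + 2 * int j) = Suc (Suc (Suc (2 * j)))" "nat (4 + 2 * int j) = Suc (Suc (Suc (2 * j + 1)))" by auto
  show "inp (input_memory \<epsilon> n es) (3 + 2 * j) = int (fst (es ! j))"
    using j concat_pairs(2)[OF j] by (simp add: inp_def input_memory_def Let_def concat_pairs(1) n)
  show "inp (input_memory \<epsilon> n es) (4 + 2 * j) = int (snd (es ! j))"
    using j concat_pairs(3)[OF j] by (simp add: inp_def input_memory_def Let_def concat_pairs(1) n)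
qed

lemma input_memory_rd: "rd (input_memory \<epsilon> n es) a i = 0"
  by (simp add: rd_def adr_def input_memory_def Let_def)

lemma input_memory_bnd:
  assumes "len (int n) \<le> b" "len (int (length es)) \<le> b" "len \<lfloor>1 / \<epsilon>\<rfloor> \<le> b" "\<And>u v. (u, v) \<in> set es \<Longrightarrow> u < n \<and> v < n" "b \<ge> 1"
  shows "bnd b (input_memory \<epsilon> n es)"
  unfolding bnd_def
proof
  fix a
  define xs where "xs = [int n, int (length es), \<lfloor>1 / \<epsilon>\<rfloor>] @ concat (map (\<lambda>(u, v). [int u, int v]) es)"
  have *: "len x \<le> b" if "x \<in> set xs" for x
  proof -
    have "len (int u) \<le> b" if "u < n" for u using len_abs_mono[of "int u" "int n"] that assms(1) by simp
    thus ?thesis using that assms(1-4) by (fastforce simp: xs_def)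
  qed
  have "input_memory \<epsilon> n es a = (if 0 \<le> a \<and> a < int (length xs) then xs ! nat a else 0)"
    by (simp add: input_memory_def xs_def Let_def)
  thus "len (input_memory \<epsilon> n es a) \<le> b" using * assms(5) by (auto simp: len_0)
qed

section \<open>Cut values of the edge set\<close>

context edge_list_instance
begin

lemma cut_value_eq: "cut_value E S = (\<Sum>j<m. if (us j \<in> S) \<noteq> (vs j \<in> S) then 1 else 0)"
  unfolding cut_value_def card_filter_E by (intro sum.cong refl if_cong) auto

lemma cut_value_VAL: "real (cut_value E S) = real m / 2 - of_int (VAL (\<lambda>v. if v \<in> S then 1 else - 1)) / 2"
proof -
  have "real (cut_value E S) = (\<Sum>j<m. 1 / 2 - of_int ((if us j \<in> S then 1 else - 1) * (if vs j \<in> S then 1 else - 1)) / 2)"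
    unfolding cut_value_eq of_nat_sum by (intro sum.cong refl) auto
  thus ?thesis by (simp add: VAL_def sum_subtractf sum_divide_distrib)
qed

lemma cut_value_cutp:
  assumes "\<And>v. v < n \<Longrightarrow> z v = (if v \<in> S then 1 else 0)"
  shows "real (cut_value E S) = cutp z"
  unfolding cut_value_eq of_nat_sum cutp_def
  by (intro sum.cong refl) (use assms edges in auto)

lemma cut_value_le: "cut_value E S \<le> m"
  unfolding cut_value_eq by (rule order_trans[OF sum_bounded_above[of _ _ 1]]) auto

lemma cuts: "finite {cut_value E S | S. S \<subseteq> {0..<n}}" "{cut_value E S | S. S \<subseteq> {0..<n}} \<noteq> {}"
proof -
  have "{cut_value E S | S. S \<subseteq> {0..<n}} = cut_value E ` Pow {0..<n}" by auto
  thus "finite {cut_value E S | S. S \<subseteq> {0..<n}}" by simp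
qed auto

text \<open>Conditional expectations: the vector with all entries 1/2 has value
  \<open>m / 2\<close>, and its coordinates are replaced one by one by the better of 0 and
  1.\<close>

lemma max_cut_half: "real m / 2 \<le> real (max_cut n E)"
proof -
  have "\<exists>z. (\<forall>v<j. z v = 0 \<or> z v = 1) \<and> (\<forall>v\<ge>j. z v = 1 / 2) \<and> real m / 2 \<le> cutp z" for j
  proof (induction j)
    case 0
    have "real m / 2 \<le> cutp (\<lambda>_. 1 / 2)" by (simp add: cutp_def)
    thus ?case by (intro exI[of _ "\<lambda>_. 1 / 2"]) auto
  next
    case (Suc j)
    then obtain z where z: "\<forall>v<j. z v = 0 \<or> z v = 1" "\<forall>v\<ge>j. z v = 1 / 2" "real m / 2 \<le> cutp z" by blast
    have "z = z(j := (0 + 1) / 2)" using z(2) by (auto intro!: ext)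
    hence "cutp z = (cutp (z(j := 0)) + cutp (z(j := 1))) / 2" using cutp_mid[of z j 0 1] by simp
    hence "real m / 2 \<le> cutp (z(j := 0)) \<or> real m / 2 \<le> cutp (z(j := 1))" using z(3) by auto
    then obtain c :: real where c: "c = 0 \<or> c = 1" "real m / 2 \<le> cutp (z(j := c))" by blast
    have "\<forall>v<Suc j. (z(j := c)) v = 0 \<or> (z(j := c)) v = 1" "\<forall>v\<ge>Suc j. (z(j := c)) v = 1 / 2" using z(1,2) c(1) by (auto simp: less_Suc_eq)
    thus ?case using c(2) by blast
  qed
  from this[of n] obtain z where z: "\<forall>v<n. z v = 0 \<or> z v = 1" "real m / 2 \<le> cutp z" by blast
  define S where "S = {v \<in> {0..<n}. z v = 1}"
  have "real (cut_value E S) = cutp z" by (rule cut_value_cutp) (use z in \<open>auto simp: S_def\<close>)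
  moreover have "cut_value E S \<le> max_cut n E" unfolding max_cut_def by (intro Max_ge cuts) (auto simp: S_def)
  ultimately show ?thesis using z(2) by linarith
qed

lemma max_cut_attained: obtains S where "S \<subseteq> {0..<n}" "max_cut n E = cut_value E S"
  using Max_in[OF cuts] unfolding max_cut_def by auto

end

text \<open>If \<open>\<lfloor>1 / \<epsilon>\<rfloor> = 1\<close>, then \<open>MAIN\<close> would
  run with \<open>P = 1\<close>, where powers of \<open>P\<close> absorb nothing; the bound with
  constant 80 is then negative and holds for every cut.\<close>

definition ALG :: prog where
  "ALG = prog.If (Less (Const 1) (Load (Const 2))) MAIN (SV nVal (Const 0))"

lemma edge_list_of_nth:
  assumes "simple_graph n E" "edge_list_of E es" "m = card E"
  shows "m = length es" "j < m \<Longrightarrow> fst (es ! j) < n" "j < m \<Longrightarrow> snd (es ! j) < n" "j < m \<Longrightarrow> fst (es ! j) \<noteq> snd (es ! j)"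
    "E = (\<lambda>j. {fst (es ! j), snd (es ! j)}) ` {..<m}" "inj_on (\<lambda>j. {fst (es ! j), snd (es ! j)}) {..<m}"
    "(u, v) \<in> set es \<Longrightarrow> u < n \<and> v < n"
proof -
  let ?h = "\<lambda>(u, v). {u, v}"
  have d: "distinct (map ?h es)" "set (map ?h es) = E" using assms(2) by (auto simp: edge_list_of_def)
  show m: "m = length es" using distinct_card[OF d(1)] d(2) assms(3) by simp
  have hj: "map ?h es ! j = {fst (es ! j), snd (es ! j)}" if "j < m" for j using that m by (simp add: case_prod_beta)
  have E: "e \<subseteq> {0..<n} \<and> card e = 2" if "e \<in> E" for e using assms(1) that by (auto simp: simple_graph_def)
  show "E = (\<lambda>j. {fst (es ! j), snd (es ! j)}) ` {..<m}"
  proof -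
    have "E = (\<lambda>j. map ?h es ! j) ` {..<length (map ?h es)}" unfolding d(2)[symmetric] set_conv_nth by blast
    hence "E = (\<lambda>j. map ?h es ! j) ` {..<m}" using m by simp
    thus ?thesis using hj by (simp cong: image_cong_simp)
  qed
  hence jE: "{fst (es ! j), snd (es ! j)} \<in> E" if "j < m" for j using that by auto
  show "fst (es ! j) < n" "snd (es ! j) < n" "fst (es ! j) \<noteq> snd (es ! j)" if "j < m"
    using E[OF jE[OF that]] by (auto intro!: notI)
  have "inj_on (\<lambda>j. map ?h es ! j) {..<m}" by (rule inj_on_nth[OF d(1)]) (simp add: m)
  moreover have "inj_on (\<lambda>j. map ?h es ! j) {..<m} = inj_on (\<lambda>j. {fst (es ! j), snd (es ! j)}) {..<m}"
    by (rule inj_on_cong) (use hj in auto)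
  ultimately show "inj_on (\<lambda>j. {fst (es ! j), snd (es ! j)}) {..<m}" by (rule iffD1[rotated])
  assume "(u, v) \<in> set es"
  hence "{u, v} \<in> E" unfolding d(2)[symmetric] by force
  thus "u < n \<and> v < n" using E by fastforce
qed

lemma alg_small_eps:
  assumes "1 / 2 < \<epsilon>" "\<epsilon> < 1" "simple_graph n E" "m = card E" "edge_list_of E es"
  shows "runs_in_time ALG (input_memory \<epsilon> n es) (time_factor (10 ^ 20 * real (psz ALG)) (n + m))"
proof -
  obtain lam where lam: "n + m + 1 \<le> 2 ^ lam" "lam \<ge> 1" "real lam \<le> 3 + log 2 (real (n + m) + 1)" by (rule lam_exists)
  define b where "b = lam + 2"
  note es = edge_list_of_nth[OF assms(3,5,4)]
  have fl: "\<lfloor>1 / \<epsilon>\<rfloor> = 1" using assms(1,2) by (simp add: floor_eq_iff field_simps)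
  have le: "len (int j) \<le> b" if "j \<le> n + m" for j
  proof -
    have "j < 2 ^ lam" using that lam(1) by simp
    hence "int j < int (2 ^ lam)" by (simp only: of_nat_less_iff)
    hence "len (int j) \<le> Suc lam" unfolding len_le_iff by simp
    thus ?thesis by (simp add: b_def)
  qed
  let ?s = "input_memory \<epsilon> n es"
  have b: "bnd b ?s" by (rule input_memory_bnd) (use le es fl in \<open>auto simp: b_def len_1\<close>)
  have v: "val (Less (Const 1) (Load (Const 2))) ?s = 0" using input_memory_inp(3)[of \<epsilon> n es] fl by (simp add: inp_def)
  have "okD b 1 ALG ?s (\<lambda>_. True)"
    unfolding ALG_def
  proof (rule okK_If)
    have "okD b 1 (SV nVal (Const 0)) ?s (\<lambda>_. True)" by (rule okD_SV) (use b in \<open>auto simp: len_0 b_def\<close>)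
    thus "okD b 1 (if val (Less (Const 1) (Load (Const 2))) ?s \<noteq> 0 then MAIN else SV nVal (Const 0)) ?s (\<lambda>_. True)" unfolding v by simp
  qed (use b in \<open>auto simp: b_def\<close>)
  hence "okE b ALG ?s (1 * psz ALG) (\<lambda>_. True) (\<lambda>_. 0) 0" by (simp only: okK_def)
  thus ?thesis
  proof (rule runs_in_time_of_okE)
    define \<Lambda> where "\<Lambda> = 3 + log 2 (real (n + m) + 1)"
    have bl: "real b \<le> 3 * \<Lambda>" "1 \<le> \<Lambda>" using lam(2,3) by (auto simp: b_def \<Lambda>_def)
    have "real (1 * psz ALG * b\<^sup>2) = real (psz ALG) * (real b)\<^sup>2" by simp
    also have "\<dots> \<le> real (psz ALG) * (3 * \<Lambda>)\<^sup>2" using bl by (intro mult_left_mono power_mono) auto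
    also have "\<dots> = (9 * real (psz ALG)) * (\<Lambda>\<^sup>2 * 1)" by (simp add: power_mult_distrib)
    also have "\<dots> \<le> (10 ^ 20 * real (psz ALG)) * (\<Lambda> ^ 6 * (real (n + m) + 1))"
      using bl by (intro mult_mono power_increasing) auto
    finally show "real (1 * psz ALG * b\<^sup>2) \<le> time_factor (10 ^ 20 * real (psz ALG)) (n + m)" by (simp add: time_factor_def \<Lambda>_def)
  qed
qed

lemma alg_large:
  assumes eps: "0 < \<epsilon>" "\<epsilon> \<le> 1 / 2" and G: "simple_graph n E" "m = card E" "edge_list_of E es"
    and k: "k = neg_threshold_rank \<epsilon> (normalized_adjacency n E)"
  shows "runs_in_time ALG (input_memory \<epsilon> n es) ((1 / \<epsilon>) powr (30 * (real k + 1)) * time_factor (10 ^ 20 * real (psz ALG)) (n + m))"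
    "(1 - 80 * \<epsilon>) * real (max_cut n E) \<le> expected_cut_value n E ALG (input_memory \<epsilon> n es)"
proof -
  note es = edge_list_of_nth[OF G(1,3,2)]
  define us vs where "us j = fst (es ! j)" and "vs j = snd (es ! j)" for j
  define L where "L = nat \<lfloor>1 / \<epsilon>\<rfloor>"
  have e2: "2 \<le> 1 / \<epsilon>" using eps by (simp add: field_simps)
  have L: "2 \<le> L" "int L = \<lfloor>1 / \<epsilon>\<rfloor>" "real L \<le> 1 / \<epsilon>" "1 / \<epsilon> < real L + 1" using e2 unfolding L_def by linarith+
  obtain p where p: "2 ^ p \<le> L" "L < 2 ^ (p + 1)" using ex_power_ivl1[of 2 L] L by auto
  define P where "P = (2::nat) ^ p"
  have "p \<noteq> 0" using p(2) L(1) by (intro notI) simp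
  hence P2: "P \<ge> 2" unfolding P_def using power_increasing[of 1 p "2::nat"] by simp
  define lg where "lg = (LEAST l. 2048 * P\<^sup>2 * (n + m + 1) \<le> 2 ^ l)"
  define H where "H = (2::nat) ^ lg"
  have "\<exists>l. 2048 * P\<^sup>2 * (n + m + 1) \<le> 2 ^ l" using less_exp[of "2048 * P\<^sup>2 * (n + m + 1)"] less_imp_le by blast
  hence Hl: "2048 * P\<^sup>2 * (n + m + 1) \<le> H" unfolding H_def lg_def by (rule LeastI_ex)
  have lgm: "2 ^ l < 2048 * P\<^sup>2 * (n + m + 1)" if "l < lg" for l using not_less_Least[OF that[unfolded lg_def]] by simp
  interpret e: edge_list_instance n m us vs P H lg E
    by unfold_locales (use es P2 Hl in \<open>auto simp: us_def vs_def H_def\<close>)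
  have Pe: "real P \<le> 1 / \<epsilon>" using p(1) L(3) unfolding P_def[symmetric] using of_nat_mono[of P L, where ?'a = real] by linarith
  have "\<epsilon> * real P \<le> 1" using Pe eps(1) by (simp add: field_simps)
  note cod = e.codim_b0[OF this, folded k]
  \<comment> \<open>As \<open>H = 2 ^ lg\<close>, the number \<open>U k ^ (2 * Nit + 3)\<close> is a
    power of two with the displayed exponent. Two more bits allow for the value itself and for the
    sign.\<close>
  define b where "b = lg * 7 * 8 ^ k * (2 * e.Nit + 3) + 2"
  have Bz: "len z \<le> b" if "\<bar>z\<bar> \<le> e.U k ^ (2 * e.Nit + 3)" for z
  proof -
    have "e.U k ^ (2 * e.Nit + 3) = 2 ^ (lg * 7 * 8 ^ k * (2 * e.Nit + 3))"
      unfolding e.U_def unfolding H_def by (simp add: power_mult[symmetric])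
    also have "\<dots> < 2 ^ Suc (lg * 7 * 8 ^ k * (2 * e.Nit + 3))" by (rule power_strict_increasing) auto
    finally have "len z \<le> Suc (Suc (lg * 7 * 8 ^ k * (2 * e.Nit + 3)))" unfolding len_le_iff using that by linarith
    thus ?thesis by (simp add: b_def)
  qed
  interpret mc: main n m us vs P H lg b k p L
    by unfold_locales (use cod Bz p lgm in \<open>auto simp: b_def P_def\<close>)
  let ?s = "input_memory \<epsilon> n es"
  have init: "mc.init ?s" unfolding mc.init_def
    using input_memory_inp[where \<epsilon> = \<epsilon> and n = n and es = es] es(1) L(2) by (simp add: input_memory_rd us_def vs_def)
  have bs: "bnd b ?s"
  proof (rule input_memory_bnd)
    show "len (int n) \<le> b" "len (int (length es)) \<le> b" using mc.len_le_of_H e.H_gt es(1) by auto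
    show "len \<lfloor>1 / \<epsilon>\<rfloor> \<le> b" unfolding L(2)[symmetric] by (rule mc.len_le_of_H[OF mc.P_L_le_H(2)])
  qed (use es(7) mc.b2 in auto)
  obtain S where S: "S \<subseteq> {0..<n}" "max_cut n E = cut_value E S" by (rule e.max_cut_attained)
  define x where "x v = (if v \<in> S then 1 else - 1 :: int)" for v
  define opt where "opt = real (max_cut n E)"
  define W where "W = max 0 (opt - 9 * real m / real P)"
  have optx: "real m / 2 - of_int (e.VAL x) / 2 = opt" unfolding opt_def S(2) e.cut_value_VAL x_def ..
  have x1: "\<bar>x v\<bar> \<le> 1" for v by (simp add: x_def)
  let ?Q = "\<lambda>s'. \<forall>v<n. inp s' v = 0 \<or> inp s' v = 1"
  let ?f = "\<lambda>s'. max 0 (e.cutp (\<lambda>v. of_int (inp s' v)))"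
  note okM = mc.ok_MAIN[where x = x, OF init bs x1, unfolded optx, folded W_def]
  have v: "val (Less (Const 1) (Load (Const 2))) ?s = 1"
    using input_memory_inp(3)[of \<epsilon> n es] e2 by (simp add: inp_def)
  have K1: "1 \<le> mc.Kmain" by (simp add: mc.Kmain_def)
  have "okK b mc.Kmain ALG ?s ?Q ?f (W * (1 - 2 * (1/2) ^ P))"
    unfolding ALG_def by (rule okK_If[OF bs mc.b0 K1], unfold v) (use okM in simp)
  hence okA: "okE b ALG ?s (mc.Kmain * psz ALG) ?Q ?f (W * (1 - 2 * (1/2) ^ P))" by (simp only: okK_def)
  show "runs_in_time ALG ?s ((1 / \<epsilon>) powr (30 * (real k + 1)) * time_factor (10 ^ 20 * real (psz ALG)) (n + m))"
  proof (rule runs_in_time_of_okE[OF okA])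
    obtain lam where lam: "n + m + 1 \<le> 2 ^ lam" "lam \<ge> 1" "real lam \<le> 3 + log 2 (real (n + m) + 1)" by (rule lam_exists)
    define \<Lambda> where "\<Lambda> = 3 + log 2 (real (n + m) + 1)"
    have "(n + 1) * (b + 1) \<le> (n + m + 1) * (b + 1)" by (intro mult_le_mono1) simp
    hence KM: "mc.Kmain \<le> (b + (n + m) + 1) + mc.Kspec + ((1024 * P) ^ k + 1) * ((k + 1) * (b + 1) + (e.Tt + 1) * ((k + 1) * (n + m + 1))) + (n + m + 1) * (b + 1)"
      unfolding mc.Kmain_def by linarith
    have "mc.Kmain * b\<^sup>2 \<le> 10 ^ 20 * (P ^ (k + 1)) ^ 30 * (lam ^ 6 * (n + m + 1))"
      by (rule time_bound[OF P_def P2 lam(1,2) lgm e.Nit_def b_def e.Tt_def mc.Kspec_def KM])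
    hence "real (mc.Kmain * b\<^sup>2) \<le> real (10 ^ 20 * (P ^ (k + 1)) ^ 30 * (lam ^ 6 * (n + m + 1)))" by (simp only: of_nat_le_iff)
    also have "\<dots> = 10 ^ 20 * ((real P) ^ (30 * (k + 1)) * (real lam ^ 6 * (real (n + m) + 1)))"
    proof -
      have e: "(P ^ (k + 1)) ^ 30 = P ^ (30 * (k + 1))" unfolding power_mult[symmetric] by (simp only: mult.commute)
      show ?thesis unfolding e by (simp only: of_nat_mult of_nat_power of_nat_add of_nat_1 of_nat_numeral mult.assoc)
    qed
    also have "\<dots> \<le> 10 ^ 20 * ((1 / \<epsilon>) ^ (30 * (k + 1)) * (\<Lambda> ^ 6 * (real (n + m) + 1)))"
      using Pe lam(3) eps(1) by (intro mult_mono mult_left_mono power_mono) (auto simp: \<Lambda>_def)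
    also have "(1 / \<epsilon>) ^ (30 * (k + 1)) = (1 / \<epsilon>) powr (30 * (real k + 1))"
      using eps(1) powr_realpow[of "1 / \<epsilon>" "30 * (k + 1)"] by (simp add: algebra_simps)
    finally have "real (mc.Kmain * b\<^sup>2) * real (psz ALG) \<le> 10 ^ 20 * ((1 / \<epsilon>) powr (30 * (real k + 1)) * (\<Lambda> ^ 6 * (real (n + m) + 1))) * real (psz ALG)"
      by (rule mult_right_mono) simp
    thus "real (mc.Kmain * psz ALG * b\<^sup>2) \<le> (1 / \<epsilon>) powr (30 * (real k + 1)) * time_factor (10 ^ 20 * real (psz ALG)) (n + m)"
      by (simp add: time_factor_def \<Lambda>_def mult_ac)
  qed
  have "W * (1 - 2 * (1/2) ^ P) \<le> (\<integral>r. real (cut_value E (output_cut n (fst r))) \<partial>measure_spmf (exec ALG ?s))"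
  proof (rule integral_ge_of_okE[OF okA, where g = "\<lambda>s'. real (cut_value E (output_cut n s'))" and c = "real m"])
    fix s' assume Q: "?Q s'"
    have "real (cut_value E (output_cut n s')) = e.cutp (\<lambda>v. of_int (inp s' v))"
      by (rule e.cut_value_cutp) (use Q in \<open>auto simp: output_cut_def inp_def\<close>)
    thus "?f s' = real (cut_value E (output_cut n s'))" using of_nat_0_le_iff[of "cut_value E (output_cut n s')", where 'a = real] by linarith
  qed (use e.cut_value_le in auto)
  \<comment> \<open>80 = 72 + 8: by \<open>1 / P \<le> 4 * \<epsilon>\<close> and
    \<open>m \<le> 2 * opt\<close>, the loss \<open>9 * m / P\<close> is at most
    \<open>72 * \<epsilon> * opt\<close>, and the failure probability \<open>2 * (1/2) ^ P\<close>
    is at most \<open>2 / P \<le> 8 * \<epsilon>\<close>.\<close>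
  moreover have "(1 - 80 * \<epsilon>) * opt \<le> W * (1 - 2 * (1/2) ^ P)"
  proof -
    have opt: "0 \<le> opt" "real m \<le> 2 * opt" using e.max_cut_half by (auto simp: opt_def)
    have "L < 2 * P" using p(2) by (simp add: P_def)
    hence "L + 1 \<le> 2 * P" by simp
    hence "real L + 1 \<le> 2 * real P" by linarith
    hence "1 / \<epsilon> < 4 * real P" using L(4) P2 by linarith
    hence iP: "1 / real P \<le> 4 * \<epsilon>" using eps(1) P2 by (simp add: field_simps)
    have "real P \<le> 2 ^ P" using less_exp[of P] by (metis less_imp_le of_nat_le_iff of_nat_numeral of_nat_power)
    hence pe: "(1/2) ^ P \<le> 1 / real P" using P2 by (simp add: power_one_over field_simps)
    have W: "opt - 72 * \<epsilon> * opt \<le> W" "W \<le> opt" "0 \<le> W"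
    proof -
      have "real m * (1 / real P) \<le> (2 * opt) * (4 * \<epsilon>)" using opt iP eps(1) by (intro mult_mono) auto
      thus "opt - 72 * \<epsilon> * opt \<le> W" unfolding W_def by (simp add: mult_ac)
    qed (use opt in \<open>auto simp: W_def\<close>)
    have "2 * (1/2) ^ P \<le> 8 * \<epsilon>" using pe iP by linarith
    hence "W * (2 * (1/2) ^ P) \<le> opt * (8 * \<epsilon>)" by (rule mult_mono[OF W(2)]) (use opt in auto)
    thus ?thesis using W(1) by (simp add: algebra_simps)
  qed
  ultimately show "(1 - 80 * \<epsilon>) * real (max_cut n E) \<le> expected_cut_value n E ALG ?s"
    unfolding expected_cut_value_def opt_def by linarith
qed

theorem theorem1p2:
  shows "\<exists>(p :: prog) (C :: real) (f :: nat \<Rightarrow> real) (g :: nat \<Rightarrow> real).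
           f \<in> O(\<lambda>k. real k) \<and> g \<in> soft_O (\<lambda>N. real N) \<and>
           (\<forall>(\<epsilon> :: real) (n :: nat) (E :: nat set set) (es :: (nat \<times> nat) list) (m :: nat) (k :: nat).
              0 < \<epsilon> \<longrightarrow> \<epsilon> < 1 \<longrightarrow>
              simple_graph n E \<longrightarrow> m = card E \<longrightarrow> edge_list_of E es \<longrightarrow>
              k = neg_threshold_rank \<epsilon> (normalized_adjacency n E) \<longrightarrow>
                runs_in_time p (input_memory \<epsilon> n es) ((1 / \<epsilon>) powr f k * g (n + m)) \<and>
                expected_cut_value n E p (input_memory \<epsilon> n es) \<ge> (1 - C * \<epsilon>) * real (max_cut n E))"
proof (intro exI conjI allI impI)
  show "(\<lambda>k. 30 * (real k + 1)) \<in> O(\<lambda>k. real k)" by real_asymp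
  show "time_factor (10 ^ 20 * real (psz ALG)) \<in> soft_O (\<lambda>N. real N)" by (rule time_factor_soft_O)
  fix \<epsilon> :: real and n E es and m k :: nat
  assume a: "0 < \<epsilon>" "\<epsilon> < 1" "simple_graph n E" "m = card E" "edge_list_of E es" "k = neg_threshold_rank \<epsilon> (normalized_adjacency n E)"
  let ?g = "time_factor (10 ^ 20 * real (psz ALG)) (n + m)"
  show "runs_in_time ALG (input_memory \<epsilon> n es) ((1 / \<epsilon>) powr (30 * (real k + 1)) * ?g)"
  proof (cases "\<epsilon> \<le> 1 / 2")
    case True
    show ?thesis by (rule alg_large(1)[OF a(1) True a(3-6)])
  next
    case False
    hence r: "runs_in_time ALG (input_memory \<epsilon> n es) ?g" using alg_small_eps[OF _ a(2-5)] by simp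
    have "0 \<le> ?g" by (simp add: time_factor_def)
    moreover have "1 \<le> (1 / \<epsilon>) powr (30 * (real k + 1))" using a(1,2) by (intro ge_one_powr_ge_zero) auto
    ultimately have "1 * ?g \<le> (1 / \<epsilon>) powr (30 * (real k + 1)) * ?g" by (intro mult_right_mono) auto
    thus ?thesis using r unfolding runs_in_time_def by fastforce
  qed
  show "(1 - 80 * \<epsilon>) * real (max_cut n E) \<le> expected_cut_value n E ALG (input_memory \<epsilon> n es)"
  proof (cases "\<epsilon> \<le> 1 / 2")
    case True
    show ?thesis by (rule alg_large(2)[OF a(1) True a(3-6)])
  next
    case False
    have "(1 - 80 * \<epsilon>) * real (max_cut n E) \<le> 0" using False by (intro mult_nonpos_nonneg) auto
    also have "0 \<le> expected_cut_value n E ALG (input_memory \<epsilon> n es)" by (simp add: expected_cut_value_def)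
    finally show ?thesis .
  qed
qed

end
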